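(* Let $\mathcal{D}$ be a billiard table bounded by a non-circular ellipse, let $\varepsilon>0$, let $\nu_\varepsilon=\rho\,d\mathbf{m}$ be any noise distribution on $\mathbb{R}^2$ whose density $\rho$ has support containing the ball $B_\varepsilon(0,0)$, and let $P$ be the Markov transition function on the collision space $M$ obtained by applying the billiard map $F$ of $\mathcal{D}$ and then the random perturbation with law $\nu_\varepsilon$. Then the resulting random billiard is ergodic and hyperbolic; that is, the probability measure $m$ with $dm=\frac{1}{2|\partial\mathcal{D}|}\,dr\,ds$ is ergodic with respect to $P$, and the largest Lyapunov exponent $\lambda_1$ associated to the derivative map $DF$ along the Markov process with transition function $P$ and initial distribution $m$ satisfies $\lambda_1>0$.
   Context: Billiard map. The boundary $\partial\mathcal{D}$ is a simple closed curve of length $L=|\partial\mathcal{D}|$, parametrized by arclength $r\in[0,L]$ with the interior $\mathcal{D}_0$ on its left. A point particle moves in $\mathcal{D}_0$ with constant velocity and reflects at the boundary by $v^+=v^--2(v^-,n)n$, $n$ the inward unit normal. A collision is described by $(r,s)$, where $r$ is the arclength parameter of the collision point and $s=\sin\varphi$, with $\varphi\in[-\pi/2,\pi/2]$ the signed angle from the post-collisional velocity $v$ to $n$. The collision space $M$ is the cylinder obtained from $R=[0,L]\times[-1,1]$ by identifying the edges $\{r=0\}$ and $\{r=L\}$, with Borel $\sigma$-algebra $\mathcal{B}$, and $F:M\to M$ is the billiard map sending a collision $(r,s)$ to the next collision $(r_1,s_1)$. It preserves the probability measure $dm=\frac{1}{2|\partial\mathcal{D}|}\,dr\,ds$. $DF(x)$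 denotes the $2\times2$ Jacobian matrix of $F$ at $x$ in the coordinates $(r,s)$; it is defined for $m$-a.e. $x$ and has determinant $1$. Random perturbation. Fix $\varepsilon>0$ and a probability measure $\nu_\varepsilon$ on $\mathbb{R}^2$ with $d\nu_\varepsilon=\rho\,d\mathbf{m}$, $\mathbf{m}$ Lebesgue measure, where $\rho$ is measurable and its support contains the ball $B_\varepsilon(0,0)$ of radius $\varepsilon$ about the origin, meaning that $\rho$ is positive on this ball. Let $\Lambda=L\mathbb{Z}\times 2\mathbb{Z}$. For $x\in M$ and $B\in\mathcal{B}$ put $\eta_\varepsilon^x(B)=\nu_\varepsilon\{u\in\mathbb{R}^2: u+x\in B \bmod \Lambda\}=\int_B\sum_{v\in\Lambda}\rho(u-x-v)\,\mathbf{m}(du)$. The Markov transition function is $P(x,B)=\eta_\varepsilon^{F(x)}(B)$ for $m$-a.e. $x\in M$ and $B\in\mathcal{B}$. The measure $m$ is invariant with respect to $P$, i.e. $m(B)=\int_M P(x,B)\,m(dx)$ for all $B\in\mathcal{B}$. Ergodicity. Let $\Omega$ be the space of sequences $\omega=(x_0,x_1,\dots)$ in $M$ with product $\sigma$-algebra $\mathcal{A}$, shift $\theta(x_0,x_1,\dots)=(x_1,x_2,\dots)$, and let $\mathbf{P}_m$ be the law on $\Omega$ of the Markov process with transition function $P$ and initial distribution $m$. The measure $m$ is ergodic with respect to $P$ if $A\in\mathcal{A}$, $\theta^{-1}(A)=A$ implies $\mathbf{P}_m(A)\in\{0,1\}$. Lyapunov exponents. Put $A^{(n)}(\omega)=DF(x_{n-1})DF(x_{n-2})\cdots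 DF(x_0)$ for $n\ge1$. The Lyapunov exponents $\lambda_1\ge\lambda_2$ are defined by $\lambda_1=\lim_{n\to\infty}\frac1n\int_\Omega\log\|A^{(n)}(\omega)\|\,\mathbf{P}_m(d\omega)$ and $\lambda_1+\lambda_2=\lim_{n\to\infty}\frac1n\int_\Omega\log|\det A^{(n)}(\omega)|\,\mathbf{P}_m(d\omega)$, where $\|\cdot\|$ is the operator norm. The random billiard is called hyperbolic if $\lambda_1>0$. *)

theory Defs
  imports "HOL-Probability.Probability" "HOL-Library.Real_Mod"
begin

text \<open>
  The physical plane is identified with \<^typ>\<open>complex\<close>, so that multiplication by \<^term>\<open>\<i>\<close> is the
  counterclockwise quarter turn. Collisions \<open>(r, s)\<close> live in \<^typ>\<open>real^2\<close>, as \<^term>\<open>vector [r, s]\<close>.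
\<close>

section \<open>Billiard tables and the billiard map\<close>

text \<open>Ellipse with foci \<open>f1\<close>, \<open>f2\<close> and major axis \<open>d\<close>; it is a circle iff \<open>f1 = f2\<close>.\<close>

definition noncircular_ellipse_table :: "complex set \<Rightarrow> bool" where
  "noncircular_ellipse_table D \<longleftrightarrow>
     (\<exists>f1 f2 d. f1 \<noteq> f2 \<and> dist f1 f2 < d \<and> D = {p. dist p f1 + dist p f2 \<le> d})"

definition unit_tangent :: "(real \<Rightarrow> complex) \<Rightarrow> real \<Rightarrow> complex" where
  "unit_tangent \<gamma> r = vector_derivative \<gamma> (at r)"

text \<open>The inward normal, since the interior lies to the left of \<open>\<gamma>\<close>.\<close>

definition unit_normal :: "(real \<Rightarrow> complex) \<Rightarrow> real \<Rightarrow> complex" where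
  "unit_normal \<gamma> r = \<i> * unit_tangent \<gamma> r"

text \<open>
  \<open>\<gamma>\<close> is the \<open>L\<close>-periodic extension of an arclength parametrization of the simple closed \<open>C\<^sup>1\<close> curve
  \<^term>\<open>frontier D\<close>; thus \<open>L\<close> is the length of \<^term>\<open>frontier D\<close>. The last conjunct says that the
  interior is on the left.
\<close>

definition arclength_parametrization :: "complex set \<Rightarrow> (real \<Rightarrow> complex) \<Rightarrow> real \<Rightarrow> bool" where
  "arclength_parametrization D \<gamma> L \<longleftrightarrow>
     0 < L \<and>
     (\<forall>r. \<gamma> (r + L) = \<gamma> r) \<and>
     inj_on \<gamma> {0..<L} \<and>
     \<gamma> ` {0..<L} = frontier D \<and>
     (\<forall>r. \<gamma> differentiable (at r)) \<and>
     continuous_on UNIV (unit_tangent \<gamma>) \<and>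
     (\<forall>r. norm (unit_tangent \<gamma> r) = 1) \<and>
     (\<forall>r. \<forall>\<^sub>F t in at_right 0. \<gamma> r + t *\<^sub>R unit_normal \<gamma> r \<in> interior D)"

text \<open>Counterclockwise angle, in \<open>(-\<pi>, \<pi>]\<close>, from \<open>v\<close> to \<open>w\<close> (both nonzero).\<close>

definition signed_angle :: "complex \<Rightarrow> complex \<Rightarrow> real" where
  "signed_angle v w = Arg (w / v)"

text \<open>
  The unit velocity \<open>v\<close> for which the angle from \<open>v\<close> to the normal is \<open>\<phi> = arcsin s\<close>.
\<close>

definition outgoing_velocity :: "(real \<Rightarrow> complex) \<Rightarrow> real^2 \<Rightarrow> complex" where
  "outgoing_velocity \<gamma> x = cis (- arcsin (x $ 2)) * unit_normal \<gamma> (x $ 1)"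

definition reflect_velocity :: "complex \<Rightarrow> complex \<Rightarrow> complex" where
  "reflect_velocity n v = v - (2 * (v \<bullet> n)) *\<^sub>R n"

definition hitting_times :: "complex set \<Rightarrow> complex \<Rightarrow> complex \<Rightarrow> real set" where
  "hitting_times D p v = {t. 0 < t \<and> p + t *\<^sub>R v \<in> frontier D}"

text \<open>
  For a strictly convex table only the tangential velocities \<open>s = -1\<close> and \<open>s = 1\<close> never hit the
  boundary again; such collisions are taken to be fixed points, as usual.
\<close>

definition billiard_map :: "complex set \<Rightarrow> (real \<Rightarrow> complex) \<Rightarrow> real \<Rightarrow> real^2 \<Rightarrow> real^2" where
  "billiard_map D \<gamma> L x =
     (let p = \<gamma> (x $ 1);
          v = outgoing_velocity \<gamma> x;
          T = hitting_times D p v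
      in if T = {} then x
         else let q = p + Inf T *\<^sub>R v;
                  r1 = (THE r1. r1 \<in> {0..<L} \<and> \<gamma> r1 = q);
                  n1 = unit_normal \<gamma> r1;
                  v1 = reflect_velocity n1 v
              in vector [r1, sin (signed_angle v1 n1)])"

text \<open>
  The Jacobian is meaningful where \<^const>\<open>billiard_map\<close> is differentiable, hence almost everywhere. The
  exceptional set contains the curves on which the first coordinate of the image jumps from \<open>L\<close>
  to \<open>0\<close>; that jump is an artefact of the coordinate.
\<close>

definition billiard_derivative ::
  "complex set \<Rightarrow> (real \<Rightarrow> complex) \<Rightarrow> real \<Rightarrow> real^2 \<Rightarrow> real^2^2" where
  "billiard_derivative D \<gamma> L x = jacobian (billiard_map D \<gamma> L) (at x)"

section \<open>Collision space, invariant measure and random perturbation\<close>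

text \<open>The cylinder, represented by the fundamental domain \<open>[0, L) \<times> [-1, 1]\<close>.\<close>

definition cylinder :: "real \<Rightarrow> (real^2) set" where
  "cylinder L = {x. x $ 1 \<in> {0..<L} \<and> x $ 2 \<in> {-1..1}}"

definition collision_space :: "real \<Rightarrow> (real^2) measure" where
  "collision_space L = restrict_space borel (cylinder L)"

definition collision_measure :: "real \<Rightarrow> (real^2) measure" where
  "collision_measure L = density (restrict_space lborel (cylinder L)) (\<lambda>_. ennreal (1 / (2 * L)))"

definition noise_measure :: "(real^2 \<Rightarrow> real) \<Rightarrow> (real^2) measure" where
  "noise_measure \<rho> = density lborel (\<lambda>u. ennreal (\<rho> u))"

definition noise_lattice :: "real \<Rightarrow> (real^2) set" where
  "noise_lattice L = {vector [L * of_int j, 2 * of_int k] | j k :: int. True}"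

text \<open>The representative in \<open>[0, L) \<times> [-1, 1)\<close> modulo the lattice.\<close>

definition wrap :: "real \<Rightarrow> real^2 \<Rightarrow> real^2" where
  "wrap L x = vector [x $ 1 rmod L, (x $ 2 + 1) rmod 2 - 1]"

text \<open>
  The lemma \<open>emeasure_perturbation\<close> below confirms that this is the measure
  \<open>B \<mapsto> \<nu> {u. u + x \<in> B mod \<Lambda>}\<close>.
\<close>

definition perturbation :: "real \<Rightarrow> (real^2 \<Rightarrow> real) \<Rightarrow> real^2 \<Rightarrow> (real^2) measure" where
  "perturbation L \<rho> x = distr (noise_measure \<rho>) (collision_space L) (\<lambda>u. wrap L (u + x))"

definition random_billiard_kernel ::
  "complex set \<Rightarrow> (real \<Rightarrow> complex) \<Rightarrow> real \<Rightarrow> (real^2 \<Rightarrow> real) \<Rightarrow> real^2 \<Rightarrow> (real^2) measure" where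
  "random_billiard_kernel D \<gamma> L \<rho> x = perturbation L \<rho> (billiard_map D \<gamma> L x)"

section \<open>Markov processes, ergodicity and Lyapunov exponents\<close>

text \<open>
  The law on the sequence space of the Markov process with initial distribution \<open>m\<close> and transition
  function \<open>P\<close>, obtained from the Ionescu-Tulcea construction.
\<close>

definition markov_law :: "'a measure \<Rightarrow> ('a \<Rightarrow> 'a measure) \<Rightarrow> (nat \<Rightarrow> 'a) measure" where
  "markov_law m P =
     projective_family.lim UNIV
       (Ionescu_Tulcea.CI (\<lambda>n \<omega>. case n of 0 \<Rightarrow> m | Suc k \<Rightarrow> P (\<omega> k)) (\<lambda>_. m)) (\<lambda>_. m)"

definition shift :: "(nat \<Rightarrow> 'a) \<Rightarrow> nat \<Rightarrow> 'a" where
  "shift \<omega> n = \<omega> (Suc n)"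

definition ergodic_wrt :: "'a measure \<Rightarrow> ('a \<Rightarrow> 'a measure) \<Rightarrow> bool" where
  "ergodic_wrt m P \<longleftrightarrow>
     (\<forall>A \<in> sets (PiM UNIV (\<lambda>_::nat. m)).
        shift -` A \<inter> space (PiM UNIV (\<lambda>_::nat. m)) = A \<longrightarrow> measure (markov_law m P) A \<in> {0, 1})"

fun cocycle :: "('a \<Rightarrow> real^'n^'n) \<Rightarrow> nat \<Rightarrow> (nat \<Rightarrow> 'a) \<Rightarrow> real^'n^'n" where
  "cocycle DF 0 \<omega> = mat 1"
| "cocycle DF (Suc n) \<omega> = DF (\<omega> n) ** cocycle DF n \<omega>"

text \<open>
  Integrability is included because \<^term>\<open>integral\<^sup>L\<close> is \<open>0\<close> for non-integrable functions.
\<close>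

definition top_lyapunov_exponent ::
  "(nat \<Rightarrow> 'a) measure \<Rightarrow> ('a \<Rightarrow> real^'n^'n) \<Rightarrow> real \<Rightarrow> bool" where
  "top_lyapunov_exponent Q DF l1 \<longleftrightarrow>
     (\<forall>n\<ge>1. integrable Q (\<lambda>\<omega>. ln (onorm ((*v) (cocycle DF n \<omega>))))) \<and>
     (\<lambda>n. (1 / real n) * (LINT \<omega>|Q. ln (onorm ((*v) (cocycle DF n \<omega>))))) \<longlonglongrightarrow> l1"

definition hyperbolic :: "(nat \<Rightarrow> 'a) measure \<Rightarrow> ('a \<Rightarrow> real^'n^'n) \<Rightarrow> bool" where
  "hyperbolic Q DF \<longleftrightarrow> (\<exists>l1. top_lyapunov_exponent Q DF l1 \<and> 0 < l1)"

section \<open>The perturbation as a measure modulo the lattice\<close>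

lemma rmod_measurable: "0 < L \<Longrightarrow> (\<lambda>a::real. a rmod L) \<in> borel_measurable borel"
  unfolding rmod_def by measurable

lemma measurable_vec_nth [measurable]: "(\<lambda>x::real^2. x $ i) \<in> borel_measurable borel"
  by (intro borel_measurable_continuous_onI continuous_intros)

lemma measurable_vector_2:
  assumes [measurable]: "f \<in> borel_measurable N" "g \<in> borel_measurable N"
  shows "(\<lambda>y. vector [f y, g y] :: real^2) \<in> borel_measurable N"
proof -
  have eq: "(\<lambda>y. vector [f y, g y] :: real^2) = (\<lambda>y. f y *\<^sub>R axis 1 1 + g y *\<^sub>R axis 2 1)"
    by (rule ext) (simp add: vec_eq_iff forall_2 axis_def)
  show ?thesis unfolding eq by measurable
qed

lemma wrap_measurable:
  assumes "0 < L" shows "wrap L \<in> borel \<rightarrow>\<^sub>M collision_space L"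
proof -
  have m [measurable]: "(\<lambda>a::real. a rmod L) \<in> borel_measurable borel"
       "(\<lambda>a::real. a rmod 2) \<in> borel_measurable borel"
    using assms by (auto intro: rmod_measurable)
  have "wrap L \<in> borel_measurable borel"
    unfolding wrap_def by (intro measurable_vector_2) measurable
  moreover have "wrap L x \<in> cylinder L" for x
  proof -
    have "x $ 1 rmod L < L" "0 \<le> x $ 1 rmod L" "(x $ 2 + 1) rmod 2 < 2" "0 \<le> (x $ 2 + 1) rmod 2"
      using assms rmod_less[of L "x $ 1"] rmod_less[of 2 "x $ 2 + 1"]
        rmod_nonneg[of L "x $ 1"] rmod_nonneg[of 2 "x $ 2 + 1"] by auto
    then show ?thesis by (auto simp: cylinder_def wrap_def)
  qed
  ultimately show ?thesis
    unfolding collision_space_def by (intro measurable_restrict_space2) auto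
qed

lemma emeasure_perturbation:
  assumes L: "0 < L" and \<rho> [measurable]: "\<rho> \<in> borel_measurable borel"
    and B: "B \<in> sets (collision_space L)"
  shows "emeasure (perturbation L \<rho> x) B =
    emeasure (noise_measure \<rho>) {u. \<exists>v\<in>noise_lattice L. u + x - v \<in> B}"
proof -
  note [measurable] = wrap_measurable[OF L]
  define w :: "int \<times> int \<Rightarrow> real^2" where
    "w jk = vector [L * of_int (fst jk), 2 * of_int (snd jk)]" for jk
  define S1 where "S1 = {u. wrap L (u + x) \<in> B}"
  define S2 where "S2 = {u. \<exists>v\<in>noise_lattice L. u + x - v \<in> B}"
  have sets_cyl: "cylinder L \<in> sets borel"
  proof -
    have "cylinder L = {x \<in> space borel. x $ 1 \<in> {0..<L} \<and> x $ 2 \<in> {-1..1}}"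
      by (auto simp: cylinder_def)
    also have "\<dots> \<in> sets borel" by measurable
    finally show ?thesis .
  qed
  have B' [measurable]: "B \<in> sets borel" and Bsub: "B \<subseteq> cylinder L"
    using B sets_cyl by (auto simp: collision_space_def sets_restrict_space_iff)
  have S1: "S1 = (\<lambda>u. wrap L (u + x)) -` B \<inter> space borel"
    by (auto simp: S1_def)
  have S1_meas: "S1 \<in> sets borel"
    unfolding S1 using B by (intro measurable_sets[where A = "collision_space L"]) measurable
  have S2: "S2 = (\<Union>jk. {u \<in> space borel. u + x - w jk \<in> B})"
    unfolding S2_def noise_lattice_def w_def by (simp add: set_eq_iff) blast
  have S2_meas: "S2 \<in> sets borel"
    unfolding S2 by (intro sets.countable_UN) auto
  have plane: "AE u in lborel. (u::real^2) $ 2 \<noteq> c" for c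
  proof -
    have "negligible {u::real^2. axis 2 1 \<bullet> u = c}"
      by (intro negligible_hyperplane) auto
    then have "negligible {u::real^2. u $ 2 = c}"
      by (simp add: inner_axis')
    moreover have "{u::real^2. u $ 2 = c} \<in> sets borel"
      by measurable
    ultimately have "{u::real^2. u $ 2 = c} \<in> null_sets lborel"
      by (simp add: negligible_iff_null_sets null_sets_completion_iff)
    then show ?thesis
      by (rule AE_I') auto
  qed
  have "AE u in lborel. \<forall>k::int. (u::real^2) $ 2 \<noteq> 2 * of_int k - 1 - x $ 2"
    unfolding AE_all_countable by (intro allI plane)
  then have "AE u in lborel. u \<in> S1 \<longleftrightarrow> u \<in> S2"
  proof eventually_elim
    fix u :: "real^2"
    assume off: "\<forall>k::int. u $ 2 \<noteq> 2 * of_int k - 1 - x $ 2"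
    define y where "y = u + x"
    have off': "y $ 2 \<noteq> 2 * of_int k - 1" for k :: int
      using off[rule_format, of k] by (auto simp: y_def)
    have "wrap L y = y - w (\<lfloor>y $ 1 / L\<rfloor>, \<lfloor>(y $ 2 + 1) / 2\<rfloor>)"
      using L by (simp add: wrap_def w_def rmod_def vec_eq_iff forall_2)
    then have "u \<in> S1 \<Longrightarrow> u \<in> S2"
      unfolding S1_def S2 y_def by auto
    moreover have "u \<in> S1" if "u \<in> S2"
    proof -
      from that obtain j k :: int where jk: "y - w (j, k) \<in> B"
        unfolding S2 y_def by auto
      have *: "0 \<le> y $ 1 - L * of_int j" "y $ 1 - L * of_int j < L"
              "-1 \<le> y $ 2 - 2 * of_int k" "y $ 2 - 2 * of_int k \<le> 1"
        using Bsub jk by (auto simp: cylinder_def w_def)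
      have "y $ 2 - 2 * of_int k \<noteq> 1"
        using off'[of "k + 1"] by auto
      with * have **: "y $ 2 - 2 * of_int k < 1" by simp
      have "y $ 1 rmod L = y $ 1 - L * of_int j"
      proof -
        have "\<lfloor>y $ 1 / L\<rfloor> = j"
          using L * by (intro floor_unique) (auto simp: field_simps)
        then show ?thesis using L by (simp add: rmod_def)
      qed
      moreover have "(y $ 2 + 1) rmod 2 = y $ 2 + 1 - 2 * of_int k"
      proof -
        have "\<lfloor>(y $ 2 + 1) / 2\<rfloor> = k"
          using * ** by (intro floor_unique) (auto simp: field_simps)
        then show ?thesis by (simp add: rmod_def)
      qed
      ultimately have "wrap L y = y - w (j, k)"
        by (simp add: wrap_def w_def vec_eq_iff forall_2)
      with jk show ?thesis by (simp add: S1_def y_def)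
    qed
    ultimately show "u \<in> S1 \<longleftrightarrow> u \<in> S2" by blast
  qed
  then have "AE u in noise_measure \<rho>. u \<in> S1 \<longleftrightarrow> u \<in> S2"
    unfolding noise_measure_def by (subst AE_density) auto
  then have "emeasure (noise_measure \<rho>) S1 = emeasure (noise_measure \<rho>) S2"
    using S1_meas S2_meas by (intro emeasure_eq_AE) (auto simp: noise_measure_def)
  moreover have "emeasure (perturbation L \<rho> x) B = emeasure (noise_measure \<rho>) S1"
  proof -
    have "(\<lambda>u. wrap L (u + x)) \<in> borel \<rightarrow>\<^sub>M collision_space L"
      by measurable
    then have "(\<lambda>u. wrap L (u + x)) \<in> noise_measure \<rho> \<rightarrow>\<^sub>M collision_space L"
      by (simp add: noise_measure_def)
    then show ?thesis
      unfolding perturbation_def using B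
      by (subst emeasure_distr) (auto simp: S1 noise_measure_def)
  qed
  ultimately show ?thesis by (simp add: S2_def)
qed

end

theory Submission
  imports Defs
begin

text \<open>
  Write \<open>m\<close> for the collision measure. Averaging over the noise satisfies a Poincare inequality in
  \<open>L\<^sup>2(m)\<close>: it decreases the \<open>L\<^sup>2\<close> norm by a definite multiple of the variance, because the variance is
  controlled by mean square increments under small translations, and the density of the noise is
  positive near \<open>0\<close>. Since \<open>F\<close> preserves \<open>m\<close>, a bounded harmonic function has the same norm before and
  after averaging, so it is constant; this is ergodicity.

  For hyperbolicity the same inequality is applied to functions \<open>f x v\<close> on the product of \<open>m\<close> with
  Lebesgue measure on the plane of tangent vectors, under composition with
  \<open>(x, v) \<mapsto> (F x, DF x v)\<close> followed by averaging in \<open>x\<close>. Norm is lost unless \<open>f x v\<close> is close to some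
  \<open>g v\<close>, and it is lost in the next step unless \<open>g (DF x v)\<close> hardly depends on \<open>x\<close>. A ping-pong argument
  excludes the latter: at three chords perpendicular to the major axis and close to a vertex, \<open>DF\<close>
  sends a steep cone into three disjoint flat cones, while at the minor axis it sends everything
  outside the steep cone into it. Hence two steps contract the squared \<open>L\<^sup>2\<close> norm by a factor \<open>q < 1\<close>.
  Applied to the indicator of the unit disc, this makes the expectation of \<open>1 / (norm of A n)\<^sup>2\<close> decay
  exponentially in \<open>n\<close>, and Jensen's inequality gives a positive exponent.

  For the ellipse everything is explicit in the eccentric anomaly: the chord from \<open>t\<close> to \<open>t + 2 d\<close> is
  parallel to the tangent at \<open>t + d\<close>.
\<close>

section \<open>Measurability of Jacobians\<close>

text \<open>The billiard in an ellipse is integrable, so exponential growth has to come from the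
  noise. A matrix of determinant 1 acts isometrically on L^2 of the plane by composition, and the
  ping-pong shows that the matrices \<open>DF x\<close> have no almost invariant function there,
  uniformly. The comparison function \<open>h\<close> in \<open>spread\<close> is arbitrary because
  small losses in two steps only show that \<open>g (DF x v)\<close> is close to some function of
  \<open>v\<close> alone. The cones must survive small changes of the chord, since single chords
  have measure zero; they are therefore given by strict inequalities in the entries. Three cones
  suffice because a third for \<open>J\<close> and a third for its complement fall short of the
  whole. A second obstacle is the distance between the definitions and what is computed: the map
  jumps where \<open>r\<close> wraps around, its Jacobian has arbitrary values where it is not
  differentiable, its entries blow up at tangential collisions, and the law of the process is a
  projective limit. A smooth lift, an almost everywhere formula with integrable norm, and
  trajectories driven by independent noise bridge the gap.\<close>

lemma norm_matrix_vector_mult_le: "norm (X *v w) \<le> norm (X::real^'n^'m) * norm w"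
proof -
  have "norm (X *v w) \<le> L2_set (\<lambda>i. norm (X $ i) * norm w) UNIV"
    unfolding norm_vec_def[of "X *v w"]
    by (rule L2_set_mono) (auto simp: matrix_vector_mul_component Cauchy_Schwarz_ineq2)
  also have "\<dots> = norm X * norm w"
    by (simp add: norm_vec_def[of X] L2_set_left_distrib)
  finally show ?thesis .
qed

lemma norm_matrix_le:
  fixes X :: "real^'n^'m"
  assumes "\<And>w. norm (X *v w) \<le> e * norm w"
  shows "norm X \<le> real CARD('m) * (real CARD('n) * e)"
proof -
  have e: "\<bar>X $ i $ j\<bar> \<le> e" for i j
  proof -
    have "\<bar>X $ i $ j\<bar> = \<bar>(X *v axis j 1) $ i\<bar>"
      by (simp add: matrix_vector_mul_component inner_axis)
    also have "\<dots> \<le> norm (X *v axis j 1)" by (rule component_le_norm_cart)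
    also have "\<dots> \<le> e" using assms[of "axis j 1"] by simp
    finally show ?thesis .
  qed
  have "norm X \<le> (\<Sum>i\<in>UNIV. norm (X $ i))"
    unfolding norm_vec_def[of X] by (rule L2_set_le_sum) simp
  also have "\<dots> \<le> (\<Sum>i\<in>(UNIV::'m set). real CARD('n) * e)"
  proof (rule sum_mono)
    fix i
    have "norm (X $ i) \<le> (\<Sum>j\<in>UNIV. \<bar>X $ i $ j\<bar>)" by (rule norm_le_l1_cart)
    also have "\<dots> \<le> (\<Sum>j\<in>(UNIV::'n set). e)" by (intro sum_mono e)
    finally show "norm (X $ i) \<le> real CARD('n) * e" by simp
  qed
  finally show ?thesis by simp
qed

text \<open>\<open>f\<close> is compared at two points \<open>y\<close>, \<open>z\<close> near
  \<open>x\<close> and never at \<open>x\<close> itself. For fixed \<open>y\<close> and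
  \<open>z\<close> both sides depend continuously on \<open>x\<close>, so the condition passes to
  limits of \<open>x\<close> even if \<open>f\<close> is discontinuous.\<close>

definition affine_approx_set :: "(real^'n \<Rightarrow> real^'m) \<Rightarrow> real^'n^'m \<Rightarrow> real \<Rightarrow> real \<Rightarrow> (real^'n) set" where
  "affine_approx_set f A e d =
     {x. \<forall>y\<in>ball x d. \<forall>z\<in>ball x d. norm (f y - f z - A *v (y - z)) \<le> e * (dist y x + dist z x)}"

lemma closed_affine_approx_set: "closed (affine_approx_set f A e d)"
  unfolding closed_sequential_limits
proof (intro allI impI, elim conjE)
  fix X l assume X: "\<forall>n. X n \<in> affine_approx_set f A e d" and l: "X \<longlonglongrightarrow> l"
  show "l \<in> affine_approx_set f A e d"
    unfolding affine_approx_set_def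
  proof (intro CollectI ballI)
    fix y z assume y: "y \<in> ball l d" and z: "z \<in> ball l d"
    have ev: "\<forall>\<^sub>F n in sequentially. w \<in> ball (X n) d" if "w \<in> ball l d" for w
    proof -
      have "(\<lambda>n. dist (X n) w) \<longlonglongrightarrow> dist l w" by (intro tendsto_intros l)
      from order_tendstoD(2)[OF this, of d] that show ?thesis by simp
    qed
    have "\<forall>\<^sub>F n in sequentially. norm (f y - f z - A *v (y - z)) \<le> e * (dist y (X n) + dist z (X n))"
      using ev[OF y] ev[OF z] by eventually_elim (use X in \<open>auto simp: affine_approx_set_def\<close>)
    moreover have "(\<lambda>n. e * (dist y (X n) + dist z (X n))) \<longlonglongrightarrow> e * (dist y l + dist z l)"
      by (intro tendsto_intros l)
    ultimately show "norm (f y - f z - A *v (y - z)) \<le> e * (dist y l + dist z l)"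
      by (intro tendsto_lowerbound[where F = sequentially]) auto
  qed
qed

text \<open>Both increments are compared with the value at \<open>x\<close>. Replacing the
  derivative \<open>B\<close> by \<open>A\<close> costs at most \<open>norm (B - A)\<close>, which
  leaves the room \<open>e - norm (B - A)\<close> for the error of differentiability.\<close>

lemma affine_approx_set_derivative:
  assumes f: "(f has_derivative (\<lambda>h. B *v h)) (at x)" and BA: "norm (B - A) < e"
  shows "\<exists>n. x \<in> affine_approx_set f A e (1 / Suc n)"
proof -
  have "0 < e - norm (B - A)" using BA by simp
  then obtain d where d: "d > 0" "\<And>y. norm (y - x) < d \<Longrightarrow>
      norm (f y - f x - B *v (y - x)) \<le> (e - norm (B - A)) * norm (y - x)"
    using f unfolding has_derivative_at_alt by blast
  obtain n where n: "1 / Suc n < d" using d(1) nat_approx_posE by blast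
  have "x \<in> affine_approx_set f A e (1 / Suc n)"
    unfolding affine_approx_set_def
  proof (intro CollectI ballI)
    fix y z assume "y \<in> ball x (1 / Suc n)" "z \<in> ball x (1 / Suc n)"
    then have y: "norm (y - x) < d" and z: "norm (z - x) < d" using n by (auto simp: dist_norm norm_minus_commute)
    have b: "norm (f w - f x - A *v (w - x)) \<le> e * norm (w - x)" if "norm (w - x) < d" for w
    proof -
      have "f w - f x - A *v (w - x) = (f w - f x - B *v (w - x)) + (B - A) *v (w - x)"
        by (simp add: matrix_vector_mult_diff_rdistrib)
      then have "norm (f w - f x - A *v (w - x)) \<le> norm (f w - f x - B *v (w - x)) + norm ((B - A) *v (w - x))"
        by (metis norm_triangle_ineq)
      with d(2)[OF that] norm_matrix_vector_mult_le[of "B - A" "w - x"] show ?thesis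
        by (simp add: algebra_simps)
    qed
    have "f y - f z - A *v (y - z) = (f y - f x - A *v (y - x)) - (f z - f x - A *v (z - x))"
      by (simp add: matrix_vector_mult_diff_distrib)
    then have "norm (f y - f z - A *v (y - z)) \<le> norm (f y - f x - A *v (y - x)) + norm (f z - f x - A *v (z - x))"
      by (metis norm_triangle_ineq4)
    with b[OF y] b[OF z] show "norm (f y - f z - A *v (y - z)) \<le> e * (dist y x + dist z x)"
      by (simp add: dist_norm algebra_simps)
  qed
  then show ?thesis ..
qed

lemma affine_approx_setD:
  assumes "x \<in> affine_approx_set f A e d" "norm (y - x) < d" "d > 0"
  shows "norm (f y - f x - A *v (y - x)) \<le> e * norm (y - x)"
proof -
  have "y \<in> ball x d" "x \<in> ball x d" using assms by (auto simp: dist_norm norm_minus_commute)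
  with assms(1) have "norm (f y - f x - A *v (y - x)) \<le> e * (dist y x + dist x x)"
    unfolding affine_approx_set_def by blast
  then show ?thesis by (simp add: dist_norm)
qed

lemma linear_bound_from_ball:
  fixes X :: "real^'n^'m"
  assumes d: "d > 0" and b: "\<And>w. norm w < d \<Longrightarrow> norm (X *v w) \<le> e * norm w"
  shows "norm (X *v w) \<le> e * norm w"
proof (cases "w = 0")
  case False
  define t where "t = d / (2 * norm w)"
  have t: "t > 0" using d False by (simp add: t_def)
  have "norm (t *\<^sub>R w) < d" using False d by (simp add: t_def)
  from b[OF this] have "t * norm (X *v w) \<le> t * (e * norm w)"
    using t by (simp add: scaleR_matrix_vector_assoc[symmetric] matrix_vector_mult_scaleR algebra_simps)
  with t show ?thesis by simp
qed simp

text \<open>Two affine approximations at one point are subtracted at a common small increment;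
  linearity then carries the bound to all increments.\<close>

lemma affine_approx_sets_norm_le:
  assumes "x \<in> affine_approx_set f A e d" "x \<in> affine_approx_set f A' e' d'" "d > 0" "d' > 0"
  shows "norm ((A - A') *v w) \<le> (e + e') * norm w"
proof (rule linear_bound_from_ball)
  show "min d d' > 0" using assms by simp
  fix w :: "real^'a" assume w: "norm w < min d d'"
  have "norm ((A - A') *v w) = norm ((f (x + w) - f x - A' *v w) - (f (x + w) - f x - A *v w))"
    by (simp add: matrix_vector_mult_diff_rdistrib)
  also have "\<dots> \<le> norm (f (x + w) - f x - A' *v w) + norm (f (x + w) - f x - A *v w)"
    by (rule norm_triangle_ineq4)
  also have "\<dots> \<le> (e + e') * norm w"
    using affine_approx_setD[OF assms(1), of "x + w"] affine_approx_setD[OF assms(2), of "x + w"] w assms(3,4)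
    by (simp add: algebra_simps)
  finally show "norm ((A - A') *v w) \<le> (e + e') * norm w" .
qed

text \<open>Converse of \<open>affine_approx_set_derivative\<close>: the matrices that approximate
  to order \<open>1 / Suc k\<close> form a Cauchy sequence, and its limit is the derivative.\<close>

lemma affine_approx_set_imp_derivative:
  fixes f :: "real^'n \<Rightarrow> real^'m"
  assumes "\<And>k. \<exists>A n. x \<in> affine_approx_set f A (1 / Suc k) (1 / Suc n)"
  shows "f differentiable (at x)"
proof -
  obtain A n where An: "\<And>k. x \<in> affine_approx_set f (A k) (1 / Suc k) (1 / Suc (n k))"
    using assms by metis
  have le: "norm ((A k - A l) *v w) \<le> (1 / Suc k + 1 / Suc l) * norm w" for k l w
    by (rule affine_approx_sets_norm_le[OF An An]) auto
  define c where "c = real CARD('m) * real CARD('n)"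
  have c: "c > 0" by (simp add: c_def)
  have le': "norm (A k - A l) \<le> c * (1 / Suc k + 1 / Suc l)" for k l
    using norm_matrix_le[of "A k - A l", OF le] by (simp add: c_def algebra_simps)
  have "Cauchy A"
  proof (rule metric_CauchyI)
    fix e :: real assume e: "e > 0"
    then obtain N where N: "1 / Suc N < e / (2 * c)" using c nat_approx_posE[of "e / (2 * c)"] by auto
    have "dist (A k) (A l) < e" if "k \<ge> N" "l \<ge> N" for k l
    proof -
      have "1 / real (Suc k) \<le> 1 / Suc N" "1 / real (Suc l) \<le> 1 / Suc N" using that by (auto simp: frac_le)
      then have "1 / real (Suc k) + 1 / Suc l < 2 * (e / (2 * c))" using N by linarith
      then have "c * (1 / real (Suc k) + 1 / Suc l) < c * (2 * (e / (2 * c)))" by (rule mult_strict_left_mono[OF _ c])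
      then have "c * (1 / real (Suc k) + 1 / Suc l) < e" using c by simp
      with le'[of k l] show ?thesis by (simp add: dist_norm)
    qed
    then show "\<exists>N. \<forall>k\<ge>N. \<forall>l\<ge>N. dist (A k) (A l) < e" by blast
  qed
  then obtain B where B: "A \<longlonglongrightarrow> B" using Cauchy_convergent convergentD by blast
  have leB: "norm ((A k - B) *v w) \<le> 1 / Suc k * norm w" for k w
  proof (rule tendsto_le[OF sequentially_bot])
    show "(\<lambda>l. (1 / Suc k + 1 / Suc l) * norm w) \<longlonglongrightarrow> 1 / Suc k * norm w"
      using tendsto_mult_right[OF tendsto_add[OF tendsto_const[of "1 / real (Suc k)"] LIMSEQ_Suc[OF lim_1_over_n[where 'a=real]]], of "norm w"] by simp
    have "norm ((A k - A l) *v w - (A k - B) *v w) \<le> norm (A l - B) * norm w" for l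
    proof -
      have "(A k - A l) *v w - (A k - B) *v w = - ((A l - B) *v w)"
        by (simp add: matrix_vector_mult_diff_rdistrib)
      then show ?thesis using norm_matrix_vector_mult_le[of "A l - B" w] by simp
    qed
    then have "\<forall>\<^sub>F l in sequentially. norm ((A k - A l) *v w - (A k - B) *v w) \<le> norm (A l - B) * norm w"
      by (intro always_eventually allI)
    then have "(\<lambda>l. (A k - A l) *v w - (A k - B) *v w) \<longlonglongrightarrow> 0"
      by (rule Lim_null_comparison) (rule tendsto_mult_left_zero[OF tendsto_norm_zero[OF LIM_zero[OF B]]])
    then show "(\<lambda>l. norm ((A k - A l) *v w)) \<longlonglongrightarrow> norm ((A k - B) *v w)"
      by (intro tendsto_norm) (simp add: LIM_zero_iff)
    show "\<forall>\<^sub>F l in sequentially. norm ((A k - A l) *v w) \<le> (1 / Suc k + 1 / Suc l) * norm w"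
      using le by simp
  qed
  have "(f has_derivative (\<lambda>h. B *v h)) (at x)"
    unfolding has_derivative_at_alt
  proof (intro conjI allI impI)
    show "bounded_linear ((*v) B)" by (simp add: linear_conv_bounded_linear[symmetric])
    fix e :: real assume "e > 0"
    then obtain k where k: "1 / Suc k < e / 2" using nat_approx_posE[of "e/2"] by auto
    have "norm (f y - f x - B *v (y - x)) \<le> e * norm (y - x)" if "norm (y - x) < 1 / Suc (n k)" for y
    proof -
      have "f y - f x - B *v (y - x) = (f y - f x - A k *v (y - x)) + (A k - B) *v (y - x)"
        by (simp add: matrix_vector_mult_diff_rdistrib)
      then have "norm (f y - f x - B *v (y - x)) \<le> norm (f y - f x - A k *v (y - x)) + norm ((A k - B) *v (y - x))"
        by (metis norm_triangle_ineq)
      also have "\<dots> \<le> (1 / Suc k + 1 / Suc k) * norm (y - x)"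
        using affine_approx_setD[OF An that] leB[of k "y - x"] by (simp add: algebra_simps)
      also have "\<dots> \<le> e * norm (y - x)" using k by (intro mult_right_mono) auto
      finally show ?thesis .
    qed
    then show "\<exists>d>0. \<forall>y. norm (y - x) < d \<longrightarrow> norm (f y - f x - B *v (y - x)) \<le> e * norm (y - x)"
      by (intro exI[of _ "1 / Suc (n k)"]) auto
  qed
  then show ?thesis unfolding differentiable_def by blast
qed

text \<open>
  No regularity of \<open>f\<close> is needed: the approximation sets above are closed for every \<open>f\<close>.
\<close>

lemma borel_measurable_jacobian:
  fixes f :: "real^'n \<Rightarrow> real^'m"
  shows "(\<lambda>x. jacobian f (at x)) \<in> borel_measurable borel"
proof -
  obtain D :: "(real^'n^'m) set" where D: "countable D" "\<And>X. open X \<Longrightarrow> X \<noteq> {} \<Longrightarrow> \<exists>d\<in>D. d \<in> X"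
    by (rule countable_dense_setE) blast
  have dense: "\<exists>A\<in>D. norm (B - A) < e" if "e > 0" for B :: "real^'n^'m" and e
    using D(2)[of "ball B e"] that by (auto simp: dist_norm)
  define W where "W A k = (\<Union>n. affine_approx_set f A (1 / Suc k) (1 / Suc n))" for A k
  have W [measurable]: "W A k \<in> sets borel" for A k
    unfolding W_def by (intro sets.countable_UN) (auto intro: borel_closed closed_affine_approx_set)
  define S where "S = {x. f differentiable (at x)}"
  have S_eq: "S = (\<Inter>k. \<Union>A\<in>D. W A k)"
  proof (intro equalityI subsetI)
    fix x assume "x \<in> S"
    then have fd: "(f has_derivative (\<lambda>h. jacobian f (at x) *v h)) (at x)"
      by (simp add: S_def jacobian_works)
    show "x \<in> (\<Inter>k. \<Union>A\<in>D. W A k)"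
    proof safe
      fix k :: nat
      obtain A where "A \<in> D" "norm (jacobian f (at x) - A) < 1 / Suc k"
        using dense[of "1 / Suc k"] by auto
      then show "x \<in> (\<Union>A\<in>D. W A k)"
        using affine_approx_set_derivative[OF fd, of A "1 / Suc k"] unfolding W_def by blast
    qed
  next
    fix x assume "x \<in> (\<Inter>k. \<Union>A\<in>D. W A k)"
    then have "\<exists>A n. x \<in> affine_approx_set f A (1 / Suc k) (1 / Suc n)" for k
      by (fastforce simp: W_def)
    then show "x \<in> S" unfolding S_def using affine_approx_set_imp_derivative by blast
  qed
  have S: "S \<in> sets borel"
    unfolding S_eq by (intro sets.countable_INT) (auto intro!: sets.countable_UN' D(1))
  define c where "c = real CARD('m) * real CARD('n)"
  have c: "c > 0" by (simp add: c_def)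
  have close: "norm (jacobian f (at x) - A) \<le> c / Suc k" if xS: "x \<in> S" and xW: "x \<in> W A k" for x A k
  proof -
    have fd: "(f has_derivative (\<lambda>h. jacobian f (at x) *v h)) (at x)"
      using xS by (simp add: S_def jacobian_works)
    obtain n where n: "x \<in> affine_approx_set f A (1 / Suc k) (1 / Suc n)" using xW unfolding W_def by blast
    have "norm ((jacobian f (at x) - A) *v w) \<le> 1 / Suc k * norm w" for w
    proof (rule tendsto_le[OF trivial_limit_sequentially])
      show "(\<lambda>l. (1 / Suc l + 1 / Suc k) * norm w) \<longlonglongrightarrow> 1 / Suc k * norm w"
        using tendsto_mult_right[OF tendsto_add[OF LIMSEQ_Suc[OF lim_1_over_n[where 'a=real]] tendsto_const[of "1 / real (Suc k)"]], of "norm w"] by simp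
      show "\<forall>\<^sub>F l in sequentially. norm ((jacobian f (at x) - A) *v w) \<le> (1 / Suc l + 1 / Suc k) * norm w"
      proof (rule always_eventually, rule allI)
        fix l
        obtain n' where "x \<in> affine_approx_set f (jacobian f (at x)) (1 / Suc l) (1 / Suc n')"
          using affine_approx_set_derivative[OF fd, of "jacobian f (at x)" "1 / Suc l"] by auto
        from affine_approx_sets_norm_le[OF this n]
        show "norm ((jacobian f (at x) - A) *v w) \<le> (1 / Suc l + 1 / Suc k) * norm w" by simp
      qed
    qed simp
    from norm_matrix_le[OF this] show ?thesis by (simp add: c_def)
  qed
  show ?thesis
  proof (rule borel_measurableI)
    fix U :: "(real^'n^'m) set" assume U: "open U"
    \<comment> \<open>Countably many pairs certify membership in an open \<open>U\<close>: at
      differentiability points in \<open>W A k\<close> the Jacobian lies within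
      \<open>c / Suc k\<close> of \<open>A\<close>, so it suffices that this closed ball lies in
      \<open>U\<close>.\<close>
    define I where "I = {(A, k::nat). A \<in> D \<and> cball A (c / Suc k) \<subseteq> U}"
    have I: "countable I"
      by (rule countable_subset[of _ "D \<times> UNIV"]) (use D(1) in \<open>auto simp: I_def\<close>)
    have eqU: "S \<inter> {x. jacobian f (at x) \<in> U} = S \<inter> (\<Union>(A, k)\<in>I. W A k)"
    proof (intro equalityI subsetI)
      fix x assume x: "x \<in> S \<inter> {x. jacobian f (at x) \<in> U}"
      then have fd: "(f has_derivative (\<lambda>h. jacobian f (at x) *v h)) (at x)"
        by (simp add: S_def jacobian_works)
      obtain e where e: "e > 0" "ball (jacobian f (at x)) e \<subseteq> U" using U x by (auto simp: open_contains_ball)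
      obtain k where k: "1 / Suc k < e / (c + 1)" using e c nat_approx_posE[of "e / (c + 1)"] by auto
      obtain A where A: "A \<in> D" "norm (jacobian f (at x) - A) < 1 / Suc k" using dense[of "1 / Suc k"] by auto
      have "cball A (c / Suc k) \<subseteq> ball (jacobian f (at x)) e"
      proof
        fix y assume "y \<in> cball A (c / Suc k)"
        then have "dist (jacobian f (at x)) y < 1 / Suc k + c / Suc k"
          using A(2) dist_triangle[of "jacobian f (at x)" y A] by (simp add: dist_norm)
        also have "\<dots> = (c + 1) * (1 / Suc k)" by (simp add: field_simps)
        also have "\<dots> < e" using k c by (simp add: field_simps)
        finally show "y \<in> ball (jacobian f (at x)) e" by simp
      qed
      then have "(A, k) \<in> I" using A e by (auto simp: I_def)
      moreover have "x \<in> W A k" using affine_approx_set_derivative[OF fd A(2)] by (auto simp: W_def)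
      ultimately show "x \<in> S \<inter> (\<Union>(A, k)\<in>I. W A k)" using x by auto
    next
      fix x assume "x \<in> S \<inter> (\<Union>(A, k)\<in>I. W A k)"
      then obtain A k where Ak: "x \<in> S" "(A, k) \<in> I" "x \<in> W A k" by auto
      with close[OF Ak(1,3)] have "jacobian f (at x) \<in> cball A (c / Suc k)"
        by (simp add: dist_norm norm_minus_commute)
      with Ak show "x \<in> S \<inter> {x. jacobian f (at x) \<in> U}" by (auto simp: I_def)
    qed
    \<comment> \<open>Where \<open>f\<close> is not differentiable,
      \<open>frechet_derivative\<close> is a choice from the empty predicate, hence the Jacobian is
      one fixed matrix.\<close>
    define K :: "real^'n^'m" where "K = matrix (SOME f'. False)"
    have "jacobian f (at x) = K" if "x \<notin> S" for x
      using that by (simp add: jacobian_def frechet_derivative_def S_def differentiable_def K_def)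
    then have split: "{x. jacobian f (at x) \<in> U} = (S \<inter> {x. jacobian f (at x) \<in> U}) \<union> (if K \<in> U then - S else {})"
      by auto
    have US: "S \<inter> {x. jacobian f (at x) \<in> U} \<in> sets borel"
      unfolding eqU by (intro sets.Int S sets.countable_UN') (use I in auto)
    have UK: "(if K \<in> U then - S else {}) \<in> sets borel" using S by auto
    have "{x. jacobian f (at x) \<in> U} \<in> sets borel"
      using sets.Un[OF US UK] unfolding split[symmetric] .
    then show "(\<lambda>x. jacobian f (at x)) -` U \<inter> space borel \<in> sets borel" by (simp add: vimage_def)
  qed
qed

section \<open>Convergence of the averages of a subadditive sequence\<close>

lemma subadditive_converges:
  fixes a :: "nat \<Rightarrow> real"
  assumes sub: "\<And>m n. a (m + n) \<le> a m + a n" and nn: "\<And>n. 0 \<le> a n"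
  shows "\<exists>l. (\<lambda>n. a n / n) \<longlonglongrightarrow> l"
proof -
  \<comment> \<open>Fekete's lemma: the limit is the infimum of the averages, which is finite
    because the sequence is nonnegative.\<close>
  define l where "l = (INF n\<in>{1..}. a n / real n)"
  have bdd: "bdd_below ((\<lambda>n. a n / real n) ` {1..})"
    by (intro bdd_belowI[of _ 0]) (auto simp: nn)
  have lower: "l \<le> a n / n" if "n \<ge> 1" for n
    unfolding l_def using that by (intro cINF_lower bdd) auto
  have mul: "a (q * k + r) \<le> q * a k + a r" for q k r
  proof (induction q)
    case (Suc q)
    have "Suc q * k + r = k + (q * k + r)" by simp
    then have "a (Suc q * k + r) \<le> a k + a (q * k + r)" using sub[of k "q * k + r"] by (simp only:)
    moreover have "real (Suc q) * a k + a r = a k + (real q * a k + a r)" by (simp add: distrib_right)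
    ultimately show ?case using Suc by linarith
  qed simp
  have "(\<lambda>n. a n / n) \<longlonglongrightarrow> l"
  proof (rule LIMSEQ_I)
    fix e :: real assume e: "e > 0"
    have "\<exists>k\<ge>1. a k / k < l + e / 2"
    proof (rule ccontr)
      assume "\<not> ?thesis"
      then have "l + e / 2 \<le> (INF n\<in>{1..}. a n / real n)" by (intro cINF_greatest) (auto simp: not_less)
      then have "l + e / 2 \<le> l" by (simp only: l_def)
      with e show False by simp
    qed
    then obtain k where k: "k \<ge> 1" "a k / k < l + e / 2" by blast
    \<comment> \<open>\<open>C\<close> dominates every possible remainder
      \<open>a (n mod k)\<close>, and \<open>N\<close> makes its share \<open>C / n\<close> smaller
      than \<open>e / 2\<close>.\<close>
    define C where "C = (\<Sum>r<k. a r)"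
    have C: "a r \<le> C" if "r < k" for r
      unfolding C_def by (rule member_le_sum) (use that nn in auto)
    have C0: "C \<ge> 0" unfolding C_def by (rule sum_nonneg) (rule nn)
    define N where "N = nat \<lceil>2 * C / e\<rceil> + 1"
    have N: "2 * C / e < N" unfolding N_def by linarith
    have "\<bar>a n / n - l\<bar> < e" if n: "n \<ge> max 1 N" for n
    proof -
      have "a n \<le> (n div k) * a k + a (n mod k)" using mul[of "n div k" k "n mod k"] by simp
      also have "\<dots> \<le> (real n / k) * a k + C"
      proof (intro add_mono mult_right_mono)
        have "real (n div k * k) \<le> real n" by (simp only: of_nat_le_iff div_times_less_eq_dividend)
        then show "real (n div k) \<le> real n / real k" using k by (simp add: field_simps)
      qed (use C[of "n mod k"] k nn in auto)
      finally have "a n / n \<le> a k / k + C / n" using n by (simp add: field_simps)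
      moreover have "C / n < e / 2"
      proof -
        have "2 * C / e < n" using N n by linarith
        then show ?thesis using e n by (simp add: field_simps)
      qed
      moreover have "l \<le> a n / n" using lower[of n] n by simp
      ultimately show ?thesis using k by linarith
    qed
    then show "\<exists>no. \<forall>n\<ge>no. norm (a n / n - l) < e" by (metis real_norm_def)
  qed
  then show ?thesis ..
qed

section \<open>The collision measure\<close>

lemma measurable_vector_pair [measurable]: "(\<lambda>p. vector [fst p, snd p] :: real^2) \<in> borel \<Otimes>\<^sub>M borel \<rightarrow>\<^sub>M borel"
  by (intro measurable_vector_2) measurable

lemma prod_Basis_real2: "(\<Prod>b\<in>Basis. g (b::real^2)) = g (axis 1 1) * (g (axis 2 1) :: 'a::comm_monoid_mult)"
proof -
  have B: "(Basis :: (real^2) set) = {axis 1 1, axis 2 1}"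
    by (auto simp: Basis_vec_def UNIV_2)
  have N: "axis 1 1 \<noteq> (axis 2 1 :: real^2)" by (simp add: axis_eq_axis)
  show ?thesis unfolding B using N by (simp add: prod.insert)
qed

lemma box_real2: "box l u = {x::real^2. l $ 1 < x $ 1 \<and> x $ 1 < u $ 1 \<and> l $ 2 < x $ 2 \<and> x $ 2 < u $ 2}"
  by (auto simp: mem_box_cart forall_2)

text \<open>Checked on boxes, which determine Lebesgue measure. It opens \<open>real^2\<close> to
  iterated integration in \<open>r\<close> and \<open>s\<close>.\<close>

lemma lborel_real2: "lborel = distr (lborel \<Otimes>\<^sub>M lborel) borel (\<lambda>p. vector [fst p, snd p] :: real^2)"
proof (rule lborel_eqI)
  fix l u :: "real^2" assume "\<And>b. b \<in> Basis \<Longrightarrow> l \<bullet> b \<le> u \<bullet> b"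
  from this[of "axis 1 1"] this[of "axis 2 1"] have le: "l $ 1 \<le> u $ 1" "l $ 2 \<le> u $ 2"
    by (auto simp: inner_axis)
  have "emeasure (distr (lborel \<Otimes>\<^sub>M lborel) borel (\<lambda>p. vector [fst p, snd p] :: real^2)) (box l u)
     = emeasure (lborel \<Otimes>\<^sub>M lborel) ({l$1<..<u$1} \<times> {l$2<..<u$2})"
    by (subst emeasure_distr) (auto simp: box_real2 space_pair_measure intro!: arg_cong2[where f=emeasure])
  also have "\<dots> = emeasure lborel {l$1<..<u$1} * emeasure lborel {l$2<..<u$2}"
    by (intro lborel.emeasure_pair_measure_Times) auto
  also have "\<dots> = ennreal ((u $ 1 - l $ 1) * (u $ 2 - l $ 2))"
    using le by (simp add: ennreal_mult)
  finally show "emeasure (distr (lborel \<Otimes>\<^sub>M lborel) borel (\<lambda>p. vector [fst p, snd p] :: real^2)) (box l u)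
     = (\<Prod>b\<in>Basis. (u - l) \<bullet> b)"
    by (simp add: prod_Basis_real2 inner_axis)
qed simp

lemma nn_integral_lborel_real2:
  fixes f :: "real^2 \<Rightarrow> ennreal"
  assumes [measurable]: "f \<in> borel_measurable borel"
  shows "(\<integral>\<^sup>+x. f x \<partial>lborel) = (\<integral>\<^sup>+a. \<integral>\<^sup>+b. f (vector [a, b]) \<partial>lborel \<partial>lborel)"
  by (subst lborel_real2) (simp add: nn_integral_distr lborel.nn_integral_fst[symmetric])

text \<open>The preimage of a box under \<open>X\<close> is its image under the inverse matrix,
  whose determinant also has absolute value 1.\<close>

lemma det_matrix_vector_preserves_lborel:
  fixes X :: "real^2^2"
  assumes "\<bar>det X\<bar> = 1"
  shows "distr lborel borel ((*v) X) = lborel"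
proof (rule lborel_eqI[symmetric])
  fix l u :: "real^2" assume le: "\<And>b. b \<in> Basis \<Longrightarrow> l \<bullet> b \<le> u \<bullet> b"
  have "invertible X" using assms by (auto simp: invertible_det_nz)
  then obtain Y where XY: "X ** Y = mat 1" "Y ** X = mat 1"
    unfolding invertible_def by blast
  have dY: "\<bar>det Y\<bar> = 1"
    using arg_cong[OF XY(1), of "\<lambda>Z. \<bar>det Z\<bar>"] assms by (simp add: det_mul abs_mult)
  have pre: "(*v) X -` box l u = (*v) Y ` box l u"
  proof (intro equalityI subsetI)
    fix x assume "x \<in> (*v) X -` box l u"
    then have "x = Y *v (X *v x)" "X *v x \<in> box l u" by (auto simp: matrix_vector_mul_assoc XY)
    then show "x \<in> (*v) Y ` box l u" by blast
  next
    fix x assume "x \<in> (*v) Y ` box l u"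
    then show "x \<in> (*v) X -` box l u" by (auto simp: matrix_vector_mul_assoc XY)
  qed
  have meas: "(*v) X \<in> borel_measurable lborel"
    by (simp add: borel_measurable_continuous_onI matrix_vector_mult_linear_continuous_on)
  have img: "(*v) Y ` box l u \<in> sets borel"
    unfolding pre[symmetric] using measurable_sets[OF meas, of "box l u"] by simp
  have lm: "(*v) Y ` box l u \<in> lmeasurable"
    by (intro measurable_linear_image) auto
  have "measure lebesgue ((*v) Y ` box l u) = \<bar>det (matrix ((*v) Y))\<bar> * measure lebesgue (box l u)"
    by (intro measure_linear_image) auto
  then have "measure lebesgue ((*v) Y ` box l u) = measure lebesgue (box l u)"
    using dY by simp
  then have "emeasure lebesgue ((*v) Y ` box l u) = emeasure lebesgue (box l u)"
    using emeasure_eq_measure2[OF lm] emeasure_eq_measure2[OF lmeasurable_box[of l u]] by metis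
  then have "emeasure (distr lborel borel ((*v) X)) (box l u) = emeasure lborel (box l u)"
    using img meas by (subst emeasure_distr) (simp_all add: pre)
  then show "emeasure (distr lborel borel ((*v) X)) (box l u) = (\<Prod>b\<in>Basis. (u - l) \<bullet> b)"
    using le by (simp add: emeasure_lborel_box)
qed simp

text \<open>A rotation of the circle of length \<open>L\<close>: cut at \<open>L - a\<close>, the
  two pieces are translated onto \<open>{a..<L}\<close> and \<open>{0..<a}\<close>.\<close>

lemma nn_integral_rmod:
  fixes f :: "real \<Rightarrow> ennreal"
  assumes L: "0 < L" and [measurable]: "f \<in> borel_measurable borel"
  shows "(\<integral>\<^sup>+x. f ((x + u) rmod L) * indicator {0..<L} x \<partial>lborel) = (\<integral>\<^sup>+x. f x * indicator {0..<L} x \<partial>lborel)"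
proof -
  define a where "a = u rmod L"
  have a: "0 \<le> a" "a < L" using L rmod_nonneg[of L u] rmod_less[of L u] by (auto simp: a_def)
  have xu: "(x + u) rmod L = (if x < L - a then x + a else x + a - L)" if "x \<in> {0..<L}" for x
  proof -
    have "(x + u) rmod L = (x rmod L + a) rmod L"
      unfolding a_def by (metis rmod_add rmod_rmod)
    also have "x rmod L = x" using that by (intro rmod_idem) auto
    also have "(x + a) rmod L = (if x < L - a then x + a else x + a - L)"
    proof (cases "x < L - a")
      case True then show ?thesis using that a by (simp add: rmod_idem)
    next
      case False
      then have "(x + a) rmod L = x + a - L" using that a L by (intro rmod_unique[where n = 1]) auto
      with False show ?thesis by simp
    qed
    finally show ?thesis .
  qed
  have "(\<integral>\<^sup>+x. f ((x + u) rmod L) * indicator {0..<L} x \<partial>lborel)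
    = (\<integral>\<^sup>+x. f (a + 1 * x) * indicator {a..<L} (a + 1 * x) + f ((a - L) + 1 * x) * indicator {0..<a} ((a - L) + 1 * x) \<partial>lborel)"
    using a by (intro nn_integral_cong) (auto simp: xu indicator_def add.commute add_diff_eq)
  also have "\<dots> = (\<integral>\<^sup>+x. f (a + 1 * x) * indicator {a..<L} (a + 1 * x) \<partial>lborel)
      + (\<integral>\<^sup>+x. f ((a - L) + 1 * x) * indicator {0..<a} ((a - L) + 1 * x) \<partial>lborel)"
    by (intro nn_integral_add) measurable
  also have "(\<integral>\<^sup>+x. f (a + 1 * x) * indicator {a..<L} (a + 1 * x) \<partial>lborel) = (\<integral>\<^sup>+x. f x * indicator {a..<L} x \<partial>lborel)"
    by (subst (2) nn_integral_real_affine[where c = 1 and t = a]) (auto simp: one_ennreal_def[symmetric])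
  also have "(\<integral>\<^sup>+x. f ((a - L) + 1 * x) * indicator {0..<a} ((a - L) + 1 * x) \<partial>lborel) = (\<integral>\<^sup>+x. f x * indicator {0..<a} x \<partial>lborel)"
    by (subst (2) nn_integral_real_affine[where c = 1 and t = "a - L"]) (auto simp: one_ennreal_def[symmetric])
  also have "(\<integral>\<^sup>+x. f x * indicator {a..<L} x \<partial>lborel) + (\<integral>\<^sup>+x. f x * indicator {0..<a} x \<partial>lborel)
     = (\<integral>\<^sup>+x. f x * indicator {a..<L} x + f x * indicator {0..<a} x \<partial>lborel)"
    by (intro nn_integral_add[symmetric]) measurable
  also have "\<dots> = (\<integral>\<^sup>+x. f x * indicator {0..<L} x \<partial>lborel)"
    using a by (intro nn_integral_cong) (auto simp: indicator_def)
  finally show ?thesis .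
qed

text \<open>Jensen for the square: the difference of the two sides is the variance of
  \<open>X\<close>.\<close>

lemma square_diff_expectation_le:
  fixes X :: "'a \<Rightarrow> real"
  assumes "prob_space M" and [measurable]: "X \<in> borel_measurable M" and X: "\<And>x. x \<in> space M \<Longrightarrow> \<bar>X x\<bar> \<le> B"
  shows "ennreal ((c - (\<integral>x. X x \<partial>M))\<^sup>2) \<le> (\<integral>\<^sup>+x. ennreal ((c - X x)\<^sup>2) \<partial>M)"
proof -
  interpret prob_space M by fact
  have iX: "integrable M X" using X by (intro integrable_const_bound[of _ B]) auto
  have iX2: "integrable M (\<lambda>x. (c - X x)\<^sup>2)"
  proof (rule integrable_const_bound[of _ "(\<bar>c\<bar> + B)\<^sup>2"])
    show "AE x in M. norm ((c - X x)\<^sup>2) \<le> (\<bar>c\<bar> + B)\<^sup>2"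
    proof (rule AE_I2)
      fix x assume "x \<in> space M"
      from X[OF this] have "\<bar>c - X x\<bar> \<le> \<bar>c\<bar> + B" by linarith
      then have "\<bar>c - X x\<bar>\<^sup>2 \<le> (\<bar>c\<bar> + B)\<^sup>2" by (intro power_mono) auto
      then show "norm ((c - X x)\<^sup>2) \<le> (\<bar>c\<bar> + B)\<^sup>2" by simp
    qed
  qed measurable
  have "0 \<le> (\<integral>x. (X x - (\<integral>x. X x \<partial>M))\<^sup>2 \<partial>M)" by simp
  define e where "e = (\<integral>x. X x \<partial>M)"
  have "(\<integral>x. (c - X x)\<^sup>2 \<partial>M) - (c - e)\<^sup>2 = (\<integral>x. (c - X x)\<^sup>2 - (c - e)\<^sup>2 - 2 * (c - e) * (e - X x) \<partial>M)"
    using iX iX2 by (simp add: e_def[symmetric] prob_space)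
  also have "\<dots> = (\<integral>x. (e - X x)\<^sup>2 \<partial>M)"
    by (intro Bochner_Integration.integral_cong) (auto simp: power2_eq_square algebra_simps)
  also have "\<dots> \<ge> 0" by simp
  finally have "(c - e)\<^sup>2 \<le> (\<integral>x. (c - X x)\<^sup>2 \<partial>M)" by simp
  then have "ennreal ((c - e)\<^sup>2) \<le> ennreal (\<integral>x. (c - X x)\<^sup>2 \<partial>M)" by (rule ennreal_leI)
  also have "\<dots> = (\<integral>\<^sup>+x. ennreal ((c - X x)\<^sup>2) \<partial>M)"
    by (rule nn_integral_eq_integral[symmetric, OF iX2]) simp
  finally show ?thesis by (simp add: e_def)
qed

section \<open>The cylinder as a torus with normalized Lebesgue measure\<close>

lemma sets_cylinder [measurable]: "cylinder L \<in> sets borel"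
proof -
  have "cylinder L = {x \<in> space borel. x $ 1 \<in> {0..<L} \<and> x $ 2 \<in> {-1..1}}" by (auto simp: cylinder_def)
  also have "\<dots> \<in> sets borel" by measurable
  finally show ?thesis .
qed

lemma sets_collision_measure [measurable_cong, simp]: "sets (collision_measure L) = sets (collision_space L)"
  by (simp add: collision_measure_def collision_space_def cong: sets_restrict_space_cong)

lemma space_collision_space [simp]: "space (collision_space L) = cylinder L"
  by (simp add: collision_space_def space_restrict_space)

lemma space_collision_measure [simp]: "space (collision_measure L) = cylinder L"
  by (simp add: collision_measure_def space_restrict_space)

lemma measurable_collisionI:
  "f \<in> borel \<rightarrow>\<^sub>M N \<Longrightarrow> f \<in> collision_space L \<rightarrow>\<^sub>M N"
  by (simp add: collision_space_def measurable_restrict_space1)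

lemma wrap_in_cylinder [simp]: "0 < L \<Longrightarrow> wrap L x \<in> cylinder L"
  using measurable_space[OF wrap_measurable, of L x] by simp

text \<open>The edge \<open>s = 1\<close> is the exception, since \<open>wrap\<close> sends it to
  \<open>s = -1\<close>.\<close>

lemma wrap_idem:
  assumes "x \<in> cylinder L" "x $ 2 \<noteq> 1" shows "wrap L x = x"
  using assms by (auto simp: wrap_def cylinder_def vec_eq_iff forall_2 rmod_idem)

text \<open>\<open>wrap\<close> is the projection to the torus, so it may be applied early inside a
  sum.\<close>

lemma wrap_add_wrap: "wrap L (wrap L x + u) = wrap L (x + u)"
proof -
  have a: "(x $ 1 rmod L + u $ 1) rmod L = (x $ 1 + u $ 1) rmod L"
    by (metis rmod_add rmod_rmod)
  have "((x $ 2 + 1) rmod 2 + u $ 2) rmod 2 = (x $ 2 + 1 + u $ 2) rmod 2"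
    by (metis rmod_add rmod_rmod)
  then show ?thesis using a by (simp add: wrap_def vec_eq_iff forall_2 add.commute add.left_commute)
qed

lemma wrap_wrap [simp]: "wrap L (wrap L x) = wrap L x"
  using wrap_add_wrap[of L x 0] by simp

lemma nn_integral_collision_lborel:
  assumes f [measurable]: "f \<in> borel_measurable borel"
  shows "(\<integral>\<^sup>+x. f x \<partial>collision_measure L) = ennreal (1 / (2 * L)) * (\<integral>\<^sup>+x. f x * indicator (cylinder L) x \<partial>lborel)"
proof -
  have f': "f \<in> borel_measurable (restrict_space lborel (cylinder L))"
    using f by (intro measurable_restrict_space1) simp
  show ?thesis
    unfolding collision_measure_def
    using f' by (subst nn_integral_density) (auto simp: nn_integral_cmult nn_integral_restrict_space)
qed

text \<open>The half-open interval for \<open>b\<close> drops only the null edge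
  \<open>s = 1\<close> and leaves a fundamental domain of the noise lattice, on which both
  coordinates can be rotated.\<close>

lemma nn_integral_collision:
  assumes L: "0 < L" and f [measurable]: "f \<in> borel_measurable borel"
  shows "(\<integral>\<^sup>+x. f x \<partial>collision_measure L) =
    ennreal (1 / (2 * L)) * (\<integral>\<^sup>+a. (\<integral>\<^sup>+b. f (vector [a, b]) * indicator {-1..<1} b \<partial>lborel) * indicator {0..<L} a \<partial>lborel)"
proof -
  have "(\<integral>\<^sup>+x. f x \<partial>collision_measure L) = ennreal (1 / (2 * L)) * (\<integral>\<^sup>+x. f x * indicator (cylinder L) x \<partial>lborel)"
    by (rule nn_integral_collision_lborel[OF f])
  also have "(\<integral>\<^sup>+x. f x * indicator (cylinder L) x \<partial>lborel) =
      (\<integral>\<^sup>+a. \<integral>\<^sup>+b. f (vector [a, b]) * indicator (cylinder L) (vector [a, b]) \<partial>lborel \<partial>lborel)"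
    by (rule nn_integral_lborel_real2) measurable
  also have "\<dots> = (\<integral>\<^sup>+a. (\<integral>\<^sup>+b. f (vector [a, b]) * indicator {-1..<1} b \<partial>lborel) * indicator {0..<L} a \<partial>lborel)"
  proof (rule nn_integral_cong)
    fix a :: real
    have m: "(\<lambda>b. f (vector [a, b])) \<in> borel_measurable borel"
      by (rule measurable_compose[OF measurable_vector_2 f]) auto
    have "(\<integral>\<^sup>+b. f (vector [a, b]) * indicator (cylinder L) (vector [a, b]) \<partial>lborel) =
       (\<integral>\<^sup>+b. (f (vector [a, b]) * indicator {-1..<1} b) * indicator {0..<L} a \<partial>lborel)"
    proof (rule nn_integral_cong_AE)
      show "AE b in lborel. f (vector [a, b]) * indicator (cylinder L) (vector [a, b]) =
         f (vector [a, b]) * indicator {- 1..<1} b * indicator {0..<L} a"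
        using AE_lborel_singleton[of "1::real"] by eventually_elim (auto simp: cylinder_def indicator_def)
    qed
    also have "\<dots> = (\<integral>\<^sup>+b. f (vector [a, b]) * indicator {-1..<1} b \<partial>lborel) * indicator {0..<L} a"
      using m by (intro nn_integral_multc) auto
    finally show "(\<integral>\<^sup>+b. f (vector [a, b]) * indicator (cylinder L) (vector [a, b]) \<partial>lborel) =
       (\<integral>\<^sup>+b. f (vector [a, b]) * indicator {-1..<1} b \<partial>lborel) * indicator {0..<L} a" .
  qed
  finally show ?thesis .
qed

lemma prob_space_collision: assumes L: "0 < L" shows "prob_space (collision_measure L)"
proof
  have "emeasure (collision_measure L) (space (collision_measure L)) = (\<integral>\<^sup>+x. 1 \<partial>collision_measure L)"
    by simp
  also have "\<dots> = ennreal (1 / (2 * L)) * (2 * ennreal L)"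
    using L by (subst nn_integral_collision) (auto simp: nn_integral_cmult)
  also have "\<dots> = 1" using L by (simp add: ennreal_mult'[symmetric] ennreal_numeral[symmetric] del: ennreal_numeral)
  finally show "emeasure (collision_measure L) (space (collision_measure L)) = 1" .
qed

lemma AE_collision_coord2: assumes "0 < L" shows "AE x in collision_measure L. x $ 2 \<noteq> c"
proof -
  have "(\<lambda>x. x $ 2) \<in> borel_measurable (collision_measure L)"
    using measurable_collisionI[OF measurable_vec_nth[of 2], of L] by (simp cong: measurable_cong_sets)
  then have X: "{x \<in> space (collision_measure L). x $ 2 = c} \<in> sets (collision_measure L)"
    by (rule measurable_equality_set) simp
  have "emeasure (collision_measure L) {x \<in> space (collision_measure L). x $ 2 = c} =
    (\<integral>\<^sup>+x. indicator {x. x $ 2 = c} x \<partial>collision_measure L)"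
    unfolding nn_integral_indicator[OF X, symmetric] by (intro nn_integral_cong) (simp add: indicator_def)
  also have "\<dots> = ennreal (1 / (2 * L)) * (\<integral>\<^sup>+a. (\<integral>\<^sup>+b. indicator {x. x $ 2 = c} (vector [a, b]::real^2) * indicator {-1..<1} b \<partial>lborel) * indicator {0..<L} a \<partial>lborel)"
    using assms by (intro nn_integral_collision) auto
  also have "(\<lambda>a::real. \<integral>\<^sup>+b. indicator {x. x $ 2 = c} (vector [a, b]::real^2) * indicator {-1..<1} b \<partial>lborel) = (\<lambda>a. 0)"
  proof
    fix a :: real
    have "(\<integral>\<^sup>+b. indicator {x. x $ 2 = c} (vector [a, b]::real^2) * indicator {-1..<1} b \<partial>lborel) = (\<integral>\<^sup>+(b::real). 0 \<partial>lborel)"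
      by (rule nn_integral_cong_AE) (use AE_lborel_singleton[of c] in eventually_elim, auto)
    then show "(\<integral>\<^sup>+b. indicator {x. x $ 2 = c} (vector [a, b]::real^2) * indicator {-1..<1} b \<partial>lborel) = 0" by simp
  qed
  finally have "{x \<in> space (collision_measure L). x $ 2 = c} \<in> null_sets (collision_measure L)"
    using X by (intro null_setsI) simp
  then show ?thesis by (rule AE_I') auto
qed

text \<open>Up to the null edge, the collision measure is Haar measure on the torus. The integrand
  is periodic after \<open>wrap\<close>, so the two coordinates are rotated one after the
  other.\<close>

lemma nn_integral_collision_translate:
  assumes L: "0 < L" and f [measurable]: "f \<in> borel_measurable (collision_space L)"
  shows "(\<integral>\<^sup>+x. f (wrap L (x + u)) \<partial>collision_measure L) = (\<integral>\<^sup>+x. f x \<partial>collision_measure L)"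
proof -
  note [measurable] = wrap_measurable[OF L]
  define g where "g x = f (wrap L x)" for x
  have g [measurable]: "g \<in> borel_measurable borel" unfolding g_def by measurable
  have gm: "(\<lambda>b. g (vector [a, b])) \<in> borel_measurable borel" for a
    by (rule measurable_compose[OF measurable_vector_2 g]) auto
  have gwrap: "g (wrap L x) = g x" for x by (simp add: g_def)
  define G where "G a = (\<integral>\<^sup>+b. g (vector [a, b]) * indicator {-1..<1} b \<partial>lborel)" for a
  have Gm [measurable]: "G \<in> borel_measurable borel" unfolding G_def by measurable
  have inner: "(\<integral>\<^sup>+b. g (vector [a, b + v]) * indicator {-1..<1} b \<partial>lborel) = G a" for a v
  proof -
    \<comment> \<open>The shift by 1 moves the interval \<open>{-1..<1}\<close> to
      \<open>{0..<2}\<close>, where \<open>rmod 2\<close> applies.\<close>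
    define \<phi> where "\<phi> t = g (vector [a, t - 1])" for t
    have [measurable]: "\<phi> \<in> borel_measurable borel"
      unfolding \<phi>_def by (rule measurable_compose[OF _ gm]) auto
    have r: "\<phi> (t rmod 2) = \<phi> t" for t
    proof -
      have "wrap L (vector [a, t rmod 2 - 1]) = wrap L (vector [a, t - 1])"
        by (simp add: wrap_def vec_eq_iff forall_2)
      then show ?thesis by (simp add: \<phi>_def g_def)
    qed
    have sh: "(\<integral>\<^sup>+b. \<phi> (b + 1 + w) * indicator {-1..<1} b \<partial>lborel) = (\<integral>\<^sup>+t. \<phi> (t + w) * indicator {0..<2} t \<partial>lborel)" for w
      by (subst (2) nn_integral_real_affine[where c = 1 and t = 1])
         (auto simp: one_ennreal_def[symmetric] add.commute intro!: nn_integral_cong split: split_indicator)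
    have "(\<integral>\<^sup>+b. g (vector [a, b + v]) * indicator {-1..<1} b \<partial>lborel) = (\<integral>\<^sup>+t. \<phi> (t + v) * indicator {0..<2} t \<partial>lborel)"
      by (subst sh[symmetric]) (simp add: \<phi>_def add.commute add.left_commute)
    also have "\<dots> = (\<integral>\<^sup>+t. \<phi> ((t + v) rmod 2) * indicator {0..<2} t \<partial>lborel)" by (simp add: r)
    also have "\<dots> = (\<integral>\<^sup>+t. \<phi> (t + 0) * indicator {0..<2} t \<partial>lborel)" by (subst nn_integral_rmod) auto
    also have "\<dots> = G a" by (subst sh[symmetric]) (simp add: \<phi>_def G_def)
    finally show ?thesis .
  qed
  have Grmod: "G (a rmod L) = G a" for a
  proof -
    have "g (vector [a rmod L, b]) = g (vector [a, b])" for b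
      unfolding g_def by (simp add: wrap_def vec_eq_iff forall_2)
    then show ?thesis by (simp add: G_def)
  qed
  have vadd: "vector [a, b] + u = (vector [a + u $ 1, b + u $ 2] :: real^2)" for a b
    by (simp add: vec_eq_iff forall_2)
  have key: "(\<integral>\<^sup>+x. g (x + u) \<partial>collision_measure L) = (\<integral>\<^sup>+x. g x \<partial>collision_measure L)"
  proof -
    have "(\<integral>\<^sup>+x. g (x + u) \<partial>collision_measure L) = ennreal (1 / (2 * L)) * (\<integral>\<^sup>+a. G (a + u $ 1) * indicator {0..<L} a \<partial>lborel)"
      using L by (subst nn_integral_collision) (auto simp: vadd inner)
    also have "(\<integral>\<^sup>+a. G (a + u $ 1) * indicator {0..<L} a \<partial>lborel) = (\<integral>\<^sup>+a. G ((a + u $ 1) rmod L) * indicator {0..<L} a \<partial>lborel)"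
      by (simp add: Grmod)
    also have "\<dots> = (\<integral>\<^sup>+a. G a * indicator {0..<L} a \<partial>lborel)" by (rule nn_integral_rmod[OF L]) measurable
    also have "ennreal (1 / (2 * L)) * \<dots> = (\<integral>\<^sup>+x. g x \<partial>collision_measure L)"
      using L by (subst nn_integral_collision) (auto simp: G_def)
    finally show ?thesis .
  qed
  have "(\<integral>\<^sup>+x. g x \<partial>collision_measure L) = (\<integral>\<^sup>+x. f x \<partial>collision_measure L)"
  proof (rule nn_integral_cong_AE)
    show "AE x in collision_measure L. g x = f x"
      using AE_collision_coord2[OF L, of 1] AE_space by eventually_elim (simp add: g_def wrap_idem)
  qed
  with key show ?thesis by (simp add: g_def)
qed

section \<open>Markov chains driven by independent noise\<close>

text \<open>The transition law \<open>P x\<close> is realized as the law of \<open>G x u\<close> for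
  noise \<open>u\<close>. Paths become explicit functions of a starting point and an independent
  noise sequence, and statements about the process turn into Fubini on a product space.\<close>

locale driven_chain =
  m: prob_space m + \<nu>: prob_space \<nu>
  for m :: "'a measure" and \<nu> :: "'b measure" +
  fixes G :: "'a \<Rightarrow> 'b \<Rightarrow> 'a" and P :: "'a \<Rightarrow> 'a measure"
  assumes measurable_G: "case_prod G \<in> m \<Otimes>\<^sub>M \<nu> \<rightarrow>\<^sub>M m"
    and P_eq: "\<And>x. x \<in> space m \<Longrightarrow> P x = distr \<nu> m (G x)"
begin

sublocale seq: sequence_space \<nu>
  by unfold_locales

abbreviation W :: "(nat \<Rightarrow> 'b) measure" where "W \<equiv> PiM UNIV (\<lambda>_. \<nu>)"
abbreviation Path :: "(nat \<Rightarrow> 'a) measure" where "Path \<equiv> PiM UNIV (\<lambda>_. m)"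

primrec traj :: "'a \<Rightarrow> (nat \<Rightarrow> 'b) \<Rightarrow> nat \<Rightarrow> 'a" where
  "traj x \<omega> 0 = x"
| "traj x \<omega> (Suc n) = G (traj x \<omega> n) (\<omega> n)"

lemma measurable_G' [measurable (raw)]:
  assumes [measurable]: "f \<in> N \<rightarrow>\<^sub>M m" "g \<in> N \<rightarrow>\<^sub>M \<nu>"
  shows "(\<lambda>x. G (f x) (g x)) \<in> N \<rightarrow>\<^sub>M m"
  using measurable_compose[OF measurable_Pair[OF assms] measurable_G] by simp

lemma measurable_traj_nth [measurable (raw)]:
  assumes [measurable]: "f \<in> N \<rightarrow>\<^sub>M m" "g \<in> N \<rightarrow>\<^sub>M W"
  shows "(\<lambda>x. traj (f x) (g x) n) \<in> N \<rightarrow>\<^sub>M m"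
  by (induction n) auto

lemma measurable_traj [measurable (raw)]:
  assumes [measurable]: "f \<in> N \<rightarrow>\<^sub>M m" "g \<in> N \<rightarrow>\<^sub>M W"
  shows "(\<lambda>x. traj (f x) (g x)) \<in> N \<rightarrow>\<^sub>M Path"
  by (rule measurable_PiM_single') (auto simp: space_PiM PiE_iff intro: measurable_space[OF measurable_traj_nth[OF assms]])

lemma G_space: "x \<in> space m \<Longrightarrow> u \<in> space \<nu> \<Longrightarrow> G x u \<in> space m"
  using measurable_space[OF measurable_G, of "(x, u)"] by (simp add: space_pair_measure)

lemma traj_space: "x \<in> space m \<Longrightarrow> \<omega> \<in> space W \<Longrightarrow> traj x \<omega> n \<in> space m"
  by (induction n) (auto simp: space_PiM PiE_iff intro: G_space)

lemma traj_Cons: "traj x (case_nat u \<omega>) = case_nat x (traj (G x u) \<omega>)"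
proof
  fix n
  have "traj x (case_nat u \<omega>) (Suc n) = traj (G x u) \<omega> n" for n
    by (induction n) auto
  then show "traj x (case_nat u \<omega>) n = case_nat x (traj (G x u) \<omega>) n" by (cases n) auto
qed

lemma shift_traj_Cons: "shift (traj x (case_nat u \<omega>)) = traj (G x u) \<omega>"
  by (simp add: traj_Cons shift_def fun_eq_iff)

lemma traj_comb_seq: "i \<le> n \<Longrightarrow> traj x (comb_seq n \<omega> \<omega>') i = traj x \<omega> i"
  by (induction i) (auto simp: comb_seq_less)

text \<open>\<open>comb_seq n \<omega> \<omega>'\<close> follows \<omega> for \<open>n\<close> steps
  and then starts \<omega>' afresh. Together with \<open>nn_integral_W_comb\<close> this is the
  Markov property at time \<open>n\<close>.\<close>

lemma traj_comb_seq_add: "traj x (comb_seq n \<omega> \<omega>') (k + n) = traj (traj x \<omega> n) \<omega>' k"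
  by (induction k) (auto simp: comb_seq_add traj_comb_seq)

lemma nn_integral_W_Cons:
  assumes [measurable]: "f \<in> borel_measurable W"
  shows "(\<integral>\<^sup>+\<omega>. f \<omega> \<partial>W) = (\<integral>\<^sup>+u. \<integral>\<^sup>+\<omega>. f (case_nat u \<omega>) \<partial>W \<partial>\<nu>)"
proof -
  have "(\<integral>\<^sup>+\<omega>. f \<omega> \<partial>W) = (\<integral>\<^sup>+\<omega>. f \<omega> \<partial>distr (\<nu> \<Otimes>\<^sub>M W) W (\<lambda>(s, \<omega>). case_nat s \<omega>))"
    by (simp add: seq.PiM_iter)
  also have "\<dots> = (\<integral>\<^sup>+p. f (case_nat (fst p) (snd p)) \<partial>(\<nu> \<Otimes>\<^sub>M W))"
    by (subst nn_integral_distr) (auto simp: case_prod_beta')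
  also have "\<dots> = (\<integral>\<^sup>+u. \<integral>\<^sup>+\<omega>. f (case_nat u \<omega>) \<partial>W \<partial>\<nu>)"
    by (subst seq.P.nn_integral_fst[symmetric]) auto
  finally show ?thesis .
qed

lemma nn_integral_W_comb:
  assumes [measurable]: "f \<in> borel_measurable W"
  shows "(\<integral>\<^sup>+\<omega>. f \<omega> \<partial>W) = (\<integral>\<^sup>+\<omega>. \<integral>\<^sup>+\<omega>'. f (comb_seq n \<omega> \<omega>') \<partial>W \<partial>W)"
proof -
  have "(\<integral>\<^sup>+\<omega>. f \<omega> \<partial>W) = (\<integral>\<^sup>+\<omega>. f \<omega> \<partial>distr (W \<Otimes>\<^sub>M W) W (\<lambda>(\<omega>, \<omega>'). comb_seq n \<omega> \<omega>'))"
    by (simp add: seq.PiM_comb_seq)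
  also have "\<dots> = (\<integral>\<^sup>+p. f (comb_seq n (fst p) (snd p)) \<partial>(W \<Otimes>\<^sub>M W))"
    by (subst nn_integral_distr) (auto simp: case_prod_beta')
  also have "\<dots> = (\<integral>\<^sup>+\<omega>. \<integral>\<^sup>+\<omega>'. f (comb_seq n \<omega> \<omega>') \<partial>W \<partial>W)"
    by (subst seq.P.nn_integral_fst[symmetric]) auto
  finally show ?thesis .
qed

lemma nn_integral_W_0:
  assumes [measurable]: "f \<in> borel_measurable \<nu>"
  shows "(\<integral>\<^sup>+\<omega>. f (\<omega> 0) \<partial>W) = (\<integral>\<^sup>+u. f u \<partial>\<nu>)"
  by (subst nn_integral_W_Cons) (auto simp: seq.P.emeasure_space_1)

definition law :: "(nat \<Rightarrow> 'a) measure" where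
  "law = distr (m \<Otimes>\<^sub>M W) Path (\<lambda>p. traj (fst p) (snd p))"

lemma sets_law [measurable_cong, simp]: "sets law = sets Path"
  by (simp add: law_def)

lemma space_law [simp]: "space law = space Path"
  by (simp add: law_def)

lemma prob_space_law: "prob_space law"
proof -
  interpret pair_prob_space m W ..
  show ?thesis unfolding law_def by (rule prob_space_distr) measurable
qed

lemma nn_integral_law:
  assumes [measurable]: "f \<in> borel_measurable Path"
  shows "(\<integral>\<^sup>+\<omega>. f \<omega> \<partial>law) = (\<integral>\<^sup>+x. \<integral>\<^sup>+\<omega>. f (traj x \<omega>) \<partial>W \<partial>m)"
  unfolding law_def
  by (subst nn_integral_distr) (auto simp: seq.P.nn_integral_fst[symmetric])

section \<open>Agreement with the Ionescu-Tulcea law\<close>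

lemma Ionescu_Tulcea_chain:
  "Ionescu_Tulcea (\<lambda>n \<omega>. case n of 0 \<Rightarrow> m | Suc k \<Rightarrow> P (\<omega> k)) (\<lambda>_. m)"
proof (rule Ionescu_Tulcea.intro)
  have P [measurable]: "P \<in> m \<rightarrow>\<^sub>M subprob_algebra m"
  proof -
    have "(\<lambda>x. distr \<nu> m (G x)) \<in> m \<rightarrow>\<^sub>M subprob_algebra m"
      using measurable_G \<nu>.subprob_space_axioms
      by (intro measurable_distr2[where M = \<nu>]) (auto simp: space_subprob_algebra)
    then show ?thesis using measurable_cong[of m P "\<lambda>x. distr \<nu> m (G x)"] P_eq by blast
  qed
  show "(\<lambda>\<omega>. case n of 0 \<Rightarrow> m | Suc k \<Rightarrow> P (\<omega> k)) \<in> PiM {0..<n} (\<lambda>_. m) \<rightarrow>\<^sub>M subprob_algebra m" for n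
    using m.subprob_space_axioms by (cases n) (auto simp: space_subprob_algebra)
  show "prob_space (case n of 0 \<Rightarrow> m | Suc k \<Rightarrow> P (\<omega> k))" if "\<omega> \<in> space (PiM {0..<n} (\<lambda>_. m))" for n \<omega>
  proof (cases n)
    case (Suc k)
    then have k: "\<omega> k \<in> space m" using that by (auto simp: space_PiM PiE_iff)
    have "prob_space (distr \<nu> m (G (\<omega> k)))"
      by (rule \<nu>.prob_space_distr) (use k in measurable)
    with Suc P_eq[OF k] show ?thesis by simp
  qed (simp add: m.prob_space_axioms)
qed

text \<open>Both laws are determined by finite-dimensional cylinders, where the composition of
  kernels is matched with the trajectory, one more coordinate at a time.\<close>

lemma markov_law_eq: "markov_law m P = law"
proof -
  interpret IT: Ionescu_Tulcea "\<lambda>n \<omega>. case n of 0 \<Rightarrow> m | Suc k \<Rightarrow> P (\<omega> k)" "\<lambda>_. m"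
    by (rule Ionescu_Tulcea_chain)
  let ?M = "\<lambda>n::nat. PiM {0..<n} (\<lambda>_. m)"
  have restr [measurable]: "(\<lambda>f. restrict f {0..<n}) \<in> Path \<rightarrow>\<^sub>M ?M n" for n
    by (rule measurable_restrict_subset) simp
  \<comment> \<open>\<open>IT.C 0 n\<close> is the joint law of the first \<open>n\<close>
    coordinates; its starting point is the unique element of the empty product.\<close>
  have C: "(\<integral>\<^sup>+\<omega>. f \<omega> \<partial>IT.C 0 n (\<lambda>_. undefined)) = (\<integral>\<^sup>+x. \<integral>\<^sup>+\<omega>. f (restrict (traj x \<omega>) {0..<n}) \<partial>W \<partial>m)"
    if "f \<in> borel_measurable (?M n)" for f :: "(nat \<Rightarrow> 'a) \<Rightarrow> ennreal" and n
    using that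
  proof (induction n arbitrary: f)
    case 0
    have "restrict \<omega> {0..<0::nat} = (\<lambda>_. undefined)" for \<omega> :: "nat \<Rightarrow> 'a" by auto
    with 0 show ?case
      by (simp add: nn_integral_return seq.P.emeasure_space_1 m.emeasure_space_1)
  next
    case (Suc n)
    note [measurable] = Suc.prems
    define g where "g \<omega> = (\<integral>\<^sup>+y. f (fun_upd \<omega> n y) \<partial>(case n of 0 \<Rightarrow> m | Suc k \<Rightarrow> P (\<omega> k)))" for \<omega>
    have "(\<lambda>\<omega>. \<integral>\<^sup>+y. f y \<partial>IT.eP n \<omega>) \<in> borel_measurable (?M n)"
      using nn_integral_measurable_subprob_algebra2[of "\<lambda>_. f" "?M n" "?M (Suc n)" "IT.eP n"] by measurable
    moreover have eP: "(\<integral>\<^sup>+y. f y \<partial>IT.eP n \<omega>) = g \<omega>" if "\<omega> \<in> space (?M n)" for \<omega>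
      unfolding g_def using that by (rule IT.nn_integral_eP) measurable
    ultimately have gm: "g \<in> borel_measurable (?M n)"
      using measurable_cong[of "?M n" "\<lambda>\<omega>. \<integral>\<^sup>+y. f y \<partial>IT.eP n \<omega>" g] by blast
    have u: "(\<lambda>_. undefined) \<in> space (?M 0)" by simp
    have "(\<integral>\<^sup>+\<omega>. f \<omega> \<partial>IT.C 0 (Suc n) (\<lambda>_. undefined)) = (\<integral>\<^sup>+\<omega>. \<integral>\<^sup>+y. f y \<partial>IT.eP n \<omega> \<partial>IT.C 0 n (\<lambda>_. undefined))"
      by (simp, rule nn_integral_bind[where B = "?M (Suc n)"])
         (use IT.sets_C[OF u, of n] IT.measurable_eP[of n] in \<open>auto cong: measurable_cong_sets\<close>)
    also have "\<dots> = (\<integral>\<^sup>+\<omega>. g \<omega> \<partial>IT.C 0 n (\<lambda>_. undefined))"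
      by (rule nn_integral_cong) (use IT.space_C[OF u, of n] eP in auto)
    also have "\<dots> = (\<integral>\<^sup>+x. \<integral>\<^sup>+\<omega>. g (restrict (traj x \<omega>) {0..<n}) \<partial>W \<partial>m)"
      by (rule Suc.IH[OF gm])
    \<comment> \<open>The kernel at index 0 is the initial law \<open>m\<close>, whereas at index
      \<open>Suc k\<close> it is \<open>P\<close> at the previous state; hence the case
      distinction.\<close>
    also have "\<dots> = (\<integral>\<^sup>+x. \<integral>\<^sup>+\<omega>. f (restrict (traj x \<omega>) {0..<Suc n}) \<partial>W \<partial>m)"
    proof (cases n)
      case 0
      have r: "restrict \<omega> {0..<0::nat} = (\<lambda>_. undefined)"
        "restrict \<omega> {0..<Suc 0} = (\<lambda>_. undefined)(0 := \<omega> 0)" for \<omega> :: "nat \<Rightarrow> 'a" by auto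
      have fm: "(\<lambda>x. f ((\<lambda>_. undefined)(0 := x))) \<in> borel_measurable m"
        using Suc.prems 0
        by (intro measurable_compose[OF _ Suc.prems] measurable_fun_upd[where J = "{0..<0}"]) auto
      show ?thesis unfolding 0 g_def r
        by (simp add: seq.P.emeasure_space_1 m.emeasure_space_1)
    next
      case (Suc k)
      show ?thesis
      proof (rule nn_integral_cong)
        fix x assume x [measurable]: "x \<in> space m"
        define h where "h \<omega> u = f ((restrict (traj x \<omega>) {0..<n})(n := G (traj x \<omega> k) u))" for \<omega> u
        have fm: "(\<lambda>p. (restrict (traj x (fst p)) {0..<n})(n := G (traj x (fst p) k) (snd p))) \<in> W \<Otimes>\<^sub>M \<nu> \<rightarrow>\<^sub>M ?M (Suc n)"
          by (rule measurable_fun_upd[where J = "{0..<n}"])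
             (auto intro!: measurable_compose[OF _ restr])
        have hm [measurable]: "case_prod h \<in> borel_measurable (W \<Otimes>\<^sub>M \<nu>)"
          unfolding h_def case_prod_beta' by (rule measurable_compose[OF fm Suc.prems])
        have "(\<integral>\<^sup>+\<omega>. g (restrict (traj x \<omega>) {0..<n}) \<partial>W) = (\<integral>\<^sup>+\<omega>. \<integral>\<^sup>+u. h \<omega> u \<partial>\<nu> \<partial>W)"
        proof (rule nn_integral_cong)
          fix \<omega> assume \<omega>: "\<omega> \<in> space W"
          have k: "traj x \<omega> k \<in> space m" using x \<omega> by (rule traj_space)
          have \<omega>n: "restrict (traj x \<omega>) {0..<n} \<in> space (?M n)"
            using traj_space[OF x \<omega>] by (auto simp: space_PiM PiE_iff)
          have "(\<lambda>y. (restrict (traj x \<omega>) {0..<n})(n := y)) \<in> m \<rightarrow>\<^sub>M ?M (Suc n)"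
            by (rule measurable_fun_upd[where J = "{0..<n}"]) (use \<omega>n in auto)
          then have "(\<lambda>y. f ((restrict (traj x \<omega>) {0..<n})(n := y))) \<in> borel_measurable m"
            by (rule measurable_compose[OF _ Suc.prems])
          then show "g (restrict (traj x \<omega>) {0..<n}) = (\<integral>\<^sup>+u. h \<omega> u \<partial>\<nu>)"
            using k by (simp add: g_def Suc P_eq h_def nn_integral_distr)
        qed
        \<comment> \<open>The new noise variable is represented as entry 0 of an independent
          sequence, which is then glued on after time \<open>k\<close>.\<close>
        also have "\<dots> = (\<integral>\<^sup>+\<omega>. \<integral>\<^sup>+\<omega>'. h \<omega> (\<omega>' 0) \<partial>W \<partial>W)"
          by (intro nn_integral_cong nn_integral_W_0[symmetric]) measurable
        also have "\<dots> = (\<integral>\<^sup>+\<omega>. \<integral>\<^sup>+\<omega>'. f (restrict (traj x (comb_seq k \<omega> \<omega>')) {0..<Suc n}) \<partial>W \<partial>W)"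
        proof (intro nn_integral_cong)
          fix \<omega> \<omega>' :: "nat \<Rightarrow> 'b"
          have "restrict (traj x (comb_seq k \<omega> \<omega>')) {0..<Suc n} = (restrict (traj x \<omega>) {0..<n})(n := G (traj x \<omega> k) (\<omega>' 0))"
            using comb_seq_add[of k \<omega> \<omega>' 0]
            by (auto simp: fun_eq_iff Suc traj_comb_seq restrict_def less_Suc_eq)
          then show "h \<omega> (\<omega>' 0) = f (restrict (traj x (comb_seq k \<omega> \<omega>')) {0..<Suc n})" by (simp add: h_def)
        qed
        also have "\<dots> = (\<integral>\<^sup>+\<omega>. f (restrict (traj x \<omega>) {0..<Suc n}) \<partial>W)"
          by (rule nn_integral_W_comb[symmetric]) measurable
        finally show "(\<integral>\<^sup>+\<omega>. g (restrict (traj x \<omega>) {0..<n}) \<partial>W) = (\<integral>\<^sup>+\<omega>. f (restrict (traj x \<omega>) {0..<Suc n}) \<partial>W)" .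
      qed
    qed
    finally show ?case .
  qed
  have "law = IT.PF.lim"
  proof (rule measure_eqI_PiM_infinite)
    show "sets IT.PF.lim = sets Path" by simp
    show "sets law = sets Path" by simp
    interpret L: prob_space law by (rule prob_space_law)
    show "finite_measure law" by (rule L.finite_measure_axioms)
    fix A :: "nat \<Rightarrow> 'a set" and J :: "nat set" assume J: "finite J" "J \<subseteq> UNIV" "\<And>i. i \<in> J \<Longrightarrow> A i \<in> sets m"
    define n where "n = IT.up_to J"
    have Jn: "J \<subseteq> {0..<n}" unfolding n_def by (rule IT.up_to[OF J(1)])
    let ?X = "Pi\<^sub>E J A"
    have X: "?X \<in> sets (PiM J (\<lambda>_. m))" using J by (intro sets_PiM_I_finite) auto
    have Xn [measurable]: "prod_emb {0..<n} (\<lambda>_. m) J ?X \<in> sets (?M n)"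
      by (rule measurable_prod_emb[OF Jn X])
    have XU [measurable]: "prod_emb UNIV (\<lambda>_. m) J ?X \<in> sets Path"
      by (rule measurable_prod_emb[OF _ X]) simp
    have u: "(\<lambda>_. undefined) \<in> space (?M 0)" by simp
    have "emeasure IT.PF.lim (prod_emb UNIV (\<lambda>_. m) J ?X) = emeasure (IT.C 0 n (\<lambda>_. undefined)) (prod_emb {0..<n} (\<lambda>_. m) J ?X)"
      using IT.lim[OF J(1) X] IT.emeasure_CI[OF Jn X] by simp
    also have "\<dots> = (\<integral>\<^sup>+\<omega>. indicator (prod_emb {0..<n} (\<lambda>_. m) J ?X) \<omega> \<partial>IT.C 0 n (\<lambda>_. undefined))"
      using IT.sets_C[OF u, of n] by simp
    also have "\<dots> = (\<integral>\<^sup>+x. \<integral>\<^sup>+\<omega>. indicator (prod_emb {0..<n} (\<lambda>_. m) J ?X) (restrict (traj x \<omega>) {0..<n}) \<partial>W \<partial>m)"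
      by (rule C) measurable
    also have "\<dots> = (\<integral>\<^sup>+x. \<integral>\<^sup>+\<omega>. indicator (prod_emb UNIV (\<lambda>_. m) J ?X) (traj x \<omega>) \<partial>W \<partial>m)"
    proof (intro nn_integral_cong)
      fix x \<omega> assume "x \<in> space m" "\<omega> \<in> space W"
      then have "traj x \<omega> i \<in> space m" for i by (rule traj_space)
      then show "(indicator (prod_emb {0..<n} (\<lambda>_. m) J ?X) (restrict (traj x \<omega>) {0..<n}) :: ennreal) =
         indicator (prod_emb UNIV (\<lambda>_. m) J ?X) (traj x \<omega>)"
        using Jn by (auto simp: indicator_def prod_emb_iff restrict_restrict Int_absorb1 PiE_iff)
    qed
    also have "\<dots> = emeasure law (prod_emb UNIV (\<lambda>_. m) J ?X)"
      by (subst nn_integral_law[symmetric]) auto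
    finally show "emeasure law (prod_emb UNIV (\<lambda>_. m) J ?X) = emeasure IT.PF.lim (prod_emb UNIV (\<lambda>_. m) J ?X)" ..
  qed
  then show ?thesis by (simp add: markov_law_def)
qed

end

section \<open>Stationary chains and the zero-one law for invariant events\<close>

locale stationary_chain = driven_chain +
  assumes invariant: "distr (m \<Otimes>\<^sub>M \<nu>) m (case_prod G) = m"
begin

lemma nn_integral_G:
  assumes [measurable]: "f \<in> borel_measurable m"
  shows "(\<integral>\<^sup>+x. \<integral>\<^sup>+u. f (G x u) \<partial>\<nu> \<partial>m) = (\<integral>\<^sup>+x. f x \<partial>m)"
proof -
  note [measurable] = measurable_G
  have "(\<integral>\<^sup>+x. f x \<partial>m) = (\<integral>\<^sup>+x. f x \<partial>distr (m \<Otimes>\<^sub>M \<nu>) m (case_prod G))" by (simp add: invariant)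
  also have "\<dots> = (\<integral>\<^sup>+p. f (case_prod G p) \<partial>(m \<Otimes>\<^sub>M \<nu>))" by (rule nn_integral_distr) measurable
  also have "\<dots> = (\<integral>\<^sup>+x. \<integral>\<^sup>+u. f (G x u) \<partial>\<nu> \<partial>m)"
    by (subst \<nu>.nn_integral_fst[symmetric]) auto
  finally show ?thesis by simp
qed

lemma nn_integral_law_shift:
  assumes [measurable]: "f \<in> borel_measurable Path"
  shows "(\<integral>\<^sup>+\<omega>. f (shift \<omega>) \<partial>law) = (\<integral>\<^sup>+\<omega>. f \<omega> \<partial>law)"
proof -
  have [measurable]: "shift \<in> Path \<rightarrow>\<^sub>M Path"
    unfolding shift_def by (rule measurable_PiM_single') (auto simp: space_PiM PiE_iff)
  have "(\<integral>\<^sup>+\<omega>. f (shift \<omega>) \<partial>law) = (\<integral>\<^sup>+x. \<integral>\<^sup>+\<omega>. f (shift (traj x \<omega>)) \<partial>W \<partial>m)"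
    by (rule nn_integral_law) measurable
  also have "\<dots> = (\<integral>\<^sup>+x. \<integral>\<^sup>+u. \<integral>\<^sup>+\<omega>. f (traj (G x u) \<omega>) \<partial>W \<partial>\<nu> \<partial>m)"
    by (intro nn_integral_cong, subst nn_integral_W_Cons) (auto simp: shift_traj_Cons)
  also have "\<dots> = (\<integral>\<^sup>+x. \<integral>\<^sup>+\<omega>. f (traj x \<omega>) \<partial>W \<partial>m)"
    by (rule nn_integral_G[where f = "\<lambda>x. \<integral>\<^sup>+\<omega>. f (traj x \<omega>) \<partial>W"]) measurable
  also have "\<dots> = (\<integral>\<^sup>+\<omega>. f \<omega> \<partial>law)" by (rule nn_integral_law[symmetric]) measurable
  finally show ?thesis .
qed

lemma nn_integral_law_shift_add:
  assumes "f \<in> borel_measurable Path"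
  shows "(\<integral>\<^sup>+\<omega>. f (\<lambda>k. \<omega> (k + n)) \<partial>law) = (\<integral>\<^sup>+\<omega>. f \<omega> \<partial>law)"
  using assms
proof (induction n arbitrary: f)
  case (Suc n)
  note [measurable] = Suc.prems
  have [measurable]: "shift \<in> Path \<rightarrow>\<^sub>M Path"
    unfolding shift_def by (rule measurable_PiM_single') (auto simp: space_PiM PiE_iff)
  have "(\<integral>\<^sup>+\<omega>. f (\<lambda>k. \<omega> (k + Suc n)) \<partial>law) = (\<integral>\<^sup>+\<omega>. f (shift (\<lambda>k. \<omega> (k + n))) \<partial>law)"
    by (simp add: shift_def[abs_def])
  also have "\<dots> = (\<integral>\<^sup>+\<omega>. f (shift \<omega>) \<partial>law)" by (rule Suc.IH[of "\<lambda>\<omega>. f (shift \<omega>)"]) measurable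
  also have "\<dots> = (\<integral>\<^sup>+\<omega>. f \<omega> \<partial>law)" by (rule nn_integral_law_shift) measurable
  finally show ?case .
qed simp

lemma nn_integral_law_nth:
  assumes [measurable]: "f \<in> borel_measurable m"
  shows "(\<integral>\<^sup>+\<omega>. f (\<omega> n) \<partial>law) = (\<integral>\<^sup>+x. f x \<partial>m)"
proof -
  have "(\<integral>\<^sup>+\<omega>. f (\<omega> n) \<partial>law) = (\<integral>\<^sup>+\<omega>. f (\<omega> 0) \<partial>law)"
    using nn_integral_law_shift_add[of "\<lambda>\<omega>. f (\<omega> 0)" n] by simp
  also have "\<dots> = (\<integral>\<^sup>+x. \<integral>\<^sup>+\<omega>. f (traj x \<omega> 0) \<partial>W \<partial>m)"
    by (rule nn_integral_law) measurable
  finally show ?thesis by (simp add: seq.P.emeasure_space_1)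
qed

text \<open>Each coordinate has law \<open>m\<close>, so a null set is visited at time
  \<open>n\<close> with probability 0, and there are countably many times.\<close>

lemma AE_law_nth:
  assumes "AE x in m. Q x"
  shows "AE \<omega> in law. \<forall>n. Q (\<omega> n)"
  unfolding AE_all_countable
proof
  fix n
  obtain N where N: "{x \<in> space m. \<not> Q x} \<subseteq> N" "N \<in> null_sets m"
    using assms by (auto elim!: AE_E simp: null_sets_def)
  have [measurable]: "N \<in> sets m" using N by auto
  have "emeasure law {\<omega> \<in> space law. \<omega> n \<in> N} = (\<integral>\<^sup>+\<omega>. indicator N (\<omega> n) \<partial>law)"
  proof -
    have "emeasure law {\<omega> \<in> space law. \<omega> n \<in> N} = (\<integral>\<^sup>+\<omega>. indicator {\<omega> \<in> space law. \<omega> n \<in> N} \<omega> \<partial>law)"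
      by (rule nn_integral_indicator[symmetric]) measurable
    also have "\<dots> = (\<integral>\<^sup>+\<omega>. indicator N (\<omega> n) \<partial>law)"
      by (intro nn_integral_cong) (auto simp: indicator_def)
    finally show ?thesis .
  qed
  also have "\<dots> = (\<integral>\<^sup>+x. indicator N x \<partial>m)" by (rule nn_integral_law_nth) measurable
  also have "\<dots> = 0" using N by auto
  finally have "emeasure law {\<omega> \<in> space law. \<omega> n \<in> N} = 0" .
  moreover have "{\<omega> \<in> space law. \<omega> n \<in> N} \<in> sets law" by measurable
  ultimately have "{\<omega> \<in> space law. \<omega> n \<in> N} \<in> null_sets law" by auto
  then show "AE \<omega> in law. Q (\<omega> n)"
  proof (rule AE_I')
    show "{\<omega> \<in> space law. \<not> Q (\<omega> n)} \<subseteq> {\<omega> \<in> space law. \<omega> n \<in> N}"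
      using N(1) by (auto simp: space_PiM PiE_iff)
  qed
qed

text \<open>For an invariant event \<open>A\<close>, the probability \<open>h x\<close> of
  \<open>A\<close> for the chain started at \<open>x\<close> is harmonic in \<open>x\<close>. If it
  is almost everywhere constant, the Markov property makes \<open>A\<close> independent of every
  cylinder, hence of itself.\<close>

lemma ergodicI:
  assumes harmonic: "\<And>h. h \<in> borel_measurable m \<Longrightarrow> (\<And>x. x \<in> space m \<Longrightarrow> 0 \<le> h x \<and> h x \<le> 1) \<Longrightarrow>
      (\<And>x. x \<in> space m \<Longrightarrow> h x = (\<integral>u. h (G x u) \<partial>\<nu>)) \<Longrightarrow> \<exists>c::real. AE x in m. h x = c"
  shows "ergodic_wrt m P"
  unfolding ergodic_wrt_def markov_law_eq
proof (intro ballI impI)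
  fix A assume A [measurable]: "A \<in> sets Path" and inv: "shift -` A \<inter> space Path = A"
  interpret law: prob_space law by (rule prob_space_law)
  have inv': "shift \<omega> \<in> A \<longleftrightarrow> \<omega> \<in> A" if "\<omega> \<in> space Path" for \<omega> using inv that by blast
  have inv_n: "(\<lambda>k. \<omega> (k + n)) \<in> A \<longleftrightarrow> \<omega> \<in> A" if \<omega>: "\<omega> \<in> space Path" for \<omega> n
  proof (induction n)
    case (Suc n)
    have "(\<lambda>k. \<omega> (k + Suc n)) = shift (\<lambda>k. \<omega> (k + n))" by (simp add: shift_def[abs_def])
    moreover have "(\<lambda>k. \<omega> (k + n)) \<in> space Path" using \<omega> by (auto simp: space_PiM PiE_iff)
    ultimately show ?case using inv' Suc by simp
  qed simp
  have traj_Path: "traj x \<omega> \<in> space Path" if "x \<in> space m" "\<omega> \<in> space W" for x \<omega>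
    using traj_space[OF that] by (auto simp: space_PiM PiE_iff)
  define H where "H x = (\<integral>\<^sup>+\<omega>. indicator A (traj x \<omega>) \<partial>W)" for x
  have Hm [measurable]: "H \<in> borel_measurable m" unfolding H_def by measurable
  have H1: "H x \<le> 1" for x
  proof -
    have "H x \<le> (\<integral>\<^sup>+\<omega>. 1 \<partial>W)" unfolding H_def by (intro nn_integral_mono) (auto split: split_indicator)
    then show ?thesis by (simp add: seq.P.emeasure_space_1)
  qed
  define h where "h x = enn2real (H x)" for x
  have hm [measurable]: "h \<in> borel_measurable m" unfolding h_def by measurable
  have Hh: "H x = ennreal (h x)" for x
    using H1[of x] unfolding h_def by (metis ennreal_enn2real ennreal_one_less_top order_le_less_trans)
  have h01: "0 \<le> h x" "h x \<le> 1" for x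
    using H1[of x] unfolding Hh by (auto simp: h_def)
  have "\<exists>c. AE x in m. h x = c"
  proof (rule harmonic[OF hm])
    fix x assume x [measurable]: "x \<in> space m"
    have "H x = (\<integral>\<^sup>+u. \<integral>\<^sup>+\<omega>. indicator A (traj x (case_nat u \<omega>)) \<partial>W \<partial>\<nu>)"
      unfolding H_def by (rule nn_integral_W_Cons) measurable
    also have "\<dots> = (\<integral>\<^sup>+u. H (G x u) \<partial>\<nu>)"
      unfolding H_def
    proof (intro nn_integral_cong)
      fix u \<omega> assume u: "u \<in> space \<nu>" and \<omega>: "\<omega> \<in> space W"
      then have "case_nat u \<omega> \<in> space W" by (auto simp: space_PiM PiE_iff split: nat.split)
      from inv'[OF traj_Path[OF x this]]
      show "(indicator A (traj x (case_nat u \<omega>)) :: ennreal) = indicator A (traj (G x u) \<omega>)"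
        by (simp add: shift_traj_Cons indicator_def)
    qed
    also have "\<dots> = ennreal (\<integral>u. h (G x u) \<partial>\<nu>)"
      unfolding Hh
    proof (rule nn_integral_eq_integral)
      show "integrable \<nu> (\<lambda>u. h (G x u))"
        by (rule \<nu>.integrable_const_bound[of _ 1]) (auto simp: h01)
    qed (simp add: h01)
    finally show "h x = (\<integral>u. h (G x u) \<partial>\<nu>)"
      unfolding Hh using h01 by (simp add: integral_nonneg_AE)
  qed (auto simp: h01)
  then obtain c where c: "AE x in m. h x = c" by blast
  have lawA: "emeasure law A = ennreal c"
  proof -
    have "emeasure law A = (\<integral>\<^sup>+\<omega>. indicator A \<omega> \<partial>law)" by simp
    also have "\<dots> = (\<integral>\<^sup>+x. H x \<partial>m)" unfolding H_def by (rule nn_integral_law) measurable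
    also have "\<dots> = (\<integral>\<^sup>+x. ennreal c \<partial>m)"
      using c by (intro nn_integral_cong_AE) (auto simp: Hh)
    finally show ?thesis by (simp add: m.emeasure_space_1)
  qed
  have c0: "0 \<le> c"
  proof -
    have "AE x in m. 0 \<le> c" using c by eventually_elim (use h01 in force)
    then show ?thesis by simp
  qed
  \<comment> \<open>Independence of the past: given the first \<open>n\<close> steps, the
    probability of \<open>A\<close> is \<open>h\<close> at the state reached at time
    \<open>n\<close>, so the two measures agree on cylinders.\<close>
  have "density law (indicator A) = density law (\<lambda>_. ennreal c)"
  proof (rule measure_eqI_PiM_infinite)
    show "sets (density law (indicator A)) = sets Path" "sets (density law (\<lambda>_. ennreal c)) = sets Path" by simp_all
    have "emeasure (density law (indicator A)) (space law) = (\<integral>\<^sup>+\<omega>. indicator A \<omega> * indicator (space law) \<omega> \<partial>law)"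
      by (rule emeasure_density) auto
    also have "\<dots> = (\<integral>\<^sup>+\<omega>. indicator A \<omega> \<partial>law)"
      by (intro nn_integral_cong) simp
    also have "\<dots> = ennreal c" using lawA by simp
    finally show "finite_measure (density law (indicator A))"
      by (intro finite_measureI) simp
    fix E :: "nat \<Rightarrow> 'a set" and J :: "nat set" assume J: "finite J" "J \<subseteq> UNIV" "\<And>i. i \<in> J \<Longrightarrow> E i \<in> sets m"
    let ?B = "prod_emb UNIV (\<lambda>_. m) J (Pi\<^sub>E J E)"
    have B [measurable]: "?B \<in> sets Path" using J by (intro sets_PiM_I) auto
    obtain n where n: "J \<subseteq> {..n}" using J(1) finite_nat_iff_bounded_le by auto
    have "emeasure (density law (indicator A)) ?B = (\<integral>\<^sup>+\<omega>. indicator A \<omega> * indicator ?B \<omega> \<partial>law)"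
      by (rule emeasure_density) auto
    also have "\<dots> = (\<integral>\<^sup>+x. \<integral>\<^sup>+\<omega>. indicator A (traj x \<omega>) * indicator ?B (traj x \<omega>) \<partial>W \<partial>m)"
      by (rule nn_integral_law) measurable
    also have "\<dots> = (\<integral>\<^sup>+x. \<integral>\<^sup>+\<omega>. ennreal (h (traj x \<omega> n)) * indicator ?B (traj x \<omega>) \<partial>W \<partial>m)"
    proof (rule nn_integral_cong)
      fix x assume x [measurable]: "x \<in> space m"
      have "(\<integral>\<^sup>+\<omega>. indicator A (traj x \<omega>) * indicator ?B (traj x \<omega>) \<partial>W) =
        (\<integral>\<^sup>+\<omega>. \<integral>\<^sup>+\<omega>'. indicator A (traj x (comb_seq n \<omega> \<omega>')) * indicator ?B (traj x (comb_seq n \<omega> \<omega>')) \<partial>W \<partial>W)"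
        by (rule nn_integral_W_comb) measurable
      also have "\<dots> = (\<integral>\<^sup>+\<omega>. \<integral>\<^sup>+\<omega>'. indicator A (traj (traj x \<omega> n) \<omega>') * indicator ?B (traj x \<omega>) \<partial>W \<partial>W)"
      proof (intro nn_integral_cong)
        fix \<omega> \<omega>' assume w: "\<omega> \<in> space W" "\<omega>' \<in> space W"
        then have cs: "comb_seq n \<omega> \<omega>' \<in> space W" by (auto simp: space_PiM PiE_iff comb_seq_def)
        have "traj x (comb_seq n \<omega> \<omega>') \<in> ?B \<longleftrightarrow> traj x \<omega> \<in> ?B"
        proof -
          have "restrict (traj x (comb_seq n \<omega> \<omega>')) J = restrict (traj x \<omega>) J"
            using n by (intro restrict_ext) (auto intro: traj_comb_seq)
          then show ?thesis using traj_Path[OF x w(1)] traj_Path[OF x cs] by (simp add: prod_emb_def space_PiM)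
        qed
        moreover have "traj x (comb_seq n \<omega> \<omega>') \<in> A \<longleftrightarrow> traj (traj x \<omega> n) \<omega>' \<in> A"
          using inv_n[OF traj_Path[OF x cs], of n] by (simp add: traj_comb_seq_add)
        ultimately show "(indicator A (traj x (comb_seq n \<omega> \<omega>')) * indicator ?B (traj x (comb_seq n \<omega> \<omega>')) :: ennreal)
          = indicator A (traj (traj x \<omega> n) \<omega>') * indicator ?B (traj x \<omega>)"
          by (simp add: indicator_def)
      qed
      also have "\<dots> = (\<integral>\<^sup>+\<omega>. H (traj x \<omega> n) * indicator ?B (traj x \<omega>) \<partial>W)"
        unfolding H_def using traj_space[OF x] by (intro nn_integral_cong nn_integral_multc) measurable
      finally show "(\<integral>\<^sup>+\<omega>. indicator A (traj x \<omega>) * indicator ?B (traj x \<omega>) \<partial>W) =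
        (\<integral>\<^sup>+\<omega>. ennreal (h (traj x \<omega> n)) * indicator ?B (traj x \<omega>) \<partial>W)" by (simp add: Hh)
    qed
    also have "\<dots> = (\<integral>\<^sup>+\<omega>. ennreal (h (\<omega> n)) * indicator ?B \<omega> \<partial>law)"
      by (rule nn_integral_law[symmetric]) measurable
    also have "\<dots> = (\<integral>\<^sup>+\<omega>. ennreal c * indicator ?B \<omega> \<partial>law)"
      using AE_law_nth[OF c] by (intro nn_integral_cong_AE) auto
    also have "\<dots> = emeasure (density law (\<lambda>_. ennreal c)) ?B"
      by (rule emeasure_density[symmetric]) auto
    finally show "emeasure (density law (indicator A)) ?B = emeasure (density law (\<lambda>_. ennreal c)) ?B" .
  qed
  \<comment> \<open>Evaluated at \<open>A\<close> itself, the equality of measures becomes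
    \<open>c = c * c\<close>.\<close>
  then have "emeasure (density law (indicator A)) A = emeasure (density law (\<lambda>_. ennreal c)) A" by simp
  then have "emeasure law A = ennreal c * emeasure law A"
    by (simp add: emeasure_density nn_integral_cmult flip: indicator_inter_arith)
  then have "c = c * c" using c0 unfolding lawA by (simp add: ennreal_mult[symmetric])
  then have "c \<in> {0, 1}" by auto
  then show "measure law A \<in> {0, 1}" using lawA c0 by (auto simp: measure_def)
qed

end

section \<open>A Poincare inequality for the noise\<close>

text \<open>The variance is half the mean square difference of two independent copies. The bound
  \<open>B\<close> gives the integrability behind the computation with real integrals.\<close>

lemma variance_double_integral:
  fixes X :: "'a \<Rightarrow> real"
  assumes "prob_space M" and [measurable]: "X \<in> borel_measurable M" and X: "\<And>x. x \<in> space M \<Longrightarrow> \<bar>X x\<bar> \<le> B"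
  shows "(\<integral>\<^sup>+x. ennreal ((X x)\<^sup>2) \<partial>M) = ennreal ((\<integral>x. X x \<partial>M)\<^sup>2) +
     ennreal (1/2) * (\<integral>\<^sup>+y. \<integral>\<^sup>+x. ennreal ((X x - X y)\<^sup>2) \<partial>M \<partial>M)"
proof -
  interpret prob_space M by fact
  define e e2 where "e = (\<integral>x. X x \<partial>M)" and "e2 = (\<integral>x. (X x)\<^sup>2 \<partial>M)"
  have iX: "integrable M X" using X by (intro integrable_const_bound[of _ B]) auto
  have iX2: "integrable M (\<lambda>x. (X x)\<^sup>2)"
  proof (rule integrable_const_bound[of _ "B\<^sup>2"])
    show "AE x in M. norm ((X x)\<^sup>2) \<le> B\<^sup>2"
    proof (rule AE_I2)
      fix x assume "x \<in> space M"
      from X[OF this] have "\<bar>X x\<bar>\<^sup>2 \<le> B\<^sup>2" by (intro power_mono) auto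
      then show "norm ((X x)\<^sup>2) \<le> B\<^sup>2" by simp
    qed
  qed measurable
  have inner: "(\<integral>\<^sup>+x. ennreal ((X x - c)\<^sup>2) \<partial>M) = ennreal (e2 - 2 * c * e + c\<^sup>2)" for c
  proof -
    have sq: "(X x - c)\<^sup>2 = (X x)\<^sup>2 - 2 * c * X x + c\<^sup>2" for x by (simp add: power2_diff)
    have i: "integrable M (\<lambda>x. (X x - c)\<^sup>2)" unfolding sq using iX iX2 by auto
    have "(\<integral>\<^sup>+x. ennreal ((X x - c)\<^sup>2) \<partial>M) = ennreal (\<integral>x. (X x - c)\<^sup>2 \<partial>M)"
      by (rule nn_integral_eq_integral[OF i]) simp
    also have "(\<integral>x. (X x - c)\<^sup>2 \<partial>M) = e2 - 2 * c * e + c\<^sup>2"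
      unfolding sq using iX iX2 by (simp add: e_def e2_def prob_space)
    finally show ?thesis .
  qed
  have nn: "0 \<le> e2 - 2 * c * e + c\<^sup>2" for c
  proof -
    have "0 \<le> (\<integral>x. (X x - c)\<^sup>2 \<partial>M)" by simp
    also have "\<dots> = e2 - 2 * c * e + c\<^sup>2"
    proof -
      have sq: "(X x - c)\<^sup>2 = (X x)\<^sup>2 - 2 * c * X x + c\<^sup>2" for x by (simp add: power2_diff)
      show ?thesis unfolding sq using iX iX2 by (simp add: e_def e2_def prob_space)
    qed
    finally show ?thesis .
  qed
  have i2: "integrable M (\<lambda>y. e2 - 2 * X y * e + (X y)\<^sup>2)" using iX iX2 by auto
  have "(\<integral>\<^sup>+y. \<integral>\<^sup>+x. ennreal ((X x - X y)\<^sup>2) \<partial>M \<partial>M) = (\<integral>\<^sup>+y. ennreal (e2 - 2 * X y * e + (X y)\<^sup>2) \<partial>M)"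
    by (simp add: inner)
  also have "\<dots> = ennreal (\<integral>y. e2 - 2 * X y * e + (X y)\<^sup>2 \<partial>M)"
    by (rule nn_integral_eq_integral[OF i2]) (simp add: nn)
  also have "(\<integral>y. e2 - 2 * X y * e + (X y)\<^sup>2 \<partial>M) = 2 * (e2 - e\<^sup>2)"
  proof -
    have "(\<integral>y. e2 - 2 * X y * e + (X y)\<^sup>2 \<partial>M) = (\<integral>y. e2 - (2 * e) * X y + (X y)\<^sup>2 \<partial>M)"
      by (simp add: ac_simps)
    also have "\<dots> = e2 - (2 * e) * e + e2"
      using iX iX2 by (simp add: e_def e2_def prob_space)
    finally show ?thesis by (simp add: power2_eq_square)
  qed
  finally have "ennreal (1/2) * (\<integral>\<^sup>+y. \<integral>\<^sup>+x. ennreal ((X x - X y)\<^sup>2) \<partial>M \<partial>M) = ennreal (1/2) * ennreal (2 * (e2 - e\<^sup>2))"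
    by (simp only:)
  also have "\<dots> = ennreal (e2 - e\<^sup>2)" by (subst ennreal_mult'[symmetric]) (auto simp: diff_divide_distrib)
  finally have "ennreal (1/2) * (\<integral>\<^sup>+y. \<integral>\<^sup>+x. ennreal ((X x - X y)\<^sup>2) \<partial>M \<partial>M) = ennreal (e2 - e\<^sup>2)" .
  moreover have "(\<integral>\<^sup>+x. ennreal ((X x)\<^sup>2) \<partial>M) = ennreal e2"
    unfolding e2_def by (rule nn_integral_eq_integral[OF iX2]) simp
  moreover have "0 \<le> e2 - e\<^sup>2" using nn[of e] by (simp add: power2_eq_square)
  ultimately show ?thesis by (simp add: e_def[symmetric] ennreal_plus[symmetric] del: ennreal_plus)
qed

text \<open>Substituting \<open>2 *\<^sub>R w\<close> for \<open>w\<close> contributes the Jacobian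
  4 of the plane, and the hypothesis on \<open>D\<close> another 4.\<close>

lemma nn_integral_ball_double:
  fixes D :: "real^2 \<Rightarrow> ennreal"
  assumes [measurable]: "D \<in> borel_measurable borel"
    and D: "\<And>w. D (2 *\<^sub>R w) \<le> 4 * D w"
  shows "(\<integral>\<^sup>+w. D w * indicator (ball 0 (2 * r)) w \<partial>lborel) \<le> 16 * (\<integral>\<^sup>+w. D w * indicator (ball 0 r) w \<partial>lborel)"
proof -
  have [measurable]: "ball (0::real^2) r' \<in> sets borel" for r' by simp
  have "(\<integral>\<^sup>+w. D w * indicator (ball 0 (2 * r)) w \<partial>lborel)
    = (\<integral>\<^sup>+w. D w * indicator (ball 0 (2 * r)) w \<partial>density (distr lborel borel (\<lambda>x. 0 + 2 *\<^sub>R x)) (\<lambda>_. \<bar>2\<bar> ^ DIM(real^2)))"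
    by (subst lborel_affine[of 2 0]) auto
  also have "\<dots> = (\<integral>\<^sup>+w. 4 * (D (2 *\<^sub>R w) * indicator (ball 0 (2 * r)) (2 *\<^sub>R w)) \<partial>lborel)"
    by (subst nn_integral_density) (simp_all add: nn_integral_distr)
  also have "\<dots> \<le> (\<integral>\<^sup>+w. 4 * ((4 * D w) * indicator (ball 0 r) w) \<partial>lborel)"
    using D by (intro nn_integral_mono mult_mono) (auto simp: indicator_def)
  also have "\<dots> = (\<integral>\<^sup>+w. 16 * (D w * indicator (ball 0 r) w) \<partial>lborel)"
  proof (rule nn_integral_cong)
    fix w show "4 * (4 * D w * indicator (ball 0 r) w) = 16 * (D w * indicator (ball 0 r) w)"
      by (simp add: mult.assoc[symmetric])
  qed
  also have "\<dots> = 16 * (\<integral>\<^sup>+w. D w * indicator (ball 0 r) w \<partial>lborel)"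
    by (rule nn_integral_cmult) measurable
  finally show ?thesis .
qed

lemma nn_integral_ball_pow:
  fixes D :: "real^2 \<Rightarrow> ennreal"
  assumes [measurable]: "D \<in> borel_measurable borel"
    and D: "\<And>w. D (2 *\<^sub>R w) \<le> 4 * D w"
  shows "(\<integral>\<^sup>+w. D w * indicator (ball 0 (2 ^ k * r)) w \<partial>lborel) \<le> 16 ^ k * (\<integral>\<^sup>+w. D w * indicator (ball 0 r) w \<partial>lborel)"
proof (induction k)
  case (Suc k)
  have "(\<integral>\<^sup>+w. D w * indicator (ball 0 (2 ^ Suc k * r)) w \<partial>lborel) \<le> 16 * (\<integral>\<^sup>+w. D w * indicator (ball 0 (2 ^ k * r)) w \<partial>lborel)"
    using nn_integral_ball_double[OF assms, of "2 ^ k * r"] by (simp add: mult.assoc)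
  also have "\<dots> \<le> 16 * (16 ^ k * (\<integral>\<^sup>+w. D w * indicator (ball 0 r) w \<partial>lborel))"
    by (intro mult_left_mono Suc) auto
  finally show ?case by (simp add: mult.assoc)
qed simp

text \<open>Inside the ball, the sets where \<rho> is below \<open>1 / Suc k\<close> decrease to the
  empty set, so one of them has less than a quarter of the volume of the half ball. Removing it and
  its translate by \<open>w\<close> leaves half of that volume.\<close>

lemma positive_density_overlap:
  fixes \<rho> :: "'a::euclidean_space \<Rightarrow> real"
  assumes [measurable]: "\<rho> \<in> borel_measurable borel" and \<epsilon>: "0 < \<epsilon>" and pos: "\<And>u. u \<in> ball 0 \<epsilon> \<Longrightarrow> 0 < \<rho> u"
  obtains c0 c1 where "0 < c0" "0 < c1"
    "\<And>w. w \<in> ball 0 (\<epsilon> / 2) \<Longrightarrow> ennreal c1 \<le> emeasure lborel {u. c0 \<le> \<rho> u \<and> c0 \<le> \<rho> (u + w)}"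
proof -
  define b where "b = measure lborel (ball (0::'a) (\<epsilon> / 2))"
  have b: "emeasure lborel (ball (0::'a) (\<epsilon> / 2)) = ennreal b"
    unfolding b_def by (rule emeasure_eq_ennreal_measure) (use emeasure_lborel_ball_finite[of "0::'a" "\<epsilon> / 2"] in simp)
  have "emeasure lborel (ball (0::'a) (\<epsilon> / 2)) \<noteq> 0"
    using \<epsilon> open_not_negligible[of "ball (0::'a) (\<epsilon>/2)"]
    by (auto simp: negligible_iff_emeasure0)
  then have b0: "0 < b" unfolding b by (metis ennreal_neg linorder_not_le)
  define T where "T k = ball 0 \<epsilon> \<inter> {u. \<rho> u < 1 / Suc k}" for k
  have T [measurable]: "T k \<in> sets borel" for k unfolding T_def by measurable
  have "(\<lambda>k. emeasure lborel (T k)) \<longlonglongrightarrow> emeasure lborel (\<Inter>k. T k)"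
  proof (rule Lim_emeasure_decseq)
    show "range T \<subseteq> sets lborel" using T by auto
    show "decseq T"
    proof (rule decseq_SucI)
      fix k
      have "1 / real (Suc (Suc k)) \<le> 1 / Suc k" by (simp add: frac_le)
      then show "T (Suc k) \<le> T k" unfolding T_def by (auto simp del: of_nat_Suc)
    qed
    show "emeasure lborel (T k) \<noteq> \<infinity>" for k
    proof -
      have "emeasure lborel (T k) \<le> emeasure lborel (ball (0::'a) \<epsilon>)"
        by (rule emeasure_mono) (auto simp: T_def)
      then show ?thesis using emeasure_lborel_ball_finite[of "0::'a" \<epsilon>] by (auto simp: top_unique)
    qed
  qed
  moreover have "(\<Inter>k. T k) = {}"
  proof -
    have "\<exists>k. u \<notin> T k" for u
    proof (cases "u \<in> ball 0 \<epsilon>")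
      case True
      then obtain k where "1 / real (Suc k) < \<rho> u" using pos nat_approx_posE by blast
      then show ?thesis by (auto simp: T_def intro!: exI[of _ k])
    qed (auto simp: T_def)
    then show ?thesis by auto
  qed
  ultimately have "(\<lambda>k. emeasure lborel (T k)) \<longlonglongrightarrow> 0" by simp
  moreover have "(0::ennreal) < ennreal (b / 4)" using b0 by simp
  ultimately have "\<forall>\<^sub>F k in sequentially. emeasure lborel (T k) < ennreal (b / 4)"
    by (rule order_tendstoD(2))
  then obtain k where k: "emeasure lborel (T k) < ennreal (b / 4)"
    using eventually_happens'[OF sequentially_bot] by blast
  define c0 where "c0 = 1 / real (Suc k)"
  show ?thesis
  proof (rule that)
    show "0 < c0" by (simp add: c0_def)
    show "0 < b / 2" using b0 by simp
    fix w :: 'a assume w: "w \<in> ball 0 (\<epsilon> / 2)"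
    let ?X = "{u. c0 \<le> \<rho> u \<and> c0 \<le> \<rho> (u + w)}"
    have X: "?X \<in> sets borel" by measurable
    have Tw: "{u. u + w \<in> T k} \<in> sets borel" by measurable
    have Tw_eq: "emeasure lborel {u. u + w \<in> T k} = emeasure lborel (T k)"
    proof -
      have "emeasure lborel (T k) = emeasure (distr lborel borel ((+) w)) (T k)" by (simp add: lborel_distr_plus)
      also have "\<dots> = emeasure lborel {u. u + w \<in> T k}"
        by (subst emeasure_distr) (auto simp: vimage_def add.commute)
      finally show ?thesis by simp
    qed
    have "ball 0 (\<epsilon> / 2) \<subseteq> ?X \<union> (T k \<union> {u. u + w \<in> T k})"
    proof
      fix u :: 'a assume u: "u \<in> ball 0 (\<epsilon> / 2)"
      have "norm (u + w) < \<epsilon>" using u w norm_triangle_ineq[of u w] by (simp add: dist_norm)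
      moreover have "norm u < \<epsilon>" using u \<epsilon> by simp
      ultimately show "u \<in> ?X \<union> (T k \<union> {u. u + w \<in> T k})" by (auto simp: T_def c0_def not_less)
    qed
    then have "ennreal b \<le> emeasure lborel (?X \<union> (T k \<union> {u. u + w \<in> T k}))"
      unfolding b[symmetric] using X Tw by (intro emeasure_mono) auto
    also have "\<dots> \<le> emeasure lborel ?X + (emeasure lborel (T k) + emeasure lborel (T k))"
      using X Tw emeasure_subadditive[of ?X lborel "T k \<union> {u. u + w \<in> T k}"]
        emeasure_subadditive[of "T k" lborel "{u. u + w \<in> T k}"]
      by (auto simp: Tw_eq intro: order_trans add_left_mono)
    also have "\<dots> \<le> emeasure lborel ?X + (ennreal (b / 4) + ennreal (b / 4))"
      using k by (intro add_mono) auto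
    also have "ennreal (b / 4) + ennreal (b / 4) = ennreal (b / 2)"
      using b0 by (subst ennreal_plus[symmetric]) (auto)
    finally have le: "ennreal b \<le> emeasure lborel ?X + ennreal (b / 2)" .
    show "ennreal (b / 2) \<le> emeasure lborel ?X"
    proof (rule ccontr)
      assume "\<not> ?thesis"
      then have lt: "emeasure lborel ?X < ennreal (b / 2)" by simp
      then have "emeasure lborel ?X + ennreal (b / 2) < ennreal (b / 2) + ennreal (b / 2)"
        by (simp add: ennreal_add_left_cancel_less add.commute)
      also have "\<dots> = ennreal b" using b0 by (subst ennreal_plus[symmetric]) auto
      finally show False using le by simp
    qed
  qed
qed

lemma square_le_sum: "ennreal ((a - c)\<^sup>2) \<le> 2 * ennreal ((a - b)\<^sup>2) + 2 * ennreal ((b - c)\<^sup>2)"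
proof -
  have "(a - c)\<^sup>2 \<le> 2 * (a - b)\<^sup>2 + 2 * (b - c)\<^sup>2"
    using sum_squares_ge_zero[of "a - 2 * b + c" 0] by (simp add: power2_eq_square algebra_simps)
  then have "ennreal ((a - c)\<^sup>2) \<le> ennreal (2 * (a - b)\<^sup>2 + 2 * (b - c)\<^sup>2)" by (rule ennreal_leI)
  also have "\<dots> = 2 * ennreal ((a - b)\<^sup>2) + 2 * ennreal ((b - c)\<^sup>2)"
    by (simp add: ennreal_mult)
  finally show ?thesis .
qed

lemma nn_integral_lborel_translate:
  fixes f :: "'a::euclidean_space \<Rightarrow> ennreal"
  assumes [measurable]: "f \<in> borel_measurable borel"
  shows "(\<integral>\<^sup>+x. f (u + x) \<partial>lborel) = (\<integral>\<^sup>+x. f x \<partial>lborel)"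
proof -
  have "(\<integral>\<^sup>+x. f x \<partial>lborel) = (\<integral>\<^sup>+x. f x \<partial>distr lborel borel ((+) u))" by (simp add: lborel_distr_plus)
  also have "\<dots> = (\<integral>\<^sup>+x. f (u + x) \<partial>lborel)" by (rule nn_integral_distr) measurable
  finally show ?thesis ..
qed

section \<open>Averaging over the noise on the torus\<close>

locale torus_noise =
  fixes L \<epsilon> :: real and \<rho> :: "real^2 \<Rightarrow> real"
  assumes L_pos: "0 < L" and \<epsilon>_pos: "0 < \<epsilon>"
    and measurable_\<rho> [measurable]: "\<rho> \<in> borel_measurable borel"
    and \<rho>_nonneg: "\<And>u. 0 \<le> \<rho> u"
    and prob_noise: "prob_space (noise_measure \<rho>)"
    and \<rho>_pos: "\<And>u. u \<in> ball 0 \<epsilon> \<Longrightarrow> 0 < \<rho> u"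
begin

abbreviation m :: "(real^2) measure" where "m \<equiv> collision_measure L"
abbreviation \<nu> :: "(real^2) measure" where "\<nu> \<equiv> noise_measure \<rho>"

sublocale m: prob_space m by (rule prob_space_collision[OF L_pos])
sublocale \<nu>: prob_space \<nu> by (rule prob_noise)

lemma sets_noise [measurable_cong, simp]: "sets \<nu> = sets borel"
  by (simp add: noise_measure_def)

lemma space_noise [simp]: "space \<nu> = UNIV"
  by (simp add: noise_measure_def)

lemma measurable_wrap [measurable]: "wrap L \<in> borel \<rightarrow>\<^sub>M collision_space L"
  by (rule wrap_measurable[OF L_pos])

lemma measurable_inclusion: "(\<lambda>x. x) \<in> collision_space L \<rightarrow>\<^sub>M borel"
  by (rule measurable_collisionI) simp

definition avg :: "(real^2 \<Rightarrow> real) \<Rightarrow> real^2 \<Rightarrow> real" where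
  "avg f z = (\<integral>u. f (wrap L (z + u)) \<partial>\<nu>)"

text \<open>Twice the variance, as a double integral, so that it makes sense in
  \<open>ennreal\<close> and can be rewritten through increments.\<close>

definition vari :: "(real^2 \<Rightarrow> real) \<Rightarrow> ennreal" where
  "vari f = (\<integral>\<^sup>+x. \<integral>\<^sup>+y. ennreal ((f x - f y)\<^sup>2) \<partial>m \<partial>m)"

definition incr :: "(real^2 \<Rightarrow> real) \<Rightarrow> real^2 \<Rightarrow> ennreal" where
  "incr f w = (\<integral>\<^sup>+z. ennreal ((f (wrap L (z + w)) - f z)\<^sup>2) \<partial>m)"

lemma measurable_incr:
  assumes [measurable]: "f \<in> borel_measurable (collision_space L)"
  shows "incr f \<in> borel_measurable borel"
proof -
  note [measurable] = measurable_inclusion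
  show ?thesis unfolding incr_def by measurable
qed

lemma nn_integral_translate:
  "f \<in> borel_measurable (collision_space L) \<Longrightarrow> (\<integral>\<^sup>+x. f (wrap L (x + u)) \<partial>m) = (\<integral>\<^sup>+x. f x \<partial>m)"
  by (rule nn_integral_collision_translate[OF L_pos])

text \<open>The increment over \<open>2 *\<^sub>R w\<close> is a sum of two increments over
  \<open>w\<close>, which have equal mean squares by translation invariance; the square of a sum of
  two terms is at most twice the sum of the squares.\<close>

lemma incr_double:
  assumes [measurable]: "f \<in> borel_measurable (collision_space L)"
  shows "incr f (2 *\<^sub>R w) \<le> 4 * incr f w"
proof -
  note [measurable] = measurable_inclusion
  have "incr f (2 *\<^sub>R w) \<le> (\<integral>\<^sup>+z. 2 * ennreal ((f (wrap L (wrap L (z + w) + w)) - f (wrap L (z + w)))\<^sup>2)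
      + 2 * ennreal ((f (wrap L (z + w)) - f z)\<^sup>2) \<partial>m)"
    unfolding incr_def
  proof (rule nn_integral_mono)
    fix z
    have "wrap L (z + 2 *\<^sub>R w) = wrap L (wrap L (z + w) + w)"
      by (simp add: wrap_add_wrap scaleR_2 add.assoc)
    then show "ennreal ((f (wrap L (z + 2 *\<^sub>R w)) - f z)\<^sup>2) \<le>
        2 * ennreal ((f (wrap L (wrap L (z + w) + w)) - f (wrap L (z + w)))\<^sup>2)
      + 2 * ennreal ((f (wrap L (z + w)) - f z)\<^sup>2)"
      using square_le_sum[of "f (wrap L (z + 2 *\<^sub>R w))" "f z" "f (wrap L (z + w))"] by simp
  qed
  also have "\<dots> = 2 * (\<integral>\<^sup>+z. ennreal ((f (wrap L (wrap L (z + w) + w)) - f (wrap L (z + w)))\<^sup>2) \<partial>m) + 2 * incr f w"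
    unfolding incr_def by (subst nn_integral_add) (auto simp: nn_integral_cmult)
  also have "(\<integral>\<^sup>+z. ennreal ((f (wrap L (wrap L (z + w) + w)) - f (wrap L (z + w)))\<^sup>2) \<partial>m) = incr f w"
    unfolding incr_def
    by (rule nn_integral_translate[of "\<lambda>z. ennreal ((f (wrap L (z + w)) - f z)\<^sup>2)"]) measurable
  also have "2 * incr f w + 2 * incr f w = 4 * incr f w"
    by (metis distrib_right numeral_Bit0)
  finally show ?thesis .
qed

text \<open>Replacing \<open>y\<close> by \<open>y + x\<close> for each fixed \<open>x\<close> turns
  the double integral into the average of \<open>incr f\<close> over the torus.\<close>

lemma vari_le_incr:
  assumes [measurable]: "f \<in> borel_measurable (collision_space L)"
  shows "vari f \<le> ennreal (1 / (2 * L)) * (\<integral>\<^sup>+w. incr f w * indicator (cylinder L) w \<partial>lborel)"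
proof -
  note [measurable] = measurable_inclusion
  interpret pm: pair_sigma_finite m m by unfold_locales
  have "vari f = (\<integral>\<^sup>+x. \<integral>\<^sup>+y. ennreal ((f (wrap L (y + x)) - f x)\<^sup>2) \<partial>m \<partial>m)"
    unfolding vari_def
  proof (rule nn_integral_cong)
    fix x
    have "(\<integral>\<^sup>+y. ennreal ((f x - f y)\<^sup>2) \<partial>m) = (\<integral>\<^sup>+y. ennreal ((f y - f x)\<^sup>2) \<partial>m)"
      by (simp add: power2_commute)
    also have "\<dots> = (\<integral>\<^sup>+y. ennreal ((f (wrap L (y + x)) - f x)\<^sup>2) \<partial>m)"
      by (rule nn_integral_translate[symmetric, of "\<lambda>y. ennreal ((f y - f x)\<^sup>2)"]) measurable
    finally show "(\<integral>\<^sup>+y. ennreal ((f x - f y)\<^sup>2) \<partial>m) = (\<integral>\<^sup>+y. ennreal ((f (wrap L (y + x)) - f x)\<^sup>2) \<partial>m)" .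
  qed
  also have "\<dots> = (\<integral>\<^sup>+y. \<integral>\<^sup>+x. ennreal ((f (wrap L (y + x)) - f x)\<^sup>2) \<partial>m \<partial>m)"
    by (rule pm.Fubini'[symmetric]) measurable
  also have "\<dots> = (\<integral>\<^sup>+y. incr f y \<partial>m)"
    by (simp add: incr_def add.commute)
  also have "\<dots> = ennreal (1 / (2 * L)) * (\<integral>\<^sup>+w. incr f w * indicator (cylinder L) w \<partial>lborel)"
    by (rule nn_integral_collision_lborel[OF measurable_incr[OF assms]])
  finally show ?thesis by simp
qed

text \<open>The variance identity is applied to the noise at each \<open>z\<close>. After
  integration over \<open>z\<close> the mixed term depends only on the difference of the two
  noises.\<close>

lemma nn_integral_avg_square:
  assumes [measurable]: "f \<in> borel_measurable (collision_space L)"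
    and B: "\<And>x. x \<in> cylinder L \<Longrightarrow> \<bar>f x\<bar> \<le> B"
  shows "(\<integral>\<^sup>+x. ennreal ((f x)\<^sup>2) \<partial>m) = (\<integral>\<^sup>+z. ennreal ((avg f z)\<^sup>2) \<partial>m)
     + ennreal (1/2) * (\<integral>\<^sup>+u. \<integral>\<^sup>+u'. incr f (u' - u) \<partial>\<nu> \<partial>\<nu>)"
proof -
  note [measurable] = measurable_inclusion
  interpret mn: pair_sigma_finite m \<nu> by unfold_locales
  have avgm [measurable]: "avg f \<in> borel_measurable m"
    unfolding avg_def by measurable
  have incr: "(\<integral>\<^sup>+z. ennreal ((f (wrap L (z + u')) - f (wrap L (z + u)))\<^sup>2) \<partial>m) = incr f (u' - u)" for u u'
  proof -
    have "(\<integral>\<^sup>+z. ennreal ((f (wrap L (z + u')) - f (wrap L (z + u)))\<^sup>2) \<partial>m) =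
       (\<integral>\<^sup>+z. ennreal ((f (wrap L (wrap L (z + u) + (u' - u))) - f (wrap L (z + u)))\<^sup>2) \<partial>m)"
      by (simp add: wrap_add_wrap)
    also have "\<dots> = incr f (u' - u)"
      unfolding incr_def by (rule nn_integral_translate[of "\<lambda>z. ennreal ((f (wrap L (z + (u' - u))) - f z)\<^sup>2)"]) measurable
    finally show ?thesis .
  qed
  have "(\<integral>\<^sup>+x. ennreal ((f x)\<^sup>2) \<partial>m) = (\<integral>\<^sup>+u. \<integral>\<^sup>+z. ennreal ((f (wrap L (z + u)))\<^sup>2) \<partial>m \<partial>\<nu>)"
    using nn_integral_translate[of "\<lambda>x. ennreal ((f x)\<^sup>2)"] by (simp add: \<nu>.emeasure_space_1[simplified])
  also have "\<dots> = (\<integral>\<^sup>+z. \<integral>\<^sup>+u. ennreal ((f (wrap L (z + u)))\<^sup>2) \<partial>\<nu> \<partial>m)"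
    by (rule mn.Fubini') measurable
  also have "\<dots> = (\<integral>\<^sup>+z. ennreal ((avg f z)\<^sup>2) + ennreal (1/2) * (\<integral>\<^sup>+u. \<integral>\<^sup>+u'. ennreal ((f (wrap L (z + u')) - f (wrap L (z + u)))\<^sup>2) \<partial>\<nu> \<partial>\<nu>) \<partial>m)"
    unfolding avg_def
  proof (rule nn_integral_cong)
    fix z
    have fw: "(\<lambda>y. f (wrap L y)) \<in> borel_measurable borel"
      by (rule measurable_compose[OF measurable_wrap assms(1)])
    have "(\<lambda>u. z + u) \<in> \<nu> \<rightarrow>\<^sub>M borel" unfolding noise_measure_def by simp
    then have "(\<lambda>u. f (wrap L (z + u))) \<in> borel_measurable \<nu>"
      by (rule measurable_compose[OF _ fw])
    then show "(\<integral>\<^sup>+u. ennreal ((f (wrap L (z + u)))\<^sup>2) \<partial>\<nu>) = ennreal ((\<integral>u. f (wrap L (z + u)) \<partial>\<nu>)\<^sup>2) +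
      ennreal (1/2) * (\<integral>\<^sup>+u. \<integral>\<^sup>+u'. ennreal ((f (wrap L (z + u')) - f (wrap L (z + u)))\<^sup>2) \<partial>\<nu> \<partial>\<nu>)"
      by (intro variance_double_integral[OF \<nu>.prob_space_axioms, where B = B]) (auto intro: B simp: L_pos)
  qed
  also have "\<dots> = (\<integral>\<^sup>+z. ennreal ((avg f z)\<^sup>2) \<partial>m) + ennreal (1/2) *
      (\<integral>\<^sup>+z. \<integral>\<^sup>+u. \<integral>\<^sup>+u'. ennreal ((f (wrap L (z + u')) - f (wrap L (z + u)))\<^sup>2) \<partial>\<nu> \<partial>\<nu> \<partial>m)"
    by (subst nn_integral_add) (auto simp: nn_integral_cmult)
  also have "(\<integral>\<^sup>+z. \<integral>\<^sup>+u. \<integral>\<^sup>+u'. ennreal ((f (wrap L (z + u')) - f (wrap L (z + u)))\<^sup>2) \<partial>\<nu> \<partial>\<nu> \<partial>m)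
     = (\<integral>\<^sup>+u. \<integral>\<^sup>+z. \<integral>\<^sup>+u'. ennreal ((f (wrap L (z + u')) - f (wrap L (z + u)))\<^sup>2) \<partial>\<nu> \<partial>m \<partial>\<nu>)"
    by (rule mn.Fubini'[symmetric]) measurable
  also have "\<dots> = (\<integral>\<^sup>+u. \<integral>\<^sup>+u'. \<integral>\<^sup>+z. ennreal ((f (wrap L (z + u')) - f (wrap L (z + u)))\<^sup>2) \<partial>m \<partial>\<nu> \<partial>\<nu>)"
    by (intro nn_integral_cong mn.Fubini'[symmetric]) measurable
  finally show ?thesis by (simp add: incr)
qed

text \<open>The difference of two independent noises has a density bounded below near 0: the overlap
  of \<rho> with its translate gives at least \<open>c0^2 * c1\<close> on the ball of radius
  \<open>\<epsilon> / 2\<close>.\<close>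

lemma double_noise_integral_ge:
  obtains c where "0 < c" "\<And>D :: real^2 \<Rightarrow> ennreal. D \<in> borel_measurable borel \<Longrightarrow>
    ennreal c * (\<integral>\<^sup>+w. D w * indicator (ball 0 (\<epsilon> / 2)) w \<partial>lborel) \<le> (\<integral>\<^sup>+u. \<integral>\<^sup>+u'. D (u' - u) \<partial>\<nu> \<partial>\<nu>)"
proof -
  obtain c0 c1 where c: "0 < c0" "0 < c1"
    "\<And>w. w \<in> ball 0 (\<epsilon> / 2) \<Longrightarrow> ennreal c1 \<le> emeasure lborel {u. c0 \<le> \<rho> u \<and> c0 \<le> \<rho> (u + w)}"
    by (rule positive_density_overlap[OF measurable_\<rho> \<epsilon>_pos \<rho>_pos]) (assumption | rule that)+
  have [measurable]: "ball (0::real^2) r \<in> sets borel" for r by simp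
  show ?thesis
  proof (rule that)
    show "0 < c0\<^sup>2 * c1" using c by simp
    fix D :: "real^2 \<Rightarrow> ennreal" assume [measurable]: "D \<in> borel_measurable borel"
    have "(\<integral>\<^sup>+u. \<integral>\<^sup>+u'. D (u' - u) \<partial>\<nu> \<partial>\<nu>) = (\<integral>\<^sup>+u. ennreal (\<rho> u) * (\<integral>\<^sup>+u'. ennreal (\<rho> u') * D (u' - u) \<partial>lborel) \<partial>lborel)"
      unfolding noise_measure_def by (simp add: nn_integral_density)
    also have "\<dots> = (\<integral>\<^sup>+u. ennreal (\<rho> u) * (\<integral>\<^sup>+w. ennreal (\<rho> (u + w)) * D w \<partial>lborel) \<partial>lborel)"
    proof (rule nn_integral_cong)
      fix u
      show "ennreal (\<rho> u) * (\<integral>\<^sup>+u'. ennreal (\<rho> u') * D (u' - u) \<partial>lborel) = ennreal (\<rho> u) * (\<integral>\<^sup>+w. ennreal (\<rho> (u + w)) * D w \<partial>lborel)"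
        by (subst nn_integral_lborel_translate[symmetric, of _ u]) simp_all
    qed
    also have "\<dots> = (\<integral>\<^sup>+u. \<integral>\<^sup>+w. ennreal (\<rho> u) * (ennreal (\<rho> (u + w)) * D w) \<partial>lborel \<partial>lborel)"
      by (intro nn_integral_cong nn_integral_cmult[symmetric]) measurable
    also have "\<dots> = (\<integral>\<^sup>+w. \<integral>\<^sup>+u. ennreal (\<rho> u) * (ennreal (\<rho> (u + w)) * D w) \<partial>lborel \<partial>lborel)"
      by (rule lborel_pair.Fubini'[symmetric]) measurable
    also have "\<dots> \<ge> (\<integral>\<^sup>+w. ennreal (c0\<^sup>2 * c1) * (D w * indicator (ball 0 (\<epsilon> / 2)) w) \<partial>lborel)"
    proof (rule nn_integral_mono)
      fix w :: "real^2"
      let ?X = "{u. c0 \<le> \<rho> u \<and> c0 \<le> \<rho> (u + w)}"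
      have [measurable]: "?X \<in> sets borel" by measurable
      show "ennreal (c0\<^sup>2 * c1) * (D w * indicator (ball 0 (\<epsilon> / 2)) w)
         \<le> (\<integral>\<^sup>+u. ennreal (\<rho> u) * (ennreal (\<rho> (u + w)) * D w) \<partial>lborel)"
      proof (cases "w \<in> ball 0 (\<epsilon> / 2)")
        case True
        have "ennreal (c0\<^sup>2 * c1) * D w \<le> ennreal (c0\<^sup>2) * emeasure lborel ?X * D w"
          using c(3)[OF True] c by (simp add: ennreal_mult mult_left_mono mult_right_mono)
        also have "\<dots> = (\<integral>\<^sup>+u. ennreal (c0\<^sup>2) * D w * indicator ?X u \<partial>lborel)"
          by (subst nn_integral_cmult_indicator) (auto simp: mult_ac)
        also have "\<dots> \<le> (\<integral>\<^sup>+u. ennreal (\<rho> u) * (ennreal (\<rho> (u + w)) * D w) \<partial>lborel)"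
        proof (rule nn_integral_mono)
          fix u
          show "ennreal (c0\<^sup>2) * D w * indicator ?X u \<le> ennreal (\<rho> u) * (ennreal (\<rho> (u + w)) * D w)"
          proof (cases "u \<in> ?X")
            case True
            then have "c0\<^sup>2 \<le> \<rho> u * \<rho> (u + w)" unfolding power2_eq_square using c by (intro mult_mono) auto
            then have "ennreal (c0\<^sup>2) \<le> ennreal (\<rho> u) * ennreal (\<rho> (u + w))"
              using \<rho>_nonneg by (simp add: ennreal_mult[symmetric] ennreal_leI)
            then have "ennreal (c0\<^sup>2) * D w \<le> ennreal (\<rho> u) * ennreal (\<rho> (u + w)) * D w"
              by (rule mult_right_mono) simp
            with True show ?thesis by (simp add: mult.assoc)
          qed simp
        qed
        finally show ?thesis using True by simp
      qed simp
    qed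
    finally show "ennreal (c0\<^sup>2 * c1) * (\<integral>\<^sup>+w. D w * indicator (ball 0 (\<epsilon> / 2)) w \<partial>lborel)
       \<le> (\<integral>\<^sup>+u. \<integral>\<^sup>+u'. D (u' - u) \<partial>\<nu> \<partial>\<nu>)"
      by (subst nn_integral_cmult[symmetric]) auto
  qed
qed

text \<open>The noise controls increments over a small ball, and the variance is controlled by
  increments over the whole cylinder. Repeated doubling compares the two.\<close>

lemma poincare:
  obtains c where "0 < c" "\<And>(f :: real^2 \<Rightarrow> real) B. f \<in> borel_measurable (collision_space L) \<Longrightarrow>
    (\<And>x. x \<in> cylinder L \<Longrightarrow> \<bar>f x\<bar> \<le> B) \<Longrightarrow>
    (\<integral>\<^sup>+z. ennreal ((avg f z)\<^sup>2) \<partial>m) + ennreal c * vari f \<le> (\<integral>\<^sup>+x. ennreal ((f x)\<^sup>2) \<partial>m)"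
proof -
  obtain c where c: "0 < c" "\<And>D :: real^2 \<Rightarrow> ennreal. D \<in> borel_measurable borel \<Longrightarrow>
    ennreal c * (\<integral>\<^sup>+w. D w * indicator (ball 0 (\<epsilon> / 2)) w \<partial>lborel) \<le> (\<integral>\<^sup>+u. \<integral>\<^sup>+u'. D (u' - u) \<partial>\<nu> \<partial>\<nu>)"
    by (rule double_noise_integral_ge) blast
  \<comment> \<open>\<open>k\<close> doublings enlarge the ball to one that contains the cylinder,
    on which the norm is at most \<open>L + 1\<close>.\<close>
  obtain k where k: "(L + 1) / (\<epsilon> / 2) < 2 ^ k" using real_arch_pow[of 2 "(L + 1) / (\<epsilon> / 2)"] by auto
  have cyl: "cylinder L \<subseteq> ball 0 (2 ^ k * (\<epsilon> / 2))"
  proof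
    fix x assume x: "x \<in> cylinder L"
    have "norm x \<le> \<bar>x $ 1\<bar> + \<bar>x $ 2\<bar>" using norm_le_l1_cart[of x] by (simp add: sum_2)
    also have "\<dots> \<le> L + 1" using x by (auto simp: cylinder_def)
    also have "\<dots> < 2 ^ k * (\<epsilon> / 2)" using k \<epsilon>_pos by (simp add: field_simps)
    finally show "x \<in> ball 0 (2 ^ k * (\<epsilon> / 2))" by simp
  qed
  \<comment> \<open>\<open>L\<close> offsets the normalization \<open>1 / (2 * L)\<close> of
    \<open>m\<close>, \<open>16 ^ k\<close> offsets the doublings, and the surviving
    \<open>1/2\<close> is the one in \<open>nn_integral_avg_square\<close>.\<close>
  define c' where "c' = c * L / 16 ^ k"
  show ?thesis
  proof (rule that)
    show "0 < c'" using c L_pos by (simp add: c'_def)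
    fix f :: "real^2 \<Rightarrow> real" and B assume f [measurable]: "f \<in> borel_measurable (collision_space L)" and B: "\<And>x. x \<in> cylinder L \<Longrightarrow> \<bar>f x\<bar> \<le> B"
    let ?I = "\<integral>\<^sup>+w. incr f w * indicator (ball 0 (\<epsilon> / 2)) w \<partial>lborel"
    have "(\<integral>\<^sup>+w. incr f w * indicator (cylinder L) w \<partial>lborel) \<le> (\<integral>\<^sup>+w. incr f w * indicator (ball 0 (2 ^ k * (\<epsilon> / 2))) w \<partial>lborel)"
      using cyl by (intro nn_integral_mono mult_left_mono) (auto simp: indicator_def)
    also have "\<dots> \<le> 16 ^ k * ?I"
      by (rule nn_integral_ball_pow) (auto intro: incr_double measurable_incr)
    finally have "vari f \<le> ennreal (1 / (2 * L)) * (16 ^ k * ?I)"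
      using vari_le_incr[OF f] by (meson mult_left_mono order_trans zero_le)
    then have "ennreal c' * vari f \<le> ennreal c' * (ennreal (1 / (2 * L)) * (16 ^ k * ?I))"
      by (rule mult_left_mono) simp
    also have "\<dots> = ennreal (1/2) * (ennreal c * ?I)"
    proof -
      define a where "a = 1 / (2 * L)"
      have "0 \<le> c'" "0 \<le> a" using c L_pos by (simp_all add: c'_def a_def)
      then have "ennreal c' * (ennreal a * (16 ^ k * ?I)) = ennreal (c' * a * 16 ^ k) * ?I"
        by (simp add: ennreal_mult ennreal_power[symmetric] mult.assoc)
      also have "c' * a * 16 ^ k = 1/2 * c" using L_pos by (simp add: c'_def a_def)
      also have "ennreal (1/2 * c) * ?I = ennreal (1/2) * (ennreal c * ?I)"
        using c ennreal_mult[of "1/2" c] by (simp add: mult.assoc)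
      finally show ?thesis by (simp only: a_def)
    qed
    also have "\<dots> \<le> ennreal (1/2) * (\<integral>\<^sup>+u. \<integral>\<^sup>+u'. incr f (u' - u) \<partial>\<nu> \<partial>\<nu>)"
      by (intro mult_left_mono c(2) measurable_incr f) simp
    finally have "(\<integral>\<^sup>+z. ennreal ((avg f z)\<^sup>2) \<partial>m) + ennreal c' * vari f \<le>
       (\<integral>\<^sup>+z. ennreal ((avg f z)\<^sup>2) \<partial>m) + ennreal (1/2) * (\<integral>\<^sup>+u. \<integral>\<^sup>+u'. incr f (u' - u) \<partial>\<nu> \<partial>\<nu>)"
      by (rule add_left_mono)
    then show "(\<integral>\<^sup>+z. ennreal ((avg f z)\<^sup>2) \<partial>m) + ennreal c' * vari f \<le> (\<integral>\<^sup>+x. ennreal ((f x)\<^sup>2) \<partial>m)"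
      using nn_integral_avg_square[OF f B] by simp
  qed
qed

end

section \<open>Contraction of the twisted transfer operator\<close>

lemma measurable_matrix_vector_mult [measurable (raw)]:
  fixes X :: "'a \<Rightarrow> real^'n^'m"
  assumes "X \<in> borel_measurable N" "v \<in> borel_measurable N"
  shows "(\<lambda>z. X z *v v z) \<in> borel_measurable N"
proof (rule borel_measurable_continuous_Pair[OF assms])
  show "continuous_on UNIV (\<lambda>x. fst x *v snd x :: real^'m)"
    unfolding matrix_vector_mult_def by (intro continuous_intros)
qed

lemma measurable_matrix_matrix_mult [measurable (raw)]:
  fixes X :: "'a \<Rightarrow> real^'n^'m" and Y :: "'a \<Rightarrow> real^'k^'n"
  assumes "X \<in> borel_measurable N" "Y \<in> borel_measurable N"
  shows "(\<lambda>z. X z ** Y z) \<in> borel_measurable N"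
proof (rule borel_measurable_continuous_Pair[OF assms])
  show "continuous_on UNIV (\<lambda>x. fst x ** snd x :: real^'k^'m)"
    unfolding matrix_matrix_mult_def by (intro continuous_intros)
qed

lemma nn_integral_det1:
  fixes f :: "real^2 \<Rightarrow> ennreal"
  assumes [measurable]: "f \<in> borel_measurable borel" and "\<bar>det X\<bar> = 1"
  shows "(\<integral>\<^sup>+v. f (X *v v) \<partial>lborel) = (\<integral>\<^sup>+v. f v \<partial>lborel)"
proof -
  have "(\<integral>\<^sup>+v. f v \<partial>lborel) = (\<integral>\<^sup>+v. f v \<partial>distr lborel borel ((*v) X))"
    using det_matrix_vector_preserves_lborel[OF assms(2)] by simp
  also have "\<dots> = (\<integral>\<^sup>+v. f (X *v v) \<partial>lborel)"
    by (rule nn_integral_distr) measurable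
  finally show ?thesis ..
qed

text \<open>An abstract measure preserving map \<open>F\<close> with a matrix cocycle
  \<open>A\<close>; the billiard enters only when the locale is interpreted.\<close>

locale random_map = torus_noise +
  fixes F :: "real^2 \<Rightarrow> real^2" and A :: "real^2 \<Rightarrow> real^2^2"
  assumes measurable_F [measurable]: "F \<in> collision_space L \<rightarrow>\<^sub>M collision_space L"
    and preserves_F: "\<And>f. f \<in> borel_measurable (collision_space L) \<Longrightarrow> (\<integral>\<^sup>+x. f (F x) \<partial>collision_measure L) = (\<integral>\<^sup>+x. f x \<partial>collision_measure L)"
    and measurable_A [measurable]: "A \<in> borel_measurable (collision_space L)"
    and det_A: "AE x in collision_measure L. \<bar>det (A x)\<bar> = 1"
begin

text \<open>Values in [0, 1] make all averages over \<open>m\<close> and over the noise genuine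
  integrals. Square integrability in \<open>v\<close> is tracked separately, through finiteness of
  \<open>N2\<close>.\<close>

definition admissible :: "(real^2 \<Rightarrow> real^2 \<Rightarrow> real) \<Rightarrow> bool" where
  "admissible f \<longleftrightarrow> case_prod f \<in> borel_measurable (collision_space L \<Otimes>\<^sub>M borel) \<and>
     (\<forall>x\<in>cylinder L. \<forall>v. 0 \<le> f x v \<and> f x v \<le> 1)"

text \<open>One step of the chain on pairs: the expectation of \<open>f\<close> at the next
  collision and at the image of the tangent vector.\<close>

definition transfer :: "(real^2 \<Rightarrow> real^2 \<Rightarrow> real) \<Rightarrow> real^2 \<Rightarrow> real^2 \<Rightarrow> real" where
  "transfer f x v = avg (\<lambda>y. f y (A x *v v)) (F x)"

definition N2 :: "(real^2 \<Rightarrow> real^2 \<Rightarrow> real) \<Rightarrow> ennreal" where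
  "N2 f = (\<integral>\<^sup>+x. \<integral>\<^sup>+v. ennreal ((f x v)\<^sup>2) \<partial>lborel \<partial>m)"

definition V2 :: "(real^2 \<Rightarrow> real^2 \<Rightarrow> real) \<Rightarrow> ennreal" where
  "V2 f = (\<integral>\<^sup>+v. vari (\<lambda>x. f x v) \<partial>lborel)"

lemma measurable_admissible:
  assumes "admissible f" "a \<in> N \<rightarrow>\<^sub>M collision_space L" "b \<in> N \<rightarrow>\<^sub>M borel"
  shows "(\<lambda>z. f (a z) (b z)) \<in> borel_measurable N"
  using measurable_compose[OF measurable_Pair[OF assms(2,3)], of "case_prod f" borel] assms(1)
  by (simp add: admissible_def)

lemma admissible_abs: "admissible f \<Longrightarrow> x \<in> cylinder L \<Longrightarrow> \<bar>f x v\<bar> \<le> 1"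
  by (auto simp: admissible_def)

lemma avg_measurable:
  assumes f: "admissible f" and a: "a \<in> N \<rightarrow>\<^sub>M collision_space L" and b: "b \<in> N \<rightarrow>\<^sub>M borel"
  shows "(\<lambda>z. avg (\<lambda>y. f y (b z)) (a z)) \<in> borel_measurable N"
  unfolding avg_def
proof (rule \<nu>.borel_measurable_lebesgue_integral)
  have "(\<lambda>p. wrap L (a (fst p) + snd p)) \<in> N \<Otimes>\<^sub>M \<nu> \<rightarrow>\<^sub>M collision_space L"
  proof (rule measurable_compose[OF _ measurable_wrap])
    have "a \<in> N \<rightarrow>\<^sub>M borel" by (rule measurable_compose[OF a measurable_inclusion])
    then show "(\<lambda>p. a (fst p) + snd p) \<in> N \<Otimes>\<^sub>M \<nu> \<rightarrow>\<^sub>M borel" by measurable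
  qed
  moreover have "(\<lambda>p. b (fst p)) \<in> N \<Otimes>\<^sub>M \<nu> \<rightarrow>\<^sub>M borel" using b by measurable
  ultimately show "case_prod (\<lambda>z u. f (wrap L (a z + u)) (b z)) \<in> borel_measurable (N \<Otimes>\<^sub>M \<nu>)"
    unfolding case_prod_beta' by (rule measurable_admissible[OF f])
qed

lemma avg_bounds:
  assumes f: "admissible f"
  shows "0 \<le> avg (\<lambda>y. f y v) x" "avg (\<lambda>y. f y v) x \<le> 1"
proof -
  have b: "0 \<le> f (wrap L (x + u)) v \<and> f (wrap L (x + u)) v \<le> 1" for u
    using f L_pos by (auto simp: admissible_def)
  then show "0 \<le> avg (\<lambda>y. f y v) x" unfolding avg_def by (intro integral_nonneg_AE) auto
  have "(\<lambda>u. f (wrap L (x + u)) v) \<in> borel_measurable \<nu>"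
  proof (rule measurable_admissible[OF f])
    show "(\<lambda>u. wrap L (x + u)) \<in> \<nu> \<rightarrow>\<^sub>M collision_space L"
      unfolding noise_measure_def by measurable
  qed simp
  then have "integrable \<nu> (\<lambda>u. f (wrap L (x + u)) v)"
    using b by (intro \<nu>.integrable_const_bound[of _ 1]) auto
  then have "avg (\<lambda>y. f y v) x \<le> (\<integral>u. 1 \<partial>\<nu>)"
    unfolding avg_def using b by (intro integral_mono) auto
  then show "avg (\<lambda>y. f y v) x \<le> 1" by (simp add: \<nu>.prob_space[simplified])
qed

lemma admissible_transfer:
  assumes "admissible f" shows "admissible (transfer f)"
  unfolding admissible_def
proof (intro conjI ballI allI)
  have "(\<lambda>p. avg (\<lambda>y. f y (A (fst p) *v snd p)) (F (fst p))) \<in> borel_measurable (collision_space L \<Otimes>\<^sub>M borel)"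
    by (rule avg_measurable[OF assms]) measurable
  then show "case_prod (transfer f) \<in> borel_measurable (collision_space L \<Otimes>\<^sub>M borel)"
    by (simp add: transfer_def case_prod_beta')
qed (use avg_bounds[OF assms] in \<open>auto simp: transfer_def\<close>)

text \<open>
  Since \<open>det (A x) = 1\<close>, the twisted composition with \<open>F\<close> is an isometry of \<open>L\<^sup>2\<close> of the product.
\<close>

lemma nn_integral_twist:
  assumes [measurable]: "case_prod \<Phi> \<in> borel_measurable (collision_space L \<Otimes>\<^sub>M borel)"
  shows "(\<integral>\<^sup>+x. \<integral>\<^sup>+v. \<Phi> (F x) (A x *v v) \<partial>lborel \<partial>m) = (\<integral>\<^sup>+v. \<integral>\<^sup>+x. \<Phi> x v \<partial>m \<partial>lborel)"
proof -
  interpret ml: pair_sigma_finite m "lborel :: (real^2) measure" by unfold_locales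
  have sec: "\<Phi> x \<in> borel_measurable borel" if "x \<in> cylinder L" for x
    using measurable_compose[OF measurable_Pair1' assms, of x] that by simp
  have "(\<integral>\<^sup>+x. \<integral>\<^sup>+v. \<Phi> (F x) (A x *v v) \<partial>lborel \<partial>m) = (\<integral>\<^sup>+x. \<integral>\<^sup>+v. \<Phi> (F x) v \<partial>lborel \<partial>m)"
  proof (rule nn_integral_cong_AE)
    show "AE x in m. (\<integral>\<^sup>+v. \<Phi> (F x) (A x *v v) \<partial>lborel) = (\<integral>\<^sup>+v. \<Phi> (F x) v \<partial>lborel)"
      using det_A AE_space
    proof eventually_elim
      fix x assume "\<bar>det (A x)\<bar> = 1" "x \<in> space m"
      moreover have "F x \<in> cylinder L" using measurable_space[OF measurable_F, of x] \<open>x \<in> space m\<close> by simp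
      ultimately show "(\<integral>\<^sup>+v. \<Phi> (F x) (A x *v v) \<partial>lborel) = (\<integral>\<^sup>+v. \<Phi> (F x) v \<partial>lborel)"
        by (intro nn_integral_det1 sec)
    qed
  qed
  also have "\<dots> = (\<integral>\<^sup>+x. \<integral>\<^sup>+v. \<Phi> x v \<partial>lborel \<partial>m)"
    by (rule preserves_F[of "\<lambda>x. \<integral>\<^sup>+v. \<Phi> x v \<partial>lborel"]) measurable
  also have "\<dots> = (\<integral>\<^sup>+v. \<integral>\<^sup>+x. \<Phi> x v \<partial>m \<partial>lborel)"
    by (rule ml.Fubini'[symmetric]) measurable
  finally show ?thesis .
qed

lemma N2_swap:
  assumes f: "admissible f"
  shows "N2 f = (\<integral>\<^sup>+v. \<integral>\<^sup>+x. ennreal ((f x v)\<^sup>2) \<partial>m \<partial>lborel)"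
proof -
  interpret ml: pair_sigma_finite m "lborel :: (real^2) measure" by unfold_locales
  have [measurable]: "case_prod f \<in> borel_measurable (collision_space L \<Otimes>\<^sub>M borel)" using f by (simp add: admissible_def)
  show ?thesis unfolding N2_def by (rule ml.Fubini'[symmetric]) measurable
qed

lemma N2_transfer:
  assumes f: "admissible f"
  shows "N2 (transfer f) = (\<integral>\<^sup>+v. \<integral>\<^sup>+x. ennreal ((avg (\<lambda>y. f y v) x)\<^sup>2) \<partial>m \<partial>lborel)"
  unfolding N2_def transfer_def
proof (rule nn_integral_twist[of "\<lambda>x v. ennreal ((avg (\<lambda>y. f y v) x)\<^sup>2)"])
  have "(\<lambda>p. avg (\<lambda>y. f y (snd p)) (fst p)) \<in> borel_measurable (collision_space L \<Otimes>\<^sub>M borel)"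
    by (rule avg_measurable[OF f]) measurable
  then show "case_prod (\<lambda>x v. ennreal ((avg (\<lambda>y. f y v) x)\<^sup>2)) \<in> borel_measurable (collision_space L \<Otimes>\<^sub>M borel)"
    unfolding case_prod_beta' by measurable
qed

lemma measurable_section:
  assumes "admissible f" shows "(\<lambda>x. f x v) \<in> borel_measurable (collision_space L)"
  by (rule measurable_admissible[OF assms]) measurable

lemma measurable_vari:
  assumes f: "admissible f" shows "(\<lambda>v. vari (\<lambda>x. f x v)) \<in> borel_measurable borel"
proof -
  have [measurable]: "case_prod f \<in> borel_measurable (collision_space L \<Otimes>\<^sub>M borel)" using f by (simp add: admissible_def)
  show ?thesis unfolding vari_def by measurable
qed

text \<open>The Poincare inequality for each fixed tangent vector, integrated over all tangent
  vectors.\<close>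

lemma transfer_energy:
  obtains c where "0 < c" "\<And>f. admissible f \<Longrightarrow> N2 (transfer f) + ennreal c * V2 f \<le> N2 f"
proof -
  obtain c where c: "0 < c" "\<And>(f :: real^2 \<Rightarrow> real) B. f \<in> borel_measurable (collision_space L) \<Longrightarrow>
    (\<And>x. x \<in> cylinder L \<Longrightarrow> \<bar>f x\<bar> \<le> B) \<Longrightarrow>
    (\<integral>\<^sup>+z. ennreal ((avg f z)\<^sup>2) \<partial>m) + ennreal c * vari f \<le> (\<integral>\<^sup>+x. ennreal ((f x)\<^sup>2) \<partial>m)"
    by (rule poincare) blast
  show ?thesis
  proof (rule that[OF c(1)])
    fix f assume f: "admissible f"
    have [measurable]: "(\<lambda>v. vari (\<lambda>x. f x v)) \<in> borel_measurable borel" by (rule measurable_vari[OF f])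
    have am: "(\<lambda>p. avg (\<lambda>y. f y (fst p)) (snd p)) \<in> borel_measurable (borel \<Otimes>\<^sub>M m)"
      by (rule avg_measurable[OF f]) measurable
    have [measurable]: "(\<lambda>v. \<integral>\<^sup>+x. ennreal ((avg (\<lambda>y. f y v) x)\<^sup>2) \<partial>m) \<in> borel_measurable borel"
      by (rule m.borel_measurable_nn_integral) (use am in \<open>simp add: case_prod_beta'\<close>)
    have "N2 (transfer f) + ennreal c * V2 f =
      (\<integral>\<^sup>+v. (\<integral>\<^sup>+x. ennreal ((avg (\<lambda>y. f y v) x)\<^sup>2) \<partial>m) + ennreal c * vari (\<lambda>x. f x v) \<partial>lborel)"
      unfolding N2_transfer[OF f] V2_def by (subst nn_integral_add) (auto simp: nn_integral_cmult)
    also have "\<dots> \<le> (\<integral>\<^sup>+v. \<integral>\<^sup>+x. ennreal ((f x v)\<^sup>2) \<partial>m \<partial>lborel)"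
      by (intro nn_integral_mono c(2)[of _ 1] measurable_section[OF f] admissible_abs[OF f])
    also have "\<dots> = N2 f" by (rule N2_swap[OF f, symmetric])
    finally show "N2 (transfer f) + ennreal c * V2 f \<le> N2 f" .
  qed
qed

section \<open>Deviation from the mean over collisions\<close>

definition mean :: "(real^2 \<Rightarrow> real^2 \<Rightarrow> real) \<Rightarrow> real^2 \<Rightarrow> real" where
  "mean f v = (\<integral>x. f x v \<partial>m)"

lemma measurable_mean:
  assumes f: "admissible f" shows "mean f \<in> borel_measurable borel"
proof -
  have [measurable]: "case_prod f \<in> borel_measurable (collision_space L \<Otimes>\<^sub>M borel)" using f by (simp add: admissible_def)
  show ?thesis unfolding mean_def by measurable
qed

lemma mean_deviation_le:
  assumes f: "admissible f"
  shows "(\<integral>\<^sup>+x. ennreal ((f x v - mean f v)\<^sup>2) \<partial>m) \<le> vari (\<lambda>x. f x v)"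
  unfolding vari_def mean_def
  by (intro nn_integral_mono square_diff_expectation_le[OF m.prob_space_axioms, where B = 1])
     (auto intro: measurable_section[OF f] admissible_abs[OF f] cong: measurable_cong_sets)

lemma mean_deviation_V2:
  assumes f: "admissible f"
  shows "(\<integral>\<^sup>+v. \<integral>\<^sup>+x. ennreal ((f x v - mean f v)\<^sup>2) \<partial>m \<partial>lborel) \<le> V2 f"
  unfolding V2_def by (intro nn_integral_mono mean_deviation_le[OF f])

lemma N2_le_mean:
  assumes f: "admissible f"
  shows "N2 f \<le> 2 * V2 f + 2 * (\<integral>\<^sup>+v. ennreal ((mean f v)\<^sup>2) \<partial>lborel)"
proof -
  have [measurable]: "mean f \<in> borel_measurable borel" by (rule measurable_mean[OF f])
  have fm [measurable]: "case_prod f \<in> borel_measurable (collision_space L \<Otimes>\<^sub>M borel)" using f by (simp add: admissible_def)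
  have sm [measurable]: "(\<lambda>x. f x v) \<in> borel_measurable (collision_space L)" for v by (rule measurable_section[OF f])
  have "N2 f = (\<integral>\<^sup>+v. \<integral>\<^sup>+x. ennreal ((f x v - 0)\<^sup>2) \<partial>m \<partial>lborel)" by (simp add: N2_swap[OF f])
  also have "\<dots> \<le> (\<integral>\<^sup>+v. \<integral>\<^sup>+x. 2 * ennreal ((f x v - mean f v)\<^sup>2) + 2 * ennreal ((mean f v - 0)\<^sup>2) \<partial>m \<partial>lborel)"
    by (intro nn_integral_mono square_le_sum)
  also have "\<dots> = (\<integral>\<^sup>+v. 2 * (\<integral>\<^sup>+x. ennreal ((f x v - mean f v)\<^sup>2) \<partial>m) + 2 * ennreal ((mean f v)\<^sup>2) \<partial>lborel)"
    by (intro nn_integral_cong, subst nn_integral_add) (auto simp: nn_integral_cmult m.emeasure_space_1[simplified])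
  also have "\<dots> = 2 * (\<integral>\<^sup>+v. \<integral>\<^sup>+x. ennreal ((f x v - mean f v)\<^sup>2) \<partial>m \<partial>lborel) + 2 * (\<integral>\<^sup>+v. ennreal ((mean f v)\<^sup>2) \<partial>lborel)"
    by (subst nn_integral_add) (auto simp: nn_integral_cmult)
  also have "\<dots> \<le> 2 * V2 f + 2 * (\<integral>\<^sup>+v. ennreal ((mean f v)\<^sup>2) \<partial>lborel)"
    by (intro add_right_mono mult_left_mono mean_deviation_V2[OF f]) simp
  finally show ?thesis .
qed

text \<open>Averaging over translations of the torus does not increase the distance to a constant,
  here to \<open>mean f v\<close>.\<close>

lemma avg_mean_deviation:
  assumes f: "admissible f"
  shows "(\<integral>\<^sup>+x. ennreal ((mean f v - avg (\<lambda>y. f y v) x)\<^sup>2) \<partial>m) \<le> (\<integral>\<^sup>+x. ennreal ((f x v - mean f v)\<^sup>2) \<partial>m)"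
proof -
  note [measurable] = measurable_inclusion
  interpret mn: pair_sigma_finite m \<nu> by unfold_locales
  have [measurable]: "(\<lambda>x. f x v) \<in> borel_measurable (collision_space L)" by (rule measurable_section[OF f])
  have fw: "(\<lambda>u. f (wrap L (x + u)) v) \<in> borel_measurable \<nu>" for x
  proof (rule measurable_admissible[OF f])
    show "(\<lambda>u. wrap L (x + u)) \<in> \<nu> \<rightarrow>\<^sub>M collision_space L"
      unfolding noise_measure_def by simp
  qed simp
  have "(\<integral>\<^sup>+x. ennreal ((mean f v - avg (\<lambda>y. f y v) x)\<^sup>2) \<partial>m)
      \<le> (\<integral>\<^sup>+x. \<integral>\<^sup>+u. ennreal ((mean f v - f (wrap L (x + u)) v)\<^sup>2) \<partial>\<nu> \<partial>m)"
    unfolding avg_def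
    by (intro nn_integral_mono square_diff_expectation_le[OF \<nu>.prob_space_axioms, where B = 1])
       (auto intro: fw admissible_abs[OF f] simp: L_pos)
  also have "\<dots> = (\<integral>\<^sup>+u. \<integral>\<^sup>+x. ennreal ((mean f v - f (wrap L (x + u)) v)\<^sup>2) \<partial>m \<partial>\<nu>)"
    by (rule mn.Fubini'[symmetric]) measurable
  also have "\<dots> = (\<integral>\<^sup>+u. \<integral>\<^sup>+x. ennreal ((mean f v - f x v)\<^sup>2) \<partial>m \<partial>\<nu>)"
    by (intro nn_integral_cong nn_integral_translate[of "\<lambda>x. ennreal ((mean f v - f x v)\<^sup>2)"]) measurable
  also have "\<dots> = (\<integral>\<^sup>+x. ennreal ((f x v - mean f v)\<^sup>2) \<partial>m)"
    by (simp add: \<nu>.emeasure_space_1[simplified] power2_commute)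
  finally show ?thesis .
qed

end

text \<open>\<open>spread\<close> says, with a constant uniform in \<open>g\<close> and
  \<open>h\<close>, that no nonzero square integrable \<open>g\<close> has all its compositions with
  \<open>A x\<close> concentrated near one function \<open>h\<close>. The second condition keeps the
  exponent finite.\<close>

locale spread_map = random_map +
  assumes spread: "\<exists>c>0. \<forall>g\<in>borel_measurable borel. \<forall>h\<in>borel_measurable borel.
      (\<integral>\<^sup>+v. ennreal ((g v)\<^sup>2) \<partial>lborel) < \<infinity> \<longrightarrow>
      ennreal c * (\<integral>\<^sup>+v. ennreal ((g v)\<^sup>2) \<partial>lborel)
        \<le> (\<integral>\<^sup>+x. \<integral>\<^sup>+v. ennreal ((g (A x *v v) - h v)\<^sup>2) \<partial>lborel \<partial>collision_measure L)"
    and integrable_norm_A: "(\<integral>\<^sup>+x. ennreal (norm (A x)) \<partial>collision_measure L) < \<infinity>"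
begin

lemma mean_square_le_N2:
  assumes f: "admissible f"
  shows "(\<integral>\<^sup>+v. ennreal ((mean f v)\<^sup>2) \<partial>lborel) \<le> N2 f"
proof -
  have "ennreal ((0 - mean f v)\<^sup>2) \<le> (\<integral>\<^sup>+x. ennreal ((0 - f x v)\<^sup>2) \<partial>m)" for v
    unfolding mean_def
    by (rule square_diff_expectation_le[OF m.prob_space_axioms, where B = 1])
       (auto intro: measurable_section[OF f] admissible_abs[OF f] cong: measurable_cong_sets)
  then show ?thesis unfolding N2_swap[OF f] by (intro nn_integral_mono) simp
qed

text \<open>If both variances are small, \<open>f x v\<close> is near its mean \<open>g v\<close>
  and \<open>transfer f x v\<close> near its mean \<open>h v\<close>. But
  \<open>transfer f x v\<close> is also near \<open>g (A x *v v)\<close>, so \<open>g\<close>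
  composed with \<open>A x\<close> is near \<open>h\<close>, and \<open>spread\<close> bounds the
  norm of \<open>g\<close>.\<close>

lemma N2_le_V2:
  obtains K where "0 < K" "\<And>f. admissible f \<Longrightarrow> N2 f < \<infinity> \<Longrightarrow> N2 f \<le> ennreal K * (V2 f + V2 (transfer f))"
proof -
  obtain c where c: "0 < c" and sp: "\<And>g h. g \<in> borel_measurable borel \<Longrightarrow> h \<in> borel_measurable borel \<Longrightarrow>
      (\<integral>\<^sup>+v. ennreal ((g v)\<^sup>2) \<partial>lborel) < \<infinity> \<Longrightarrow>
      ennreal c * (\<integral>\<^sup>+v. ennreal ((g v)\<^sup>2) \<partial>lborel)
        \<le> (\<integral>\<^sup>+x. \<integral>\<^sup>+v. ennreal ((g (A x *v v) - h v)\<^sup>2) \<partial>lborel \<partial>m)"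
    using spread by blast
  show ?thesis
  \<comment> \<open>The 2 comes from \<open>N2_le_mean\<close>; the \<open>4 / c\<close> comes from
    inserting the bound on the norm of \<open>g\<close>, where each triangle inequality costs a
    factor 2.\<close>
  proof (rule that[of "2 + 4 / c"])
    show "0 < 2 + 4 / c" using c by (simp add: add_pos_pos)
    fix f assume f: "admissible f" and fin: "N2 f < \<infinity>"
    interpret ml: pair_sigma_finite m "lborel :: (real^2) measure" by unfold_locales
    have Tf: "admissible (transfer f)" by (rule admissible_transfer[OF f])
    have fm [measurable]: "case_prod f \<in> borel_measurable (collision_space L \<Otimes>\<^sub>M borel)"
      and Tm [measurable]: "case_prod (transfer f) \<in> borel_measurable (collision_space L \<Otimes>\<^sub>M borel)"
      using f Tf by (simp_all add: admissible_def)
    define g h where "g = mean f" and "h = mean (transfer f)"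
    have [measurable]: "g \<in> borel_measurable borel" "h \<in> borel_measurable borel"
      unfolding g_def h_def by (intro measurable_mean f Tf)+
    have am: "(\<lambda>p. avg (\<lambda>y. f y (snd p)) (fst p)) \<in> borel_measurable (collision_space L \<Otimes>\<^sub>M borel)"
      by (rule avg_measurable[OF f]) measurable
    have "(\<integral>\<^sup>+x. \<integral>\<^sup>+v. ennreal ((g (A x *v v) - transfer f x v)\<^sup>2) \<partial>lborel \<partial>m)
       = (\<integral>\<^sup>+v. \<integral>\<^sup>+x. ennreal ((g v - avg (\<lambda>y. f y v) x)\<^sup>2) \<partial>m \<partial>lborel)"
      unfolding transfer_def
    proof (rule nn_integral_twist[of "\<lambda>x v. ennreal ((g v - avg (\<lambda>y. f y v) x)\<^sup>2)"])
      show "case_prod (\<lambda>x v. ennreal ((g v - avg (\<lambda>y. f y v) x)\<^sup>2)) \<in> borel_measurable (collision_space L \<Otimes>\<^sub>M borel)"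
        unfolding case_prod_beta' using am by measurable
    qed
    also have "\<dots> \<le> (\<integral>\<^sup>+v. \<integral>\<^sup>+x. ennreal ((f x v - g v)\<^sup>2) \<partial>m \<partial>lborel)"
      unfolding g_def by (intro nn_integral_mono avg_mean_deviation[OF f])
    also have "\<dots> \<le> V2 f" unfolding g_def by (rule mean_deviation_V2[OF f])
    finally have 1: "(\<integral>\<^sup>+x. \<integral>\<^sup>+v. ennreal ((g (A x *v v) - transfer f x v)\<^sup>2) \<partial>lborel \<partial>m) \<le> V2 f" .
    have "(\<integral>\<^sup>+x. \<integral>\<^sup>+v. ennreal ((transfer f x v - h v)\<^sup>2) \<partial>lborel \<partial>m) = (\<integral>\<^sup>+v. \<integral>\<^sup>+x. ennreal ((transfer f x v - h v)\<^sup>2) \<partial>m \<partial>lborel)"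
      by (rule ml.Fubini'[symmetric]) measurable
    also have "\<dots> \<le> V2 (transfer f)" unfolding h_def by (rule mean_deviation_V2[OF Tf])
    finally have 2: "(\<integral>\<^sup>+x. \<integral>\<^sup>+v. ennreal ((transfer f x v - h v)\<^sup>2) \<partial>lborel \<partial>m) \<le> V2 (transfer f)" .
    have "ennreal c * (\<integral>\<^sup>+v. ennreal ((g v)\<^sup>2) \<partial>lborel) \<le> (\<integral>\<^sup>+x. \<integral>\<^sup>+v. ennreal ((g (A x *v v) - h v)\<^sup>2) \<partial>lborel \<partial>m)"
      by (rule sp) (use mean_square_le_N2[OF f] fin measurable_mean[OF f] in \<open>auto simp: g_def intro: order_le_less_trans\<close>)
    also have "\<dots> \<le> (\<integral>\<^sup>+x. \<integral>\<^sup>+v. 2 * ennreal ((g (A x *v v) - transfer f x v)\<^sup>2) + 2 * ennreal ((transfer f x v - h v)\<^sup>2) \<partial>lborel \<partial>m)"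
      by (intro nn_integral_mono square_le_sum)
    also have "\<dots> = (\<integral>\<^sup>+x. 2 * (\<integral>\<^sup>+v. ennreal ((g (A x *v v) - transfer f x v)\<^sup>2) \<partial>lborel)
        + 2 * (\<integral>\<^sup>+v. ennreal ((transfer f x v - h v)\<^sup>2) \<partial>lborel) \<partial>m)"
    proof (rule nn_integral_cong)
      fix x assume x: "x \<in> space m"
      have [measurable]: "transfer f x \<in> borel_measurable borel"
        using measurable_compose[OF measurable_Pair1' Tm, of x] x by simp
      show "(\<integral>\<^sup>+v. 2 * ennreal ((g (A x *v v) - transfer f x v)\<^sup>2) + 2 * ennreal ((transfer f x v - h v)\<^sup>2) \<partial>lborel)
         = 2 * (\<integral>\<^sup>+v. ennreal ((g (A x *v v) - transfer f x v)\<^sup>2) \<partial>lborel)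
        + 2 * (\<integral>\<^sup>+v. ennreal ((transfer f x v - h v)\<^sup>2) \<partial>lborel)"
        by (subst nn_integral_add) (auto simp: nn_integral_cmult)
    qed
    also have "\<dots> = 2 * (\<integral>\<^sup>+x. \<integral>\<^sup>+v. ennreal ((g (A x *v v) - transfer f x v)\<^sup>2) \<partial>lborel \<partial>m)
        + 2 * (\<integral>\<^sup>+x. \<integral>\<^sup>+v. ennreal ((transfer f x v - h v)\<^sup>2) \<partial>lborel \<partial>m)"
      by (subst nn_integral_add) (auto simp: nn_integral_cmult)
    also have "\<dots> \<le> 2 * V2 f + 2 * V2 (transfer f)"
      by (intro add_mono mult_left_mono 1 2) auto
    finally have 3: "ennreal c * (\<integral>\<^sup>+v. ennreal ((g v)\<^sup>2) \<partial>lborel) \<le> 2 * (V2 f + V2 (transfer f))"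
      by (simp add: distrib_left)
    have "(\<integral>\<^sup>+v. ennreal ((g v)\<^sup>2) \<partial>lborel) = ennreal (1 / c) * (ennreal c * (\<integral>\<^sup>+v. ennreal ((g v)\<^sup>2) \<partial>lborel))"
      using c by (simp add: mult.assoc[symmetric] ennreal_mult[symmetric])
    also have "\<dots> \<le> ennreal (1 / c) * (2 * (V2 f + V2 (transfer f)))"
      by (rule mult_left_mono[OF 3]) simp
    finally have 4: "(\<integral>\<^sup>+v. ennreal ((g v)\<^sup>2) \<partial>lborel) \<le> ennreal (1 / c) * (2 * (V2 f + V2 (transfer f)))" .
    have "N2 f \<le> 2 * V2 f + 2 * (\<integral>\<^sup>+v. ennreal ((g v)\<^sup>2) \<partial>lborel)"
      unfolding g_def by (rule N2_le_mean[OF f])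
    also have "\<dots> \<le> 2 * (V2 f + V2 (transfer f)) + 2 * (ennreal (1 / c) * (2 * (V2 f + V2 (transfer f))))"
      by (intro add_mono mult_left_mono 4) (auto simp: add_increasing2)
    also have "\<dots> = ennreal (2 + 4 / c) * (V2 f + V2 (transfer f))"
    proof -
      have "ennreal (2 + 4 / c) = 2 + 2 * (ennreal (1 / c) * 2)"
      proof -
        have "ennreal (2 + 4 / c) = ennreal 2 + ennreal (2 * ((1 / c) * 2))"
          using c by (subst ennreal_plus) auto
        also have "ennreal (2 * ((1 / c) * 2)) = ennreal 2 * ennreal ((1 / c) * 2)"
          using c by (intro ennreal_mult) auto
        also have "ennreal ((1 / c) * 2) = ennreal (1 / c) * ennreal 2"
          using c by (intro ennreal_mult) auto
        finally show ?thesis by simp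
      qed
      then show ?thesis by (simp add: distrib_right mult.assoc)
    qed
    finally show "N2 f \<le> ennreal (2 + 4 / c) * (V2 f + V2 (transfer f))" .
  qed
qed

text \<open>Over two steps the losses add up to \<open>c * (V2 f + V2 (transfer f))\<close>, which
  by \<open>N2_le_V2\<close> is at least a fixed fraction of \<open>N2 f\<close>.\<close>

lemma two_step_contraction:
  obtains q where "1/2 \<le> q" "q < 1" "\<And>f. admissible f \<Longrightarrow> N2 f < \<infinity> \<Longrightarrow> N2 (transfer (transfer f)) \<le> ennreal q * N2 f"
proof -
  obtain c where c: "0 < c" "\<And>f. admissible f \<Longrightarrow> N2 (transfer f) + ennreal c * V2 f \<le> N2 f"
    by (rule transfer_energy) blast
  obtain K where K: "0 < K" "\<And>f. admissible f \<Longrightarrow> N2 f < \<infinity> \<Longrightarrow> N2 f \<le> ennreal K * (V2 f + V2 (transfer f))"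
    by (rule N2_le_V2) blast
  \<comment> \<open>The cap \<open>1/2\<close> keeps the factor \<open>1 - \<kappa>\<close>
    positive, so that its square root and logarithm can be used later.\<close>
  define \<kappa> where "\<kappa> = min (1/2) (c / K)"
  have \<kappa>: "0 < \<kappa>" "\<kappa> \<le> 1/2" "\<kappa> * K \<le> c"
    using c K by (auto simp: \<kappa>_def min_def field_simps)
  show ?thesis
  proof (rule that)
    show "1/2 \<le> 1 - \<kappa>" "1 - \<kappa> < 1" using \<kappa> by auto
    fix f assume f: "admissible f" and fin: "N2 f < \<infinity>"
    have Tf: "admissible (transfer f)" by (rule admissible_transfer[OF f])
    have "ennreal \<kappa> * N2 f \<le> ennreal \<kappa> * (ennreal K * (V2 f + V2 (transfer f)))"
      by (rule mult_left_mono[OF K(2)[OF f fin]]) simp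
    also have "\<dots> = ennreal (\<kappa> * K) * (V2 f + V2 (transfer f))"
      using \<kappa> K by (simp add: ennreal_mult mult.assoc)
    also have "\<dots> \<le> ennreal c * (V2 f + V2 (transfer f))"
      by (rule mult_right_mono) (use \<kappa> in \<open>auto intro: ennreal_leI\<close>)
    finally have "N2 (transfer (transfer f)) + ennreal \<kappa> * N2 f \<le> N2 (transfer (transfer f)) + ennreal c * V2 (transfer f) + ennreal c * V2 f"
      by (simp add: add_left_mono distrib_left add.assoc add.commute add.left_commute)
    also have "\<dots> \<le> N2 (transfer f) + ennreal c * V2 f"
      by (rule add_right_mono[OF c(2)[OF Tf]])
    also have "\<dots> \<le> N2 f" by (rule c(2)[OF f])
    finally have le: "N2 (transfer (transfer f)) + ennreal \<kappa> * N2 f \<le> N2 f" .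
    obtain b where b: "0 \<le> b" "N2 f = ennreal b" using fin by (cases "N2 f") auto
    have "N2 (transfer (transfer f)) \<le> N2 f" using le by (metis add_increasing2 order_trans le_iff_add zero_le)
    then obtain a where a: "0 \<le> a" "N2 (transfer (transfer f)) = ennreal a"
      using b by (cases "N2 (transfer (transfer f))") (auto simp: top_unique)
    have "ennreal (a + \<kappa> * b) \<le> ennreal b"
      using le a b \<kappa> by (simp add: ennreal_mult)
    then have "a + \<kappa> * b \<le> b" using b(1) by (simp add: ennreal_le_iff del: ennreal_plus)
    then have "a \<le> (1 - \<kappa>) * b" by (simp add: algebra_simps)
    then show "N2 (transfer (transfer f)) \<le> ennreal (1 - \<kappa>) * N2 f"
      using a b \<kappa> by (simp add: ennreal_mult[symmetric] ennreal_leI)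
  qed
qed

end

section \<open>Ergodicity and hyperbolicity of the perturbed map\<close>

lemma cocycle_Suc_shift: "cocycle A (Suc n) \<omega> = cocycle A n (shift \<omega>) ** A (\<omega> 0)"
proof (induction n)
  case (Suc n)
  then show ?case by (simp add: shift_def matrix_mul_assoc)
qed simp

lemma cocycle_add: "cocycle A (n + k) \<omega> = cocycle A k (\<lambda>i. \<omega> (i + n)) ** cocycle A n \<omega>"
  by (induction k) (simp_all add: matrix_mul_assoc add.commute)

text \<open>The operator norm is 1-Lipschitz for the Euclidean norm of matrices; continuity and
  measurability follow.\<close>

lemma abs_onorm_diff_le: "\<bar>onorm ((*v) X) - onorm ((*v) Y)\<bar> \<le> norm (X - Y :: real^'n^'m)"
proof -
  have le: "onorm ((*v) X) \<le> onorm ((*v) Y) + norm (X - Y)" for X Y :: "real^'n^'m"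
  proof (rule onorm_le)
    fix v
    have "X *v v = Y *v v + (X - Y) *v v" by (simp add: matrix_vector_mult_diff_rdistrib)
    then have "norm (X *v v) \<le> norm (Y *v v) + norm ((X - Y) *v v)" by (metis norm_triangle_ineq)
    also have "\<dots> \<le> onorm ((*v) Y) * norm v + norm (X - Y) * norm v"
      by (intro add_mono onorm norm_matrix_vector_mult_le) (simp add: linear_conv_bounded_linear[symmetric])
    finally show "norm (X *v v) \<le> (onorm ((*v) Y) + norm (X - Y)) * norm v" by (simp add: distrib_right)
  qed
  show ?thesis using le[of X Y] le[of Y X] by (simp add: norm_minus_commute abs_le_iff)
qed

lemma measurable_onorm [measurable]: "(\<lambda>X::real^'n^'m. onorm ((*v) X)) \<in> borel_measurable borel"
proof (rule borel_measurable_continuous_onI)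
  show "continuous_on UNIV (\<lambda>X::real^'n^'m. onorm ((*v) X))"
    unfolding continuous_on_iff
  proof (intro ballI allI impI)
    fix X :: "real^'n^'m" and e :: real assume "0 < e"
    then show "\<exists>d>0. \<forall>Y\<in>UNIV. dist Y X < d \<longrightarrow> dist (onorm ((*v) Y)) (onorm ((*v) X)) < e"
      using abs_onorm_diff_le by (intro exI[of _ e]) (auto simp: dist_norm intro: le_less_trans)
  qed
qed

lemma onorm_matrix_le_norm: "onorm ((*v) X) \<le> norm (X :: real^'n^'m)"
  by (rule onorm_le) (rule norm_matrix_vector_mult_le)

lemma onorm_matrix_mult_le: "onorm ((*v) (X ** Y)) \<le> onorm ((*v) X) * onorm ((*v) (Y :: real^'k^'n))"
proof -
  have "(*v) (X ** Y) = (*v) X \<circ> (*v) Y" by (auto simp: fun_eq_iff matrix_vector_mul_assoc)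
  then show ?thesis by (simp add: onorm_compose linear_conv_bounded_linear[symmetric])
qed

lemma emeasure_cball_real2:
  assumes "0 \<le> r" shows "emeasure lborel (cball (0::real^2) r) = ennreal (unit_ball_vol 2 * r\<^sup>2)"
  using emeasure_cball[OF assms, of "0::real^2"] by simp

text \<open>\<open>X\<close> maps the unit disc into the disc whose radius is the operator norm, and
  it preserves area.\<close>

lemma onorm_ge_1:
  fixes X :: "real^2^2"
  assumes "\<bar>det X\<bar> = 1" shows "1 \<le> onorm ((*v) X)"
proof -
  let ?o = "onorm ((*v) X)"
  have bl: "bounded_linear ((*v) X)" by (simp add: linear_conv_bounded_linear[symmetric])
  have o0: "0 \<le> ?o" by (rule onorm_pos_le[OF bl])
  have "ennreal (unit_ball_vol 2) = (\<integral>\<^sup>+v. indicator (cball (0::real^2) 1) v \<partial>lborel)"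
    using emeasure_cball_real2[of 1] by simp
  also have "\<dots> \<le> (\<integral>\<^sup>+v. indicator (cball 0 ?o) (X *v v) \<partial>lborel)"
  proof (rule nn_integral_mono)
    fix v :: "real^2"
    have "norm (X *v v) \<le> ?o" if "norm v \<le> 1"
      using onorm[OF bl, of v] mult_left_mono[OF that o0] by simp
    then show "(indicator (cball 0 1) v :: ennreal) \<le> indicator (cball 0 ?o) (X *v v)"
      by (auto simp: indicator_def)
  qed
  also have "\<dots> = emeasure lborel (cball (0::real^2) ?o)"
    using assms nn_integral_det1[OF borel_measurable_indicator, of "cball 0 ?o" X] by simp
  also have "\<dots> = ennreal (unit_ball_vol 2 * ?o\<^sup>2)" using emeasure_cball_real2[OF o0] by simp
  finally have "unit_ball_vol 2 \<le> unit_ball_vol 2 * ?o\<^sup>2" by (simp add: ennreal_le_iff)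
  then have "1\<^sup>2 \<le> ?o\<^sup>2" by (simp add: mult_le_cancel_left1)
  then show ?thesis using o0 by (rule power2_le_imp_le)
qed

text \<open>A vector whose length is at most the reciprocal of the operator norm lies in the unit
  disc before and after \<open>X\<close>. The left side is the area of the disc of such
  vectors.\<close>

lemma inverse_square_onorm_le_area:
  fixes X :: "real^2^2"
  assumes "\<bar>det X\<bar> = 1"
  shows "ennreal (unit_ball_vol 2 / (onorm ((*v) X))\<^sup>2)
    \<le> (\<integral>\<^sup>+v. indicator (cball (0::real^2) 1) v * indicator (cball 0 1) (X *v v) \<partial>lborel)"
proof -
  let ?o = "onorm ((*v) X)"
  have bl: "bounded_linear ((*v) X)" by (simp add: linear_conv_bounded_linear[symmetric])
  have o1: "1 \<le> ?o" by (rule onorm_ge_1[OF assms])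
  have "ennreal (unit_ball_vol 2 / ?o\<^sup>2) = (\<integral>\<^sup>+v. indicator (cball (0::real^2) (1 / ?o)) v \<partial>lborel)"
    using o1 emeasure_cball_real2[of "1 / ?o"] by (simp add: power_divide)
  also have "\<dots> \<le> (\<integral>\<^sup>+v. indicator (cball (0::real^2) 1) v * indicator (cball 0 1) (X *v v) \<partial>lborel)"
  proof (rule nn_integral_mono)
    fix v :: "real^2"
    have "norm v \<le> 1 \<and> norm (X *v v) \<le> 1" if "norm v \<le> 1 / ?o"
    proof
      have "1 / ?o \<le> 1" using o1 by simp
      then show "norm v \<le> 1" using that by linarith
      have "norm (X *v v) \<le> ?o * norm v" by (rule onorm[OF bl])
      also have "\<dots> \<le> ?o * (1 / ?o)" using that o1 by (intro mult_left_mono) auto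
      also have "\<dots> = 1" using o1 by simp
      finally show "norm (X *v v) \<le> 1" .
    qed
    then show "(indicator (cball 0 (1 / ?o)) v :: ennreal) \<le> indicator (cball (0::real^2) 1) v * indicator (cball 0 1) (X *v v)"
      by (auto simp: indicator_def)
  qed
  finally show ?thesis .
qed

section \<open>Stationarity and ergodicity of the perturbed map\<close>

context random_map
begin

definition step :: "real^2 \<Rightarrow> real^2 \<Rightarrow> real^2" where
  "step x u = wrap L (u + F x)"

lemma measurable_step: "case_prod step \<in> m \<Otimes>\<^sub>M \<nu> \<rightarrow>\<^sub>M m"
proof -
  have "(\<lambda>x. F x) \<in> collision_space L \<rightarrow>\<^sub>M borel"
    by (rule measurable_compose[OF measurable_F measurable_inclusion])
  then have [measurable]: "F \<in> m \<rightarrow>\<^sub>M borel" by (simp cong: measurable_cong_sets)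
  have "(\<lambda>p. wrap L (snd p + F (fst p))) \<in> m \<Otimes>\<^sub>M \<nu> \<rightarrow>\<^sub>M collision_space L"
    by (rule measurable_compose[OF _ measurable_wrap]) measurable
  then show ?thesis by (simp add: step_def[abs_def] case_prod_beta' cong: measurable_cong_sets)
qed

text \<open>Invariance holds for each fixed value of the noise: \<open>F\<close> preserves
  \<open>m\<close>, and so does the translation of the torus that follows.\<close>

sublocale stationary_chain m \<nu> step "\<lambda>x. perturbation L \<rho> (F x)"
proof (intro stationary_chain.intro driven_chain.intro driven_chain_axioms.intro stationary_chain_axioms.intro)
  show "perturbation L \<rho> (F x) = distr \<nu> m (step x)" for x
    unfolding perturbation_def by (rule distr_cong) (simp_all add: step_def)
  show "distr (m \<Otimes>\<^sub>M \<nu>) m (case_prod step) = m"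
  proof (rule measure_eqI)
    fix B assume "B \<in> sets (distr (m \<Otimes>\<^sub>M \<nu>) m (case_prod step))"
    then have B [measurable]: "B \<in> sets m" by simp
    note [measurable] = measurable_step
    interpret mn: pair_sigma_finite m \<nu> by unfold_locales
    have iB: "indicator B \<in> borel_measurable (collision_space L)" using B by simp
    have "emeasure (distr (m \<Otimes>\<^sub>M \<nu>) m (case_prod step)) B = (\<integral>\<^sup>+x. indicator B x \<partial>distr (m \<Otimes>\<^sub>M \<nu>) m (case_prod step))"
      using B by simp
    also have "\<dots> = (\<integral>\<^sup>+p. indicator B (case_prod step p) \<partial>(m \<Otimes>\<^sub>M \<nu>))"
      by (rule nn_integral_distr) measurable
    also have "\<dots> = (\<integral>\<^sup>+u. \<integral>\<^sup>+x. indicator B (step x u) \<partial>m \<partial>\<nu>)"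
      by (subst mn.nn_integral_snd[symmetric]) auto
    also have "\<dots> = (\<integral>\<^sup>+u. \<integral>\<^sup>+x. indicator B x \<partial>m \<partial>\<nu>)"
    proof (rule nn_integral_cong)
      fix u
      have "(\<lambda>y. u + y) \<in> collision_space L \<rightarrow>\<^sub>M borel"
        using measurable_compose[OF measurable_inclusion, of "\<lambda>y. u + y" borel] by simp
      then have "(\<lambda>y. wrap L (u + y)) \<in> collision_space L \<rightarrow>\<^sub>M collision_space L"
        by (rule measurable_compose[OF _ measurable_wrap])
      then have "(\<lambda>y. indicator B (wrap L (u + y)) :: ennreal) \<in> borel_measurable (collision_space L)"
        by (rule measurable_compose[OF _ iB])
      then have "(\<integral>\<^sup>+x. indicator B (step x u) \<partial>m) = (\<integral>\<^sup>+x. indicator B (wrap L (u + x)) \<partial>m)"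
        unfolding step_def by (rule preserves_F)
      also have "\<dots> = (\<integral>\<^sup>+x. indicator B x \<partial>m)"
        using nn_integral_translate[OF iB, of u] by (simp add: add.commute)
      finally show "(\<integral>\<^sup>+x. indicator B (step x u) \<partial>m) = (\<integral>\<^sup>+x. indicator B x \<partial>m)" .
    qed
    also have "\<dots> = emeasure m B" using B by (simp add: \<nu>.emeasure_space_1[simplified])
    finally show "emeasure (distr (m \<Otimes>\<^sub>M \<nu>) m (case_prod step)) B = emeasure m B" .
  qed simp
qed (unfold_locales, rule measurable_step)

text \<open>
  A bounded harmonic \<open>h\<close> is \<open>avg h \<circ> F\<close>, so \<open>h\<close> and \<open>avg h\<close> have the same \<open>L\<^sup>2\<close> norm, and the
  Poincare inequality kills the variance of \<open>h\<close>.
\<close>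

theorem ergodic: "ergodic_wrt m (\<lambda>x. perturbation L \<rho> (F x))"
proof (rule ergodicI)
  fix h :: "real^2 \<Rightarrow> real"
  assume h: "h \<in> borel_measurable m" and h01: "\<And>x. x \<in> space m \<Longrightarrow> 0 \<le> h x \<and> h x \<le> 1"
    and harm: "\<And>x. x \<in> space m \<Longrightarrow> h x = (\<integral>u. h (step x u) \<partial>\<nu>)"
  have hm [measurable]: "h \<in> borel_measurable (collision_space L)"
    using h by (simp cong: measurable_cong_sets)
  have harm': "h x = avg h (F x)" if "x \<in> cylinder L" for x
    using harm[of x] that by (simp add: avg_def step_def add.commute)
  obtain c where c: "0 < c" "\<And>(f :: real^2 \<Rightarrow> real) B. f \<in> borel_measurable (collision_space L) \<Longrightarrow>
    (\<And>x. x \<in> cylinder L \<Longrightarrow> \<bar>f x\<bar> \<le> B) \<Longrightarrow>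
    (\<integral>\<^sup>+z. ennreal ((avg f z)\<^sup>2) \<partial>m) + ennreal c * vari f \<le> (\<integral>\<^sup>+x. ennreal ((f x)\<^sup>2) \<partial>m)"
    by (rule poincare) blast
  have am: "avg h \<in> borel_measurable (collision_space L)"
  proof -
    note [measurable] = measurable_inclusion
    show ?thesis unfolding avg_def by measurable
  qed
  have "(\<integral>\<^sup>+x. ennreal ((h x)\<^sup>2) \<partial>m) = (\<integral>\<^sup>+x. ennreal ((avg h (F x))\<^sup>2) \<partial>m)"
    by (intro nn_integral_cong) (simp add: harm')
  also have "\<dots> = (\<integral>\<^sup>+x. ennreal ((avg h x)\<^sup>2) \<partial>m)"
    by (rule preserves_F) (use am in measurable)
  finally have eq: "(\<integral>\<^sup>+z. ennreal ((avg h z)\<^sup>2) \<partial>m) = (\<integral>\<^sup>+x. ennreal ((h x)\<^sup>2) \<partial>m)" ..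
  have "(\<integral>\<^sup>+x. ennreal ((h x)\<^sup>2) \<partial>m) \<le> (\<integral>\<^sup>+x. 1 \<partial>m)"
    using h01 by (intro nn_integral_mono) (auto simp: power_le_one)
  then have fin: "(\<integral>\<^sup>+x. ennreal ((h x)\<^sup>2) \<partial>m) < \<infinity>"
    by (simp add: m.emeasure_space_1[simplified] order_le_less_trans)
  have "(\<integral>\<^sup>+x. ennreal ((h x)\<^sup>2) \<partial>m) + ennreal c * vari h \<le> (\<integral>\<^sup>+x. ennreal ((h x)\<^sup>2) \<partial>m) + 0"
    using c(2)[OF hm, of 1] h01 eq by auto
  then have "ennreal c * vari h \<le> 0"
    using fin by (subst (asm) ennreal_add_left_cancel_le) auto
  then have "vari h = 0" using c(1) by simp
  then have "AE x in m. (\<integral>\<^sup>+y. ennreal ((h x - h y)\<^sup>2) \<partial>m) = 0"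
    unfolding vari_def by (subst (asm) nn_integral_0_iff_AE) auto
  then have ae: "AE x in m. x \<in> space m \<and> (\<integral>\<^sup>+y. ennreal ((h x - h y)\<^sup>2) \<partial>m) = 0"
    using AE_space by eventually_elim simp
  have "\<exists>x. x \<in> space m \<and> (\<integral>\<^sup>+y. ennreal ((h x - h y)\<^sup>2) \<partial>m) = 0"
  proof (rule ccontr)
    assume no: "\<nexists>x. x \<in> space m \<and> (\<integral>\<^sup>+y. ennreal ((h x - h y)\<^sup>2) \<partial>m) = 0"
    from ae have "AE x in m. False" by eventually_elim (use no in blast)
    then show False by simp
  qed
  then obtain x where x: "x \<in> space m" "(\<integral>\<^sup>+y. ennreal ((h x - h y)\<^sup>2) \<partial>m) = 0" by blast
  then have "AE y in m. ennreal ((h x - h y)\<^sup>2) = 0"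
    by (subst (asm) nn_integral_0_iff_AE) auto
  then have "AE y in m. h y = h x" by eventually_elim simp
  then show "\<exists>c. AE x in m. h x = c" ..
qed

end

section \<open>Growth of the cocycle along the random trajectory\<close>

lemma ennreal_add_le: "ennreal (a + b) \<le> ennreal a + ennreal b"
proof -
  have "ennreal (a + b) \<le> ennreal (max 0 a + max 0 b)" by (intro ennreal_leI) auto
  also have "\<dots> = ennreal (max 0 a) + ennreal (max 0 b)" by (intro ennreal_plus) auto
  finally show ?thesis by (simp add: ennreal_max_0)
qed

context spread_map
begin

text \<open>The probability that a tangent vector \<open>v\<close> at \<open>x\<close> lies in the
  unit disc at time \<open>n\<close>. By \<open>bounded_prob_Suc\<close> it is the
  \<open>n\<close>-th iterate of \<open>transfer\<close> on the indicator of that disc.\<close>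

definition bounded_prob :: "nat \<Rightarrow> real^2 \<Rightarrow> real^2 \<Rightarrow> real" where
  "bounded_prob n x v = enn2real (\<integral>\<^sup>+\<omega>. indicator (cball 0 1) (cocycle A n (traj x \<omega>) *v v) \<partial>W)"

lemma measurable_cocycle [measurable]: "cocycle A n \<in> borel_measurable Path"
proof (induction n)
  case (Suc n)
  have [measurable]: "A \<in> borel_measurable m" by (simp cong: measurable_cong_sets)
  have "(\<lambda>\<omega>. A (\<omega> n) ** cocycle A n \<omega>) \<in> borel_measurable Path"
    using Suc by measurable
  then show ?case by simp
qed simp

lemma ennreal_bounded_prob:
  "ennreal (bounded_prob n x v) = (\<integral>\<^sup>+\<omega>. indicator (cball 0 1) (cocycle A n (traj x \<omega>) *v v) \<partial>W)"
  and bounded_prob_le_1: "bounded_prob n x v \<le> 1"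
proof -
  have "(\<integral>\<^sup>+\<omega>. indicator (cball 0 1) (cocycle A n (traj x \<omega>) *v v) \<partial>W) \<le> (\<integral>\<^sup>+\<omega>. 1 \<partial>W)"
    by (intro nn_integral_mono) (simp add: indicator_def)
  then have le: "(\<integral>\<^sup>+\<omega>. indicator (cball 0 1) (cocycle A n (traj x \<omega>) *v v) \<partial>W) \<le> 1"
    by (simp add: seq.P.emeasure_space_1)
  then show "ennreal (bounded_prob n x v) = (\<integral>\<^sup>+\<omega>. indicator (cball 0 1) (cocycle A n (traj x \<omega>) *v v) \<partial>W)"
    unfolding bounded_prob_def by (rule ennreal_enn2real[OF order_le_less_trans[OF _ ennreal_one_less_top]])
  then have "ennreal (bounded_prob n x v) \<le> ennreal 1" using le by simp
  then show "bounded_prob n x v \<le> 1" by (simp add: ennreal_le_iff)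
qed

lemma admissible_bounded_prob: "admissible (bounded_prob n)"
  unfolding admissible_def
proof (intro conjI ballI allI)
  have [measurable]: "(\<lambda>p. traj (fst (fst p)) (snd p)) \<in> (m \<Otimes>\<^sub>M borel) \<Otimes>\<^sub>M W \<rightarrow>\<^sub>M Path"
    by (rule measurable_traj) measurable
  have [measurable]: "cball (0::real^2) 1 \<in> sets borel" by simp
  have "(\<lambda>p. indicator (cball 0 1) (cocycle A n (traj (fst (fst p)) (snd p)) *v snd (fst p)) :: ennreal)
     \<in> borel_measurable ((m \<Otimes>\<^sub>M borel) \<Otimes>\<^sub>M W)"
    by measurable
  then have "(\<lambda>p. \<integral>\<^sup>+\<omega>. indicator (cball 0 1) (cocycle A n (traj (fst p) \<omega>) *v snd p) \<partial>W) \<in> borel_measurable (m \<Otimes>\<^sub>M borel)"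
    by (intro seq.P.borel_measurable_nn_integral) (simp add: case_prod_beta')
  then have "(\<lambda>p. bounded_prob n (fst p) (snd p)) \<in> borel_measurable (m \<Otimes>\<^sub>M borel)"
    unfolding bounded_prob_def by measurable
  then show "case_prod (bounded_prob n) \<in> borel_measurable (collision_space L \<Otimes>\<^sub>M borel)"
    by (simp add: case_prod_beta' cong: measurable_cong_sets)
qed (simp_all add: bounded_prob_le_1, simp add: bounded_prob_def)

lemma bounded_prob_Suc:
  assumes x: "x \<in> cylinder L"
  shows "bounded_prob (Suc n) x v = transfer (bounded_prob n) x v"
proof -
  have [measurable]: "x \<in> space m" using x by simp
  have [measurable]: "cball (0::real^2) 1 \<in> sets borel" by simp
  have "ennreal (bounded_prob (Suc n) x v) = (\<integral>\<^sup>+u. \<integral>\<^sup>+\<omega>. indicator (cball 0 1) (cocycle A (Suc n) (traj x (case_nat u \<omega>)) *v v) \<partial>W \<partial>\<nu>)"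
    unfolding ennreal_bounded_prob by (rule nn_integral_W_Cons) measurable
  also have "\<dots> = (\<integral>\<^sup>+u. ennreal (bounded_prob n (step x u) (A x *v v)) \<partial>\<nu>)"
    unfolding ennreal_bounded_prob cocycle_Suc_shift shift_traj_Cons
    by (simp add: traj_Cons matrix_vector_mul_assoc)
  also have "\<dots> = ennreal (\<integral>u. bounded_prob n (step x u) (A x *v v) \<partial>\<nu>)"
  proof (rule nn_integral_eq_integral)
    have "(\<lambda>u. bounded_prob n (step x u) (A x *v v)) \<in> borel_measurable \<nu>"
    proof (rule measurable_admissible[OF admissible_bounded_prob])
      show "step x \<in> \<nu> \<rightarrow>\<^sub>M collision_space L"
        unfolding step_def[abs_def] noise_measure_def by simp
    qed simp
    then show "integrable \<nu> (\<lambda>u. bounded_prob n (step x u) (A x *v v))"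
      by (rule \<nu>.integrable_const_bound[of _ 1, rotated]) (simp add: bounded_prob_le_1, simp add: bounded_prob_def bounded_prob_le_1[unfolded bounded_prob_def])
  qed (simp add: bounded_prob_def)
  finally have "bounded_prob (Suc n) x v = (\<integral>u. bounded_prob n (step x u) (A x *v v) \<partial>\<nu>)"
    by (subst (asm) ennreal_inj) (simp_all add: bounded_prob_def integral_nonneg_AE)
  then show ?thesis by (simp add: transfer_def avg_def step_def add.commute)
qed

lemma N2_cong: "(\<And>x v. x \<in> cylinder L \<Longrightarrow> f x v = g x v) \<Longrightarrow> N2 f = N2 g"
  unfolding N2_def by (intro nn_integral_cong) simp

lemma transfer_cong:
  assumes "\<And>x v. x \<in> cylinder L \<Longrightarrow> f x v = g x v" shows "transfer f = transfer g"
  unfolding transfer_def avg_def fun_eq_iff using assms by (simp add: L_pos)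

lemma N2_bounded_prob_0: "N2 (bounded_prob 0) = ennreal (unit_ball_vol 2)"
proof -
  have "bounded_prob 0 x v = indicator (cball 0 1) v" for x v
    by (simp add: bounded_prob_def seq.P.emeasure_space_1 indicator_def)
  then have "N2 (bounded_prob 0) = (\<integral>\<^sup>+x. \<integral>\<^sup>+v. indicator (cball 0 1) (v::real^2) \<partial>lborel \<partial>m)"
    unfolding N2_def by (intro nn_integral_cong) (simp add: indicator_def)
  then show ?thesis using emeasure_cball_real2[of 1] by (simp add: m.emeasure_space_1[simplified])
qed

lemma N2_bounded_prob_decay:
  obtains q where "1/2 \<le> q" "q < 1" "\<And>k. N2 (bounded_prob (2 * k)) \<le> ennreal (q ^ k * unit_ball_vol 2)"
proof -
  obtain q where q: "1/2 \<le> q" "q < 1" "\<And>f. admissible f \<Longrightarrow> N2 f < \<infinity> \<Longrightarrow> N2 (transfer (transfer f)) \<le> ennreal q * N2 f"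
    by (rule two_step_contraction) blast
  have "N2 (bounded_prob (2 * k)) \<le> ennreal (q ^ k * unit_ball_vol 2)" for k
  proof (induction k)
    case (Suc k)
    have t: "transfer (bounded_prob (Suc (2 * k))) = transfer (transfer (bounded_prob (2 * k)))"
      by (rule transfer_cong) (rule bounded_prob_Suc)
    have "N2 (bounded_prob (2 * Suc k)) = N2 (transfer (bounded_prob (Suc (2 * k))))"
      by (rule N2_cong) (simp add: bounded_prob_Suc)
    also have "\<dots> \<le> ennreal q * N2 (bounded_prob (2 * k))"
      unfolding t using Suc by (intro q(3) admissible_bounded_prob) (simp add: order_le_less_trans)
    also have "\<dots> \<le> ennreal q * ennreal (q ^ k * unit_ball_vol 2)"
      by (rule mult_left_mono[OF Suc]) simp
    also have "\<dots> = ennreal (q ^ Suc k * unit_ball_vol 2)"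
      using q by (subst ennreal_mult[symmetric]) (auto simp: mult.assoc)
    finally show ?case .
  qed (simp add: N2_bounded_prob_0)
  with q that show ?thesis by blast
qed

lemma AE_det_cocycle: "AE \<omega> in law. \<forall>n. \<bar>det (cocycle A n \<omega>)\<bar> = 1"
proof -
  have "AE \<omega> in law. \<forall>n. \<bar>det (A (\<omega> n))\<bar> = 1"
    by (rule AE_law_nth[OF det_A])
  then show ?thesis
  proof eventually_elim
    fix \<omega> :: "nat \<Rightarrow> real^2" assume d: "\<forall>n. \<bar>det (A (\<omega> n))\<bar> = 1"
    show "\<forall>n. \<bar>det (cocycle A n \<omega>)\<bar> = 1"
    proof
      fix n show "\<bar>det (cocycle A n \<omega>)\<bar> = 1"
        by (induction n) (simp_all add: det_mul abs_mult d)
    qed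
  qed
qed

text \<open>The area inequality bounds the integrand by the chance that a vector of the unit disc is
  again in it at time \<open>2 * k\<close>. This is an L^1 quantity, and reaching it from the L^2
  decay \<open>q ^ k\<close> costs a square root, hence \<open>s = sqrt q\<close>.\<close>

lemma expectation_inverse_square_onorm:
  obtains s where "0 < s" "s < 1"
    "\<And>k. (\<integral>\<^sup>+\<omega>. ennreal (1 / (onorm ((*v) (cocycle A (2 * k) \<omega>)))\<^sup>2) \<partial>law) \<le> ennreal (s ^ k)"
proof -
  obtain q where q: "1/2 \<le> q" "q < 1" and decay: "\<And>k. N2 (bounded_prob (2 * k)) \<le> ennreal (q ^ k * unit_ball_vol 2)"
    by (rule N2_bounded_prob_decay) blast
  define s where "s = sqrt q"
  have s: "0 < s" "s < 1" "s\<^sup>2 = q" using q by (auto simp: s_def)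
  define b :: real where "b = unit_ball_vol 2"
  have b: "0 < b" by (simp add: b_def)
  interpret ml: pair_sigma_finite m "lborel :: (real^2) measure" by unfold_locales
  interpret lw: pair_sigma_finite "lborel :: (real^2) measure" W by unfold_locales
  have [measurable]: "cball (0::real^2) 1 \<in> sets borel" by simp
  interpret L: prob_space law by (rule prob_space_law)
  interpret ll: pair_sigma_finite "lborel :: (real^2) measure" law by unfold_locales
  show ?thesis
  proof (rule that[OF s(1,2)])
    fix k :: nat
    let ?n = "2 * k"
    have fm: "case_prod (bounded_prob ?n) \<in> borel_measurable (collision_space L \<Otimes>\<^sub>M borel)"
      using admissible_bounded_prob by (simp add: admissible_def)
    \<comment> \<open>The weight in \<open>y \<le> 1 / (2 * t) * y^2 + t / 2\<close>; with
      \<open>t = s ^ k\<close> both terms integrate to the order of \<open>t\<close>.\<close>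
    define t where "t = s ^ k"
    have t: "0 < t" "t\<^sup>2 = q ^ k" using s by (auto simp: t_def power_mult[symmetric] mult.commute[of _ 2] power_mult)
    have "(\<integral>\<^sup>+\<omega>. ennreal (b / (onorm ((*v) (cocycle A ?n \<omega>)))\<^sup>2) \<partial>law)
      \<le> (\<integral>\<^sup>+\<omega>. \<integral>\<^sup>+v. indicator (cball (0::real^2) 1) v * indicator (cball 0 1) (cocycle A ?n \<omega> *v v) \<partial>lborel \<partial>law)"
      by (rule nn_integral_mono_AE) (use AE_det_cocycle in eventually_elim, auto simp: b_def intro!: inverse_square_onorm_le_area)
    also have "\<dots> = (\<integral>\<^sup>+v. \<integral>\<^sup>+\<omega>. indicator (cball (0::real^2) 1) v * indicator (cball 0 1) (cocycle A ?n \<omega> *v v) \<partial>law \<partial>lborel)"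
      by (rule ll.Fubini') measurable
    also have "\<dots> = (\<integral>\<^sup>+v. indicator (cball (0::real^2) 1) v * (\<integral>\<^sup>+x. ennreal (bounded_prob ?n x v) \<partial>m) \<partial>lborel)"
    proof (rule nn_integral_cong)
      fix v :: "real^2"
      have "(\<integral>\<^sup>+\<omega>. indicator (cball (0::real^2) 1) v * indicator (cball 0 1) (cocycle A ?n \<omega> *v v) \<partial>law)
        = indicator (cball (0::real^2) 1) v * (\<integral>\<^sup>+\<omega>. indicator (cball 0 1) (cocycle A ?n \<omega> *v v) \<partial>law)"
        by (rule nn_integral_cmult) measurable
      also have "(\<integral>\<^sup>+\<omega>. indicator (cball 0 1) (cocycle A ?n \<omega> *v v) \<partial>law) = (\<integral>\<^sup>+x. ennreal (bounded_prob ?n x v) \<partial>m)"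
        unfolding ennreal_bounded_prob by (rule nn_integral_law) measurable
      finally show "(\<integral>\<^sup>+\<omega>. indicator (cball (0::real^2) 1) v * indicator (cball 0 1) (cocycle A ?n \<omega> *v v) \<partial>law)
        = indicator (cball (0::real^2) 1) v * (\<integral>\<^sup>+x. ennreal (bounded_prob ?n x v) \<partial>m)" .
    qed
    also have "\<dots> \<le> (\<integral>\<^sup>+v. ennreal (1 / (2 * t)) * (\<integral>\<^sup>+x. ennreal ((bounded_prob ?n x v)\<^sup>2) \<partial>m) + ennreal (t / 2) * indicator (cball 0 1) v \<partial>lborel)"
    proof (rule nn_integral_mono)
      fix v :: "real^2"
      have [measurable]: "(\<lambda>x. bounded_prob ?n x v) \<in> borel_measurable (collision_space L)"
        by (rule measurable_section[OF admissible_bounded_prob])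
      show "indicator (cball (0::real^2) 1) v * (\<integral>\<^sup>+x. ennreal (bounded_prob ?n x v) \<partial>m)
        \<le> ennreal (1 / (2 * t)) * (\<integral>\<^sup>+x. ennreal ((bounded_prob ?n x v)\<^sup>2) \<partial>m) + ennreal (t / 2) * indicator (cball 0 1) v"
      proof (cases "v \<in> cball 0 1")
        case True
        have "(\<integral>\<^sup>+x. ennreal (bounded_prob ?n x v) \<partial>m) \<le> (\<integral>\<^sup>+x. ennreal (1 / (2 * t)) * ennreal ((bounded_prob ?n x v)\<^sup>2) + ennreal (t / 2) \<partial>m)"
        proof (rule nn_integral_mono)
          fix x
          define y where "y = bounded_prob ?n x v"
          have "0 \<le> (y - t)\<^sup>2 / (2 * t)" using t by simp
          also have "(y - t)\<^sup>2 / (2 * t) = 1 / (2 * t) * y\<^sup>2 + t / 2 - y"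
            using t by (simp add: field_simps power2_eq_square)
          finally have "y \<le> 1 / (2 * t) * y\<^sup>2 + t / 2" by simp
          then have "ennreal y \<le> ennreal (1 / (2 * t) * y\<^sup>2 + t / 2)" by (rule ennreal_leI)
          also have "\<dots> = ennreal (1 / (2 * t)) * ennreal (y\<^sup>2) + ennreal (t / 2)"
            using t by (simp add: ennreal_mult[symmetric])
          finally show "ennreal (bounded_prob ?n x v) \<le> ennreal (1 / (2 * t)) * ennreal ((bounded_prob ?n x v)\<^sup>2) + ennreal (t / 2)"
            by (simp only: y_def)
        qed
        also have "\<dots> = ennreal (1 / (2 * t)) * (\<integral>\<^sup>+x. ennreal ((bounded_prob ?n x v)\<^sup>2) \<partial>m) + ennreal (t / 2)"
          by (subst nn_integral_add) (auto simp: nn_integral_cmult m.emeasure_space_1[simplified])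
        finally show ?thesis using True by simp
      qed simp
    qed
    also have "\<dots> = ennreal (1 / (2 * t)) * N2 (bounded_prob ?n) + ennreal (t / 2) * ennreal b"
      unfolding N2_swap[OF admissible_bounded_prob]
      using emeasure_cball_real2[of 1] fm unfolding b_def
      by (subst nn_integral_add) (auto simp: nn_integral_cmult)
    also have "\<dots> \<le> ennreal (1 / (2 * t)) * ennreal (t\<^sup>2 * b) + ennreal (t / 2) * ennreal b"
      unfolding t(2) b_def by (intro add_right_mono mult_left_mono decay) simp
    also have "\<dots> = ennreal (1 / (2 * t) * (t\<^sup>2 * b) + t / 2 * b)"
      using t(1) b by (simp add: ennreal_mult[symmetric] ennreal_plus[symmetric] del: ennreal_plus)
    also have "1 / (2 * t) * (t\<^sup>2 * b) + t / 2 * b = b * t"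
      using t(1) by (simp add: field_simps power2_eq_square)
    finally have le: "(\<integral>\<^sup>+\<omega>. ennreal (b / (onorm ((*v) (cocycle A ?n \<omega>)))\<^sup>2) \<partial>law) \<le> ennreal (b * t)" .
    have "(\<integral>\<^sup>+\<omega>. ennreal (1 / (onorm ((*v) (cocycle A ?n \<omega>)))\<^sup>2) \<partial>law)
      = (\<integral>\<^sup>+\<omega>. ennreal (1 / b) * ennreal (b / (onorm ((*v) (cocycle A ?n \<omega>)))\<^sup>2) \<partial>law)"
    proof (rule nn_integral_cong)
      fix \<omega>
      show "ennreal (1 / (onorm ((*v) (cocycle A ?n \<omega>)))\<^sup>2) = ennreal (1 / b) * ennreal (b / (onorm ((*v) (cocycle A ?n \<omega>)))\<^sup>2)"
        using b by (subst ennreal_mult[symmetric]) auto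
    qed
    also have "\<dots> = ennreal (1 / b) * (\<integral>\<^sup>+\<omega>. ennreal (b / (onorm ((*v) (cocycle A ?n \<omega>)))\<^sup>2) \<partial>law)"
      by (rule nn_integral_cmult) measurable
    also have "\<dots> \<le> ennreal (1 / b) * ennreal (b * t)" by (rule mult_left_mono[OF le]) simp
    also have "\<dots> = ennreal t" using b t(1) by (subst ennreal_mult[symmetric]) auto
    finally show "(\<integral>\<^sup>+\<omega>. ennreal (1 / (onorm ((*v) (cocycle A (2 * k) \<omega>)))\<^sup>2) \<partial>law) \<le> ennreal (s ^ k)"
      by (simp only: t_def)
  qed
qed

abbreviation log_norm :: "nat \<Rightarrow> (nat \<Rightarrow> real^2) \<Rightarrow> real" where
  "log_norm n \<omega> \<equiv> ln (onorm ((*v) (cocycle A n \<omega>)))"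

lemma AE_log_norm_nonneg: "AE \<omega> in law. \<forall>n. 0 \<le> log_norm n \<omega>"
  using AE_det_cocycle by eventually_elim (auto intro!: ln_ge_zero onorm_ge_1)

lemma AE_log_norm_add: "AE \<omega> in law. log_norm (n + k) \<omega> \<le> log_norm n \<omega> + log_norm k (\<lambda>i. \<omega> (i + n))"
proof -
  have "AE \<omega> in law. \<forall>i. \<bar>det (A (\<omega> i))\<bar> = 1" by (rule AE_law_nth[OF det_A])
  then show ?thesis
  proof eventually_elim
    fix \<omega> :: "nat \<Rightarrow> real^2" assume d: "\<forall>i. \<bar>det (A (\<omega> i))\<bar> = 1"
    have dc: "\<bar>det (cocycle A j \<omega>')\<bar> = 1" if "\<forall>i. \<bar>det (A (\<omega>' i))\<bar> = 1" for j \<omega>'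
      by (induction j) (simp_all add: det_mul abs_mult that)
    have 1: "1 \<le> onorm ((*v) (cocycle A j \<omega>))" for j by (intro onorm_ge_1 dc d)
    have 2: "1 \<le> onorm ((*v) (cocycle A k (\<lambda>i. \<omega> (i + n))))" by (intro onorm_ge_1 dc) (simp add: d)
    have "ln (onorm ((*v) (cocycle A (n + k) \<omega>))) \<le> ln (onorm ((*v) (cocycle A k (\<lambda>i. \<omega> (i + n)))) * onorm ((*v) (cocycle A n \<omega>)))"
      using 1[of "n + k"] onorm_matrix_mult_le unfolding cocycle_add by (intro ln_mono) auto
    also have "\<dots> = ln (onorm ((*v) (cocycle A k (\<lambda>i. \<omega> (i + n))))) + ln (onorm ((*v) (cocycle A n \<omega>)))"
      using 1[of n] 2 by (intro ln_mult_pos) auto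
    finally show "log_norm (n + k) \<omega> \<le> log_norm n \<omega> + log_norm k (\<lambda>i. \<omega> (i + n))" by simp
  qed
qed

definition log_growth :: "nat \<Rightarrow> ennreal" where
  "log_growth n = (\<integral>\<^sup>+\<omega>. ennreal (log_norm n \<omega>) \<partial>law)"

text \<open>Submultiplicativity of the operator norm, with stationarity of the process for the
  shifted factor.\<close>

lemma log_growth_add: "log_growth (n + k) \<le> log_growth n + log_growth k"
proof -
  have sh: "(\<lambda>\<omega>. (\<lambda>i. \<omega> (i + n))) \<in> Path \<rightarrow>\<^sub>M Path"
    by (rule measurable_PiM_single') (auto simp: space_PiM PiE_iff)
  note [measurable] = sh
  have "log_growth (n + k) \<le> (\<integral>\<^sup>+\<omega>. ennreal (log_norm n \<omega>) + ennreal (log_norm k (\<lambda>i. \<omega> (i + n))) \<partial>law)"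
    unfolding log_growth_def
  proof (rule nn_integral_mono_AE)
    show "AE \<omega> in law. ennreal (log_norm (n + k) \<omega>) \<le> ennreal (log_norm n \<omega>) + ennreal (log_norm k (\<lambda>i. \<omega> (i + n)))"
      using AE_log_norm_add[of n k]
    proof eventually_elim
      fix \<omega> assume "log_norm (n + k) \<omega> \<le> log_norm n \<omega> + log_norm k (\<lambda>i. \<omega> (i + n))"
      then have "ennreal (log_norm (n + k) \<omega>) \<le> ennreal (log_norm n \<omega> + log_norm k (\<lambda>i. \<omega> (i + n)))" by (rule ennreal_leI)
      also have "\<dots> \<le> ennreal (log_norm n \<omega>) + ennreal (log_norm k (\<lambda>i. \<omega> (i + n)))"
        by (rule ennreal_add_le)
      finally show "ennreal (log_norm (n + k) \<omega>) \<le> ennreal (log_norm n \<omega>) + ennreal (log_norm k (\<lambda>i. \<omega> (i + n)))" .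
    qed
  qed
  also have "\<dots> = log_growth n + (\<integral>\<^sup>+\<omega>. ennreal (log_norm k (\<lambda>i. \<omega> (i + n))) \<partial>law)"
    unfolding log_growth_def by (rule nn_integral_add) measurable
  also have "(\<integral>\<^sup>+\<omega>. ennreal (log_norm k (\<lambda>i. \<omega> (i + n))) \<partial>law) = log_growth k"
    unfolding log_growth_def by (rule nn_integral_law_shift_add[of "\<lambda>\<omega>. ennreal (log_norm k \<omega>)"]) measurable
  finally show ?thesis .
qed

text \<open>Subadditivity reduces the claim to one step, where the logarithm of the norm is below
  the norm itself, which is integrable.\<close>

lemma log_growth_finite: "log_growth n < \<infinity>"
proof (induction n)
  case 0
  have "onorm ((*v) (mat 1 :: real^2^2)) = 1"
  proof -
    have "(*v) (mat 1 :: real^2^2) = (\<lambda>x. x)" by (simp add: fun_eq_iff)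
    then show ?thesis by (simp only: onorm_id)
  qed
  then show ?case by (simp add: log_growth_def)
next
  case (Suc n)
  have [measurable]: "A \<in> borel_measurable m" by (simp cong: measurable_cong_sets)
  have "log_growth 1 \<le> (\<integral>\<^sup>+\<omega>. ennreal (norm (A (\<omega> 0))) \<partial>law)"
    unfolding log_growth_def
  proof (rule nn_integral_mono_AE)
    show "AE \<omega> in law. ennreal (log_norm 1 \<omega>) \<le> ennreal (norm (A (\<omega> 0)))"
      using AE_det_cocycle
    proof eventually_elim
      fix \<omega> :: "nat \<Rightarrow> real^2" assume d: "\<forall>n. \<bar>det (cocycle A n \<omega>)\<bar> = 1"
      have "1 \<le> onorm ((*v) (cocycle A 1 \<omega>))" by (rule onorm_ge_1) (use d in blast)
      then have "log_norm 1 \<omega> \<le> onorm ((*v) (cocycle A 1 \<omega>))" using ln_le_minus_one[of "onorm ((*v) (cocycle A 1 \<omega>))"] by linarith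
      also have "\<dots> \<le> norm (cocycle A 1 \<omega>)" by (rule onorm_matrix_le_norm)
      finally show "ennreal (log_norm 1 \<omega>) \<le> ennreal (norm (A (\<omega> 0)))" by (intro ennreal_leI) simp
    qed
  qed
  also have "\<dots> = (\<integral>\<^sup>+x. ennreal (norm (A x)) \<partial>m)"
    by (rule nn_integral_law_nth[of "\<lambda>x. ennreal (norm (A x))"]) measurable
  finally have "log_growth 1 < \<infinity>" using integrable_norm_A by (rule order_le_less_trans)
  with Suc log_growth_add[of n 1] show ?case
    by (simp add: order_le_less_trans ennreal_add_eq_top less_top[symmetric] top_unique) (metis ennreal_add_eq_top neq_top_trans)
qed

lemma integrable_log_norm: "integrable law (log_norm n)"
proof (rule integrableI_nn_integral_finite[where x = "enn2real (log_growth n)"])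
  show "AE \<omega> in law. 0 \<le> log_norm n \<omega>" using AE_log_norm_nonneg by eventually_elim simp
  show "(\<integral>\<^sup>+\<omega>. ennreal (log_norm n \<omega>) \<partial>law) = ennreal (enn2real (log_growth n))"
    using log_growth_finite[of n] by (simp add: log_growth_def)
  show "log_norm n \<in> borel_measurable law" by measurable
qed

lemma log_growth_eq: "log_growth n = ennreal (\<integral>\<omega>. log_norm n \<omega> \<partial>law)"
  unfolding log_growth_def
  by (rule nn_integral_eq_integral[OF integrable_log_norm]) (use AE_log_norm_nonneg in eventually_elim, auto)

theorem hyperbolic: "hyperbolic law A"
proof -
  define a where "a n = (\<integral>\<omega>. log_norm n \<omega> \<partial>law)" for n
  have a0: "0 \<le> a n" for n
    unfolding a_def by (rule integral_nonneg_AE) (use AE_log_norm_nonneg in eventually_elim, auto)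
  have "a (n + k) \<le> a n + a k" for n k
    using log_growth_add[of n k] a0 unfolding log_growth_eq a_def[symmetric]
    by (simp add: ennreal_plus[symmetric] ennreal_le_iff del: ennreal_plus)
  from subadditive_converges[OF this a0] obtain l where l: "(\<lambda>n. a n / n) \<longlonglongrightarrow> l" by blast
  obtain s where s: "0 < s" "s < 1" and dec:
    "\<And>k. (\<integral>\<^sup>+\<omega>. ennreal (1 / (onorm ((*v) (cocycle A (2 * k) \<omega>)))\<^sup>2) \<partial>law) \<le> ennreal (s ^ k)"
    by (rule expectation_inverse_square_onorm) blast
  interpret L: prob_space law by (rule prob_space_law)
  \<comment> \<open>Jensen in the form \<open>ln y \<le> y - 1\<close> at
    \<open>y = Y \<omega> / s ^ k\<close>, whose expectation is at most 1.\<close>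
  have lower: "- (real k * ln s) / 2 \<le> a (2 * k)" for k
  proof -
    define Y where "Y \<omega> = 1 / (onorm ((*v) (cocycle A (2 * k) \<omega>)))\<^sup>2" for \<omega>
    have [measurable]: "Y \<in> borel_measurable law" unfolding Y_def by measurable
    have Y0: "0 \<le> Y \<omega>" for \<omega> by (simp add: Y_def)
    have iY: "integrable law Y"
    proof (rule L.integrable_const_bound[of _ 1])
      show "AE \<omega> in law. norm (Y \<omega>) \<le> 1"
        using AE_det_cocycle
      proof eventually_elim
        fix \<omega> :: "nat \<Rightarrow> real^2" assume d: "\<forall>n. \<bar>det (cocycle A n \<omega>)\<bar> = 1"
        have "1 \<le> onorm ((*v) (cocycle A (2 * k) \<omega>))" using d by (intro onorm_ge_1) auto
        then have "1 \<le> (onorm ((*v) (cocycle A (2 * k) \<omega>)))\<^sup>2" by (rule one_le_power)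
        then show "norm (Y \<omega>) \<le> 1" by (auto simp: Y_def divide_le_eq)
      qed
    qed measurable
    have "ennreal (\<integral>\<omega>. Y \<omega> \<partial>law) \<le> ennreal (s ^ k)"
      using dec[of k] by (subst nn_integral_eq_integral[symmetric, OF iY]) (auto simp: Y_def)
    then have EY: "(\<integral>\<omega>. Y \<omega> \<partial>law) \<le> s ^ k" using s by (simp add: ennreal_le_iff)
    have "(\<integral>\<omega>. - 2 * log_norm (2 * k) \<omega> \<partial>law) \<le> (\<integral>\<omega>. Y \<omega> / s ^ k - 1 + k * ln s \<partial>law)"
    proof (rule integral_mono_AE)
      show "AE \<omega> in law. - 2 * log_norm (2 * k) \<omega> \<le> Y \<omega> / s ^ k - 1 + k * ln s"
        using AE_det_cocycle
      proof eventually_elim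
        fix \<omega> :: "nat \<Rightarrow> real^2" assume d: "\<forall>n. \<bar>det (cocycle A n \<omega>)\<bar> = 1"
        have o: "1 \<le> onorm ((*v) (cocycle A (2 * k) \<omega>))" using d by (intro onorm_ge_1) auto
        have "ln (Y \<omega> / s ^ k) \<le> Y \<omega> / s ^ k - 1"
          using o s by (intro ln_le_minus_one) (simp add: Y_def)
        moreover have "ln (Y \<omega> / s ^ k) = - 2 * log_norm (2 * k) \<omega> - k * ln s"
          using o s by (simp add: Y_def ln_div ln_mult_pos ln_realpow)
        ultimately show "- 2 * log_norm (2 * k) \<omega> \<le> Y \<omega> / s ^ k - 1 + k * ln s" by linarith
      qed
    qed (use iY integrable_log_norm in auto)
    also have "\<dots> = (\<integral>\<omega>. Y \<omega> \<partial>law) / s ^ k - 1 + k * ln s"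
      using iY by (simp add: L.prob_space[simplified])
    also have "\<dots> \<le> k * ln s"
      using EY s by (simp add: field_simps)
    finally have "- 2 * a (2 * k) \<le> k * ln s" by (simp add: a_def)
    then show ?thesis by linarith
  qed
  \<comment> \<open>One factor 2 comes from the time \<open>2 * k\<close>, the other from the square
    of the norm.\<close>
  have "- ln s / 4 \<le> l"
  proof (rule LIMSEQ_le_const)
    have "strict_mono (\<lambda>k. 2 * Suc k)" by (simp add: strict_mono_def)
    from LIMSEQ_subseq_LIMSEQ[OF l this]
    show "(\<lambda>k. a (2 * Suc k) / real (2 * Suc k)) \<longlonglongrightarrow> l" by (simp add: comp_def)
    have "- ln s / 4 \<le> a (2 * Suc k) / real (2 * Suc k)" for k
      using lower[of "Suc k"] by (simp add: field_simps)
    then show "\<exists>N. \<forall>n\<ge>N. - ln s / 4 \<le> a (2 * Suc n) / real (2 * Suc n)" by blast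
  qed
  moreover have "ln s < 0" using s by simp
  ultimately have "0 < l" by linarith
  moreover have "top_lyapunov_exponent law A l"
    unfolding top_lyapunov_exponent_def using integrable_log_norm l by (simp add: a_def)
  ultimately show ?thesis unfolding hyperbolic_def by blast
qed

end

section \<open>A cone criterion for spreading\<close>

text \<open>From \<open>l^2 \<le> (1 + 1/10) * k^2 + (1 + 10) * (k - l)^2\<close>. The factor 11/10
  has to be close enough to 1 for the final count of masses.\<close>

lemma measure_square_density_le:
  fixes k l :: "'a::euclidean_space \<Rightarrow> real"
  assumes [measurable]: "k \<in> borel_measurable borel" "l \<in> borel_measurable borel" "B \<in> sets borel"
    and fk: "finite_measure (density lborel (\<lambda>v. ennreal ((k v)\<^sup>2)))"
    and fl: "finite_measure (density lborel (\<lambda>v. ennreal ((l v)\<^sup>2)))"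
    and e: "(\<integral>\<^sup>+v. ennreal ((k v - l v)\<^sup>2) \<partial>lborel) \<le> ennreal e" and e0: "0 \<le> e"
  shows "measure (density lborel (\<lambda>v. ennreal ((l v)\<^sup>2))) B
     \<le> 11/10 * measure (density lborel (\<lambda>v. ennreal ((k v)\<^sup>2))) B + 11 * e"
proof -
  let ?K = "density lborel (\<lambda>v. ennreal ((k v)\<^sup>2))" and ?L = "density lborel (\<lambda>v. ennreal ((l v)\<^sup>2))"
  interpret K: finite_measure ?K by fact
  interpret L: finite_measure ?L by fact
  have pt: "ennreal ((l v)\<^sup>2) \<le> ennreal (11/10) * ennreal ((k v)\<^sup>2) + 11 * ennreal ((k v - l v)\<^sup>2)" for v
  proof -
    have "0 \<le> (k v / 10 + (k v - l v))\<^sup>2 * 10" by simp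
    then have "(l v)\<^sup>2 \<le> 11/10 * (k v)\<^sup>2 + 11 * (k v - l v)\<^sup>2"
      by (simp add: power2_eq_square algebra_simps)
    then have "ennreal ((l v)\<^sup>2) \<le> ennreal (11/10 * (k v)\<^sup>2 + 11 * (k v - l v)\<^sup>2)" by (rule ennreal_leI)
    also have "\<dots> = ennreal (11/10) * ennreal ((k v)\<^sup>2) + ennreal 11 * ennreal ((k v - l v)\<^sup>2)"
      by (subst ennreal_plus) (auto simp only: ennreal_mult'' zero_le_power2, simp_all)
    finally show ?thesis by simp
  qed
  have "emeasure ?L B = (\<integral>\<^sup>+v. ennreal ((l v)\<^sup>2) * indicator B v \<partial>lborel)"
    by (rule emeasure_density) auto
  also have "\<dots> \<le> (\<integral>\<^sup>+v. ennreal (11/10) * (ennreal ((k v)\<^sup>2) * indicator B v) + 11 * ennreal ((k v - l v)\<^sup>2) \<partial>lborel)"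
  proof (rule nn_integral_mono)
    fix v show "ennreal ((l v)\<^sup>2) * indicator B v \<le> ennreal (11/10) * (ennreal ((k v)\<^sup>2) * indicator B v) + 11 * ennreal ((k v - l v)\<^sup>2)"
      using pt[of v] by (simp add: indicator_def)
  qed
  also have "\<dots> = ennreal (11/10) * (\<integral>\<^sup>+v. ennreal ((k v)\<^sup>2) * indicator B v \<partial>lborel) + 11 * (\<integral>\<^sup>+v. ennreal ((k v - l v)\<^sup>2) \<partial>lborel)"
    by (subst nn_integral_add) (auto simp: nn_integral_cmult)
  also have "\<dots> \<le> ennreal (11/10) * emeasure ?K B + 11 * ennreal e"
    by (subst emeasure_density) (auto intro!: add_left_mono mult_left_mono e)
  also have "\<dots> = ennreal (11/10 * measure ?K B + 11 * e)"
  proof -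
    have "ennreal (11/10 * measure ?K B + 11 * e) = ennreal (11/10 * measure ?K B) + ennreal (11 * e)"
      using e0 by (intro ennreal_plus) auto
    also have "ennreal (11/10 * measure ?K B) = ennreal (11/10) * ennreal (measure ?K B)"
      by (rule ennreal_mult) auto
    also have "ennreal (11 * e) = 11 * ennreal e" using e0 by (simp add: ennreal_mult)
    finally show ?thesis by (simp add: K.emeasure_eq_measure)
  qed
  finally show ?thesis
    using e0 by (simp add: L.emeasure_eq_measure ennreal_le_iff del: ennreal_plus)
qed

context random_map
begin

text \<open>Markov's inequality on \<open>U\<close>: if \<Phi> were at least \<open>e\<close> almost
  everywhere there, its integral would reach \<open>e * d\<close>.\<close>

lemma ex_small_in_positive_set:
  assumes [measurable]: "\<Phi> \<in> borel_measurable (collision_space L)" and U: "U \<in> sets m" "ennreal d \<le> emeasure m U"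
    and int: "(\<integral>\<^sup>+x. \<Phi> x \<partial>m) < ennreal (e * d)" and "0 < d" "0 < e"
  shows "\<exists>x\<in>U. \<bar>det (A x)\<bar> = 1 \<and> \<Phi> x < ennreal e"
proof (rule ccontr)
  assume no: "\<not> ?thesis"
  have "ennreal (e * d) \<le> ennreal e * emeasure m U"
    using U assms(5,6) by (simp add: ennreal_mult mult_left_mono)
  also have "\<dots> = (\<integral>\<^sup>+x. ennreal e * indicator U x \<partial>m)"
    using U by (simp add: nn_integral_cmult_indicator)
  also have "\<dots> \<le> (\<integral>\<^sup>+x. \<Phi> x \<partial>m)"
  proof (rule nn_integral_mono_AE)
    show "AE x in m. ennreal e * indicator U x \<le> \<Phi> x"
      using det_A by eventually_elim (use no in \<open>auto simp: indicator_def not_less\<close>)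
  qed
  finally show False using int by simp
qed

text \<open>
  If \<open>\<bar>g \<circ> A x\<bar>\<^sup>2\<close> hardly depended on \<open>x\<close>, the mass of \<open>J\<close> would be at most about a third
  for each of the measures involved, because it is carried into three disjoint cones, and then the
  complement of \<open>J\<close> could not be mapped into \<open>J\<close>.
\<close>

lemma spread_of_cones:
  fixes U C C' :: "nat \<Rightarrow> (real^2) set"
  assumes U: "\<And>i. i < 4 \<Longrightarrow> U i \<in> sets m" "\<And>i. i < 4 \<Longrightarrow> 0 < emeasure m (U i)"
    and sets [measurable]: "J \<in> sets borel" "\<And>i. C i \<in> sets borel" "\<And>i. C' i \<in> sets borel"
    and disj: "\<And>i j. i < 3 \<Longrightarrow> j < 3 \<Longrightarrow> i \<noteq> j \<Longrightarrow> C i \<inter> C j = {}" "\<And>i j. i < 3 \<Longrightarrow> j < 3 \<Longrightarrow> i \<noteq> j \<Longrightarrow> C' i \<inter> C' j = {}"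
    and fwd: "\<And>i x v. i < 3 \<Longrightarrow> x \<in> U i \<Longrightarrow> v \<in> J \<Longrightarrow> A x *v v \<in> C i"
    and bwd: "\<And>i x v. i < 3 \<Longrightarrow> x \<in> U i \<Longrightarrow> A x *v v \<in> J \<Longrightarrow> v \<in> C' i"
    and off: "\<And>x v. x \<in> U 3 \<Longrightarrow> v \<notin> J \<Longrightarrow> v \<noteq> 0 \<Longrightarrow> A x *v v \<in> J"
  shows "\<exists>c>0. \<forall>g\<in>borel_measurable borel. \<forall>h\<in>borel_measurable borel.
      (\<integral>\<^sup>+v. ennreal ((g v)\<^sup>2) \<partial>lborel) < \<infinity> \<longrightarrow>
      ennreal c * (\<integral>\<^sup>+v. ennreal ((g v)\<^sup>2) \<partial>lborel)
        \<le> (\<integral>\<^sup>+x. \<integral>\<^sup>+v. ennreal ((g (A x *v v) - h v)\<^sup>2) \<partial>lborel \<partial>m)"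
proof -
  define d where "d = Min ((\<lambda>i. measure m (U i)) ` {..<4::nat})"
  have d0: "0 < d" unfolding d_def
    using U by (subst Min_gr_iff) (auto simp: m.emeasure_eq_measure lessThan_empty_iff)
  have dU: "ennreal d \<le> emeasure m (U i)" if "i < 4" for i
    unfolding d_def m.emeasure_eq_measure using that by (intro ennreal_leI Min_le) auto
  \<comment> \<open>A value small enough that all terms \<open>11 * e\<close> are negligible in the
    linear inequalities at the end.\<close>
  define \<eta> :: real where "\<eta> = 1 / 10000"
  show ?thesis
  proof (intro exI[of _ "\<eta> * d"] conjI ballI impI)
    show "0 < \<eta> * d" using d0 by (simp add: \<eta>_def)
    fix g h :: "real^2 \<Rightarrow> real"
    assume g [measurable]: "g \<in> borel_measurable borel" and h [measurable]: "h \<in> borel_measurable borel"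
      and fin: "(\<integral>\<^sup>+v. ennreal ((g v)\<^sup>2) \<partial>lborel) < \<infinity>"
    define \<Phi> where "\<Phi> x = (\<integral>\<^sup>+v. ennreal ((g (A x *v v) - h v)\<^sup>2) \<partial>lborel)" for x
    have \<Phi>m [measurable]: "\<Phi> \<in> borel_measurable (collision_space L)" unfolding \<Phi>_def by measurable
    show "ennreal (\<eta> * d) * (\<integral>\<^sup>+v. ennreal ((g v)\<^sup>2) \<partial>lborel) \<le> (\<integral>\<^sup>+x. \<integral>\<^sup>+v. ennreal ((g (A x *v v) - h v)\<^sup>2) \<partial>lborel \<partial>m)"
      unfolding \<Phi>_def[symmetric]
    proof (rule ccontr)
      assume lt': "\<not> ennreal (\<eta> * d) * (\<integral>\<^sup>+v. ennreal ((g v)\<^sup>2) \<partial>lborel) \<le> (\<integral>\<^sup>+x. \<Phi> x \<partial>m)"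
      let ?S = "\<integral>\<^sup>+v. ennreal ((g v)\<^sup>2) \<partial>lborel"
      have lt: "(\<integral>\<^sup>+x. \<Phi> x \<partial>m) < ennreal (\<eta> * d) * ?S" using lt' by simp
      obtain s where s: "0 \<le> s" "?S = ennreal s" using fin by (cases ?S) auto
      have "s \<noteq> 0" using lt s by auto
      then have s0: "0 < s" using s by simp
      have lt2: "(\<integral>\<^sup>+x. \<Phi> x \<partial>m) < ennreal ((\<eta> * s) * d)"
        using lt s d0 by (simp add: ennreal_mult[symmetric] \<eta>_def mult_ac)
      have "\<exists>x\<in>U i. \<bar>det (A x)\<bar> = 1 \<and> \<Phi> x < ennreal (\<eta> * s)" if "i < 4" for i
        using that s0 d0 by (intro ex_small_in_positive_set[OF \<Phi>m U(1) dU lt2]) (auto simp: \<eta>_def)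
      then obtain X where X: "\<And>i. i < 4 \<Longrightarrow> X i \<in> U i \<and> \<bar>det (A (X i))\<bar> = 1 \<and> \<Phi> (X i) < ennreal (\<eta> * s)"
        by metis
      \<comment> \<open>\<mu> and \<kappa> have the densities \<open>g^2\<close> and
        \<open>h^2\<close>; \<open>P i\<close>, with the density of \<open>g\<close> composed with
        the matrix at \<open>X i\<close>, is mapped to \<mu> by that matrix. By the choice of
        \<open>X i\<close>, each \<open>P i\<close> is close to \<kappa>.\<close>
      define \<mu> \<kappa> where "\<mu> = density lborel (\<lambda>v. ennreal ((g v)\<^sup>2))" and "\<kappa> = density lborel (\<lambda>v. ennreal ((h v)\<^sup>2))"
      define P where "P i = density lborel (\<lambda>v. ennreal ((g (A (X i) *v v))\<^sup>2))" for i
      define e where "e = \<eta> * s"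
      have e0: "0 \<le> e" using s0 by (simp add: e_def \<eta>_def)
      have \<mu>_space: "emeasure \<mu> (space \<mu>) = ennreal s"
        unfolding \<mu>_def using s by (simp add: emeasure_density)
      then have fin\<mu>: "finite_measure \<mu>" by (intro finite_measureI) auto
      interpret \<mu>: finite_measure \<mu> by (rule fin\<mu>)
      have pull: "emeasure (P i) ((*v) (A (X i)) -` B) = emeasure \<mu> B" if i: "i < 4" and B [measurable]: "B \<in> sets borel" for i B
      proof -
        have [measurable]: "(*v) (A (X i)) -` B \<in> sets borel"
          using measurable_sets[of "(*v) (A (X i))" borel borel B] B by simp
        have "emeasure (P i) ((*v) (A (X i)) -` B) = (\<integral>\<^sup>+v. ennreal ((g (A (X i) *v v))\<^sup>2) * indicator B (A (X i) *v v) \<partial>lborel)"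
          unfolding P_def by (subst emeasure_density) (auto simp: indicator_def intro!: nn_integral_cong)
        also have "\<dots> = (\<integral>\<^sup>+v. ennreal ((g v)\<^sup>2) * indicator B v \<partial>lborel)"
          using X[OF i] nn_integral_det1[of "\<lambda>v. ennreal ((g v)\<^sup>2) * indicator B v" "A (X i)"] by simp
        also have "\<dots> = emeasure \<mu> B" unfolding \<mu>_def by (rule emeasure_density[symmetric]) auto
        finally show ?thesis .
      qed
      have finP: "finite_measure (P i)" if "i < 4" for i
        using pull[OF that, of UNIV] \<mu>_space by (intro finite_measureI) (auto simp: P_def \<mu>_def)
      have pullm: "measure (P i) ((*v) (A (X i)) -` B) = measure \<mu> B" if "i < 4" "B \<in> sets borel" for i B
        using pull[OF that] by (simp add: measure_def)
      have setsP: "sets (P i) = sets borel" "sets \<mu> = sets borel" "sets \<kappa> = sets borel" for i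
        by (simp_all add: P_def \<mu>_def \<kappa>_def)
      have pre: "(*v) (A (X i)) -` B \<in> sets borel" if "B \<in> sets borel" for i B
        using measurable_sets[of "(*v) (A (X i))" borel borel B] that by simp
      have cl: "(\<integral>\<^sup>+v. ennreal ((g (A (X i) *v v) - h v)\<^sup>2) \<partial>lborel) \<le> ennreal e" if "i < 4" for i
        using X[OF that] by (simp add: \<Phi>_def e_def less_imp_le)
      have fin\<kappa>: "finite_measure \<kappa>"
      proof -
        have "emeasure \<kappa> (space \<kappa>) = (\<integral>\<^sup>+v. ennreal ((h v - 0)\<^sup>2) \<partial>lborel)"
          unfolding \<kappa>_def by (simp add: emeasure_density)
        also have "\<dots> \<le> (\<integral>\<^sup>+v. 2 * ennreal ((h v - g (A (X 0) *v v))\<^sup>2) + 2 * ennreal ((g (A (X 0) *v v) - 0)\<^sup>2) \<partial>lborel)"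
          by (intro nn_integral_mono square_le_sum)
        also have "\<dots> = 2 * (\<integral>\<^sup>+v. ennreal ((g (A (X 0) *v v) - h v)\<^sup>2) \<partial>lborel) + 2 * (\<integral>\<^sup>+v. ennreal ((g (A (X 0) *v v))\<^sup>2) \<partial>lborel)"
          by (subst nn_integral_add) (auto simp: nn_integral_cmult power2_commute)
        also have "(\<integral>\<^sup>+v. ennreal ((g (A (X 0) *v v))\<^sup>2) \<partial>lborel) = ennreal s"
          using X[of 0] nn_integral_det1[of "\<lambda>v. ennreal ((g v)\<^sup>2)" "A (X 0)"] s by simp
        also have "2 * (\<integral>\<^sup>+v. ennreal ((g (A (X 0) *v v) - h v)\<^sup>2) \<partial>lborel) + 2 * ennreal s \<le> 2 * ennreal e + 2 * ennreal s"
          by (intro add_right_mono mult_left_mono cl) auto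
        also have "\<dots> < \<infinity>" by (simp add: ennreal_mult_less_top)
        finally show ?thesis by (intro finite_measureI) auto
      qed
      interpret \<kappa>: finite_measure \<kappa> by (rule fin\<kappa>)
      have le1: "measure \<kappa> B \<le> 11/10 * measure (P i) B + 11 * e" if "i < 4" "B \<in> sets borel" for i B
        using measure_square_density_le[of "\<lambda>v. g (A (X i) *v v)" h B e] finP[OF that(1)] fin\<kappa> cl[OF that(1)] e0 that(2)
        unfolding P_def \<kappa>_def by simp
      have le2: "measure (P i) B \<le> 11/10 * measure \<kappa> B + 11 * e" if "i < 4" "B \<in> sets borel" for i B
        using measure_square_density_le[of h "\<lambda>v. g (A (X i) *v v)" B e] finP[OF that(1)] fin\<kappa> cl[OF that(1)] e0 that(2)
        unfolding P_def \<kappa>_def by (simp add: power2_commute)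
      have spc: "space \<mu> = UNIV" "space \<kappa> = UNIV" by (simp_all add: \<mu>_def \<kappa>_def)
      have \<mu>UNIV: "measure \<mu> UNIV = s" using \<mu>_space s0 by (simp add: spc measure_def)
      have sum3: "measure M (D 0) + measure M (D 1) + measure M (D 2) \<le> measure M UNIV"
        if "finite_measure M" "sets M = sets borel" "\<And>i. D i \<in> sets borel"
          "\<And>i j. i < 3 \<Longrightarrow> j < 3 \<Longrightarrow> i \<noteq> j \<Longrightarrow> D i \<inter> D j = {}" for M :: "(real^2) measure" and D :: "nat \<Rightarrow> (real^2) set"
      proof -
        interpret finite_measure M by fact
        have "measure M (D 0 \<union> D 1 \<union> D 2) = measure M (D 0) + measure M (D 1) + measure M (D 2)"
          using that(2,3) that(4)[of 0 1] that(4)[of 0 2] that(4)[of 1 2]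
          by (subst finite_measure_Union finite_measure_Union; auto)+
        then show ?thesis using finite_measure_mono[of "D 0 \<union> D 1 \<union> D 2" UNIV] that(2,3)
          by (metis sets.top sets_eq_imp_space_eq space_borel top_greatest)
      qed
      \<comment> \<open>\<open>J\<close> is carried into \<open>C i\<close>, so \<kappa> of
        \<open>J\<close> hardly exceeds \<mu> of each \<open>C i\<close>. The next two bounds arise
        likewise from \<open>bwd\<close> and \<open>off\<close>.\<close>
      have J\<kappa>: "measure \<kappa> J \<le> 11/10 * measure \<mu> (C i) + 11 * e" if i: "i < 3" for i
      proof -
        interpret Pi: finite_measure "P i" using finP i by simp
        have "measure (P i) J \<le> measure (P i) ((*v) (A (X i)) -` C i)"
          using i X[of i] fwd[OF i] pre[of "C i" i] sets by (intro Pi.finite_measure_mono) (auto simp: setsP)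
        also have "\<dots> = measure \<mu> (C i)" using i by (intro pullm) auto
        finally show ?thesis using le1[of i J] i by auto
      qed
      have J\<mu>: "measure \<mu> J \<le> 11/10 * measure \<kappa> (C' i) + 11 * e" if i: "i < 3" for i
      proof -
        interpret Pi: finite_measure "P i" using finP i by simp
        have "measure \<mu> J = measure (P i) ((*v) (A (X i)) -` J)" using i by (intro pullm[symmetric]) auto
        also have "\<dots> \<le> measure (P i) (C' i)"
          using i X[of i] bwd[OF i] sets by (intro Pi.finite_measure_mono) (auto simp: setsP)
        finally show ?thesis using le2[of i "C' i"] i sets by auto
      qed
      have K\<kappa>: "measure \<kappa> (- J) \<le> 11/10 * measure \<mu> J + 11 * e"
      proof -
        interpret P3: finite_measure "P 3" using finP by simp
        \<comment> \<open>The origin is excluded in \<open>off\<close>, but it carries no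
          mass.\<close>
        have z: "emeasure (P 3) {0} = 0" unfolding P_def by (subst emeasure_density) (auto simp: nn_integral_indicator_singleton')
        have "measure (P 3) (- J) \<le> measure (P 3) ((*v) (A (X 3)) -` J \<union> {0})"
          using X[of 3] off pre[of J 3] sets by (intro P3.finite_measure_mono) (auto simp: setsP)
        also have "\<dots> \<le> measure (P 3) ((*v) (A (X 3)) -` J) + measure (P 3) {0}"
          using pre[of J 3] sets by (intro measure_Un_le) (auto simp: setsP)
        also have "\<dots> = measure \<mu> J" using z pullm[of 3 J] by (simp add: measure_def)
        finally show ?thesis using le1[of 3 "- J"] sets by auto
      qed
      \<comment> \<open>Up to multiples of \<open>e\<close>: summing over three disjoint cones gives
        \<open>J\<close> at most \<open>11/30 * s\<close> of \<kappa>, and at most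
        \<open>11/30\<close> of the total of \<kappa> for \<mu>; so its complement gets at most
        \<open>121/300\<close> of that total. The total is then at most \<open>110/179 * s\<close>,
        whereas closeness to \<open>P 0\<close> forces at least \<open>10/11 * s\<close>.\<close>
      have "measure \<mu> (C 0) + measure \<mu> (C 1) + measure \<mu> (C 2) \<le> s"
        using sum3[OF fin\<mu> setsP(2), of C] disj \<mu>UNIV by auto
      moreover have "measure \<kappa> (C' 0) + measure \<kappa> (C' 1) + measure \<kappa> (C' 2) \<le> measure \<kappa> UNIV"
        using sum3[OF fin\<kappa> setsP(3), of C'] disj by auto
      moreover have "measure \<kappa> UNIV = measure \<kappa> J + measure \<kappa> (- J)"
        using \<kappa>.finite_measure_compl[of J] sets by (simp add: setsP spc Compl_eq_Diff_UNIV)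
      moreover have PU: "measure (P 0) UNIV = s" using pullm[of 0 UNIV] \<mu>UNIV by simp
      moreover have "s \<le> 11/10 * measure \<kappa> UNIV + 11 * e" using le2[of 0 UNIV] PU by simp
      moreover have "measure \<kappa> UNIV \<le> 11/10 * s + 11 * e" using le1[of 0 UNIV] PU by simp
      moreover have "e = s / 10000" by (simp add: e_def \<eta>_def)
      moreover have "measure \<kappa> J \<le> 11/10 * measure \<mu> (C 0) + 11 * e" "measure \<kappa> J \<le> 11/10 * measure \<mu> (C 1) + 11 * e"
        "measure \<kappa> J \<le> 11/10 * measure \<mu> (C 2) + 11 * e" by (rule J\<kappa>; simp)+
      moreover have "measure \<mu> J \<le> 11/10 * measure \<kappa> (C' 0) + 11 * e" "measure \<mu> J \<le> 11/10 * measure \<kappa> (C' 1) + 11 * e"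
        "measure \<mu> J \<le> 11/10 * measure \<kappa> (C' 2) + 11 * e" by (rule J\<mu>; simp)+
      ultimately show False using K\<kappa> s0 by linarith
    qed
  qed
qed

end

section \<open>Arclength and eccentric anomaly on an ellipse\<close>

locale ellipse =
  \<comment> \<open>Normal form: centre \<open>z0\<close>, major axis along the unit vector
    \<open>e\<close>, semi-axes \<open>a\<close> and \<open>b\<close>. Strictness in
    \<open>b_less_a\<close> says that the ellipse is not a circle.\<close>
  fixes a b :: real and z0 e :: complex
  assumes b_pos: "0 < b" and b_less_a: "b < a" and norm_e: "norm e = 1"
begin

lemma a_pos: "0 < a" using b_pos b_less_a by simp

lemma e_nz: "e \<noteq> 0" using norm_e by auto

definition crd :: "complex \<Rightarrow> complex" where "crd p = (p - z0) / e"

text \<open>The quadratic form of the ellipse in the coordinates along its axes. Interior, boundary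
  and hitting times are read off from its values.\<close>

definition lev :: "complex \<Rightarrow> real" where "lev p = (Re (crd p) / a)\<^sup>2 + (Im (crd p) / b)\<^sup>2"

text \<open>Parametrized by the eccentric anomaly rather than by arclength; \<open>spd\<close> is
  the speed of this parametrization.\<close>

definition curve :: "real \<Rightarrow> complex" where "curve t = z0 + e * Complex (a * cos t) (b * sin t)"

definition curve' :: "real \<Rightarrow> complex" where "curve' t = e * Complex (- a * sin t) (b * cos t)"

definition spd :: "real \<Rightarrow> real" where "spd t = sqrt (a\<^sup>2 * (sin t)\<^sup>2 + b\<^sup>2 * (cos t)\<^sup>2)"

definition table :: "complex set" where "table = {p. lev p \<le> 1}"

lemma crd_inverse: "z0 + e * crd p = p"
  using e_nz by (simp add: crd_def)

lemma continuous_lev: "continuous_on UNIV lev"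
  unfolding lev_def crd_def by (intro continuous_intros) (use a_pos b_pos e_nz in auto)

lemma open_lev_less: "open {p. lev p < 1}"
  using open_Collect_less[OF continuous_lev continuous_on_const] .

lemma closed_lev_le: "closed {p. lev p \<le> 1}"
  using closed_Collect_le[OF continuous_lev continuous_on_const] .

lemma interior_table: "interior table = {p. lev p < 1}"
proof
  show "{p. lev p < 1} \<subseteq> interior table"
    by (rule interior_maximal) (auto simp: table_def open_lev_less)
  show "interior table \<subseteq> {p. lev p < 1}"
  proof
    fix p assume p: "p \<in> interior table"
    then have le: "lev p \<le> 1" using interior_subset by (auto simp: table_def)
    have "lev p \<noteq> 1"
    proof
      assume l1: "lev p = 1"
      obtain d where d: "0 < d" "ball p d \<subseteq> table" using p by (auto simp: mem_interior)
      \<comment> \<open>Moving outward along the ray from the centre multiplies \<open>lev\<close>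
        by \<open>(1 + t)^2\<close>, so no boundary point is interior. The step is small enough to
        stay in the ball.\<close>
      define t where "t = d / (2 * (norm (p - z0) + 1))"
      have n0: "0 < norm (p - z0) + 1" using norm_ge_zero[of "p - z0"] by linarith
      then have t0: "0 < t" using d by (simp add: t_def)
      define q where "q = p + of_real t * (p - z0)"
      have "t * norm (p - z0) = d / 2 * (norm (p - z0) / (norm (p - z0) + 1))" by (simp add: t_def)
      also have "\<dots> \<le> d / 2 * 1" using d n0 by (intro mult_left_mono) auto
      finally have "t * norm (p - z0) < d" using d by simp
      then have "q \<in> ball p d" using t0 by (simp add: q_def dist_norm norm_mult)
      then have "lev q \<le> 1" using d by (auto simp: table_def)
      moreover have "crd q = of_real (1 + t) * crd p"
        using e_nz by (simp add: q_def crd_def field_simps)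
      then have "lev q = (1 + t)\<^sup>2 * lev p"
        by (simp add: lev_def power_mult_distrib power_divide distrib_left)
      ultimately have "(1 + t)\<^sup>2 \<le> 1" using l1 by simp
      moreover have "1 < (1 + t)\<^sup>2" using t0 by (simp add: power2_eq_square algebra_simps add_pos_pos)
      ultimately show False by simp
    qed
    with le show "p \<in> {p. lev p < 1}" by simp
  qed
qed

lemma frontier_table: "frontier table = {p. lev p = 1}"
proof -
  have cl: "closure table = table" unfolding table_def by (rule closure_closed[OF closed_lev_le])
  have iff: "p \<in> table - {p. lev p < 1} \<longleftrightarrow> lev p = 1" for p
    unfolding table_def Diff_iff mem_Collect_eq by linarith
  show ?thesis unfolding frontier_def interior_table cl by (rule set_eqI) (simp only: iff mem_Collect_eq)
qed

lemma lev_affine: "lev (z0 + e * Complex x y) = (x / a)\<^sup>2 + (y / b)\<^sup>2"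
  using e_nz by (simp add: lev_def crd_def)

lemma spd_sq: "(spd t)\<^sup>2 = a\<^sup>2 * (sin t)\<^sup>2 + b\<^sup>2 * (cos t)\<^sup>2"
  by (simp add: spd_def add_nonneg_nonneg)

lemma spd_sq_bounds: "b\<^sup>2 \<le> (spd t)\<^sup>2" "(spd t)\<^sup>2 \<le> a\<^sup>2"
proof -
  have ab: "b\<^sup>2 \<le> a\<^sup>2" using b_pos b_less_a by (intro power_mono) auto
  have 1: "(cos t)\<^sup>2 = 1 - (sin t)\<^sup>2" by (simp add: cos_squared_eq)
  have s: "0 \<le> (sin t)\<^sup>2" "(sin t)\<^sup>2 \<le> 1" by (auto simp: abs_square_le_1)
  have e: "(spd t)\<^sup>2 = b\<^sup>2 + (a\<^sup>2 - b\<^sup>2) * (sin t)\<^sup>2" unfolding spd_sq 1 by (simp add: algebra_simps)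
  show "b\<^sup>2 \<le> (spd t)\<^sup>2" unfolding e using ab s by simp
  show "(spd t)\<^sup>2 \<le> a\<^sup>2" unfolding e using mult_left_mono[OF s(2), of "a\<^sup>2 - b\<^sup>2"] ab by simp
qed

lemma spd_ge: "b \<le> spd t" and spd_le: "spd t \<le> a" and spd_pos: "0 < spd t"
proof -
  have n: "0 \<le> spd t" by (simp add: spd_def add_nonneg_nonneg)
  show 1: "b \<le> spd t" using spd_sq_bounds(1) n by (rule power2_le_imp_le)
  show "spd t \<le> a" by (rule power2_le_imp_le[OF spd_sq_bounds(2)]) (use a_pos in simp)
  show "0 < spd t" using 1 b_pos by simp
qed

lemma spd_nz [simp]: "spd t \<noteq> 0" using spd_pos[of t] by simp

lemma norm_curve': "norm (curve' t) = spd t"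
  by (simp add: curve'_def norm_mult norm_e complex_norm spd_def power_mult_distrib)

lemma spd_2pi [simp]: "spd (t + 2 * pi) = spd t"
  by (simp add: spd_def)

lemma spd_pi [simp]: "spd (t + pi) = spd t"
  by (simp add: spd_def)

lemma continuous_spd [continuous_intros]:
  assumes "continuous_on S f" shows "continuous_on S (\<lambda>x. spd (f x))"
proof -
  have "continuous_on UNIV spd" unfolding spd_def[abs_def] by (intro continuous_intros)
  then show ?thesis using assms by (rule continuous_on_compose2) simp
qed

lemma curve_eq_iff: "curve s = curve t \<longleftrightarrow> (\<exists>k::int. s = t + 2 * pi * k)"
proof -
  have "curve s = curve t \<longleftrightarrow> cos s = cos t \<and> sin s = sin t"
    using e_nz a_pos b_pos by (simp add: curve_def)
  also have "\<dots> \<longleftrightarrow> (\<exists>k::int. s = t + 2 * pi * k)"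
    using sin_cos_eq_iff[of s t] by (auto simp: mult.commute mult.left_commute)
  finally show ?thesis .
qed

end

text \<open>
  Squaring \<open>\<bar>w + c\<bar> + \<bar>w - c\<bar> \<le> 2 a\<close> twice gives the equation of the ellipse, with \<open>b\<^sup>2 = a\<^sup>2 - c\<^sup>2\<close>.
\<close>

lemma sum_dist_foci_iff:
  fixes x y a c :: real
  assumes "0 \<le> c" "c < a"
  shows "cmod (Complex (x + c) y) + cmod (Complex (x - c) y) \<le> 2 * a \<longleftrightarrow>
     (x / a)\<^sup>2 + (y / sqrt (a\<^sup>2 - c\<^sup>2))\<^sup>2 \<le> 1"
proof -
  define P Q where "P = cmod (Complex (x + c) y)" and "Q = cmod (Complex (x - c) y)"
  have P: "0 \<le> P" "P\<^sup>2 = (x + c)\<^sup>2 + y\<^sup>2" and Q: "0 \<le> Q" "Q\<^sup>2 = (x - c)\<^sup>2 + y\<^sup>2"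
    by (simp_all add: P_def Q_def cmod_power2)
  define b2 where "b2 = a\<^sup>2 - c\<^sup>2"
  have b2: "0 < b2" using assms by (simp add: b2_def power_strict_mono)
  have a0: "0 < a" using assms by simp
  define R where "R = 2 * a\<^sup>2 - (x\<^sup>2 + y\<^sup>2 + c\<^sup>2)"
  have "P + Q \<le> 2 * a \<longleftrightarrow> (P + Q)\<^sup>2 \<le> (2 * a)\<^sup>2"
    using P(1) Q(1) a0 abs_le_square_iff[of "P + Q" "2 * a"] by simp
  also have "\<dots> \<longleftrightarrow> P * Q \<le> R"
  proof -
    have "(P + Q)\<^sup>2 = P\<^sup>2 + Q\<^sup>2 + 2 * (P * Q)" by (simp add: power2_sum)
    also have "P\<^sup>2 + Q\<^sup>2 = 2 * (x\<^sup>2 + y\<^sup>2 + c\<^sup>2)"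
      unfolding P(2) Q(2) by (simp add: power2_eq_square algebra_simps)
    finally show ?thesis by (simp add: R_def power_mult_distrib) linarith
  qed
  also have "\<dots> \<longleftrightarrow> 0 \<le> R \<and> (P * Q)\<^sup>2 \<le> R\<^sup>2"
  proof -
    have "0 \<le> P * Q" using P(1) Q(1) by simp
    then show ?thesis using power2_le_imp_le[of "P * Q" R] power_mono[of "P * Q" R 2] by auto
  qed
  also have "(P * Q)\<^sup>2 \<le> R\<^sup>2 \<longleftrightarrow> b2 * x\<^sup>2 + a\<^sup>2 * y\<^sup>2 \<le> a\<^sup>2 * b2"
  proof -
    have "(P * Q)\<^sup>2 \<le> R\<^sup>2 \<longleftrightarrow> 0 \<le> R\<^sup>2 - (P * Q)\<^sup>2" by simp
    also have "R\<^sup>2 - (P * Q)\<^sup>2 = 4 * (a\<^sup>2 * b2 - (b2 * x\<^sup>2 + a\<^sup>2 * y\<^sup>2))"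
      unfolding power_mult_distrib P(2) Q(2) R_def b2_def by (simp add: power2_eq_square algebra_simps)
    finally have iff: "(P * Q)\<^sup>2 \<le> R\<^sup>2 \<longleftrightarrow> 0 \<le> 4 * (a\<^sup>2 * b2 - (b2 * x\<^sup>2 + a\<^sup>2 * y\<^sup>2))" .
    have "0 \<le> 4 * r \<longleftrightarrow> 0 \<le> r" for r :: real by linarith
    then show ?thesis unfolding iff by (simp only: diff_ge_0_iff_ge)
  qed
  also have "0 \<le> R \<and> b2 * x\<^sup>2 + a\<^sup>2 * y\<^sup>2 \<le> a\<^sup>2 * b2 \<longleftrightarrow> b2 * x\<^sup>2 + a\<^sup>2 * y\<^sup>2 \<le> a\<^sup>2 * b2"
  proof -
    have "0 \<le> R" if h: "b2 * x\<^sup>2 + a\<^sup>2 * y\<^sup>2 \<le> a\<^sup>2 * b2"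
    proof -
      have "b2 * y\<^sup>2 \<le> a\<^sup>2 * y\<^sup>2" by (intro mult_right_mono) (auto simp: b2_def)
      then have "b2 * (x\<^sup>2 + y\<^sup>2) \<le> b2 * a\<^sup>2" using h by (simp add: algebra_simps)
      then have "x\<^sup>2 + y\<^sup>2 \<le> a\<^sup>2" using b2 by simp
      then show ?thesis using b2 by (simp add: R_def b2_def)
    qed
    then show ?thesis by blast
  qed
  also have "\<dots> \<longleftrightarrow> (x / a)\<^sup>2 + (y / sqrt b2)\<^sup>2 \<le> 1"
    using a0 b2 by (simp add: power_divide field_simps)
  finally show ?thesis by (simp add: P_def Q_def b2_def)
qed

text \<open>The frame is centred between the foci with its first axis along them;
  \<open>f1 \<noteq> f2\<close> gives \<open>b < a\<close>.\<close>

lemma noncircular_ellipseE: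
  assumes "noncircular_ellipse_table D"
  obtains a b z0 e where "ellipse a b e" "D = ellipse.table a b z0 e"
proof -
  obtain f1 f2 d where f: "f1 \<noteq> f2" "dist f1 f2 < d" and D: "D = {p. dist p f1 + dist p f2 \<le> d}"
    using assms by (auto simp: noncircular_ellipse_table_def)
  define c where "c = dist f1 f2 / 2"
  define a where "a = d / 2"
  define b where "b = sqrt (a\<^sup>2 - c\<^sup>2)"
  define z0 where "z0 = (f1 + f2) / 2"
  define e where "e = (f2 - f1) / of_real (dist f1 f2)"
  have c: "0 < c" "c < a" using f by (auto simp: c_def a_def)
  have ne: "norm e = 1" using f by (simp add: e_def norm_divide dist_norm norm_minus_commute)
  have "a\<^sup>2 - c\<^sup>2 > 0" using c by (simp add: power_strict_mono)
  then have b0: "0 < b" by (simp add: b_def)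
  have "b < sqrt (a\<^sup>2)" unfolding b_def by (rule real_sqrt_less_mono) (use c in simp)
  then have ba: "b < a" using c by simp
  interpret ellipse a b z0 e by unfold_locales (fact b0 ba ne)+
  have ec: "e * of_real c = (f2 - f1) / 2" using f by (simp add: e_def c_def)
  have "dist p f1 + dist p f2 \<le> d \<longleftrightarrow> lev p \<le> 1" for p
  proof -
    define w where "w = crd p"
    have p: "p = z0 + e * w" by (simp add: w_def crd_inverse)
    have "p - f1 = e * (w + of_real c)" "p - f2 = e * (w - of_real c)"
      unfolding p distrib_left right_diff_distrib ec by (simp_all add: z0_def field_simps)
    then have "dist p f1 + dist p f2 = cmod (w + of_real c) + cmod (w - of_real c)"
      by (simp add: dist_norm norm_mult ne)
    also have "w + of_real c = Complex (Re w + c) (Im w)" by (simp add: complex_eq_iff)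
    also have "w - of_real c = Complex (Re w - c) (Im w)" by (simp add: complex_eq_iff)
    finally have "dist p f1 + dist p f2 = cmod (Complex (Re w + c) (Im w)) + cmod (Complex (Re w - c) (Im w))" .
    moreover have "d = 2 * a" by (simp add: a_def)
    ultimately show ?thesis
      using sum_dist_foci_iff[of c a "Re w" "Im w"] c
      unfolding lev_def w_def[symmetric] b_def[symmetric] by simp
  qed
  then have "D = table" unfolding D table_def by simp
  then show ?thesis using that ellipse_axioms by blast
qed

context ellipse
begin

text \<open>\<open>\<gamma>\<close> is known only through its axioms, so the eccentric anomaly has
  to be constructed along it. Unit speed and the equation of the ellipse determine the angular speed
  up to sign, the inward normal fixes the sign, and injectivity on one period fixes the winding
  number as 1.\<close>

lemma arclength_lift:
  assumes arc: "arclength_parametrization table \<gamma> L"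
  obtains \<alpha> where "\<And>r. \<gamma> r = curve (\<alpha> r)" "\<And>r. (\<alpha> has_real_derivative 1 / spd (\<alpha> r)) (at r)"
    "\<And>r. \<alpha> (r + L) = \<alpha> r + 2 * pi" "\<And>r. unit_tangent \<gamma> r = curve' (\<alpha> r) / spd (\<alpha> r)"
proof -
  have L: "0 < L" and per: "\<And>r. \<gamma> (r + L) = \<gamma> r" and inj: "inj_on \<gamma> {0..<L}"
    and range: "\<gamma> ` {0..<L} = frontier table" and diff: "\<And>r. \<gamma> differentiable (at r)"
    and unit: "\<And>r. norm (unit_tangent \<gamma> r) = 1"
    and inward: "\<And>r. \<forall>\<^sub>F t in at_right 0. \<gamma> r + t *\<^sub>R unit_normal \<gamma> r \<in> interior table"
    using arc by (auto simp: arclength_parametrization_def)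
  define \<tau> where "\<tau> r = unit_tangent \<gamma> r / e" for r
  have dv: "(\<gamma> has_vector_derivative unit_tangent \<gamma> r) (at r)" for r
    unfolding unit_tangent_def using diff by (simp add: vector_derivative_works)
  define p q where "p r = Re (crd (\<gamma> r)) / a" and "q r = Im (crd (\<gamma> r)) / b" for r
  have dcrd: "((\<lambda>r. crd (\<gamma> r)) has_vector_derivative \<tau> r) (at r)" for r
    unfolding crd_def \<tau>_def
    using has_vector_derivative_divide[OF has_vector_derivative_diff[OF dv has_vector_derivative_const[of z0]], of e]
    by simp
  have dp: "(p has_real_derivative Re (\<tau> r) / a) (at r)" for r
    unfolding p_def[abs_def]
    by (rule DERIV_cdivide) (simp add: has_real_derivative_iff_has_vector_derivative
        bounded_linear.has_vector_derivative[OF bounded_linear_Re dcrd])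
  have dq: "(q has_real_derivative Im (\<tau> r) / b) (at r)" for r
    unfolding q_def[abs_def]
    by (rule DERIV_cdivide) (simp add: has_real_derivative_iff_has_vector_derivative
        bounded_linear.has_vector_derivative[OF bounded_linear_Im dcrd])
  have \<gamma>rmod: "\<gamma> (x + of_int n * L) = \<gamma> x" for x and n :: int
  proof (induction n rule: int_induct[where k = 0])
    case (step1 i)
    have "\<gamma> (x + of_int (i + 1) * L) = \<gamma> ((x + of_int i * L) + L)" by (simp add: algebra_simps)
    with step1 per show ?case by simp
  next
    case (step2 i)
    have "\<gamma> (x + of_int i * L) = \<gamma> ((x + of_int (i - 1) * L) + L)" by (simp add: algebra_simps)
    with step2 per show ?case by simp
  qed simp
  have fr: "\<gamma> r \<in> frontier table" for r
  proof -
    have "r rmod L \<in> {0..<L}" using L rmod_less[of L r] rmod_nonneg[of L r] by auto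
    moreover have "\<gamma> r = \<gamma> (r rmod L)"
      using \<gamma>rmod[of "r rmod L" "\<lfloor>r / L\<rfloor>"] L by (simp add: rmod_def mult.commute)
    ultimately show ?thesis using range imageI[of "r rmod L" "{0..<L}" \<gamma>] by metis
  qed
  have pq: "(p r)\<^sup>2 + (q r)\<^sup>2 = 1" for r
    using fr[of r] unfolding frontier_table by (simp add: lev_def p_def q_def)
  \<comment> \<open>\<open>(p, q)\<close> moves on the unit circle with velocity orthogonal to
    itself; \<open>lam\<close> is its angular speed.\<close>
  define lam where "lam r = Im (\<tau> r) / b * p r - Re (\<tau> r) / a * q r" for r
  have orth: "p r * (Re (\<tau> r) / a) + q r * (Im (\<tau> r) / b) = 0" for r
  proof -
    have "((\<lambda>r. (p r)\<^sup>2 + (q r)\<^sup>2) has_real_derivative 2 * p r * (Re (\<tau> r) / a) + 2 * q r * (Im (\<tau> r) / b)) (at r)"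
      by (rule derivative_eq_intros dp dq refl | simp add: mult_ac)+
    moreover have "((\<lambda>r. (p r)\<^sup>2 + (q r)\<^sup>2) has_real_derivative 0) (at r)"
      unfolding pq by simp
    ultimately have "2 * p r * (Re (\<tau> r) / a) + 2 * q r * (Im (\<tau> r) / b) = 0" by (rule DERIV_unique)
    then show ?thesis by linarith
  qed
  have p': "Re (\<tau> r) / a = - (lam r * q r)" and q': "Im (\<tau> r) / b = lam r * p r" for r
  proof -
    define s t where "s = Re (\<tau> r) / a" and "t = Im (\<tau> r) / b"
    have o: "p r * s + q r * t = 0" using orth[of r] by (simp add: s_def t_def)
    have l: "lam r = t * p r - s * q r" by (simp add: lam_def s_def t_def)
    have "s = s * ((p r)\<^sup>2 + (q r)\<^sup>2)" by (simp add: pq)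
    also have "\<dots> = p r * (p r * s + q r * t) - lam r * q r"
      unfolding l by (simp add: power2_eq_square algebra_simps)
    finally show "s = - (lam r * q r)" using o by simp
    have "t = t * ((p r)\<^sup>2 + (q r)\<^sup>2)" by (simp add: pq)
    also have "\<dots> = q r * (p r * s + q r * t) + lam r * p r"
      unfolding l by (simp add: power2_eq_square algebra_simps)
    finally show "t = lam r * p r" using o by simp
  qed
  have Re\<tau>: "Re (\<tau> r) = - (a * lam r * q r)" and Im\<tau>: "Im (\<tau> r) = b * lam r * p r" for r
    using p'[of r] q'[of r] a_pos b_pos by (simp_all add: field_simps)
  have norm\<tau>: "(Re (\<tau> r))\<^sup>2 + (Im (\<tau> r))\<^sup>2 = 1" for r
    using unit[of r] by (simp add: cmod_power2[symmetric] \<tau>_def norm_divide norm_e)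
  define k where "k r = 1 / sqrt (a\<^sup>2 * (q r)\<^sup>2 + b\<^sup>2 * (p r)\<^sup>2)" for r
  have kpos: "0 < a\<^sup>2 * (q r)\<^sup>2 + b\<^sup>2 * (p r)\<^sup>2" for r
  proof -
    have "0 < b\<^sup>2 * ((p r)\<^sup>2 + (q r)\<^sup>2)" using b_pos by (simp add: pq)
    also have "\<dots> \<le> a\<^sup>2 * (q r)\<^sup>2 + b\<^sup>2 * (p r)\<^sup>2"
    proof -
      have "b\<^sup>2 * (q r)\<^sup>2 \<le> a\<^sup>2 * (q r)\<^sup>2" using b_pos b_less_a by (intro mult_right_mono power_mono) auto
      then show ?thesis by (simp add: distrib_left)
    qed
    finally show ?thesis .
  qed
  have lamsq: "(lam r)\<^sup>2 * (a\<^sup>2 * (q r)\<^sup>2 + b\<^sup>2 * (p r)\<^sup>2) = 1" for r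
    using norm\<tau>[of r] unfolding Re\<tau> Im\<tau> by (simp add: power_mult_distrib algebra_simps)
  \<comment> \<open>If \<open>lam\<close> were negative, a step along the normal would not decrease
    \<open>lev\<close>, although it is assumed to enter the interior.\<close>
  have lamnn: "0 \<le> lam r" for r
  proof (rule ccontr)
    assume neg: "\<not> 0 \<le> lam r"
    have "\<forall>\<^sub>F t in at_right (0::real). 0 < t" by (simp add: eventually_at_right_less)
    with inward[of r] have "\<forall>\<^sub>F t in at_right (0::real). 0 < t \<and> \<gamma> r + t *\<^sub>R unit_normal \<gamma> r \<in> interior table"
      by eventually_elim simp
    then obtain t :: real where t: "0 < t" "\<gamma> r + t *\<^sub>R unit_normal \<gamma> r \<in> interior table"
      using eventually_happens'[OF trivial_limit_at_right_real] by blast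
    have "crd (\<gamma> r + t *\<^sub>R unit_normal \<gamma> r) = crd (\<gamma> r) + of_real t * (\<i> * \<tau> r)"
      using e_nz by (simp add: crd_def \<tau>_def unit_normal_def scaleR_conv_of_real field_simps)
    then have "lev (\<gamma> r + t *\<^sub>R unit_normal \<gamma> r) = (p r - t * Im (\<tau> r) / a)\<^sup>2 + (q r + t * Re (\<tau> r) / b)\<^sup>2"
      by (simp add: lev_def p_def q_def add_divide_distrib diff_divide_distrib)
    also have "\<dots> = (p r)\<^sup>2 + (q r)\<^sup>2 + 2 * t * (q r * (Re (\<tau> r) / b) - p r * (Im (\<tau> r) / a)) + t\<^sup>2 * ((Im (\<tau> r) / a)\<^sup>2 + (Re (\<tau> r) / b)\<^sup>2)"
      by (simp add: power2_eq_square algebra_simps)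
    finally have "1 + 2 * t * (q r * (Re (\<tau> r) / b) - p r * (Im (\<tau> r) / a)) + t\<^sup>2 * ((Im (\<tau> r) / a)\<^sup>2 + (Re (\<tau> r) / b)\<^sup>2) < 1"
      using t(2) unfolding interior_table pq by simp
    moreover have "0 \<le> t\<^sup>2 * ((Im (\<tau> r) / a)\<^sup>2 + (Re (\<tau> r) / b)\<^sup>2)" by simp
    ultimately have "2 * t * (q r * (Re (\<tau> r) / b) - p r * (Im (\<tau> r) / a)) < 0" by linarith
    then have "q r * (Re (\<tau> r) / b) - p r * (Im (\<tau> r) / a) < 0"
      using t(1) by (simp add: mult_less_0_iff)
    moreover have "q r * (Re (\<tau> r) / b) - p r * (Im (\<tau> r) / a) = - lam r * (a / b * (q r)\<^sup>2 + b / a * (p r)\<^sup>2)"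
      unfolding Re\<tau> Im\<tau> by (simp add: power2_eq_square algebra_simps)
    moreover have "0 \<le> - lam r * (a / b * (q r)\<^sup>2 + b / a * (p r)\<^sup>2)"
      using neg a_pos b_pos by (intro mult_nonneg_nonneg add_nonneg_nonneg) auto
    ultimately show False by linarith
  qed
  have lamk: "lam r = k r" for r
  proof -
    have "(lam r)\<^sup>2 = (k r)\<^sup>2" using lamsq[of r] kpos[of r] by (simp add: k_def power_divide field_simps)
    moreover have "0 \<le> k r" using kpos[of r] by (simp add: k_def)
    ultimately show ?thesis using lamnn[of r] by (simp add: power2_eq_iff_nonneg)
  qed
  have ck: "isCont k r" for r
    unfolding k_def using kpos[of r]
    by (intro continuous_intros DERIV_isCont[OF dp] DERIV_isCont[OF dq]) auto
  \<comment> \<open>The lift is obtained by integrating the angular speed from a starting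
    angle.\<close>
  obtain K where K: "\<And>r. (K has_vector_derivative k r) (at r)"
    using einterval_antiderivative[of "-\<infinity>" \<infinity> k] ck by auto
  obtain \<alpha>0 where \<alpha>0: "p 0 = cos \<alpha>0" "q 0 = sin \<alpha>0"
    using sincos_total_2pi[OF pq[of 0]] by blast
  define \<alpha> where "\<alpha> r = K r - K 0 + \<alpha>0" for r
  have d\<alpha>k: "(\<alpha> has_real_derivative k r) (at r)" for r
    unfolding \<alpha>_def[abs_def] using K[of r]
    by (auto intro!: derivative_eq_intros simp: has_real_derivative_iff_has_vector_derivative[symmetric])
  have dp': "(p has_real_derivative - (k r * q r)) (at r)" and dq': "(q has_real_derivative k r * p r) (at r)" for r
    using dp[of r] dq[of r] p'[of r] q'[of r] by (simp_all add: lamk)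
  \<comment> \<open>\<open>X\<close> and \<open>Y\<close> are the cosine and sine of the difference
    between the angle of \<open>(p, q)\<close> and \<open>\<alpha>\<close>; their derivatives
    vanish.\<close>
  define X where "X r = p r * cos (\<alpha> r) + q r * sin (\<alpha> r)" for r
  define Y where "Y r = q r * cos (\<alpha> r) - p r * sin (\<alpha> r)" for r
  have "(X has_real_derivative 0) (at r)" "(Y has_real_derivative 0) (at r)" for r
    unfolding X_def[abs_def] Y_def[abs_def]
    by (rule derivative_eq_intros dp' dq' d\<alpha>k refl | simp add: algebra_simps)+
  then have XY: "X r = 1" "Y r = 0" for r
    using DERIV_isconst_all[of X r 0] DERIV_isconst_all[of Y r 0] \<alpha>0 pq[of 0]
    by (auto simp: X_def Y_def \<alpha>_def power2_eq_square)
  have pc: "p r = cos (\<alpha> r)" and qs: "q r = sin (\<alpha> r)" for r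
  proof -
    have "p r * ((cos (\<alpha> r))\<^sup>2 + (sin (\<alpha> r))\<^sup>2) = X r * cos (\<alpha> r) - Y r * sin (\<alpha> r)"
      unfolding X_def Y_def by algebra
    then show "p r = cos (\<alpha> r)" by (simp add: XY)
    have "q r * ((cos (\<alpha> r))\<^sup>2 + (sin (\<alpha> r))\<^sup>2) = X r * sin (\<alpha> r) + Y r * cos (\<alpha> r)"
      unfolding X_def Y_def by algebra
    then show "q r = sin (\<alpha> r)" by (simp add: XY)
  qed
  have k_spd: "k r = 1 / spd (\<alpha> r)" for r by (simp add: k_def spd_def pc qs)
  have \<gamma>_curve: "\<gamma> r = curve (\<alpha> r)" for r
  proof -
    have "Complex (a * cos (\<alpha> r)) (b * sin (\<alpha> r)) = crd (\<gamma> r)"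
      using pc[of r] qs[of r] a_pos b_pos by (simp add: p_def q_def complex_eq_iff field_simps)
    then show ?thesis by (simp add: curve_def crd_inverse)
  qed
  have d\<alpha>: "(\<alpha> has_real_derivative 1 / spd (\<alpha> r)) (at r)" for r using d\<alpha>k[of r] by (simp add: k_spd)
  have tan: "unit_tangent \<gamma> r = curve' (\<alpha> r) / spd (\<alpha> r)" for r
  proof -
    have "\<tau> r = Complex (- a * sin (\<alpha> r)) (b * cos (\<alpha> r)) / spd (\<alpha> r)"
      by (simp add: complex_eq_iff Re\<tau> Im\<tau> lamk k_spd pc qs)
    then show ?thesis using e_nz by (simp add: \<tau>_def curve'_def field_simps)
  qed
  have mono: "\<alpha> x < \<alpha> y" if "x < y" for x y
    using that by (rule DERIV_pos_imp_increasing) (use d\<alpha> spd_pos in fastforce)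
  have cont: "continuous_on S \<alpha>" for S
    by (rule DERIV_continuous_on) (rule has_field_derivative_at_within[OF d\<alpha>])
  have "\<exists>j::int. \<alpha> (r + L) = \<alpha> r + 2 * pi * j" for r
    using per[of r] unfolding \<gamma>_curve curve_eq_iff .
  then obtain j :: "real \<Rightarrow> int" where j: "\<And>r. \<alpha> (r + L) = \<alpha> r + 2 * pi * j r" by metis
  have spd_j: "spd (\<alpha> (r + L)) = spd (\<alpha> r)" for r
  proof -
    have "cos (\<alpha> (r + L)) = p r" "sin (\<alpha> (r + L)) = q r"
      unfolding pc[symmetric] qs[symmetric] by (simp_all add: p_def q_def per)
    then show ?thesis by (simp add: spd_def pc qs)
  qed
  have "((\<lambda>r. \<alpha> (r + L) - \<alpha> r) has_real_derivative 0) (at r)" for r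
    using DERIV_diff[OF DERIV_chain2[OF d\<alpha>[of "r + L"] DERIV_add[OF DERIV_ident DERIV_const]] d\<alpha>[of r]]
    by (simp add: spd_j)
  then have const: "\<alpha> (r + L) - \<alpha> r = \<alpha> (0 + L) - \<alpha> 0" for r
    using DERIV_isconst_all[of "\<lambda>r. \<alpha> (r + L) - \<alpha> r" r 0] by blast
  have "j 0 = 1"
  proof -
    have "0 < 2 * pi * j 0" using j[of 0] mono[OF L] by simp
    then have "0 < j 0" by (simp add: zero_less_mult_iff)
    \<comment> \<open>With winding number at least 2 the lift would reach
      \<open>\<alpha> 0 + 2 * pi\<close> strictly inside the period and repeat the point
      \<open>\<gamma> 0\<close>.\<close>
    moreover have "\<not> 2 \<le> j 0"
    proof
      assume "2 \<le> j 0"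
      then have "2 * pi * 1 < 2 * pi * real_of_int (j 0)" by (intro mult_strict_left_mono) auto
      then have lt: "\<alpha> 0 + 2 * pi < \<alpha> L" using j[of 0] by simp
      have "\<exists>r\<ge>0. r \<le> L \<and> \<alpha> r = \<alpha> 0 + 2 * pi"
        using lt L by (intro IVT' cont) auto
      then obtain r where r: "0 \<le> r" "r \<le> L" "\<alpha> r = \<alpha> 0 + 2 * pi" by blast
      have "r \<noteq> 0" "r \<noteq> L" using r lt by auto
      moreover have "\<gamma> r = \<gamma> 0" unfolding \<gamma>_curve curve_eq_iff using r by (intro exI[of _ 1]) simp
      ultimately show False using inj r L by (auto dest!: inj_onD[where x = r and y = 0])
    qed
    ultimately show ?thesis by simp
  qed
  then have per\<alpha>: "\<alpha> (r + L) = \<alpha> r + 2 * pi" for r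
    using const[of r] j[of 0] by simp
  show ?thesis using that \<gamma>_curve d\<alpha> per\<alpha> tan by blast
qed

end

section \<open>The billiard map of an ellipse\<close>

context ellipse
begin

definition dir :: "real \<Rightarrow> complex" where "dir t = curve' t / spd t"

text \<open>The cosine of the angle between the tangents at \<open>x\<close> and \<open>y\<close>,
  see \<open>dir_inner\<close>. For a chord parallel to the tangent at \<open>y\<close> it is the
  coordinate \<open>s\<close> at an end \<open>x\<close>.\<close>

definition Tg :: "real \<Rightarrow> real \<Rightarrow> real" where
  "Tg x y = (a\<^sup>2 * sin x * sin y + b\<^sup>2 * cos x * cos y) / (spd x * spd y)"

text \<open>
  With \<open>t\<close> the eccentric anomaly of the base point, the chord leaving at tangential velocity \<open>s\<close> is
  parallel to the tangent at \<open>t + half_chord t s\<close> and ends at \<open>t + 2 * half_chord t s\<close>.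
\<close>

definition chord_cot :: "real \<Rightarrow> real \<Rightarrow> real" where
  "chord_cot t s = (a * b * s / sqrt (1 - s\<^sup>2) - (a\<^sup>2 - b\<^sup>2) * sin t * cos t) / (spd t)\<^sup>2"

text \<open>\<open>pi / 2 - arctan\<close> is the branch of the inverse cotangent with values in (0,
  pi), as befits half of a parameter increment between 0 and \<open>2 * pi\<close>.\<close>

definition half_chord :: "real \<Rightarrow> real \<Rightarrow> real" where
  "half_chord t s = pi / 2 - arctan (chord_cot t s)"

lemma norm_dir: "norm (dir t) = 1"
  using spd_pos[of t] by (simp add: dir_def norm_divide norm_curve')

lemma inner_mult_e: "(e * x) \<bullet> (e * y) = x \<bullet> y"
proof -
  have "(e * x) \<bullet> (e * y) = ((Re e)\<^sup>2 + (Im e)\<^sup>2) * (x \<bullet> y)"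
    by (simp add: inner_complex_def power2_eq_square algebra_simps)
  also have "(Re e)\<^sup>2 + (Im e)\<^sup>2 = 1" using norm_e by (simp add: cmod_power2[symmetric])
  finally show ?thesis by simp
qed

lemma dir_eq: "dir t = e * Complex (- a * sin t / spd t) (b * cos t / spd t)"
proof -
  have "Complex (- a * sin t) (b * cos t) / spd t = Complex (- a * sin t / spd t) (b * cos t / spd t)"
    by (simp add: complex_eq_iff)
  then show ?thesis unfolding dir_def curve'_def times_divide_eq_right[symmetric] by (rule arg_cong)
qed

lemma dir_inner: "dir x \<bullet> dir y = Tg x y"
  unfolding dir_eq inner_mult_e by (simp add: Tg_def inner_complex_def power2_eq_square add_divide_distrib mult_ac)

lemma half_chord_bounds: "0 < half_chord t s" "half_chord t s < pi"
  using arctan_bounded[of "chord_cot t s"] by (auto simp: half_chord_def)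

lemma sin_half_chord_pos: "0 < sin (half_chord t s)"
  by (rule sin_gt_zero) (rule half_chord_bounds)+

lemma cos_half_chord: "cos (half_chord t s) = chord_cot t s * sin (half_chord t s)"
proof -
  have "cos (half_chord t s) = sin (arctan (chord_cot t s))" "sin (half_chord t s) = cos (arctan (chord_cot t s))"
    by (simp_all add: half_chord_def cos_diff sin_diff)
  moreover have "cos (arctan (chord_cot t s)) \<noteq> 0" by (rule cos_arctan_not_zero)
  ultimately show ?thesis using tan_arctan[of "chord_cot t s"] by (simp add: tan_def field_simps)
qed

lemma Tg_add: "Tg t (t + d) * spd (t + d) * spd t = (spd t)\<^sup>2 * cos d + (a\<^sup>2 - b\<^sup>2) * sin t * cos t * sin d"
proof -
  have "Tg t (t + d) * spd (t + d) * spd t = a\<^sup>2 * sin t * sin (t + d) + b\<^sup>2 * cos t * cos (t + d)"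
    by (simp add: Tg_def)
  also have "\<dots> = (spd t)\<^sup>2 * cos d + (a\<^sup>2 - b\<^sup>2) * sin t * cos t * sin d"
    unfolding spd_sq by (simp add: sin_add cos_add power2_eq_square algebra_simps)
  finally show ?thesis .
qed

text \<open>Lagrange's identity for two unit tangents: the squares of inner product and cross
  product add up to 1, and the cross product is a multiple of the sine of the parameter
  difference.\<close>

lemma Tg_sq: "(Tg x y)\<^sup>2 + (a * b * sin (y - x) / (spd x * spd y))\<^sup>2 = 1"
proof -
  have "(a\<^sup>2 * sin x * sin y + b\<^sup>2 * cos x * cos y)\<^sup>2 + (a * b * sin (y - x))\<^sup>2
      = (a\<^sup>2 * (sin x)\<^sup>2 + b\<^sup>2 * (cos x)\<^sup>2) * (a\<^sup>2 * (sin y)\<^sup>2 + b\<^sup>2 * (cos y)\<^sup>2)"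
    unfolding sin_diff by algebra
  also have "\<dots> = (spd x * spd y)\<^sup>2" by (simp add: spd_sq power_mult_distrib)
  finally show ?thesis
    by (simp add: Tg_def power_divide add_divide_distrib[symmetric])
qed

lemma sqrt_1_minus_Tg:
  assumes "0 \<le> sin d"
  shows "sqrt (1 - (Tg t (t + d))\<^sup>2) = a * b * sin d / (spd t * spd (t + d))"
proof -
  have "1 - (Tg t (t + d))\<^sup>2 = (a * b * sin d / (spd t * spd (t + d)))\<^sup>2"
    using Tg_sq[of t "t + d"] by simp
  moreover have "0 \<le> a * b * sin d / (spd t * spd (t + d))"
    using assms a_pos b_pos spd_pos[of t] spd_pos[of "t + d"] by simp
  ultimately show ?thesis by (simp only: real_sqrt_abs abs_of_nonneg)
qed

text \<open>By the definition of \<open>chord_cot\<close>, \<open>(S, r)\<close> and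
  \<open>(s, q)\<close> are proportional. Both are unit vectors with positive second entry, so they
  are equal.\<close>

lemma Tg_half_chord:
  assumes s: "\<bar>s\<bar> < 1" shows "Tg t (t + half_chord t s) = s"
proof -
  define d where "d = half_chord t s"
  define S where "S = Tg t (t + d)"
  have sd: "0 < sin d" unfolding d_def by (rule sin_half_chord_pos)
  have s2: "0 < 1 - s\<^sup>2" using s by (simp add: abs_square_less_1)
  define q where "q = sqrt (1 - s\<^sup>2)"
  have q: "0 < q" "q\<^sup>2 = 1 - s\<^sup>2" using s2 by (auto simp: q_def)
  define r where "r = a * b * sin d / (spd t * spd (t + d))"
  have r: "0 < r" using sd a_pos b_pos spd_pos[of t] spd_pos[of "t + d"] by (simp add: r_def)
  have "(spd t)\<^sup>2 * cos d + (a\<^sup>2 - b\<^sup>2) * sin t * cos t * sin d = (a * b * s / q) * sin d"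
    using cos_half_chord[of t s] unfolding d_def[symmetric] chord_cot_def q_def[symmetric]
    by (simp add: field_simps)
  then have "S * (spd (t + d) * spd t) = s / q * (a * b * sin d)"
    using Tg_add[of t d] by (simp add: S_def mult.assoc)
  then have "S = s / q * (a * b * sin d) / (spd (t + d) * spd t)"
    by (subst nonzero_eq_divide_eq) (simp_all only: mult_eq_0_iff spd_nz, simp_all)
  then have Sr: "S = s / q * r" by (simp add: r_def mult.commute)
  have "S\<^sup>2 + r\<^sup>2 = 1" using Tg_sq[of t "t + d"] by (simp add: S_def r_def)
  then have "r\<^sup>2 * (s\<^sup>2 + q\<^sup>2) = q\<^sup>2"
    unfolding Sr using q(1) by (simp add: power_mult_distrib power_divide field_simps)
  then have "r\<^sup>2 = q\<^sup>2" by (simp add: q(2))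
  then have "r = q" using r q(1) by (simp add: power2_eq_iff_nonneg)
  then show ?thesis using Sr q by (simp add: S_def d_def)
qed

text \<open>Together with \<open>Tg_half_chord\<close> this makes \<open>d\<close> in (0, pi) a
  coordinate equivalent to \<open>s\<close> in (-1, 1) for fixed \<open>t\<close>.\<close>

lemma half_chord_Tg:
  assumes d: "0 < d" "d < pi" shows "half_chord t (Tg t (t + d)) = d"
proof -
  have sd: "0 < sin d" using d by (rule sin_gt_zero)
  let ?S = "Tg t (t + d)"
  have "a * b * ?S / sqrt (1 - ?S\<^sup>2) = ?S * spd (t + d) * spd t / sin d"
    unfolding sqrt_1_minus_Tg[OF less_imp_le[OF sd]] using sd a_pos b_pos by (simp add: field_simps)
  also have "\<dots> = (spd t)\<^sup>2 * (cos d / sin d) + (a\<^sup>2 - b\<^sup>2) * sin t * cos t"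
    using sd unfolding Tg_add by (simp add: field_simps)
  finally have "chord_cot t ?S = cos d / sin d" by (simp add: chord_cot_def)
  also have "\<dots> = tan (pi / 2 - d)" by (simp add: tan_def sin_diff cos_diff)
  finally show ?thesis using d by (simp add: half_chord_def arctan_tan)
qed

lemma abs_Tg_less_1:
  assumes "sin d \<noteq> 0" shows "\<bar>Tg t (t + d)\<bar> < 1"
proof -
  have "(a * b * sin d / (spd t * spd (t + d)))\<^sup>2 > 0"
    using assms a_pos b_pos by simp
  then have "(Tg t (t + d))\<^sup>2 < 1" using Tg_sq[of t "t + d"] unfolding add_diff_cancel_left' by linarith
  then show ?thesis by (simp add: abs_square_less_1)
qed

text \<open>The right side is the outgoing velocity, a rotation of the tangent at the base. The
  product of one tangent with the conjugate of the other identifies it as the tangent at the middle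
  parameter.\<close>

lemma dir_half_chord:
  assumes s: "\<bar>s\<bar> < 1"
  shows "dir (t + half_chord t s) = Complex s (sqrt (1 - s\<^sup>2)) * dir t"
proof -
  define d where "d = half_chord t s"
  have S: "Tg t (t + d) = s" using Tg_half_chord[OF s] by (simp add: d_def)
  have sd: "0 < sin d" unfolding d_def by (rule sin_half_chord_pos)
  have q: "sqrt (1 - s\<^sup>2) = a * b * sin d / (spd t * spd (t + d))"
    using sqrt_1_minus_Tg[of d t] sd by (simp add: S)
  define u v where "u = Complex (- a * sin t) (b * cos t)" and "v = Complex (- a * sin (t + d)) (b * cos (t + d))"
  have "v * cnj u = Complex (s * (spd t * spd (t + d))) (a * b * sin d)"
  proof -
    have 1: "a\<^sup>2 * sin t * sin (t + d) + b\<^sup>2 * cos t * cos (t + d) = s * (spd t * spd (t + d))"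
      using S[unfolded Tg_def] by (simp add: field_simps)
    have 2: "sin (t + d) * cos t - cos (t + d) * sin t = sin d"
      using sin_diff[of "t + d" t] by simp
    have "Re (v * cnj u) = a\<^sup>2 * sin t * sin (t + d) + b\<^sup>2 * cos t * cos (t + d)"
      by (simp add: u_def v_def power2_eq_square)
    moreover have "Im (v * cnj u) = a * b * (sin (t + d) * cos t - cos (t + d) * sin t)"
      by (simp add: u_def v_def algebra_simps)
    ultimately show ?thesis unfolding 1 2 by (simp add: complex_eq_iff)
  qed
  moreover have "cnj u * u = (spd t)\<^sup>2"
    by (simp add: complex_eq_iff u_def spd_sq) (simp add: power2_eq_square)
  moreover have "Complex (s * (spd t * spd (t + d))) (a * b * sin d) = Complex s (sqrt (1 - s\<^sup>2)) * of_real (spd t * spd (t + d))"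
    unfolding q by (simp add: complex_eq_iff)
  ultimately have "v * (spd t)\<^sup>2 = Complex s (sqrt (1 - s\<^sup>2)) * of_real (spd t * spd (t + d)) * u"
    by (metis mult.assoc)
  then have "v * spd t = Complex s (sqrt (1 - s\<^sup>2)) * u * spd (t + d)"
    using spd_nz[of t] by (simp add: power2_eq_square mult_ac)
  then have "e * v / spd (t + d) = Complex s (sqrt (1 - s\<^sup>2)) * (e * u / spd t)"
    by (simp add: field_simps)
  then show ?thesis by (simp add: dir_def curve'_def u_def v_def d_def)
qed

text \<open>On a line through a boundary point \<open>lev\<close> is quadratic: one root of
  \<open>lev = 1\<close> is 0, the other is \<open>2 * sin (m - t) * spd m\<close>, the signed
  length of the chord.\<close>

lemma lev_chord:
  "lev (curve t + \<tau> *\<^sub>R dir m) = 1 + (\<tau> / spd m) * (\<tau> / spd m - 2 * sin (m - t))"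
proof -
  define u where "u = \<tau> / spd m"
  have "curve t + \<tau> *\<^sub>R dir m = z0 + e * Complex (a * (cos t - u * sin m)) (b * (sin t + u * cos m))"
    by (simp add: curve_def dir_def curve'_def u_def complex_eq_iff field_simps)
  then have "lev (curve t + \<tau> *\<^sub>R dir m) = (cos t - u * sin m)\<^sup>2 + (sin t + u * cos m)\<^sup>2"
    using a_pos b_pos by (simp add: lev_affine)
  also have "\<dots> = ((cos t)\<^sup>2 + (sin t)\<^sup>2) + u\<^sup>2 * ((sin m)\<^sup>2 + (cos m)\<^sup>2) - 2 * u * (sin m * cos t - cos m * sin t)"
    by (simp add: power2_sum power2_diff power_mult_distrib algebra_simps del: sin_cos_squared_add sin_cos_squared_add2)
  also have "\<dots> = 1 + u * (u - 2 * sin (m - t))"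
    by (simp add: sin_diff power2_eq_square algebra_simps)
  finally show ?thesis by (simp add: u_def)
qed

lemma curve_chord: "curve t + (2 * sin d * spd (t + d)) *\<^sub>R dir (t + d) = curve (t + 2 * d)"
proof -
  have c: "cos (t + 2 * d) = cos t - 2 * sin d * sin (t + d)" and s: "sin (t + 2 * d) = sin t + 2 * sin d * cos (t + d)"
  proof -
    have e: "(t + d) + d = t + 2 * d" "(t + d) - d = t" by simp_all
    have "cos (x - d) - cos (x + d) = 2 * sin d * sin x" "sin (x + d) - sin (x - d) = 2 * sin d * cos x" for x
      by (simp_all add: cos_diff cos_add sin_diff sin_add)
    from this[of "t + d"] show "cos (t + 2 * d) = cos t - 2 * sin d * sin (t + d)"
      "sin (t + 2 * d) = sin t + 2 * sin d * cos (t + d)" unfolding e by linarith+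
  qed
  have "(2 * sin d * spd (t + d)) *\<^sub>R dir (t + d) = of_real (2 * sin d) * curve' (t + d)"
    by (simp add: dir_def scaleR_conv_of_real)
  then show ?thesis unfolding curve_def c s curve'_def
    by (simp add: complex_eq_iff algebra_simps)
qed

end

section \<open>The billiard map in terms of the eccentric anomaly\<close>

locale ellipse_billiard = ellipse +
  fixes \<gamma> :: "real \<Rightarrow> complex" and L :: real and \<alpha> :: "real \<Rightarrow> real"
  assumes L_pos: "0 < L"
    and \<gamma>_curve: "\<And>r. \<gamma> r = curve (\<alpha> r)"
    and deriv_\<alpha>: "\<And>r. (\<alpha> has_real_derivative 1 / spd (\<alpha> r)) (at r)"
    and \<alpha>_period: "\<And>r. \<alpha> (r + L) = \<alpha> r + 2 * pi"
    and tangent: "\<And>r. unit_tangent \<gamma> r = dir (\<alpha> r)"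
begin

lemma \<alpha>_less: "x < y \<Longrightarrow> \<alpha> x < \<alpha> y"
  by (rule DERIV_pos_imp_increasing[where f = \<alpha>]) (use deriv_\<alpha> spd_pos in fastforce)+

lemma continuous_\<alpha>: "continuous_on S \<alpha>"
  by (rule DERIV_continuous_on) (rule has_field_derivative_at_within[OF deriv_\<alpha>])

lemma \<alpha>_period_int: "\<alpha> (r + of_int n * L) = \<alpha> r + 2 * pi * of_int n"
proof (induction n rule: int_induct[where k = 0])
  case (step1 i)
  have h: "r + of_int (i + 1) * L = (r + of_int i * L) + L" by (simp add: algebra_simps)
  show ?case unfolding h \<alpha>_period step1(2) by (simp add: algebra_simps)
next
  case (step2 i)
  have h: "r + of_int i * L = (r + of_int (i - 1) * L) + L" by (simp add: algebra_simps)
  have "\<alpha> (r + of_int i * L) = \<alpha> (r + of_int (i - 1) * L) + 2 * pi" unfolding h by (rule \<alpha>_period)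
  with step2(2) have "\<alpha> (r + of_int (i - 1) * L) = \<alpha> r + 2 * pi * of_int i - 2 * pi" by linarith
  then show ?case by (simp add: right_diff_distrib)
qed simp

lemma inj_\<alpha>: "inj \<alpha>"
  using \<alpha>_less by (intro linorder_injI) (metis less_irrefl)

lemma surj_\<alpha>: "surj \<alpha>"
proof -
  have "\<exists>r. \<alpha> r = y" for y
  proof -
    define n where "n = \<lceil>\<bar>y - \<alpha> 0\<bar> / (2 * pi)\<rceil>"
    have c: "\<bar>y - \<alpha> 0\<bar> / (2 * pi) \<le> of_int n" unfolding n_def by (rule le_of_int_ceiling)
    then have "\<bar>y - \<alpha> 0\<bar> \<le> of_int n * (2 * pi)" by (subst (asm) pos_divide_le_eq) auto
    then have n: "\<bar>y - \<alpha> 0\<bar> \<le> 2 * pi * of_int n" by (simp only: mult.commute)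
    have "0 \<le> \<bar>y - \<alpha> 0\<bar> / (2 * pi)" by simp
    with c have "0 \<le> real_of_int n" by linarith
    then have "0 \<le> n" by simp
    then have n0: "0 \<le> of_int n * L" using L_pos by simp
    have "\<exists>r\<ge>of_int (- n) * L. r \<le> of_int n * L \<and> \<alpha> r = y"
      using \<alpha>_period_int[of 0 n] \<alpha>_period_int[of 0 "- n"] n n0 by (intro IVT' continuous_\<alpha>) auto
    then show ?thesis by blast
  qed
  then show ?thesis by (metis surjI)
qed

text \<open>Arclength as a function of the eccentric anomaly, both unrolled to the real
  line.\<close>

definition rinv :: "real \<Rightarrow> real" where "rinv = inv \<alpha>"

lemma \<alpha>_rinv [simp]: "\<alpha> (rinv t) = t" and rinv_\<alpha> [simp]: "rinv (\<alpha> r) = r"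
  using surj_\<alpha> inj_\<alpha> by (simp_all add: rinv_def surj_f_inv_f)

lemma rinv_period_int: "rinv (t + 2 * pi * of_int n) = rinv t + of_int n * L"
  using \<alpha>_period_int[of "rinv t" n] by (metis \<alpha>_rinv rinv_\<alpha>)

lemma deriv_rinv: "(rinv has_real_derivative spd t) (at t)"
proof -
  have c: "isCont rinv t"
  proof -
    have "isCont rinv (\<alpha> (rinv t))"
      by (rule isCont_inverse_function[where d = 1]) (use DERIV_isCont[OF deriv_\<alpha>] in auto)
    then show ?thesis by simp
  qed
  have "(rinv has_real_derivative inverse (1 / spd t)) (at t)"
    by (rule DERIV_inverse_function[where f = \<alpha> and a = "t - 1" and b = "t + 1"])
       (use deriv_\<alpha>[of "rinv t"] c spd_pos[of t] in auto)
  then show ?thesis by simp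
qed

lemma rmod_eq_shift: "\<exists>n::int. x rmod L = x + of_int n * L"
  using L_pos by (intro exI[of _ "- \<lfloor>x / L\<rfloor>"]) (simp add: rmod_def mult.commute)

lemma \<alpha>_rmod: "\<exists>n::int. \<alpha> (x rmod L) = \<alpha> x + 2 * pi * of_int n"
  using rmod_eq_shift[of x] \<alpha>_period_int by metis

lemma the_parameter: "(THE r1. r1 \<in> {0..<L} \<and> \<gamma> r1 = curve t) = rinv t rmod L"
proof (rule the_equality)
  obtain n :: int where n: "\<alpha> (rinv t rmod L) = t + 2 * pi * of_int n" using \<alpha>_rmod[of "rinv t"] by auto
  have "\<gamma> (rinv t rmod L) = curve t" unfolding \<gamma>_curve curve_eq_iff using n by blast
  then show "rinv t rmod L \<in> {0..<L} \<and> \<gamma> (rinv t rmod L) = curve t"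
    using L_pos rmod_less[of L "rinv t"] rmod_nonneg[of L "rinv t"] by auto
  fix r1 assume r1: "r1 \<in> {0..<L} \<and> \<gamma> r1 = curve t"
  then obtain k :: int where "\<alpha> r1 = t + 2 * pi * of_int k" by (auto simp: \<gamma>_curve curve_eq_iff)
  then have "r1 = rinv t + of_int k * L" by (metis rinv_\<alpha> rinv_period_int)
  then show "r1 = rinv t rmod L"
    using r1 L_pos by (intro rmod_unique[symmetric, where n = "- k"]) auto
qed

lemma unit_normal_eq: "unit_normal \<gamma> r = \<i> * dir (\<alpha> r)"
  by (simp add: unit_normal_def tangent)

lemma sin_cos_period_int:
  "sin (t + 2 * pi * of_int n) = sin t" "cos (t + 2 * pi * of_int n) = cos t"
  using sin_cos_eq_iff[of "t + 2 * pi * of_int n" t]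
  by (auto intro!: exI[of _ n] simp: mult.commute mult.left_commute)

lemma spd_period_int: "spd (t + 2 * pi * of_int n) = spd t"
  by (simp add: spd_def sin_cos_period_int)

lemma dir_period_int: "dir (t + 2 * pi * of_int n) = dir t"
  by (simp add: dir_def curve'_def spd_period_int sin_cos_period_int)

lemma outgoing_eq:
  assumes "\<bar>x $ 2\<bar> \<le> 1"
  shows "outgoing_velocity \<gamma> x = Complex (x $ 2) (sqrt (1 - (x $ 2)\<^sup>2)) * dir (\<alpha> (x $ 1))"
proof -
  have "cis (- arcsin (x $ 2)) * \<i> = Complex (x $ 2) (sqrt (1 - (x $ 2)\<^sup>2))"
    using assms by (simp add: complex_eq_iff cos_arcsin abs_le_iff)
  then show ?thesis by (simp add: outgoing_velocity_def unit_normal_eq mult.assoc[symmetric])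
qed

text \<open>The sine of the angle from a unit velocity to the normal is the component along the
  tangent \<open>- \<i> * n\<close>, and reflection keeps that component.\<close>

lemma sin_signed_angle_reflect:
  assumes n: "norm n = 1" and v: "norm v = 1"
  shows "sin (signed_angle (reflect_velocity n v) n) = (- \<i> * n) \<bullet> v"
proof -
  define w where "w = reflect_velocity n v"
  have nn: "n \<bullet> n = 1" and vv: "v \<bullet> v = 1" using n v by (simp_all add: dot_square_norm)
  have ww: "w \<bullet> w = 1"
    by (simp add: w_def reflect_velocity_def inner_diff_left inner_diff_right nn vv inner_commute[of n v] algebra_simps)
  then have w1: "norm w = 1" by (simp add: norm_eq_sqrt_inner)
  have "n / w = n * cnj w"
  proof -
    have "w * cnj w = 1" using w1 by (simp add: complex_norm_square[symmetric])
    moreover have "w \<noteq> 0" using w1 by auto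
    ultimately show ?thesis by (simp add: divide_eq_eq mult.assoc mult.commute[of "cnj w"])
  qed
  moreover have nw: "norm (n / w) = 1" using n w1 by (simp add: norm_divide)
  ultimately have "sin (Arg (n / w)) = Im (n * cnj w)"
    using sin_Arg[of "n / w"] by (cases "n / w = 0") auto
  also have "\<dots> = (- \<i> * n) \<bullet> w"
    by (simp add: inner_complex_def)
  also have "\<dots> = (- \<i> * n) \<bullet> v - 2 * (v \<bullet> n) * ((- \<i> * n) \<bullet> n)"
    by (simp add: w_def reflect_velocity_def inner_diff_right)
  also have "(- \<i> * n) \<bullet> n = 0" by (simp add: inner_complex_def)
  finally show ?thesis by (simp add: signed_angle_def w_def)
qed

text \<open>The unique positive hitting time is the length of the chord, which ends at parameter
  \<open>t + 2 * d\<close>; its direction is the tangent at \<open>t + d\<close>.\<close>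

lemma billiard_map_interior:
  assumes s: "\<bar>x $ 2\<bar> < 1"
  defines "t \<equiv> \<alpha> (x $ 1)"
  defines "d \<equiv> half_chord t (x $ 2)"
  shows "billiard_map table \<gamma> L x = vector [rinv (t + 2 * d) rmod L, Tg (t + 2 * d) (t + d)]"
proof -
  have v: "outgoing_velocity \<gamma> x = dir (t + d)"
    using outgoing_eq[of x] s dir_half_chord[OF s, of t] by (simp add: t_def d_def)
  have sd: "0 < sin d" unfolding d_def by (rule sin_half_chord_pos)
  have hit: "hitting_times table (\<gamma> (x $ 1)) (dir (t + d)) = {2 * sin d * spd (t + d)}"
    unfolding hitting_times_def frontier_table \<gamma>_curve t_def[symmetric] mem_Collect_eq lev_chord
    using sd spd_pos[of "t + d"] by (auto simp: field_simps)
  have q: "\<gamma> (x $ 1) + (2 * sin d * spd (t + d)) *\<^sub>R dir (t + d) = curve (t + 2 * d)"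
    unfolding \<gamma>_curve t_def[symmetric] by (rule curve_chord)
  obtain n :: int where n: "\<alpha> (rinv (t + 2 * d) rmod L) = t + 2 * d + 2 * pi * of_int n"
    using \<alpha>_rmod[of "rinv (t + 2 * d)"] by auto
  have nrm: "unit_normal \<gamma> (rinv (t + 2 * d) rmod L) = \<i> * dir (t + 2 * d)"
    unfolding unit_normal_eq n dir_period_int ..
  have "sin (signed_angle (reflect_velocity (\<i> * dir (t + 2 * d)) (dir (t + d))) (\<i> * dir (t + 2 * d))) = Tg (t + 2 * d) (t + d)"
    by (subst sin_signed_angle_reflect) (simp_all add: norm_mult norm_dir dir_inner mult.assoc[symmetric])
  then show ?thesis
    unfolding billiard_map_def Let_def v hit by (simp add: q the_parameter[simplified] nrm)
qed

text \<open>A tangent line meets the ellipse only at the point of contact: for \<open>m = t\<close>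
  the two roots in \<open>lev_chord\<close> coincide.\<close>

lemma billiard_map_boundary:
  assumes "\<bar>x $ 2\<bar> = 1" shows "billiard_map table \<gamma> L x = x"
proof -
  define t where "t = \<alpha> (x $ 1)"
  have "outgoing_velocity \<gamma> x = x $ 2 *\<^sub>R dir t"
  proof -
    have "(x $ 2)\<^sup>2 = 1" using assms by (metis abs_square_eq_1)
    moreover have "Complex (x $ 2) 0 * dir t = x $ 2 *\<^sub>R dir t" by (simp add: complex_eq_iff)
    ultimately show ?thesis using outgoing_eq[of x] assms by (simp add: t_def)
  qed
  moreover have "hitting_times table (\<gamma> (x $ 1)) (x $ 2 *\<^sub>R dir t) = {}"
  proof -
    have "lev (curve t + \<tau> *\<^sub>R (x $ 2 *\<^sub>R dir t)) \<noteq> 1" if "0 < \<tau>" for \<tau>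
      using lev_chord[of t "\<tau> * x $ 2" t] that assms spd_pos[of t] by (auto simp: mult_less_0_iff)
    then show ?thesis unfolding hitting_times_def frontier_table \<gamma>_curve t_def[symmetric] by auto
  qed
  ultimately show ?thesis by (simp add: billiard_map_def)
qed

end

section \<open>The derivative of the billiard map\<close>

definition dmap :: "real \<Rightarrow> real \<Rightarrow> real \<Rightarrow> real \<Rightarrow> real^2^2" where
  "dmap P Q M k = vector [vector [Q * (2 * M\<^sup>2 - P\<^sup>2) / P^3, - (2 * P * Q * M^3 / k)],
     vector [k / (Q * M * P^3) - k * (2 * M\<^sup>2 - P\<^sup>2) / (Q^3 * M * P^3), 2 * P * M\<^sup>2 / Q^3 - P / Q]]"

lemma dmap_nth [simp]:
  "dmap P Q M k $ 1 $ 1 = Q * (2 * M\<^sup>2 - P\<^sup>2) / P^3" "dmap P Q M k $ 1 $ 2 = - (2 * P * Q * M^3 / k)"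
  "dmap P Q M k $ 2 $ 1 = k / (Q * M * P^3) - k * (2 * M\<^sup>2 - P\<^sup>2) / (Q^3 * M * P^3)"
  "dmap P Q M k $ 2 $ 2 = 2 * P * M\<^sup>2 / Q^3 - P / Q"
  by (simp_all add: dmap_def)

lemma det_dmap:
  assumes "P \<noteq> 0" "Q \<noteq> 0" "M \<noteq> 0" "k \<noteq> 0" shows "det (dmap P Q M k) = 1"
  unfolding det_2 dmap_nth using assms by (simp add: field_simps power2_eq_square power3_eq_cube)

lemma has_derivative_vector_2:
  assumes "(f has_derivative f') (at x)" "(g has_derivative g') (at x)"
  shows "((\<lambda>y. vector [f y, g y] :: real^2) has_derivative (\<lambda>h. vector [f' h, g' h])) (at x)"
proof -
  have eq: "vector [u, v] = u *\<^sub>R axis 1 1 + v *\<^sub>R (axis 2 1 :: real^2)" for u v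
    by (simp add: vec_eq_iff forall_2 axis_def)
  show ?thesis unfolding eq by (intro has_derivative_add has_derivative_scaleR_left assms)
qed

lemma norm_matrix_le_sum_2: "norm (X :: real^2^2) \<le> \<bar>X$1$1\<bar> + \<bar>X$1$2\<bar> + \<bar>X$2$1\<bar> + \<bar>X$2$2\<bar>"
proof -
  have "norm X \<le> (\<Sum>i\<in>UNIV. norm (X $ i))"
    unfolding norm_vec_def[of X] by (rule L2_set_le_sum) simp
  also have "\<dots> \<le> (\<Sum>i\<in>UNIV. \<Sum>j\<in>UNIV. \<bar>X $ i $ j\<bar>)"
    by (intro sum_mono norm_le_l1_cart)
  finally show ?thesis by (simp add: sum_2)
qed

context ellipse
begin

lemma deriv_spd: "(spd has_real_derivative (a\<^sup>2 - b\<^sup>2) * sin t * cos t / spd t) (at t)"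
proof -
  have p: "0 < a\<^sup>2 * (sin t)\<^sup>2 + b\<^sup>2 * (cos t)\<^sup>2" using spd_pos[of t] spd_sq[of t] by (metis zero_less_power)
  have "((\<lambda>t. a\<^sup>2 * (sin t)\<^sup>2 + b\<^sup>2 * (cos t)\<^sup>2) has_real_derivative
     a\<^sup>2 * (2 * sin t * cos t) - b\<^sup>2 * (2 * cos t * sin t)) (at t)"
    by (rule derivative_eq_intros refl | simp)+
  from DERIV_chain2[OF DERIV_real_sqrt[OF p] this]
  have d: "((\<lambda>t. sqrt (a\<^sup>2 * (sin t)\<^sup>2 + b\<^sup>2 * (cos t)\<^sup>2)) has_real_derivative
     inverse (spd t) / 2 * (a\<^sup>2 * (2 * sin t * cos t) - b\<^sup>2 * (2 * cos t * sin t))) (at t)"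
    by (simp only: spd_def)
  have "spd = (\<lambda>t. sqrt (a\<^sup>2 * (sin t)\<^sup>2 + b\<^sup>2 * (cos t)\<^sup>2))" by (rule ext) (rule spd_def)
  then have "(spd has_real_derivative inverse (spd t) / 2 * (a\<^sup>2 * (2 * sin t * cos t) - b\<^sup>2 * (2 * cos t * sin t))) (at t)"
    using d by (simp only:)
  then show ?thesis
    by (rule DERIV_cong) (use spd_nz[of t] in \<open>simp add: field_simps\<close>)
qed

definition tk :: "real \<Rightarrow> real" where "tk d = a\<^sup>2 * b\<^sup>2 * sin d"

lemma tk_pos: "0 < sin d \<Longrightarrow> 0 < tk d"
  using a_pos b_pos by (simp add: tk_def)

text \<open>The quotient rule collapses: in \<open>c1\<close> and \<open>c2\<close> the numerators
  reduce to \<open>a^2 * b^2\<close> times the sine of the parameter difference, which is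
  \<open>tk\<close>.\<close>

lemma has_derivative_Tg:
  assumes f: "(f has_derivative f') (at z)" and g: "(g has_derivative g') (at z)"
  shows "((\<lambda>y. Tg (f y) (g y)) has_derivative
     (\<lambda>h. tk (g z - f z) / (spd (f z) ^ 3 * spd (g z)) * f' h - tk (g z - f z) / (spd (f z) * spd (g z) ^ 3) * g' h)) (at z)"
proof -
  define x y where "x = f z" and "y = g z"
  define P M where "P = spd x" and "M = spd y"
  have PM: "P \<noteq> 0" "M \<noteq> 0" by (simp_all add: P_def M_def)
  define N where "N = a\<^sup>2 * sin x * sin y + b\<^sup>2 * cos x * cos y"
  define n1 n2 where "n1 = a\<^sup>2 * cos x * sin y - b\<^sup>2 * sin x * cos y" and "n2 = a\<^sup>2 * sin x * cos y - b\<^sup>2 * cos x * sin y"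
  define ex ey where "ex = (a\<^sup>2 - b\<^sup>2) * sin x * cos x" and "ey = (a\<^sup>2 - b\<^sup>2) * sin y * cos y"
  define k where "k = tk (y - x)"
  have c1: "n1 * P\<^sup>2 - N * ex = k"
  proof -
    have "n1 * P\<^sup>2 - N * ex = a\<^sup>2 * b\<^sup>2 * (cos x * sin y - sin x * cos y) * ((sin x)\<^sup>2 + (cos x)\<^sup>2)"
      unfolding n1_def P_def spd_sq N_def ex_def by algebra
    then show ?thesis by (simp add: k_def tk_def sin_diff mult.commute)
  qed
  have c2: "n2 * M\<^sup>2 - N * ey = - k"
  proof -
    have "n2 * M\<^sup>2 - N * ey = - (a\<^sup>2 * b\<^sup>2 * (cos x * sin y - sin x * cos y)) * ((sin y)\<^sup>2 + (cos y)\<^sup>2)"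
      unfolding n2_def M_def spd_sq N_def ey_def by algebra
    then show ?thesis by (simp add: k_def tk_def sin_diff mult.commute)
  qed
  have dN: "((\<lambda>z. a\<^sup>2 * sin (f z) * sin (g z) + b\<^sup>2 * cos (f z) * cos (g z)) has_derivative (\<lambda>h. n1 * f' h + n2 * g' h)) (at z)"
    by (rule derivative_eq_intros f g refl | simp add: n1_def n2_def x_def y_def fun_eq_iff algebra_simps)+
  have dP: "((\<lambda>z. spd (f z)) has_derivative (\<lambda>h. f' h * (ex / P))) (at z)"
    using DERIV_compose_FDERIV[OF deriv_spd f] by (simp add: ex_def P_def x_def)
  have dM: "((\<lambda>z. spd (g z)) has_derivative (\<lambda>h. g' h * (ey / M))) (at z)"
    using DERIV_compose_FDERIV[OF deriv_spd g] by (simp add: ey_def M_def y_def)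
  have "((\<lambda>z. Tg (f z) (g z)) has_derivative
     (\<lambda>h. - N * (inverse (P * M) * (P * (g' h * (ey / M)) + f' h * (ex / P) * M) * inverse (P * M)) + (n1 * f' h + n2 * g' h) / (P * M))) (at z)"
    unfolding Tg_def using has_derivative_divide[OF dN has_derivative_mult[OF dP dM]] PM
    by (simp add: N_def P_def M_def x_def y_def)
  moreover have "- N * (inverse (P * M) * (P * (v * (ey / M)) + u * (ex / P) * M) * inverse (P * M)) + (n1 * u + n2 * v) / (P * M)
     = k / (P ^ 3 * M) * u - k / (P * M ^ 3) * v" for u v
  proof -
    have "- N * (inverse (P * M) * (P * (v * (ey / M)) + u * (ex / P) * M) * inverse (P * M)) + (n1 * u + n2 * v) / (P * M)
       = (n1 * P\<^sup>2 - N * ex) / (P ^ 3 * M) * u + (n2 * M\<^sup>2 - N * ey) / (P * M ^ 3) * v"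
      using PM by (simp add: field_simps power2_eq_square power3_eq_cube)
    then show ?thesis by (simp add: c1 c2)
  qed
  ultimately show ?thesis by (simp add: k_def P_def M_def x_def y_def)
qed

end

context ellipse_billiard
begin

definition base :: "real^2 \<Rightarrow> real" where "base x = \<alpha> (x $ 1)"
definition half :: "real^2 \<Rightarrow> real" where "half x = half_chord (base x) (x $ 2)"
definition mid :: "real^2 \<Rightarrow> real" where "mid x = base x + half x"
definition tip :: "real^2 \<Rightarrow> real" where "tip x = base x + 2 * half x"

text \<open>The Jacobian in closed form: the arguments of \<open>dmap\<close> are the speeds at the
  start, end and middle parameter of the chord, and \<open>a^2 * b^2\<close> times the sine of its
  half length in the parameter.\<close>

definition dF :: "real^2 \<Rightarrow> real^2^2" where
  "dF x = dmap (spd (base x)) (spd (tip x)) (spd (mid x)) (tk (half x))"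

lemma sin_half_pos: "0 < sin (half x)" by (simp add: half_def sin_half_chord_pos)

lemma tk_half_pos: "0 < tk (half x)" by (rule tk_pos[OF sin_half_pos])

lemma det_dF: "det (dF x) = 1"
  unfolding dF_def using tk_half_pos[of x] by (intro det_dmap) auto

lemma has_derivative_nth: "((\<lambda>y::real^2. y $ i) has_derivative (\<lambda>h. h $ i)) (at x)"
  by (rule bounded_linear.has_derivative[OF bounded_linear_vec_nth has_derivative_ident])

lemma has_derivative_base: "(base has_derivative (\<lambda>h. h $ 1 / spd (base x))) (at x)"
  using DERIV_compose_FDERIV[OF deriv_\<alpha> has_derivative_nth[of 1 x]] by (simp add: base_def[abs_def])

text \<open>Only differentiability is taken from the explicit formula; the derivative itself is
  found implicitly in \<open>has_derivative_mid\<close>.\<close>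

lemma ex_derivative_half:
  assumes s: "\<bar>x $ 2\<bar> < 1" shows "\<exists>D. (half has_derivative D) (at x)"
proof -
  have s2: "0 < 1 - (x $ 2)\<^sup>2" using s by (simp add: abs_square_less_1)
  have n: "a\<^sup>2 * (sin (base x))\<^sup>2 + b\<^sup>2 * (cos (base x))\<^sup>2 \<noteq> 0"
    using spd_sq[of "base x"] by (metis power_not_zero spd_nz)
  obtain D where "((\<lambda>y. (a * b * y $ 2 / sqrt (1 - (y $ 2)\<^sup>2) - (a\<^sup>2 - b\<^sup>2) * sin (base y) * cos (base y)) /
      (a\<^sup>2 * (sin (base y))\<^sup>2 + b\<^sup>2 * (cos (base y))\<^sup>2)) has_derivative D) (at x)"
    using s2 n by (atomize_elim, intro exI) (rule derivative_intros has_derivative_base has_derivative_nth | simp)+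
  then have "((\<lambda>y. chord_cot (base y) (y $ 2)) has_derivative D) (at x)" by (simp add: chord_cot_def spd_sq)
  from has_derivative_diff[OF has_derivative_const DERIV_compose_FDERIV[OF DERIV_arctan this], of "pi / 2"]
  show ?thesis unfolding half_def[abs_def] half_chord_def by blast
qed

lemma open_strip: "open {y::real^2. \<bar>y $ 2\<bar> < 1}"
  by (intro open_Collect_less continuous_intros)

text \<open>Implicit differentiation of the identity
  \<open>Tg (base y) (mid y) = y $ 2\<close>.\<close>

lemma has_derivative_mid:
  assumes s: "\<bar>x $ 2\<bar> < 1"
  shows "(mid has_derivative (\<lambda>h. spd (mid x)^2 / spd (base x)^3 * h $ 1
      - spd (base x) * spd (mid x)^3 / tk (half x) * h $ 2)) (at x)"
proof -
  obtain D0 where "(half has_derivative D0) (at x)" using ex_derivative_half[OF s] by blast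
  from has_derivative_add[OF has_derivative_base this]
  obtain D where D: "(mid has_derivative D) (at x)" by (auto simp: mid_def[abs_def])
  let ?P = "spd (base x)" and ?M = "spd (mid x)" and ?k = "tk (half x)"
  have k: "?k \<noteq> 0" using tk_half_pos[of x] by simp
  have "((\<lambda>y. Tg (base y) (mid y)) has_derivative (\<lambda>h. ?k / (?P ^ 3 * ?M) * (h $ 1 / ?P) - ?k / (?P * ?M ^ 3) * D h)) (at x)"
    using has_derivative_Tg[OF has_derivative_base D] by (simp add: mid_def)
  moreover have "((\<lambda>y. Tg (base y) (mid y)) has_derivative (\<lambda>h. h $ 2)) (at x)"
    by (rule has_derivative_transform_within_open[OF has_derivative_nth open_strip])
       (use s in \<open>auto simp: mid_def half_def Tg_half_chord\<close>)
  ultimately have "(\<lambda>h. ?k / (?P ^ 3 * ?M) * (h $ 1 / ?P) - ?k / (?P * ?M ^ 3) * D h) = (\<lambda>h. h $ 2)"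
    by (rule has_derivative_unique)
  then have eq: "?k / (?P ^ 3 * ?M) * (h $ 1 / ?P) - ?k / (?P * ?M ^ 3) * D h = h $ 2" for h by meson
  have "D h = ?M^2 / ?P^3 * h $ 1 - ?P * ?M^3 / ?k * h $ 2" for h
    unfolding eq[of h, symmetric] using k by (simp add: field_simps power2_eq_square power3_eq_cube)
  then have "D = (\<lambda>h. ?M^2 / ?P^3 * h $ 1 - ?P * ?M^3 / ?k * h $ 2)" ..
  with D show ?thesis by simp
qed

lemma tip_eq: "tip x = 2 * mid x - base x"
  by (simp add: tip_def mid_def)

text \<open>The map before reduction modulo \<open>L\<close>, smooth also where the first coordinate
  of the billiard map jumps.\<close>

definition lifted_map :: "real^2 \<Rightarrow> real^2" where
  "lifted_map x = vector [rinv (tip x), Tg (tip x) (mid x)]"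

text \<open>Everything follows from the derivative of \<open>mid\<close> by the chain rule, because
  the tip is \<open>2 * mid x - base x\<close>.\<close>

lemma has_derivative_lifted_map:
  assumes s: "\<bar>x $ 2\<bar> < 1"
  shows "(lifted_map has_derivative (*v) (dF x)) (at x)"
proof -
  let ?P = "spd (base x)" and ?M = "spd (mid x)" and ?k = "tk (half x)" and ?Q = "spd (tip x)"
  define m' where "m' h = ?M^2 / ?P^3 * h $ 1 - ?P * ?M^3 / ?k * h $ 2" for h :: "real^2"
  have k: "?k \<noteq> 0" using tk_half_pos[of x] by simp
  have dm: "(mid has_derivative m') (at x)" using has_derivative_mid[OF s] by (simp add: m'_def[abs_def])
  have dt: "(tip has_derivative (\<lambda>h. 2 * m' h - h $ 1 / ?P)) (at x)"
    unfolding tip_eq[abs_def] by (intro has_derivative_diff has_derivative_mult_right dm has_derivative_base)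
  have dr: "((\<lambda>y. rinv (tip y)) has_derivative (\<lambda>h. (2 * m' h - h $ 1 / ?P) * ?Q)) (at x)"
    using DERIV_compose_FDERIV[OF deriv_rinv dt] by simp
  have neg: "tk (mid x - tip x) = - ?k" by (simp add: mid_def tip_def tk_def)
  have ds: "((\<lambda>y. Tg (tip y) (mid y)) has_derivative (\<lambda>h. - ?k / (?Q ^ 3 * ?M) * (2 * m' h - h $ 1 / ?P) + ?k / (?Q * ?M ^ 3) * m' h)) (at x)"
    using has_derivative_Tg[OF dt dm] unfolding neg by simp
  have "vector [(2 * m' h - h $ 1 / ?P) * ?Q, - ?k / (?Q ^ 3 * ?M) * (2 * m' h - h $ 1 / ?P) + ?k / (?Q * ?M ^ 3) * m' h] = dF x *v h" for h
  proof -
    have "(2 * m' h - h $ 1 / ?P) * ?Q = ?Q * (2 * ?M\<^sup>2 - ?P\<^sup>2) / ?P^3 * h $ 1 + - (2 * ?P * ?Q * ?M^3 / ?k) * h $ 2"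
      unfolding m'_def using k by (simp add: field_simps power2_eq_square power3_eq_cube)
    moreover have "- ?k / (?Q ^ 3 * ?M) * (2 * m' h - h $ 1 / ?P) + ?k / (?Q * ?M ^ 3) * m' h
      = (?k / (?Q * ?M * ?P^3) - ?k * (2 * ?M\<^sup>2 - ?P\<^sup>2) / (?Q^3 * ?M * ?P^3)) * h $ 1 + (2 * ?P * ?M\<^sup>2 / ?Q^3 - ?P / ?Q) * h $ 2"
      unfolding m'_def using k by (simp add: field_simps power2_eq_square power3_eq_cube)
    ultimately show ?thesis
      by (simp add: vec_eq_iff forall_2 matrix_vector_mult_def sum_2 dF_def)
  qed
  then show ?thesis
    using has_derivative_vector_2[OF dr ds] by (simp add: lifted_map_def[abs_def])
qed

lemma billiard_map_lifted:
  assumes "\<bar>x $ 2\<bar> < 1"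
  shows "billiard_map table \<gamma> L x = vector [lifted_map x $ 1 rmod L, lifted_map x $ 2]"
  using billiard_map_interior[OF assms] by (simp add: lifted_map_def tip_def mid_def half_def base_def)

lemma continuous_at_lifted_map: "\<bar>x $ 2\<bar> < 1 \<Longrightarrow> isCont lifted_map x"
  using has_derivative_continuous[OF has_derivative_lifted_map] .

text \<open>Where the image is not at \<open>r = 0\<close>, the integer part \<open>n\<close> is
  locally constant, so nearby the map is a translate of its lift.\<close>

lemma billiard_derivative_eq:
  assumes s: "\<bar>x $ 2\<bar> < 1" and nz: "billiard_map table \<gamma> L x $ 1 \<noteq> 0"
  shows "billiard_derivative table \<gamma> L x = dF x"
proof -
  define n where "n = \<lfloor>lifted_map x $ 1 / L\<rfloor>"
  have r: "y rmod L = y - of_int n * L" if "of_int n * L \<le> y" "y < of_int (n + 1) * L" for y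
  proof -
    have "\<lfloor>y / L\<rfloor> = n" using that L_pos by (intro floor_unique) (auto simp: field_simps)
    then show ?thesis using L_pos by (simp add: rmod_def)
  qed
  have lo: "of_int n * L \<le> lifted_map x $ 1" and hi: "lifted_map x $ 1 < of_int (n + 1) * L"
    using floor_divide_lower[OF L_pos, of "lifted_map x $ 1"] floor_divide_upper[OF L_pos, of "lifted_map x $ 1"]
    by (simp_all add: n_def)
  have "lifted_map x $ 1 \<noteq> of_int n * L" using nz r[OF lo hi] by (simp add: billiard_map_lifted[OF s])
  with lo have lo': "of_int n * L < lifted_map x $ 1" by simp
  have ev: "\<forall>\<^sub>F y in nhds x. billiard_map table \<gamma> L y = lifted_map y - vector [of_int n * L, 0]"
  proof -
    have c: "isCont (\<lambda>y. lifted_map y $ 1) x"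
      by (intro continuous_intros continuous_at_lifted_map s)
    have t: "((\<lambda>y. lifted_map y $ 1) \<longlongrightarrow> lifted_map x $ 1) (nhds x)"
      using c unfolding isCont_def
      by (rule tendsto_at_iff_tendsto_nhds[THEN iffD1, of "\<lambda>y. lifted_map y $ 1"])
    have "\<forall>\<^sub>F y in nhds x. \<bar>y $ 2\<bar> < 1" using open_strip s by (intro eventually_nhds[THEN iffD2] exI[of _ "{y. \<bar>y $ 2\<bar> < 1}"]) auto
    moreover note order_tendstoD(1)[OF t lo'] order_tendstoD(2)[OF t hi]
    ultimately show ?thesis
    proof eventually_elim
      fix y :: "real^2" assume y: "\<bar>y $ 2\<bar> < 1" and l: "of_int n * L < lifted_map y $ 1" and h: "lifted_map y $ 1 < of_int (n + 1) * L"
      show "billiard_map table \<gamma> L y = lifted_map y - vector [of_int n * L, 0]"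
        unfolding billiard_map_lifted[OF y] r[OF less_imp_le[OF l] h] by (simp add: vec_eq_iff forall_2)
    qed
  qed
  obtain S where S: "open S" "x \<in> S" "\<And>y. y \<in> S \<Longrightarrow> billiard_map table \<gamma> L y = lifted_map y - vector [of_int n * L, 0]"
    using ev unfolding eventually_nhds by blast
  have "((\<lambda>y. lifted_map y - vector [of_int n * L, 0]) has_derivative (\<lambda>h. dF x *v h - 0)) (at x)"
    by (intro has_derivative_diff has_derivative_lifted_map[OF s] has_derivative_const)
  then have "(billiard_map table \<gamma> L has_derivative (*v) (dF x)) (at x)"
    using has_derivative_transform_within_open[OF _ S(1,2), of _ "(*v) (dF x)" UNIV "billiard_map table \<gamma> L"] S(3) by simp
  then have "(*v) (dF x) = frechet_derivative (billiard_map table \<gamma> L) (at x)"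
    by (rule frechet_derivative_at)
  then show ?thesis
    unfolding billiard_derivative_def jacobian_def by (metis matrix_of_matrix_vector_mul)
qed

text \<open>All speeds lie between \<open>b\<close> and \<open>a\<close>, so the only singular
  factor is the reciprocal of \<open>tk\<close>, at tangential collisions.\<close>

lemma norm_dF_le:
  obtains C where "0 < C" "\<And>x. norm (dF x) \<le> C / sin (half x)"
proof -
  define C1 where "C1 = a * (2 * a\<^sup>2 + a\<^sup>2) / b^3"
  define C2 where "C2 = 2 * a * a * a^3 / (a\<^sup>2 * b\<^sup>2)"
  define C3 where "C3 = a\<^sup>2 * b\<^sup>2 / (b * b * b^3) + a\<^sup>2 * b\<^sup>2 * (2 * a\<^sup>2 + a\<^sup>2) / (b^3 * b * b^3)"
  define C4 where "C4 = 2 * a * a\<^sup>2 / b^3 + a / b"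
  have pos: "0 < C1" "0 < C2" "0 < C3" "0 < C4"
    using a_pos b_pos by (auto simp: C1_def C2_def C3_def C4_def add_pos_pos)
  show ?thesis
  proof (rule that[of "C1 + C2 + C3 + C4"])
    show "0 < C1 + C2 + C3 + C4" using pos by simp
    fix x
    let ?P = "spd (base x)" and ?M = "spd (mid x)" and ?k = "tk (half x)" and ?Q = "spd (tip x)" and ?s = "sin (half x)"
    have s: "0 < ?s" "?s \<le> 1" by (rule sin_half_pos) simp
    have P: "b \<le> ?P" "?P \<le> a" "0 < ?P" and Q: "b \<le> ?Q" "?Q \<le> a" "0 < ?Q" and M: "b \<le> ?M" "?M \<le> a" "0 < ?M"
      using spd_ge spd_le spd_pos by auto
    have k: "0 < ?k" "?k \<le> a\<^sup>2 * b\<^sup>2" using tk_half_pos s(2) a_pos b_pos by (auto simp: tk_def mult_left_le)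
    have dq: "\<bar>2 * ?M\<^sup>2 - ?P\<^sup>2\<bar> \<le> 2 * a\<^sup>2 + a\<^sup>2"
    proof (rule abs_leI)
      show "2 * ?M\<^sup>2 - ?P\<^sup>2 \<le> 2 * a\<^sup>2 + a\<^sup>2"
        using spd_sq_bounds(2)[of "mid x"] zero_le_power2[of ?P] zero_le_power2[of a] by linarith
      show "- (2 * ?M\<^sup>2 - ?P\<^sup>2) \<le> 2 * a\<^sup>2 + a\<^sup>2"
        using spd_sq_bounds(2)[of "base x"] zero_le_power2[of ?M] zero_le_power2[of a] by linarith
    qed
    have pw: "b^3 \<le> ?P^3" "b^3 \<le> ?Q^3" "?M^3 \<le> a^3" "?M\<^sup>2 \<le> a\<^sup>2"
      using P Q M b_pos by (auto intro!: power_mono)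
    have up: "u \<le> K / ?s" if "u \<le> K" "0 < K" for u K
    proof -
      have "K * ?s \<le> K" using that(2) s(2) by (simp add: mult_left_le)
      then have "K \<le> K / ?s" using s(1) by (simp add: le_divide_eq)
      with that(1) show ?thesis by linarith
    qed
    have "\<bar>dF x $ 1 $ 1\<bar> = ?Q * \<bar>2 * ?M\<^sup>2 - ?P\<^sup>2\<bar> / ?P^3"
      unfolding dF_def dmap_nth using P(3) Q(3) by (simp add: abs_mult)
    also have "\<dots> \<le> C1"
      unfolding C1_def by (rule frac_le[OF _ mult_mono[OF Q(2) dq] _ pw(1)]) (use a_pos b_pos in auto)
    finally have 1: "\<bar>dF x $ 1 $ 1\<bar> \<le> C1 / ?s"
      using pos(1) by (rule up)
    have 2: "\<bar>dF x $ 1 $ 2\<bar> \<le> C2 / ?s"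
    proof -
      have "\<bar>dF x $ 1 $ 2\<bar> = 2 * ?P * ?Q * ?M^3 / (a\<^sup>2 * b\<^sup>2) / ?s"
        unfolding dF_def dmap_nth using P(3) Q(3) M(3) s by (simp add: abs_mult tk_def)
      also have "\<dots> \<le> C2 / ?s"
        unfolding C2_def
        by (intro divide_right_mono mult_mono[OF mult_mono[OF mult_left_mono[OF P(2)] Q(2)] pw(3)])
           (use a_pos P(3) Q(3) M(3) s in auto)
      finally show ?thesis .
    qed
    have "\<bar>dF x $ 2 $ 1\<bar> \<le> \<bar>?k / (?Q * ?M * ?P^3)\<bar> + \<bar>?k * (2 * ?M\<^sup>2 - ?P\<^sup>2) / (?Q^3 * ?M * ?P^3)\<bar>"
      unfolding dF_def dmap_nth by (rule abs_triangle_ineq4)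
    also have "\<dots> = ?k / (?Q * ?M * ?P^3) + ?k * \<bar>2 * ?M\<^sup>2 - ?P\<^sup>2\<bar> / (?Q^3 * ?M * ?P^3)"
      using P(3) Q(3) M(3) k(1) by (simp add: abs_mult)
    also have "\<dots> \<le> C3"
      unfolding C3_def
    proof (rule add_mono)
      show "?k / (?Q * ?M * ?P^3) \<le> a\<^sup>2 * b\<^sup>2 / (b * b * b^3)"
        by (rule frac_le[OF _ k(2) _ mult_mono[OF mult_mono[OF Q(1) M(1)] pw(1)]]) (use b_pos k Q(3) M(3) in auto)
      show "?k * \<bar>2 * ?M\<^sup>2 - ?P\<^sup>2\<bar> / (?Q^3 * ?M * ?P^3) \<le> a\<^sup>2 * b\<^sup>2 * (2 * a\<^sup>2 + a\<^sup>2) / (b^3 * b * b^3)"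
        by (rule frac_le[OF _ mult_mono[OF k(2) dq] _ mult_mono[OF mult_mono[OF pw(2) M(1)] pw(1)]])
           (use b_pos k Q(3) M(3) in auto)
    qed
    finally have 3: "\<bar>dF x $ 2 $ 1\<bar> \<le> C3 / ?s"
      using pos(3) by (rule up)
    have "\<bar>dF x $ 2 $ 2\<bar> \<le> \<bar>2 * ?P * ?M\<^sup>2 / ?Q^3\<bar> + \<bar>?P / ?Q\<bar>"
      unfolding dF_def dmap_nth by (rule abs_triangle_ineq4)
    also have "\<dots> = 2 * ?P * ?M\<^sup>2 / ?Q^3 + ?P / ?Q"
      using P(3) Q(3) by simp
    also have "\<dots> \<le> C4"
      unfolding C4_def
    proof (rule add_mono)
      show "2 * ?P * ?M\<^sup>2 / ?Q^3 \<le> 2 * a * a\<^sup>2 / b^3"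
        by (rule frac_le[OF _ mult_mono[OF mult_left_mono[OF P(2)] pw(4)] _ pw(2)]) (use a_pos b_pos P(3) in auto)
      show "?P / ?Q \<le> a / b"
        by (rule frac_le[OF _ P(2) _ Q(1)]) (use a_pos b_pos in auto)
    qed
    finally have 4: "\<bar>dF x $ 2 $ 2\<bar> \<le> C4 / ?s"
      using pos(4) by (rule up)
    show "norm (dF x) \<le> (C1 + C2 + C3 + C4) / ?s"
      using norm_matrix_le_sum_2[of "dF x"] 1 2 3 4 by (simp add: add_divide_distrib)
  qed
qed

end

section \<open>Invariance of the collision measure\<close>

context ellipse_billiard
begin

section \<open>Periodicity and measurability of the chord data\<close>

lemma Tg_period_int: "Tg (s + 2 * pi * of_int n) (t + 2 * pi * of_int n) = Tg s t"
  by (simp add: Tg_def spd_period_int sin_cos_period_int)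

lemma half_chord_period_int: "half_chord (t + 2 * pi * of_int n) s = half_chord t s"
  by (simp add: half_chord_def chord_cot_def spd_period_int sin_cos_period_int)

lemma rinv_rmod_period_int: "rinv (t + 2 * pi * of_int n) rmod L = rinv t rmod L"
  using rmod_add[of "rinv t" L "of_int n * L"] by (simp add: rinv_period_int)

lemma measurable_\<alpha> [measurable]: "\<alpha> \<in> borel_measurable borel"
  by (rule borel_measurable_continuous_onI) (rule continuous_\<alpha>)

lemma measurable_base [measurable]: "base \<in> borel_measurable borel"
  unfolding base_def[abs_def] by measurable

lemma measurable_rinv [measurable]: "rinv \<in> borel_measurable borel"
  by (intro borel_measurable_continuous_onI DERIV_continuous_on[OF has_field_derivative_at_within[OF deriv_rinv]])

lemma measurable_spd [measurable]: "spd \<in> borel_measurable borel"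
  by (intro borel_measurable_continuous_onI continuous_intros)

lemma measurable_tk [measurable]: "tk \<in> borel_measurable borel"
  unfolding tk_def[abs_def] by measurable

lemma measurable_Tg [measurable (raw)]:
  assumes [measurable]: "f \<in> borel_measurable N" "g \<in> borel_measurable N"
  shows "(\<lambda>x. Tg (f x) (g x)) \<in> borel_measurable N"
  unfolding Tg_def by measurable

lemma measurable_half [measurable]: "half \<in> borel_measurable borel"
  unfolding half_def[abs_def] half_chord_def chord_cot_def base_def by measurable

lemma measurable_rmod_L [measurable]: "(\<lambda>x. x rmod L) \<in> borel_measurable borel"
  by (rule rmod_measurable[OF L_pos])

text \<open>Coordinates on collisions: the base has eccentric anomaly \<theta>, and the chord is
  parallel to the tangent at \<open>\<theta> + \<sigma> * d\<close>. The sign 1 describes a chord by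
  its start, the sign -1 by its end.\<close>

definition chord :: "real \<Rightarrow> real \<Rightarrow> real \<Rightarrow> real^2" where
  "chord \<sigma> \<theta> d = vector [rinv \<theta> rmod L, Tg \<theta> (\<theta> + \<sigma> * d)]"

text \<open>The density of the collision measure in the coordinates (\<theta>, d), up to
  \<open>1 / (2 * L)\<close>. The speed at \<theta> that comes from \<open>dr\<close> cancels the
  one that comes from \<open>ds\<close>.\<close>

definition weight :: "real \<Rightarrow> real \<Rightarrow> real \<Rightarrow> ennreal" where
  "weight \<sigma> \<theta> d = ennreal (tk d / spd (\<theta> + \<sigma> * d) ^ 3)"

lemma measurable_chord [measurable (raw)]:
  assumes [measurable]: "f \<in> borel_measurable N" "g \<in> borel_measurable N"
  shows "(\<lambda>x. chord \<sigma> (f x) (g x)) \<in> borel_measurable N"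
  unfolding chord_def by (intro measurable_vector_2) measurable

lemma measurable_weight [measurable (raw)]:
  assumes [measurable]: "f \<in> borel_measurable N" "g \<in> borel_measurable N"
  shows "(\<lambda>x. weight \<sigma> (f x) (g x)) \<in> borel_measurable N"
  unfolding weight_def by measurable

lemma chord_period_int: "chord \<sigma> (\<theta> + 2 * pi * of_int n) d = chord \<sigma> \<theta> d"
proof -
  have "\<theta> + 2 * pi * of_int n + \<sigma> * d = (\<theta> + \<sigma> * d) + 2 * pi * of_int n" by simp
  then show ?thesis unfolding chord_def by (simp only: Tg_period_int rinv_rmod_period_int)
qed

lemma weight_period_int: "weight \<sigma> (\<theta> + 2 * pi * of_int n) d = weight \<sigma> \<theta> d"
proof -
  have "\<theta> + 2 * pi * of_int n + \<sigma> * d = (\<theta> + \<sigma> * d) + 2 * pi * of_int n" by simp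
  then show ?thesis unfolding weight_def by (simp only: spd_period_int)
qed

lemma tk_nonneg: "0 \<le> d \<Longrightarrow> d \<le> pi \<Longrightarrow> 0 \<le> tk d"
  using sin_ge_zero[of d] by (simp add: tk_def)

lemma deriv_Tg_chord:
  assumes \<sigma>: "\<sigma> = 1 \<or> \<sigma> = -1"
  shows "((\<lambda>d. - Tg \<theta> (\<theta> + \<sigma> * d)) has_real_derivative tk d / (spd \<theta> * spd (\<theta> + \<sigma> * d) ^ 3)) (at d)"
proof -
  have g: "((\<lambda>d. \<theta> + \<sigma> * d) has_derivative (\<lambda>h. \<sigma> * h)) (at d)"
    by (rule derivative_eq_intros refl | simp)+
  have t: "tk (\<theta> + \<sigma> * d - \<theta>) = \<sigma> * tk d" and ss: "\<sigma> * \<sigma> = 1" using \<sigma> by (auto simp: tk_def)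
  have "((\<lambda>d. Tg \<theta> (\<theta> + \<sigma> * d)) has_derivative
      (\<lambda>h. \<sigma> * tk d / (spd \<theta> ^ 3 * spd (\<theta> + \<sigma> * d)) * 0 - \<sigma> * tk d / (spd \<theta> * spd (\<theta> + \<sigma> * d) ^ 3) * (\<sigma> * h))) (at d)"
    using has_derivative_Tg[OF has_derivative_const g, of \<theta>] unfolding t .
  moreover have "\<sigma> * tk d / (spd \<theta> ^ 3 * spd (\<theta> + \<sigma> * d)) * 0 - \<sigma> * tk d / (spd \<theta> * spd (\<theta> + \<sigma> * d) ^ 3) * (\<sigma> * h)
      = - (tk d / (spd \<theta> * spd (\<theta> + \<sigma> * d) ^ 3)) * h" for h
  proof -
    have "\<sigma> * tk d / (spd \<theta> * spd (\<theta> + \<sigma> * d) ^ 3) * (\<sigma> * h) = (\<sigma> * \<sigma>) * (tk d / (spd \<theta> * spd (\<theta> + \<sigma> * d) ^ 3)) * h"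
      by simp
    then show ?thesis unfolding ss by simp
  qed
  ultimately have "((\<lambda>d. Tg \<theta> (\<theta> + \<sigma> * d)) has_derivative (\<lambda>h. - (tk d / (spd \<theta> * spd (\<theta> + \<sigma> * d) ^ 3)) * h)) (at d)"
    by (simp only:)
  from DERIV_minus[OF this[folded has_field_derivative_def]] show ?thesis by simp
qed

text \<open>Substitution along \<open>- Tg\<close>, which increases from -1 to 1 as \<open>d\<close>
  runs through [0, pi]; the sign is absorbed by reflecting the interval.\<close>

lemma nn_integral_Tg:
  fixes f :: "real \<Rightarrow> ennreal"
  assumes \<sigma>: "\<sigma> = 1 \<or> \<sigma> = -1" and [measurable]: "f \<in> borel_measurable borel"
  shows "(\<integral>\<^sup>+s. f s * indicator {-1..<1} s \<partial>lborel) =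
    (\<integral>\<^sup>+d. f (Tg \<theta> (\<theta> + \<sigma> * d)) * ennreal (tk d / (spd \<theta> * spd (\<theta> + \<sigma> * d) ^ 3)) * indicator {0..pi} d \<partial>lborel)"
proof -
  define g where "g d = - Tg \<theta> (\<theta> + \<sigma> * d)" for d
  have T0: "Tg \<theta> \<theta> = 1"
  proof -
    have "a\<^sup>2 * sin \<theta> * sin \<theta> + b\<^sup>2 * cos \<theta> * cos \<theta> = spd \<theta> * spd \<theta>"
      using spd_sq[of \<theta>] by (simp add: power2_eq_square mult.assoc)
    then show ?thesis by (simp add: Tg_def)
  qed
  have g0: "g 0 = -1" by (simp add: g_def T0)
  have gp: "g pi = 1"
  proof -
    have "sin (\<theta> + \<sigma> * pi) = - sin \<theta>" "cos (\<theta> + \<sigma> * pi) = - cos \<theta>" using \<sigma> by auto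
    moreover from this have "spd (\<theta> + \<sigma> * pi) = spd \<theta>" by (simp add: spd_def)
    ultimately have "g pi = Tg \<theta> \<theta>" by (simp add: g_def Tg_def minus_divide_left)
    then show ?thesis by (simp add: T0)
  qed
  have cont: "continuous_on {0..pi} (\<lambda>d. tk d / (spd \<theta> * spd (\<theta> + \<sigma> * d) ^ 3))"
    unfolding tk_def
    by (intro continuous_intros continuous_on_compose2[OF continuous_spd[of UNIV]]) auto
  have "(\<integral>\<^sup>+s. f s * indicator {-1..<1} s \<partial>lborel) = (\<integral>\<^sup>+s. f s * indicator {-1..1} s \<partial>lborel)"
    by (rule nn_integral_cong_AE) (use AE_lborel_singleton[of 1] in eventually_elim, auto simp: indicator_def)
  also have "\<dots> = (\<integral>\<^sup>+s. f (- s) * indicator {-1..1} s \<partial>lborel)"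
  proof -
    have "(\<integral>\<^sup>+s. f s * indicator {-1..1} s \<partial>lborel) = (\<integral>\<^sup>+s. f (- s) * indicator {-1..1} (- s) \<partial>lborel)"
      using nn_integral_real_affine[of "\<lambda>s. f s * indicator {-1..1} s" "-1" 0] by simp
    also have "\<dots> = (\<integral>\<^sup>+s. f (- s) * indicator {-1..1} s \<partial>lborel)"
      by (rule nn_integral_cong) (auto simp: indicator_def)
    finally show ?thesis .
  qed
  also have "\<dots> = (\<integral>\<^sup>+s. f (- s) * indicator {g 0..g pi} s \<partial>lborel)" by (simp add: g0 gp)
  also have "\<dots> = (\<integral>\<^sup>+d. f (- g d) * ennreal (tk d / (spd \<theta> * spd (\<theta> + \<sigma> * d) ^ 3)) * indicator {0..pi} d \<partial>lborel)"
    unfolding g_def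
    by (rule nn_integral_substitution_aux[where f = "\<lambda>s. f (- s)"]) (use cont deriv_Tg_chord[OF \<sigma>] tk_nonneg spd_pos in \<open>auto intro!: divide_nonneg_nonneg mult_nonneg_nonneg less_imp_le[OF spd_pos]\<close>)
  finally show ?thesis by (simp add: g_def)
qed

lemma nn_integral_periodic:
  fixes f :: "real \<Rightarrow> ennreal"
  assumes [measurable]: "f \<in> borel_measurable borel" and per: "\<And>t n. f (t + 2 * pi * of_int n) = f t"
  shows "(\<integral>\<^sup>+t. f (t + u) * indicator {0..<2*pi} t \<partial>lborel) = (\<integral>\<^sup>+t. f t * indicator {0..<2*pi} t \<partial>lborel)"
proof -
  have r: "f (x rmod (2 * pi)) = f x" for x
    using per[of x "- \<lfloor>x / (2 * pi)\<rfloor>"] by (simp add: rmod_def mult.commute)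
  show ?thesis using nn_integral_rmod[of "2 * pi" f u] by (simp add: r)
qed

text \<open>One period of \<open>r\<close> corresponds to the interval of length
  \<open>2 * pi\<close> from \<open>\<alpha> 0\<close>, which periodicity moves to start at
  0.\<close>

lemma nn_integral_arclength:
  fixes f :: "real \<Rightarrow> ennreal"
  assumes [measurable]: "f \<in> borel_measurable borel"
  shows "(\<integral>\<^sup>+r. f r * indicator {0..<L} r \<partial>lborel) =
    (\<integral>\<^sup>+\<theta>. f (rinv \<theta> rmod L) * ennreal (spd \<theta>) * indicator {0..<2*pi} \<theta> \<partial>lborel)"
proof -
  define h where "h r = f (r rmod L)" for r
  have [measurable]: "h \<in> borel_measurable borel" unfolding h_def by measurable
  define k where "k \<theta> = h (rinv \<theta>) * ennreal (spd \<theta>)" for \<theta>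
  have [measurable]: "k \<in> borel_measurable borel" unfolding k_def by measurable
  have per: "k (t + 2 * pi * of_int n) = k t" for t n
    by (simp add: k_def h_def rinv_rmod_period_int spd_period_int)
  have ra: "rinv (\<alpha> 0 + 2 * pi) = L" using \<alpha>_period[of 0] rinv_\<alpha>[of L] by simp
  have ind: "indicator {\<alpha> 0..<\<alpha> 0 + 2 * pi} (t + \<alpha> 0) = (indicator {0..<2*pi} t :: ennreal)" for t
    by (auto simp: indicator_def)
  have "(\<integral>\<^sup>+r. f r * indicator {0..<L} r \<partial>lborel) = (\<integral>\<^sup>+r. h r * indicator {rinv (\<alpha> 0)..rinv (\<alpha> 0 + 2 * pi)} r \<partial>lborel)"
    unfolding ra rinv_\<alpha>
    by (rule nn_integral_cong_AE, use AE_lborel_singleton[of L] in eventually_elim)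
       (auto simp: indicator_def h_def rmod_idem)
  also have "\<dots> = (\<integral>\<^sup>+\<theta>. h (rinv \<theta>) * ennreal (spd \<theta>) * indicator {\<alpha> 0..\<alpha> 0 + 2 * pi} \<theta> \<partial>lborel)"
    by (rule nn_integral_substitution_aux) (use deriv_rinv less_imp_le[OF spd_pos] in \<open>auto intro!: continuous_intros\<close>)
  also have "\<dots> = (\<integral>\<^sup>+\<theta>. k \<theta> * indicator {\<alpha> 0..<\<alpha> 0 + 2 * pi} \<theta> \<partial>lborel)"
    by (rule nn_integral_cong_AE, use AE_lborel_singleton[of "\<alpha> 0 + 2 * pi"] in eventually_elim)
       (auto simp: indicator_def k_def)
  also have "\<dots> = (\<integral>\<^sup>+\<theta>. k (\<theta> + \<alpha> 0) * indicator {0..<2*pi} \<theta> \<partial>lborel)"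
    by (subst nn_integral_real_affine[where c = 1 and t = "\<alpha> 0"]) (simp_all add: add.commute[of "\<alpha> 0"] ind[unfolded add.commute[of "\<alpha> 0" "2 * pi"]])
  also have "\<dots> = (\<integral>\<^sup>+\<theta>. k \<theta> * indicator {0..<2*pi} \<theta> \<partial>lborel)"
    by (rule nn_integral_periodic) (simp_all add: per)
  finally show ?thesis by (simp add: k_def h_def)
qed

lemma nn_integral_collision_chord:
  assumes \<sigma>: "\<sigma> = 1 \<or> \<sigma> = -1" and f [measurable]: "f \<in> borel_measurable borel"
  shows "(\<integral>\<^sup>+x. f x \<partial>collision_measure L) = ennreal (1 / (2 * L)) *
    (\<integral>\<^sup>+\<theta>. (\<integral>\<^sup>+d. f (chord \<sigma> \<theta> d) * weight \<sigma> \<theta> d * indicator {0..pi} d \<partial>lborel) * indicator {0..<2*pi} \<theta> \<partial>lborel)"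
proof -
  note [measurable] = measurable_vector_2
  define K where "K r = (\<integral>\<^sup>+d. f (vector [r, Tg (\<alpha> r) (\<alpha> r + \<sigma> * d)]) *
      ennreal (tk d / (spd (\<alpha> r) * spd (\<alpha> r + \<sigma> * d) ^ 3)) * indicator {0..pi} d \<partial>lborel)" for r
  have [measurable]: "K \<in> borel_measurable borel" unfolding K_def by measurable
  have "(\<integral>\<^sup>+b. f (vector [r, b]) * indicator {-1..<1} b \<partial>lborel) = K r" for r
    unfolding K_def by (rule nn_integral_Tg[OF \<sigma>]) measurable
  then have "(\<integral>\<^sup>+x. f x \<partial>collision_measure L) = ennreal (1 / (2 * L)) * (\<integral>\<^sup>+r. K r * indicator {0..<L} r \<partial>lborel)"
    by (subst nn_integral_collision[OF L_pos f]) simp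
  also have "(\<integral>\<^sup>+r. K r * indicator {0..<L} r \<partial>lborel) =
    (\<integral>\<^sup>+\<theta>. K (rinv \<theta> rmod L) * ennreal (spd \<theta>) * indicator {0..<2*pi} \<theta> \<partial>lborel)"
    by (rule nn_integral_arclength) measurable
  finally have *: "(\<integral>\<^sup>+x. f x \<partial>collision_measure L) = ennreal (1 / (2 * L)) *
    (\<integral>\<^sup>+\<theta>. K (rinv \<theta> rmod L) * ennreal (spd \<theta>) * indicator {0..<2*pi} \<theta> \<partial>lborel)" .
  have "K (rinv \<theta> rmod L) * ennreal (spd \<theta>) = (\<integral>\<^sup>+d. f (chord \<sigma> \<theta> d) * weight \<sigma> \<theta> d * indicator {0..pi} d \<partial>lborel)" for \<theta>
  proof -
    obtain n :: int where n: "\<alpha> (rinv \<theta> rmod L) = \<theta> + 2 * pi * of_int n" using \<alpha>_rmod[of "rinv \<theta>"] by auto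
    have s: "\<theta> + 2 * pi * of_int n + \<sigma> * d = (\<theta> + \<sigma> * d) + 2 * pi * of_int n" for d by simp
    have K: "K (rinv \<theta> rmod L) = (\<integral>\<^sup>+d. f (chord \<sigma> \<theta> d) *
        ennreal (tk d / (spd \<theta> * spd (\<theta> + \<sigma> * d) ^ 3)) * indicator {0..pi} d \<partial>lborel)"
      unfolding K_def n s chord_def by (simp only: Tg_period_int spd_period_int)
    have w: "ennreal (tk d / (spd \<theta> * spd (\<theta> + \<sigma> * d) ^ 3)) * ennreal (spd \<theta>) = weight \<sigma> \<theta> d" for d
      unfolding weight_def ennreal_mult''[OF less_imp_le[OF spd_pos[of \<theta>]], symmetric]
      using spd_nz[of \<theta>] by (simp add: field_simps)
    have "K (rinv \<theta> rmod L) * ennreal (spd \<theta>) = (\<integral>\<^sup>+d. f (chord \<sigma> \<theta> d) *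
        ennreal (tk d / (spd \<theta> * spd (\<theta> + \<sigma> * d) ^ 3)) * indicator {0..pi} d * ennreal (spd \<theta>) \<partial>lborel)"
      unfolding K by (rule nn_integral_multc[symmetric]) measurable
    also have "\<dots> = (\<integral>\<^sup>+d. f (chord \<sigma> \<theta> d) * weight \<sigma> \<theta> d * indicator {0..pi} d \<partial>lborel)"
      unfolding w[symmetric] by (simp only: ac_simps)
    finally show ?thesis .
  qed
  then show ?thesis unfolding * by simp
qed

text \<open>A Borel map of the whole plane that agrees with the billiard map on the cylinder, so
  that measurability is read off from a formula.\<close>

definition total_map :: "real^2 \<Rightarrow> real^2" where
  "total_map x = (if \<bar>x $ 2\<bar> < 1 then vector [rinv (tip x) rmod L, Tg (tip x) (mid x)] else x)"

lemma billiard_map_eq_total: "x \<in> cylinder L \<Longrightarrow> billiard_map table \<gamma> L x = total_map x"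
  using billiard_map_interior[of x] billiard_map_boundary[of x]
  by (auto simp: total_map_def tip_def mid_def half_def base_def cylinder_def)

lemma measurable_total_map [measurable]: "total_map \<in> borel \<rightarrow>\<^sub>M borel"
proof -
  note [measurable] = measurable_vector_2
  show ?thesis unfolding total_map_def[abs_def] tip_def mid_def by measurable
qed

lemma abs_Tg_le_1: "\<bar>Tg x y\<bar> \<le> 1"
proof -
  have "(Tg x y)\<^sup>2 \<le> 1" using Tg_sq[of x y] zero_le_power2[of "a * b * sin (y - x) / (spd x * spd y)"] by linarith
  then show ?thesis by (simp add: abs_square_le_1)
qed

lemma total_map_cylinder: "x \<in> cylinder L \<Longrightarrow> total_map x \<in> cylinder L"
  using L_pos rmod_less[of L "rinv (tip x)"] rmod_nonneg[of L "rinv (tip x)"] abs_Tg_le_1[of "tip x" "mid x"]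
  by (auto simp: total_map_def cylinder_def abs_le_iff)

lemma measurable_billiard_map: "billiard_map table \<gamma> L \<in> collision_space L \<rightarrow>\<^sub>M collision_space L"
proof -
  have "total_map \<in> collision_space L \<rightarrow>\<^sub>M collision_space L"
    by (subst (2) collision_space_def)
       (intro measurable_restrict_space2 measurable_collisionI measurable_total_map, auto simp: total_map_cylinder)
  then show ?thesis
    by (rule measurable_cong[THEN iffD2, rotated]) (simp add: billiard_map_eq_total)
qed

lemma half_chord_point:
  assumes d: "0 < d" "d < pi" shows "half (chord 1 \<theta> d) = d"
proof -
  obtain n :: int where n: "\<alpha> (rinv \<theta> rmod L) = \<theta> + 2 * pi * of_int n" using \<alpha>_rmod[of "rinv \<theta>"] by auto
  show ?thesis by (simp add: half_def base_def chord_def n half_chord_period_int half_chord_Tg[OF d])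
qed

lemma total_map_chord:
  assumes d: "0 < d" "d < pi" shows "total_map (chord 1 \<theta> d) = chord (-1) (\<theta> + 2 * d) d"
proof -
  obtain n :: int where n: "\<alpha> (rinv \<theta> rmod L) = \<theta> + 2 * pi * of_int n" using \<alpha>_rmod[of "rinv \<theta>"] by auto
  have b: "base (chord 1 \<theta> d) = \<theta> + 2 * pi * of_int n" by (simp add: base_def chord_def n)
  have t: "tip (chord 1 \<theta> d) = (\<theta> + 2 * d) + 2 * pi * of_int n" "mid (chord 1 \<theta> d) = (\<theta> + d) + 2 * pi * of_int n"
    by (simp_all add: tip_def mid_def b half_chord_point[OF d])
  have "\<bar>chord 1 \<theta> d $ 2\<bar> < 1" using abs_Tg_less_1[of d \<theta>] sin_gt_zero[OF d] by (simp add: chord_def)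
  then have "total_map (chord 1 \<theta> d) = vector [rinv (\<theta> + 2 * d) rmod L, Tg (\<theta> + 2 * d) (\<theta> + d)]"
    unfolding total_map_def t Tg_period_int rinv_rmod_period_int by simp
  also have "\<dots> = chord (-1) (\<theta> + 2 * d) d" by (simp add: chord_def add.commute)
  finally show ?thesis .
qed

text \<open>In the coordinates (\<theta>, d) the map is the shear from \<theta> to
  \<open>\<theta> + 2 * d\<close> with \<open>d\<close> fixed. The weight depends only on
  \<open>d\<close> and the middle parameter, which the descriptions of a chord by its start and by
  its end share. Fubini and periodicity in \<theta> then give invariance.\<close>

theorem nn_integral_billiard_map:
  assumes f: "f \<in> borel_measurable (collision_space L)"
  shows "(\<integral>\<^sup>+x. f (billiard_map table \<gamma> L x) \<partial>collision_measure L) = (\<integral>\<^sup>+x. f x \<partial>collision_measure L)"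
proof -
  define g where "g x = f x * indicator (cylinder L) x" for x
  have [measurable]: "g \<in> borel_measurable borel"
    using f unfolding g_def[abs_def] collision_space_def
    by (subst (asm) borel_measurable_restrict_space_iff_ennreal) auto
  define G where "G \<beta> d = g (chord (-1) \<beta> d) * weight (-1) \<beta> d * indicator {0..pi} d" for \<beta> d
  have G_meas [measurable]: "(\<lambda>x. G (p x) (q x)) \<in> borel_measurable N"
    if [measurable]: "p \<in> borel_measurable N" "q \<in> borel_measurable N" for p q and N :: "'x measure"
    unfolding G_def by measurable
  have GG: "g (total_map (chord 1 \<theta> d)) * weight 1 \<theta> d * indicator {0..pi} d = G (\<theta> + 2 * d) d" for \<theta> d
  proof -
    consider "d = 0 \<or> d = pi" | "0 < d" "d < pi" | "d \<notin> {0..pi}" by fastforce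
    then show ?thesis
    proof cases
      case 1 then show ?thesis by (auto simp: G_def weight_def tk_def)
    next
      case 2 then show ?thesis by (simp add: G_def total_map_chord weight_def add.commute)
    qed (simp add: G_def)
  qed
  have "(\<integral>\<^sup>+x. f (billiard_map table \<gamma> L x) \<partial>collision_measure L) = (\<integral>\<^sup>+x. g (total_map x) \<partial>collision_measure L)"
    by (rule nn_integral_cong) (simp add: g_def billiard_map_eq_total total_map_cylinder)
  also have "\<dots> = ennreal (1 / (2 * L)) *
    (\<integral>\<^sup>+\<theta>. (\<integral>\<^sup>+d. G (\<theta> + 2 * d) d \<partial>lborel) * indicator {0..<2*pi} \<theta> \<partial>lborel)"
    unfolding GG[symmetric] by (rule nn_integral_collision_chord) (simp, measurable)
  also have "(\<integral>\<^sup>+\<theta>. (\<integral>\<^sup>+d. G (\<theta> + 2 * d) d \<partial>lborel) * indicator {0..<2*pi} \<theta> \<partial>lborel)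
      = (\<integral>\<^sup>+\<theta>. (\<integral>\<^sup>+d. G (\<theta> + 2 * d) d * indicator {0..<2*pi} \<theta> \<partial>lborel) \<partial>lborel)"
    by (intro nn_integral_cong nn_integral_multc[symmetric]) measurable
  also have "\<dots> = (\<integral>\<^sup>+d. (\<integral>\<^sup>+\<theta>. G (\<theta> + 2 * d) d * indicator {0..<2*pi} \<theta> \<partial>lborel) \<partial>lborel)"
    by (rule lborel_pair.Fubini') measurable
  also have "\<dots> = (\<integral>\<^sup>+d. (\<integral>\<^sup>+\<theta>. G \<theta> d * indicator {0..<2*pi} \<theta> \<partial>lborel) \<partial>lborel)"
    by (intro nn_integral_cong nn_integral_periodic) (measurable, simp add: G_def chord_period_int weight_period_int)
  also have "\<dots> = (\<integral>\<^sup>+\<theta>. (\<integral>\<^sup>+d. G \<theta> d * indicator {0..<2*pi} \<theta> \<partial>lborel) \<partial>lborel)"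
    by (rule lborel_pair.Fubini') measurable
  also have "\<dots> = (\<integral>\<^sup>+\<theta>. (\<integral>\<^sup>+d. G \<theta> d \<partial>lborel) * indicator {0..<2*pi} \<theta> \<partial>lborel)"
    by (intro nn_integral_cong nn_integral_multc) measurable
  also have "ennreal (1 / (2 * L)) * \<dots> = (\<integral>\<^sup>+x. g x \<partial>collision_measure L)"
    unfolding G_def by (rule nn_integral_collision_chord[symmetric]) (simp, measurable)
  also have "\<dots> = (\<integral>\<^sup>+x. f x \<partial>collision_measure L)"
    by (rule nn_integral_cong) (simp add: g_def)
  finally show ?thesis .
qed

section \<open>Integrability and almost everywhere form of the derivative\<close>

lemma nn_integral_inverse_sin_half:
  assumes "0 < C" shows "(\<integral>\<^sup>+x. ennreal (C / sin (half x)) \<partial>collision_measure L) < \<infinity>"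
proof -
  \<comment> \<open>The factor \<open>sin d\<close> in the weight cancels the singularity and leaves
    a bounded integrand.\<close>
  define K where "K = C * (a\<^sup>2 * b\<^sup>2) / b ^ 3"
  have bd: "ennreal (C / sin (half (chord 1 \<theta> d))) * weight 1 \<theta> d * indicator {0..pi} d \<le> ennreal K * indicator {0..pi} d" for \<theta> d
  proof -
    consider "d = 0 \<or> d = pi" | "0 < d" "d < pi" | "d \<notin> {0..pi}" by fastforce
    then show ?thesis
    proof cases
      case 1 then show ?thesis by (auto simp: weight_def tk_def)
    next
      case 2
      have s: "0 < sin d" using 2 by (rule sin_gt_zero)
      have "ennreal (C / sin d) * weight 1 \<theta> d = ennreal (C / sin d * (tk d / spd (\<theta> + d) ^ 3))"
        unfolding weight_def using s assms by (subst ennreal_mult'[symmetric]) auto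
      also have "C / sin d * (tk d / spd (\<theta> + d) ^ 3) = C * (a\<^sup>2 * b\<^sup>2) / spd (\<theta> + d) ^ 3"
        using s by (simp add: tk_def)
      also have "ennreal \<dots> \<le> ennreal K"
        unfolding K_def using assms b_pos spd_ge[of "\<theta> + d"]
        by (intro ennreal_leI divide_left_mono power_mono) auto
      finally show ?thesis using 2 by (simp add: half_chord_point)
    qed simp
  qed
  have "(\<integral>\<^sup>+x. ennreal (C / sin (half x)) \<partial>collision_measure L) = ennreal (1 / (2 * L)) *
    (\<integral>\<^sup>+\<theta>. (\<integral>\<^sup>+d. ennreal (C / sin (half (chord 1 \<theta> d))) * weight 1 \<theta> d * indicator {0..pi} d \<partial>lborel) * indicator {0..<2*pi} \<theta> \<partial>lborel)"
    by (rule nn_integral_collision_chord) (simp, measurable)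
  also have "\<dots> \<le> ennreal (1 / (2 * L)) *
    (\<integral>\<^sup>+\<theta>. (\<integral>\<^sup>+d. ennreal K * indicator {0..pi} d \<partial>lborel) * indicator {0..<2*pi} \<theta> \<partial>lborel)"
    by (rule mult_left_mono[OF nn_integral_mono[OF mult_right_mono[OF nn_integral_mono[OF bd]]]]) auto
  also have "\<dots> = ennreal (1 / (2 * L)) * (ennreal K * ennreal pi * ennreal (2 * pi))"
    by (simp add: nn_integral_cmult_indicator)
  also have "\<dots> < \<infinity>" by (simp add: ennreal_mult_less_top)
  finally show ?thesis .
qed

lemma AE_coord1: "AE x in collision_measure L. x $ 1 \<noteq> 0"
proof -
  define h :: "real^2 \<Rightarrow> ennreal" where "h x = indicator {0} (x $ 1)" for x
  have [measurable]: "h \<in> borel_measurable borel" unfolding h_def by measurable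
  have "(\<integral>\<^sup>+a. (\<integral>\<^sup>+b. h (vector [a, b]) * indicator {-1..<1} b \<partial>lborel) * indicator {0..<L} a \<partial>lborel) = (\<integral>\<^sup>+a. 0 \<partial>(lborel :: real measure))"
    by (rule nn_integral_cong_AE, use AE_lborel_singleton[of 0] in eventually_elim) (simp add: h_def)
  then have "(\<integral>\<^sup>+x. h x \<partial>collision_measure L) = 0"
    by (subst nn_integral_collision[OF L_pos]) auto
  moreover have "h \<in> borel_measurable (collision_measure L)"
    using measurable_collisionI[of h borel L] by (simp cong: measurable_cong_sets)
  ultimately have "AE x in collision_measure L. h x = 0" by (simp add: nn_integral_0_iff_AE)
  then show ?thesis by eventually_elim (auto simp: h_def)
qed

text \<open>The jump set is the preimage of the null set \<open>r = 0\<close>, hence null by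
  invariance.\<close>

lemma AE_billiard_map_coord1: "AE x in collision_measure L. billiard_map table \<gamma> L x $ 1 \<noteq> 0"
proof -
  define h :: "real^2 \<Rightarrow> ennreal" where "h x = indicator {0} (x $ 1)" for x
  have h: "h \<in> borel_measurable borel" unfolding h_def by measurable
  have h': "h \<in> borel_measurable (collision_space L)" by (rule measurable_collisionI[OF h])
  have "(\<integral>\<^sup>+x. h x \<partial>collision_measure L) = (\<integral>\<^sup>+x. 0 \<partial>collision_measure L)"
    by (rule nn_integral_cong_AE, use AE_coord1 in eventually_elim) (simp add: h_def)
  then have "(\<integral>\<^sup>+x. h (billiard_map table \<gamma> L x) \<partial>collision_measure L) = 0"
    by (simp add: nn_integral_billiard_map[OF h'])
  moreover have "(\<lambda>x. h (billiard_map table \<gamma> L x)) \<in> borel_measurable (collision_measure L)"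
    using measurable_compose[OF measurable_billiard_map h'] by (simp cong: measurable_cong_sets)
  ultimately have "AE x in collision_measure L. h (billiard_map table \<gamma> L x) = 0" by (simp add: nn_integral_0_iff_AE)
  then show ?thesis by eventually_elim (auto simp: h_def)
qed

lemma AE_billiard_derivative_eq: "AE x in collision_measure L. billiard_derivative table \<gamma> L x = dF x"
  using AE_billiard_map_coord1 AE_collision_coord2[OF L_pos, of 1] AE_collision_coord2[OF L_pos, of "-1"] AE_space
proof eventually_elim
  fix x :: "real^2"
  assume "billiard_map table \<gamma> L x $ 1 \<noteq> 0" "x $ 2 \<noteq> 1" "x $ 2 \<noteq> -1" "x \<in> space (collision_measure L)"
  moreover from this have "\<bar>x $ 2\<bar> < 1" by (auto simp: cylinder_def)
  ultimately show "billiard_derivative table \<gamma> L x = dF x" by (intro billiard_derivative_eq)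
qed

lemma measurable_billiard_derivative: "billiard_derivative table \<gamma> L \<in> borel_measurable (collision_space L)"
  unfolding billiard_derivative_def[abs_def] by (intro measurable_collisionI borel_measurable_jacobian)

lemma det_billiard_derivative: "AE x in collision_measure L. \<bar>det (billiard_derivative table \<gamma> L x)\<bar> = 1"
  using AE_billiard_derivative_eq by eventually_elim (simp add: det_dF)

lemma nn_integral_norm_billiard_derivative:
  "(\<integral>\<^sup>+x. ennreal (norm (billiard_derivative table \<gamma> L x)) \<partial>collision_measure L) < \<infinity>"
proof -
  obtain C where C: "0 < C" "\<And>x. norm (dF x) \<le> C / sin (half x)" by (rule norm_dF_le) blast
  have "(\<integral>\<^sup>+x. ennreal (norm (billiard_derivative table \<gamma> L x)) \<partial>collision_measure L)
      \<le> (\<integral>\<^sup>+x. ennreal (C / sin (half x)) \<partial>collision_measure L)"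
    by (rule nn_integral_mono_AE, use AE_billiard_derivative_eq in eventually_elim) (simp add: C(2) ennreal_leI)
  also have "\<dots> < \<infinity>" by (rule nn_integral_inverse_sin_half[OF C(1)])
  finally show ?thesis .
qed

end

section \<open>Cones for symmetric chords\<close>

text \<open>For nonzero \<open>c\<close>: the slopes strictly between \<open>c / 2\<close> and
  \<open>3 * c / 2\<close>, with the vertical axis and the origin left out.\<close>

definition slope_cone :: "real \<Rightarrow> (real^2) set" where
  "slope_cone c = {v. \<bar>v $ 2 - c * v $ 1\<bar> < \<bar>c\<bar> / 2 * \<bar>v $ 1\<bar>}"

definition steep_cone :: "real \<Rightarrow> (real^2) set" where
  "steep_cone \<kappa> = {v. \<kappa> * \<bar>v $ 1\<bar> < \<bar>v $ 2\<bar>}"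

lemma slope_cone_sets [measurable]: "slope_cone c \<in> sets borel"
proof -
  have "slope_cone c = {v \<in> space borel. \<bar>v $ 2 - c * v $ 1\<bar> < \<bar>c\<bar> / 2 * \<bar>v $ 1\<bar>}" by (simp add: slope_cone_def)
  then show ?thesis by simp
qed

lemma steep_cone_sets [measurable]: "steep_cone \<kappa> \<in> sets borel"
proof -
  have "steep_cone \<kappa> = {v \<in> space borel. \<kappa> * \<bar>v $ 1\<bar> < \<bar>v $ 2\<bar>}" by (simp add: steep_cone_def)
  then show ?thesis by simp
qed

text \<open>Absolute slopes exceed \<open>\<bar>c\<bar> / 2\<close> in the one cone and stay below
  \<open>3 * \<bar>c'\<bar> / 2\<close> in the other.\<close>

lemma slope_cone_disjoint:
  assumes "3 * \<bar>c'\<bar> \<le> \<bar>c\<bar>" shows "slope_cone c \<inter> slope_cone c' = {}"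
proof -
  have False if "v \<in> slope_cone c" "v \<in> slope_cone c'" for v
  proof -
    let ?s = "\<bar>v $ 1\<bar>"
    have 1: "\<bar>v $ 2 - c * v $ 1\<bar> < \<bar>c\<bar> / 2 * ?s" "\<bar>v $ 2 - c' * v $ 1\<bar> < \<bar>c'\<bar> / 2 * ?s"
      using that by (auto simp: slope_cone_def)
    have "\<bar>c\<bar> * ?s = \<bar>c * v $ 1\<bar>" "\<bar>c'\<bar> * ?s = \<bar>c' * v $ 1\<bar>" by (simp_all add: abs_mult)
    moreover have "3 * \<bar>c'\<bar> * ?s \<le> \<bar>c\<bar> * ?s" using assms by (intro mult_right_mono) auto
    ultimately show False using 1 by linarith
  qed
  then show ?thesis by blast
qed

text \<open>A condition, strict and continuous in the entries, under which the matrix with rows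
  \<open>p q\<close> and \<open>r s\<close> sends \<open>steep_cone \<kappa>\<close> into
  \<open>slope_cone c\<close>.\<close>

definition cone_ineq :: "real \<Rightarrow> real \<Rightarrow> real \<Rightarrow> real \<Rightarrow> real \<Rightarrow> real \<Rightarrow> bool" where
  "cone_ineq \<kappa> c p q r s \<longleftrightarrow> \<bar>r - c * p\<bar> / \<kappa> + \<bar>s - c * q\<bar> < \<bar>c\<bar> / 2 * (\<bar>q\<bar> - \<bar>p\<bar> / \<kappa>)"

lemma cone_ineqD:
  assumes K: "cone_ineq \<kappa> c p q r s" and \<kappa>: "0 < \<kappa>" and v: "\<kappa> * \<bar>x\<bar> < \<bar>y\<bar>"
  shows "\<bar>(r * x + s * y) - c * (p * x + q * y)\<bar> < \<bar>c\<bar> / 2 * \<bar>p * x + q * y\<bar>"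
proof -
  have x: "\<bar>x\<bar> \<le> \<bar>y\<bar> / \<kappa>" using v \<kappa> by (simp add: field_simps)
  have y: "0 < \<bar>y\<bar>" using v \<kappa> by (smt (verit) mult_nonneg_nonneg)
  have "\<bar>(r * x + s * y) - c * (p * x + q * y)\<bar> = \<bar>(r - c * p) * x + (s - c * q) * y\<bar>"
    by (simp add: algebra_simps)
  also have "\<dots> \<le> \<bar>r - c * p\<bar> * \<bar>x\<bar> + \<bar>s - c * q\<bar> * \<bar>y\<bar>"
    unfolding abs_mult[symmetric] by (rule abs_triangle_ineq)
  also have "\<dots> \<le> \<bar>r - c * p\<bar> * (\<bar>y\<bar> / \<kappa>) + \<bar>s - c * q\<bar> * \<bar>y\<bar>"
    using x by (intro add_right_mono mult_left_mono) auto
  also have "\<dots> = (\<bar>r - c * p\<bar> / \<kappa> + \<bar>s - c * q\<bar>) * \<bar>y\<bar>" by (simp add: algebra_simps)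
  also have "\<dots> < \<bar>c\<bar> / 2 * (\<bar>q\<bar> - \<bar>p\<bar> / \<kappa>) * \<bar>y\<bar>"
    using K[unfolded cone_ineq_def] y by (rule mult_strict_right_mono)
  also have "\<dots> = \<bar>c\<bar> / 2 * (\<bar>q\<bar> * \<bar>y\<bar> - \<bar>p\<bar> * (\<bar>y\<bar> / \<kappa>))" by (simp add: algebra_simps)
  also have "\<dots> \<le> \<bar>c\<bar> / 2 * (\<bar>q\<bar> * \<bar>y\<bar> - \<bar>p\<bar> * \<bar>x\<bar>)"
    using x by (intro mult_left_mono diff_left_mono) auto
  also have "\<dots> \<le> \<bar>c\<bar> / 2 * \<bar>p * x + q * y\<bar>"
    unfolding abs_mult[symmetric] by (intro mult_left_mono) auto
  finally show ?thesis .
qed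

text \<open>The second condition is the first one for the adjugate, which is the inverse when the
  determinant is 1, with \<open>- c\<close> for \<open>c\<close>.\<close>

definition transverse :: "real \<Rightarrow> real \<Rightarrow> (real^2^2) set" where
  "transverse \<kappa> c = {X. cone_ineq \<kappa> c (X$1$1) (X$1$2) (X$2$1) (X$2$2) \<and>
      cone_ineq \<kappa> (- c) (X$2$2) (- (X$1$2)) (- (X$2$1)) (X$1$1)}"

text \<open>A worst-case estimate over vectors of absolute slope at most \<kappa>, again strict in
  the entries.\<close>

definition steepening :: "real \<Rightarrow> (real^2^2) set" where
  "steepening \<kappa> = {X. \<kappa> * (\<bar>X$1$1\<bar> + \<kappa> * \<bar>X$1$2\<bar>) < \<bar>X$2$1\<bar> - \<kappa> * \<bar>X$2$2\<bar>}"

lemma open_transverse: "\<kappa> \<noteq> 0 \<Longrightarrow> open (transverse \<kappa> c)"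
  unfolding transverse_def cone_ineq_def
  by (intro open_Collect_conj open_Collect_less continuous_intros) auto

lemma open_steepening: "open (steepening \<kappa>)"
  unfolding steepening_def by (intro open_Collect_less continuous_intros)

lemma matrix_vector_mult_nth_2:
  "(X *v v) $ i = X $ i $ 1 * v $ 1 + X $ i $ 2 * v $ 2" for X :: "real^2^2"
  by (simp add: matrix_vector_mult_def sum_2)

lemma transverse_forward:
  assumes "X \<in> transverse \<kappa> c" "0 < \<kappa>" "v \<in> steep_cone \<kappa>"
  shows "X *v v \<in> slope_cone c"
  using cone_ineqD[of \<kappa> c "X$1$1" "X$1$2" "X$2$1" "X$2$2" "v $ 1" "v $ 2"] assms
  by (simp add: transverse_def steep_cone_def slope_cone_def matrix_vector_mult_nth_2)

lemma transverse_backward: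
  assumes X: "X \<in> transverse \<kappa> c" "0 < \<kappa>" "det X = 1" and v: "X *v v \<in> steep_cone \<kappa>"
  shows "v \<in> slope_cone (- c)"
proof -
  define x y where "x = (X *v v) $ 1" and "y = (X *v v) $ 2"
  have d: "X$1$1 * X$2$2 - X$1$2 * X$2$1 = 1" using X(3) by (simp add: det_2)
  have "X$2$2 * x + - (X$1$2) * y = (X$1$1 * X$2$2 - X$1$2 * X$2$1) * v $ 1"
    "- (X$2$1) * x + X$1$1 * y = (X$1$1 * X$2$2 - X$1$2 * X$2$1) * v $ 2"
    by (simp_all add: x_def y_def matrix_vector_mult_nth_2 algebra_simps)
  then have e: "X$2$2 * x + - (X$1$2) * y = v $ 1" "- (X$2$1) * x + X$1$1 * y = v $ 2"
    by (simp_all add: d)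
  have "\<kappa> * \<bar>x\<bar> < \<bar>y\<bar>" using v by (simp add: steep_cone_def x_def y_def)
  with X have "\<bar>v $ 2 - - c * v $ 1\<bar> < \<bar>- c\<bar> / 2 * \<bar>v $ 1\<bar>"
    unfolding e[symmetric] transverse_def by (intro cone_ineqD) auto
  then show ?thesis by (simp add: slope_cone_def)
qed

lemma steepening_off:
  assumes X: "X \<in> steepening \<kappa>" and \<kappa>: "0 < \<kappa>" and v: "v \<notin> steep_cone \<kappa>" "v \<noteq> 0"
  shows "X *v v \<in> steep_cone \<kappa>"
proof -
  let ?x = "v $ 1" and ?y = "v $ 2"
  have le: "\<bar>?y\<bar> \<le> \<kappa> * \<bar>?x\<bar>" using v by (simp add: steep_cone_def)
  have x: "0 < \<bar>?x\<bar>"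
  proof (rule ccontr)
    assume "\<not> 0 < \<bar>?x\<bar>"
    with le have "v = 0" by (simp add: vec_eq_iff forall_2)
    with v show False by simp
  qed
  have "\<kappa> * \<bar>X$1$1 * ?x + X$1$2 * ?y\<bar> \<le> \<kappa> * (\<bar>X$1$1\<bar> * \<bar>?x\<bar> + \<bar>X$1$2\<bar> * \<bar>?y\<bar>)"
    unfolding abs_mult[symmetric] using \<kappa> by (intro mult_left_mono abs_triangle_ineq) auto
  also have "\<dots> \<le> \<kappa> * (\<bar>X$1$1\<bar> * \<bar>?x\<bar> + \<bar>X$1$2\<bar> * (\<kappa> * \<bar>?x\<bar>))"
    using \<kappa> le by (intro mult_left_mono add_left_mono) auto
  also have "\<dots> = \<kappa> * (\<bar>X$1$1\<bar> + \<kappa> * \<bar>X$1$2\<bar>) * \<bar>?x\<bar>" by (simp add: algebra_simps)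
  also have "\<dots> < (\<bar>X$2$1\<bar> - \<kappa> * \<bar>X$2$2\<bar>) * \<bar>?x\<bar>"
    using X x unfolding steepening_def by (intro mult_strict_right_mono) auto
  also have "\<dots> = \<bar>X$2$1\<bar> * \<bar>?x\<bar> - \<bar>X$2$2\<bar> * (\<kappa> * \<bar>?x\<bar>)" by (simp add: algebra_simps)
  also have "\<dots> \<le> \<bar>X$2$1\<bar> * \<bar>?x\<bar> - \<bar>X$2$2\<bar> * \<bar>?y\<bar>"
    using le by (intro diff_left_mono mult_left_mono) auto
  also have "\<dots> \<le> \<bar>X$2$1 * ?x + X$2$2 * ?y\<bar>"
    unfolding abs_mult[symmetric] by linarith
  finally show ?thesis by (simp add: steep_cone_def matrix_vector_mult_nth_2)
qed

text \<open>
  The hypotheses on the entries hold for \<open>DF\<close> at chords symmetric about the major axis, and \<open>w \<rightarrow> -\<infinity>\<close> as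
  the chord shrinks to a vertex; this provides arbitrarily flat image cones.
\<close>

lemma transverse_symmetric:
  assumes \<kappa>: "0 < \<kappa>" and u: "1/2 \<le> u" "u \<le> 1" and w: "w < 0" "5 / \<kappa> < - w"
    and X: "X$1$1 = u" "X$2$2 = u" "X$1$2 = w" "X$2$1 * w = u\<^sup>2 - 1"
  shows "X \<in> transverse \<kappa> (u / w)"
proof -
  have r: "X$2$1 = (u\<^sup>2 - 1) / w" using X(4) w(1) by (simp add: field_simps)
  have e1: "(u\<^sup>2 - 1) / w - u / w * u = - 1 / w" "u - u / w * w = 0"
    using w(1) by (simp_all add: field_simps power2_eq_square)
  have e2: "- ((u\<^sup>2 - 1) / w) - - (u / w) * u = 1 / w" "u - - (u / w) * - w = 0"
    using w(1) by (simp_all add: field_simps power2_eq_square)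
  \<comment> \<open>The 5 leaves \<open>4 / \<kappa>\<close> after subtracting
    \<open>u / \<kappa>\<close>, and \<open>u / 2\<close> is at least 1/4.\<close>
  have "1 / \<kappa> < u / 2 * (- w - u / \<kappa>)"
  proof -
    have "u / \<kappa> \<le> 1 / \<kappa>" using u(2) \<kappa> by (simp add: divide_right_mono)
    then have h: "4 / \<kappa> < - w - u / \<kappa>" using w(2) by linarith
    have "1 / \<kappa> = 1/4 * (4 / \<kappa>)" by simp
    also have "\<dots> < 1/4 * (- w - u / \<kappa>)" using h by (intro mult_strict_left_mono) auto
    also have "\<dots> \<le> u / 2 * (- w - u / \<kappa>)"
    proof (intro mult_right_mono)
      have "0 < 4 / \<kappa>" using \<kappa> by simp
      with h show "0 \<le> - w - u / \<kappa>" by linarith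
    qed (use u in auto)
    finally show ?thesis .
  qed
  then have "1 / \<kappa> / - w < u / 2 * (- w - u / \<kappa>) / - w" using w(1) by (intro divide_strict_right_mono) auto
  then have main: "1 / - w / \<kappa> < u / - w / 2 * (- w - u / \<kappa>)" by (simp add: field_simps)
  have abs: "\<bar>w\<bar> = - w" "\<bar>u\<bar> = u" using w u by auto
  show ?thesis
    unfolding transverse_def cone_ineq_def mem_Collect_eq X(1-3) r e1 e2
    using main by (simp add: abs_divide abs)
qed

lemma dmap_eq_axis:
  "dmap P Q M k = (Q * (2 * M\<^sup>2 - P\<^sup>2) / P^3) *\<^sub>R axis 1 (axis 1 1) + (- (2 * P * Q * M^3 / k)) *\<^sub>R axis 1 (axis 2 1)
     + (k / (Q * M * P^3) - k * (2 * M\<^sup>2 - P\<^sup>2) / (Q^3 * M * P^3)) *\<^sub>R axis 2 (axis 1 1) + (2 * P * M\<^sup>2 / Q^3 - P / Q) *\<^sub>R axis 2 (axis 2 1)"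
  by (simp add: vec_eq_iff forall_2 axis_def)

lemma measurable_dmap [measurable (raw)]:
  assumes [measurable]: "P \<in> borel_measurable N" "Q \<in> borel_measurable N" "M \<in> borel_measurable N" "k \<in> borel_measurable N"
  shows "(\<lambda>x. dmap (P x) (Q x) (M x) (k x)) \<in> borel_measurable N"
  unfolding dmap_eq_axis by measurable

lemma continuous_on_dmap:
  assumes "continuous_on S P" "continuous_on S Q" "continuous_on S M" "continuous_on S k"
    "\<And>x. x \<in> S \<Longrightarrow> P x \<noteq> 0" "\<And>x. x \<in> S \<Longrightarrow> Q x \<noteq> 0" "\<And>x. x \<in> S \<Longrightarrow> M x \<noteq> 0" "\<And>x. x \<in> S \<Longrightarrow> k x \<noteq> 0"
  shows "continuous_on S (\<lambda>x. dmap (P x) (Q x) (M x) (k x))"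
  unfolding dmap_eq_axis by (intro continuous_intros assms) (use assms in auto)

section \<open>Sets of collisions of positive measure with prescribed derivative\<close>

context ellipse_billiard
begin

lemma dF_chord:
  assumes d: "0 < d" "d < pi"
  shows "dF (chord 1 \<theta> d) = dmap (spd \<theta>) (spd (\<theta> + 2 * d)) (spd (\<theta> + d)) (tk d)"
proof -
  obtain n :: int where n: "\<alpha> (rinv \<theta> rmod L) = \<theta> + 2 * pi * of_int n" using \<alpha>_rmod[of "rinv \<theta>"] by auto
  have b: "base (chord 1 \<theta> d) = \<theta> + 2 * pi * of_int n" by (simp add: base_def chord_def n)
  have t: "tip (chord 1 \<theta> d) = (\<theta> + 2 * d) + 2 * pi * of_int n" "mid (chord 1 \<theta> d) = (\<theta> + d) + 2 * pi * of_int n"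
    by (simp_all add: tip_def mid_def b half_chord_point[OF d])
  show ?thesis unfolding dF_def b t half_chord_point[OF d] by (simp only: spd_period_int)
qed

text \<open>In the coordinates (\<theta>, d) the derivative is continuous and the measure has a
  positive density, so one chord with derivative in the open set \<open>E\<close> brings an open set
  of chords of positive measure.\<close>

lemma emeasure_open_derivative_pos:
  fixes E :: "(real^2^2) set"
  assumes E: "open E" and \<theta>: "0 < \<theta>" "\<theta> < 2 * pi" and d: "0 < d" "d < pi"
    and mem: "dmap (spd \<theta>) (spd (\<theta> + 2 * d)) (spd (\<theta> + d)) (tk d) \<in> E"
  defines "U \<equiv> {x \<in> space (collision_measure L). billiard_derivative table \<gamma> L x \<in> E \<and> det (billiard_derivative table \<gamma> L x) = 1}"
  shows "U \<in> sets (collision_measure L)" "0 < emeasure (collision_measure L) U"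
proof -
  note [measurable] = measurable_billiard_derivative
  have [measurable]: "E \<in> sets borel" using E by simp
  have [measurable]: "(det :: real^2^2 \<Rightarrow> real) \<in> borel_measurable borel"
    by (intro borel_measurable_continuous_onI) (simp add: det_2, intro continuous_intros)
  have [measurable]: "billiard_derivative table \<gamma> L \<in> borel_measurable (collision_measure L)"
    using measurable_billiard_derivative by (simp cong: measurable_cong_sets)
  show U [measurable]: "U \<in> sets (collision_measure L)" unfolding U_def by measurable
  show "0 < emeasure (collision_measure L) U"
  proof (rule ccontr)
    assume "\<not> 0 < emeasure (collision_measure L) U"
    then have U0: "emeasure (collision_measure L) U = 0" by simp
    define h where "h x = (indicator E (dF x) :: ennreal)" for x
    have [measurable]: "dF \<in> borel_measurable borel" unfolding dF_def[abs_def] tip_def mid_def by measurable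
    have [measurable]: "h \<in> borel_measurable borel" unfolding h_def by measurable
    define k :: "real \<times> real \<Rightarrow> ennreal" where
      "k p = h (chord 1 (fst p) (snd p)) * weight 1 (fst p) (snd p) * indicator {0..pi} (snd p) * indicator {0..<2*pi} (fst p)" for p
    have [measurable]: "k \<in> borel_measurable borel"
      unfolding k_def borel_prod[symmetric] by measurable
    have "(\<integral>\<^sup>+x. h x \<partial>collision_measure L) = (\<integral>\<^sup>+x. indicator U x \<partial>collision_measure L)"
      by (rule nn_integral_cong_AE, use AE_billiard_derivative_eq AE_space in eventually_elim)
         (auto simp: h_def U_def det_dF indicator_def)
    also have "\<dots> = 0" using U U0 by simp
    finally have "ennreal (1 / (2 * L)) * (\<integral>\<^sup>+\<theta>. (\<integral>\<^sup>+d. h (chord 1 \<theta> d) * weight 1 \<theta> d * indicator {0..pi} d \<partial>lborel) * indicator {0..<2*pi} \<theta> \<partial>lborel) = 0"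
      by (subst (asm) nn_integral_collision_chord[of 1]) simp_all
    then have "(\<integral>\<^sup>+\<theta>. (\<integral>\<^sup>+d. h (chord 1 \<theta> d) * weight 1 \<theta> d * indicator {0..pi} d \<partial>lborel) * indicator {0..<2*pi} \<theta> \<partial>lborel) = 0"
      using L_pos by (simp add: ennreal_eq_0_iff)
    also have "(\<integral>\<^sup>+\<theta>. (\<integral>\<^sup>+d. h (chord 1 \<theta> d) * weight 1 \<theta> d * indicator {0..pi} d \<partial>lborel) * indicator {0..<2*pi} \<theta> \<partial>lborel)
       = (\<integral>\<^sup>+\<theta>. (\<integral>\<^sup>+d. k (\<theta>, d) \<partial>lborel) \<partial>lborel)"
      unfolding k_def fst_conv snd_conv by (intro nn_integral_cong nn_integral_multc[symmetric]) measurable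
    also have "\<dots> = (\<integral>\<^sup>+p. k p \<partial>(lborel \<Otimes>\<^sub>M lborel))"
      by (rule lborel.nn_integral_fst) (simp add: lborel_prod)
    also have "\<dots> = (\<integral>\<^sup>+p. k p \<partial>lborel)" by (simp add: lborel_prod)
    finally have "AE p in lborel. k p = 0" by (subst (asm) nn_integral_0_iff_AE) simp_all
    define R where "R = {0<..<2*pi} \<times> {0<..<pi}"
    define X where "X p = dmap (spd (fst p)) (spd (fst p + 2 * snd p)) (spd (fst p + snd p)) (tk (snd p))" for p
    have tkp: "0 < tk (snd p)" if "p \<in> R" for p
      using that by (intro tk_pos sin_gt_zero) (auto simp: R_def)
    have cX: "continuous_on R X"
      unfolding X_def
    proof (rule continuous_on_dmap)
      show "continuous_on R (\<lambda>x. tk (snd x))" unfolding tk_def by (intro continuous_intros)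
      show "tk (snd x) \<noteq> 0" if "x \<in> R" for x using tkp[OF that] by simp
    qed (auto intro!: continuous_intros)
    have oR: "open R" unfolding R_def by (intro open_Times) auto
    have O: "open (X -` E \<inter> R)" using continuous_open_preimage[OF cX oR E] by (simp add: Int_commute)
    have "k p \<noteq> 0" if "p \<in> X -` E \<inter> R" for p
    proof -
      have r: "0 < snd p" "snd p < pi" "0 < fst p" "fst p < 2 * pi" using that by (auto simp: R_def)
      have "h (chord 1 (fst p) (snd p)) = 1" using that by (simp add: h_def dF_chord[OF r(1,2)] X_def)
      moreover have "weight 1 (fst p) (snd p) \<noteq> 0"
        using tkp[of p] that spd_pos[of "fst p + snd p"] by (simp add: weight_def ennreal_eq_0_iff not_le)
      ultimately show ?thesis using r by (simp add: k_def)
    qed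
    then have sub: "X -` E \<inter> R \<subseteq> {p. k p \<noteq> 0}" by blast
    have null: "{p. k p \<noteq> 0} \<in> null_sets lborel"
    proof -
      have "{p \<in> space lborel. k p \<noteq> 0} \<in> sets lborel" by measurable
      then have "{p. k p \<noteq> 0} \<in> sets lborel" by simp
      then show ?thesis using \<open>AE p in lborel. k p = 0\<close> by (subst AE_iff_null_sets) auto
    qed
    have "X -` E \<inter> R \<in> null_sets lborel"
      by (rule null_sets_subset[OF null _ sub]) (use borel_open[OF O] in simp)
    then have "negligible (X -` E \<inter> R)"
      by (simp add: negligible_iff_null_sets null_sets_completionI)
    with O have "X -` E \<inter> R = {}" using open_not_negligible by blast
    moreover have "(\<theta>, d) \<in> X -` E \<inter> R" using \<theta> d mem by (auto simp: X_def R_def)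
    ultimately show False by blast
  qed
qed

text \<open>Chords from parameter \<open>- d\<close> to \<open>d\<close> around a vertex, started at
  \<open>2 * pi - d\<close> to keep \<theta> in its range. The entry \<open>w\<close> is of order
  \<open>1 / sin d\<close>.\<close>

lemma ex_symmetric_chord:
  assumes "0 < K"
  obtains d u w where "0 < d" "d < pi" "1/2 \<le> u" "u \<le> 1" "w < 0" "K \<le> - w"
    "let X = dmap (spd (2 * pi - d)) (spd (2 * pi - d + 2 * d)) (spd (2 * pi - d + d)) (tk d)
     in X$1$1 = u \<and> X$2$2 = u \<and> X$1$2 = w \<and> X$2$1 * w = u\<^sup>2 - 1"
proof -
  \<comment> \<open>The first bound gives \<open>3 * P^2 \<le> 4 * b^2\<close> and thus
    \<open>1/2 \<le> u\<close>; the second gives \<open>K \<le> - w\<close>.\<close>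
  define s where "s = min (b / (2 * a)) (2 * b^3 / (a\<^sup>2 * K))"
  have s0: "0 < s" using a_pos b_pos assms by (simp add: s_def)
  have s1: "s \<le> b / (2 * a)" "s \<le> 2 * b^3 / (a\<^sup>2 * K)" by (simp_all add: s_def)
  have "b / (2 * a) < 1" using a_pos b_pos b_less_a by (simp add: field_simps)
  with s1 have s2: "s < 1" by linarith
  define d where "d = arcsin s"
  have sd: "sin d = s" using s0 s2 by (simp add: d_def)
  have d: "0 < d" "d < pi"
    using arcsin_less_arcsin[of 0 s] arcsin_bounded[of s] s0 s2 pi_gt_zero unfolding d_def by auto
  define P where "P = spd d"
  have P: "P\<^sup>2 = b\<^sup>2 + (a\<^sup>2 - b\<^sup>2) * s\<^sup>2"
    unfolding P_def spd_sq sd cos_squared_eq by (simp add: algebra_simps)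
  have P0: "0 < P" by (simp add: P_def spd_pos)
  have e: "spd (2 * pi - d) = P" "spd (2 * pi - d + 2 * d) = P" "spd (2 * pi - d + d) = b"
    using b_pos by (simp_all add: spd_def P_def sin_diff cos_diff sin_add cos_add)
  define u where "u = 2 * b\<^sup>2 / P\<^sup>2 - 1"
  define w where "w = - (2 * P\<^sup>2 * b / (a\<^sup>2 * s))"
  have Pb: "b\<^sup>2 \<le> P\<^sup>2"
    unfolding P using b_pos b_less_a by (simp add: power_mono)
  have Pu: "3 * P\<^sup>2 \<le> 4 * b\<^sup>2"
  proof -
    have "s\<^sup>2 \<le> (b / (2 * a))\<^sup>2" using s0 s1 by (intro power_mono) auto
    then have "a\<^sup>2 * s\<^sup>2 \<le> a\<^sup>2 * (b / (2 * a))\<^sup>2" by (intro mult_left_mono) auto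
    also have "\<dots> = b\<^sup>2 / 4" using a_pos by (simp add: power_divide power_mult_distrib)
    finally have "4 * (a\<^sup>2 * s\<^sup>2) \<le> b\<^sup>2" by simp
    moreover have "0 \<le> b\<^sup>2 * s\<^sup>2" by simp
    moreover have "0 \<le> b\<^sup>2" by simp
    ultimately have "3 * (a\<^sup>2 * s\<^sup>2) - 3 * (b\<^sup>2 * s\<^sup>2) \<le> b\<^sup>2" by linarith
    then show ?thesis unfolding P left_diff_distrib by simp
  qed
  show ?thesis
  proof (rule that[of d u w])
    show "1/2 \<le> u" "u \<le> 1" unfolding u_def using Pu Pb P0 by (simp_all add: field_simps)
    show "w < 0" unfolding w_def using P0 b_pos a_pos s0 by simp
    have "K * (a\<^sup>2 * s) \<le> 2 * b ^ 3"
      using s1(2) assms a_pos by (simp add: field_simps)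
    also have "\<dots> = 2 * b\<^sup>2 * b" by (simp add: power3_eq_cube power2_eq_square)
    also have "\<dots> \<le> 2 * P\<^sup>2 * b" using Pb b_pos by simp
    finally show "K \<le> - w" unfolding w_def using a_pos s0 by (simp add: field_simps)
    show "let X = dmap (spd (2 * pi - d)) (spd (2 * pi - d + 2 * d)) (spd (2 * pi - d + d)) (tk d)
     in X$1$1 = u \<and> X$2$2 = u \<and> X$1$2 = w \<and> X$2$1 * w = u\<^sup>2 - 1"
      unfolding Let_def e dmap_nth u_def w_def tk_def sd using P0 b_pos a_pos s0
      by (simp add: field_simps power2_eq_square power3_eq_cube)
  qed (use d in auto)
qed

text \<open>The minor axis as a chord, from parameter \<open>3 * pi / 2\<close> to
  \<open>5 * pi / 2\<close>. Its lower left entry \<open>2 * (a^2 - b^2) * b / a^4\<close> is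
  positive because the ellipse is not a circle.\<close>

lemma ex_steepening_chord:
  obtains \<kappa> where "0 < \<kappa>"
    "dmap (spd (3 * pi / 2)) (spd (3 * pi / 2 + 2 * (pi / 2))) (spd (3 * pi / 2 + pi / 2)) (tk (pi / 2)) \<in> steepening \<kappa>"
proof -
  have "cos (3 * pi / 2) = 0" "(sin (3 * pi / 2))\<^sup>2 = 1"
    using cos_add[of pi "pi/2"] sin_add[of pi "pi/2"] by simp_all
  then have "spd (3 * pi / 2) = a" using a_pos by (simp add: spd_def)
  moreover have "spd (3 * pi / 2 + 2 * (pi / 2)) = spd (3 * pi / 2)" using spd_pi[of "3 * pi / 2"] by simp
  moreover have "3 * pi / 2 + pi / 2 = 2 * pi" by simp
  moreover have "spd (2 * pi) = b" using b_pos by (simp add: spd_def)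
  ultimately have e: "spd (3 * pi / 2) = a" "spd (3 * pi / 2 + 2 * (pi / 2)) = a" "spd (3 * pi / 2 + pi / 2) = b"
    by (simp_all only:)
  define X where "X = dmap a a b (a\<^sup>2 * b\<^sup>2)"
  have X: "X$1$1 = 2 * b\<^sup>2 / a\<^sup>2 - 1" "X$2$2 = 2 * b\<^sup>2 / a\<^sup>2 - 1" "X$1$2 = - (2 * b)" "X$2$1 = 2 * (a\<^sup>2 - b\<^sup>2) * b / a^4"
    unfolding X_def dmap_nth using a_pos b_pos by (simp_all add: field_simps power2_eq_square power3_eq_cube power4_eq_xxxx)
  have ab: "b\<^sup>2 < a\<^sup>2" using b_pos b_less_a by (intro power_strict_mono) auto
  then have p: "0 < X$2$1" unfolding X using a_pos b_pos by simp
  have u: "\<bar>2 * b\<^sup>2 / a\<^sup>2 - 1\<bar> \<le> 1" using ab a_pos by (simp add: abs_le_iff field_simps)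
  \<comment> \<open>Small enough that the other entries, bounded by 1 and \<open>2 * b\<close>, use
    up at most half of the lower left entry.\<close>
  define \<kappa> where "\<kappa> = min 1 (X$2$1 / (4 * (1 + b)))"
  have \<kappa>: "0 < \<kappa>" "\<kappa> \<le> 1" "\<kappa> * (4 * (1 + b)) \<le> X$2$1"
  proof -
    show "0 < \<kappa>" "\<kappa> \<le> 1" using p b_pos by (auto simp: \<kappa>_def)
    have "\<kappa> \<le> X$2$1 / (4 * (1 + b))" by (simp add: \<kappa>_def)
    then show "\<kappa> * (4 * (1 + b)) \<le> X$2$1" using b_pos by (subst (asm) pos_le_divide_eq) auto
  qed
  have "\<kappa> * (\<bar>X$1$1\<bar> + \<kappa> * \<bar>X$1$2\<bar>) + \<kappa> * \<bar>X$2$2\<bar> \<le> \<kappa> * (1 + 1 * (2 * b)) + \<kappa> * 1"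
    unfolding X(1-3) using u \<kappa> b_pos by (intro add_mono mult_left_mono mult_mono) auto
  also have "\<dots> = \<kappa> * (4 * (1 + b)) / 2" by (simp add: algebra_simps)
  also have "\<dots> < X$2$1" using \<kappa> p by linarith
  finally have "X \<in> steepening \<kappa>" using p by (simp add: steepening_def)
  moreover have "tk (pi / 2) = a\<^sup>2 * b\<^sup>2" by (simp add: tk_def)
  ultimately have "dmap (spd (3 * pi / 2)) (spd (3 * pi / 2 + 2 * (pi / 2))) (spd (3 * pi / 2 + pi / 2)) (tk (pi / 2)) \<in> steepening \<kappa>"
    by (simp only: e X_def)
  with \<kappa>(1) show ?thesis by (rule that)
qed

lemma spread_billiard_derivative:
  assumes "random_map L \<epsilon> \<rho> (billiard_map table \<gamma> L) (billiard_derivative table \<gamma> L)"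
  shows "\<exists>c>0. \<forall>g\<in>borel_measurable borel. \<forall>h\<in>borel_measurable borel.
      (\<integral>\<^sup>+v. ennreal ((g v)\<^sup>2) \<partial>lborel) < \<infinity> \<longrightarrow>
      ennreal c * (\<integral>\<^sup>+v. ennreal ((g v)\<^sup>2) \<partial>lborel)
        \<le> (\<integral>\<^sup>+x. \<integral>\<^sup>+v. ennreal ((g (billiard_derivative table \<gamma> L x *v v) - h v)\<^sup>2) \<partial>lborel \<partial>collision_measure L)"
proof -
  interpret random_map L \<epsilon> \<rho> "billiard_map table \<gamma> L" "billiard_derivative table \<gamma> L" by fact
  \<comment> \<open>The sets also record determinant 1, which \<open>transverse_backward\<close>
    uses to invert the matrix.\<close>
  define W where "W E = {x \<in> space (collision_measure L). billiard_derivative table \<gamma> L x \<in> E \<and> det (billiard_derivative table \<gamma> L x) = 1}" for E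
  obtain \<kappa> where \<kappa>: "0 < \<kappa>"
    and E3: "dmap (spd (3 * pi / 2)) (spd (3 * pi / 2 + 2 * (pi / 2))) (spd (3 * pi / 2 + pi / 2)) (tk (pi / 2)) \<in> steepening \<kappa>"
    by (rule ex_steepening_chord)
  have W3: "W (steepening \<kappa>) \<in> sets (collision_measure L)" "0 < emeasure (collision_measure L) (W (steepening \<kappa>))"
    unfolding W_def using emeasure_open_derivative_pos[OF open_steepening _ _ _ _ E3] by auto
  have ex: "\<exists>c. c \<noteq> 0 \<and> \<bar>c\<bar> \<le> \<eta> \<and> W (transverse \<kappa> c) \<in> sets (collision_measure L) \<and> 0 < emeasure (collision_measure L) (W (transverse \<kappa> c))"
    if \<eta>: "0 < \<eta>" for \<eta>
  proof -
    \<comment> \<open>\<open>6 / \<kappa>\<close> secures the strict bound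
      \<open>5 / \<kappa> < - w\<close>, and \<open>1 / \<eta>\<close> makes the slope
      \<open>u / w\<close> at most \<eta> in absolute value.\<close>
    have "0 < max (6 / \<kappa>) (1 / \<eta>)" using \<kappa> by (simp add: less_max_iff_disj)
    then obtain d u w where d: "0 < d" "d < pi" and u: "1/2 \<le> u" "u \<le> 1" and w: "w < 0" "max (6 / \<kappa>) (1 / \<eta>) \<le> - w"
      and X: "let X = dmap (spd (2 * pi - d)) (spd (2 * pi - d + 2 * d)) (spd (2 * pi - d + d)) (tk d)
         in X$1$1 = u \<and> X$2$2 = u \<and> X$1$2 = w \<and> X$2$1 * w = u\<^sup>2 - 1"
      by (rule ex_symmetric_chord)
    define X where "X = dmap (spd (2 * pi - d)) (spd (2 * pi - d + 2 * d)) (spd (2 * pi - d + d)) (tk d)"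
    have "5 / \<kappa> < 6 / \<kappa>" using \<kappa> by (simp add: divide_strict_right_mono)
    then have "5 / \<kappa> < - w" using w(2) by simp
    then have t: "X \<in> transverse \<kappa> (u / w)"
      using X unfolding Let_def X_def[symmetric] by (intro transverse_symmetric[OF \<kappa> u w(1)]) auto
    have "u / - w \<le> 1 / - w" using u w(1) by (intro divide_right_mono) auto
    also have "\<dots> \<le> \<eta>" using w \<eta> by (simp add: field_simps)
    finally have "\<bar>u / w\<bar> \<le> \<eta>" using u w(1) by simp
    moreover have "u / w \<noteq> 0" using u w(1) by simp
    ultimately show ?thesis
      using emeasure_open_derivative_pos[OF open_transverse[of \<kappa> "u / w"] _ _ d t[unfolded X_def]] \<kappa> d
      unfolding W_def by (intro exI[of _ "u / w"]) auto
  qed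
  define good where "good c \<longleftrightarrow> c \<noteq> 0 \<and> W (transverse \<kappa> c) \<in> sets (collision_measure L) \<and> 0 < emeasure (collision_measure L) (W (transverse \<kappa> c))" for c
  \<comment> \<open>Each slope is at most a third of the previous one in absolute value, which makes
    the three cones pairwise disjoint.\<close>
  obtain c0 where c0: "good c0" using ex[of 1] by (auto simp: good_def)
  obtain c1 where c1: "good c1" "3 * \<bar>c1\<bar> \<le> \<bar>c0\<bar>" using ex[of "\<bar>c0\<bar> / 3"] c0 by (auto simp: good_def)
  obtain c2 where c2: "good c2" "3 * \<bar>c2\<bar> \<le> \<bar>c1\<bar>" using ex[of "\<bar>c1\<bar> / 3"] c1 by (auto simp: good_def)
  define cc where "cc i = (if i = 0 then c0 else if i = 1 then c1 else c2)" for i :: nat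
  have good: "good (cc i)" for i using c0 c1 c2 by (simp add: cc_def)
  have c02: "3 * \<bar>c2\<bar> \<le> \<bar>c0\<bar>" using c1(2) c2(2) by linarith
  have dec: "3 * \<bar>cc i\<bar> \<le> \<bar>cc j\<bar> \<or> 3 * \<bar>cc j\<bar> \<le> \<bar>cc i\<bar>" if "i < 3" "j < 3" "i \<noteq> j" for i j :: nat
    using that c1(2) c2(2) c02 by (auto simp: cc_def)
  define U where "U i = (if i = 3 then W (steepening \<kappa>) else W (transverse \<kappa> (cc i)))" for i :: nat
  show ?thesis
  proof (rule spread_of_cones[where U = U and J = "steep_cone \<kappa>" and C = "\<lambda>i. slope_cone (cc i)" and C' = "\<lambda>i. slope_cone (- cc i)"])
    fix i :: nat assume "i < 4"
    show "U i \<in> sets (collision_measure L)" "0 < emeasure (collision_measure L) (U i)"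
      using W3 good[of i] by (auto simp: U_def good_def)
  next
    fix i j :: nat assume "i < 3" "j < 3" "i \<noteq> j"
    from dec[OF this] show "slope_cone (cc i) \<inter> slope_cone (cc j) = {}" "slope_cone (- cc i) \<inter> slope_cone (- cc j) = {}"
      using slope_cone_disjoint[of "cc i" "cc j"] slope_cone_disjoint[of "cc j" "cc i"]
        slope_cone_disjoint[of "- cc i" "- cc j"] slope_cone_disjoint[of "- cc j" "- cc i"]
      by (auto simp: Int_commute)
  next
    fix i :: nat and x v :: "real^2" assume i: "i < 3" and x: "x \<in> U i"
    then have X: "billiard_derivative table \<gamma> L x \<in> transverse \<kappa> (cc i)" "det (billiard_derivative table \<gamma> L x) = 1"
      by (auto simp: U_def W_def)
    show "billiard_derivative table \<gamma> L x *v v \<in> slope_cone (cc i)" if "v \<in> steep_cone \<kappa>"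
      by (rule transverse_forward[OF X(1) \<kappa> that])
    show "v \<in> slope_cone (- cc i)" if "billiard_derivative table \<gamma> L x *v v \<in> steep_cone \<kappa>"
      by (rule transverse_backward[OF X(1) \<kappa> X(2) that])
  next
    fix x v :: "real^2" assume x: "x \<in> U 3" and v: "v \<notin> steep_cone \<kappa>" "v \<noteq> 0"
    then have "billiard_derivative table \<gamma> L x \<in> steepening \<kappa>" by (auto simp: U_def W_def)
    then show "billiard_derivative table \<gamma> L x *v v \<in> steep_cone \<kappa>" using \<kappa> v by (rule steepening_off)
  qed auto
qed

end

theorem theorem4p8:
  fixes D :: "complex set" and \<gamma> :: "real \<Rightarrow> complex" and L \<epsilon> :: real
    and \<rho> :: "real^2 \<Rightarrow> real"
  assumes "noncircular_ellipse_table D"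
    and "arclength_parametrization D \<gamma> L"
    and "0 < \<epsilon>"
    and "\<rho> \<in> borel_measurable borel"
    and "\<And>u. 0 \<le> \<rho> u"
    and "prob_space (noise_measure \<rho>)"
    and "\<And>u. u \<in> ball 0 \<epsilon> \<Longrightarrow> 0 < \<rho> u"
  shows "ergodic_wrt (collision_measure L) (random_billiard_kernel D \<gamma> L \<rho>) \<and>
         hyperbolic
           (markov_law (collision_measure L) (random_billiard_kernel D \<gamma> L \<rho>))
           (billiard_derivative D \<gamma> L)"
proof -
  obtain a b z0 e where el: "ellipse a b e" and D: "D = ellipse.table a b z0 e"
    using noncircular_ellipseE[OF assms(1)] .
  interpret ellipse a b z0 e by (rule el)
  have L: "0 < L" using assms(2) by (simp add: arclength_parametrization_def)
  obtain \<alpha> where \<alpha>: "\<And>r. \<gamma> r = curve (\<alpha> r)" "\<And>r. (\<alpha> has_real_derivative 1 / spd (\<alpha> r)) (at r)"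
    "\<And>r. \<alpha> (r + L) = \<alpha> r + 2 * pi" "\<And>r. unit_tangent \<gamma> r = curve' (\<alpha> r) / spd (\<alpha> r)"
    by (rule arclength_lift[OF assms(2)[unfolded D]]) (assumption | rule that)+
  interpret ellipse_billiard a b z0 e \<gamma> L \<alpha>
    by unfold_locales (simp_all only: L \<alpha> dir_def)
  interpret torus_noise L \<epsilon> \<rho>
    by (rule torus_noise.intro) (rule L assms(3-7) | assumption)+
  interpret R: random_map L \<epsilon> \<rho> "billiard_map table \<gamma> L" "billiard_derivative table \<gamma> L"
    by unfold_locales
      (simp_all only: measurable_billiard_map nn_integral_billiard_map measurable_billiard_derivative det_billiard_derivative)
  interpret S: spread_map L \<epsilon> \<rho> "billiard_map table \<gamma> L" "billiard_derivative table \<gamma> L"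
    by unfold_locales
      (rule spread_billiard_derivative[OF R.random_map_axioms] nn_integral_norm_billiard_derivative)+
  have P: "random_billiard_kernel table \<gamma> L \<rho> = (\<lambda>x. perturbation L \<rho> (billiard_map table \<gamma> L x))"
    by (rule ext) (rule random_billiard_kernel_def)
  show ?thesis
    unfolding D P using R.ergodic S.hyperbolic by (simp add: R.markov_law_eq)
qed

end
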